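(* Let $R$ be a (fixed) connected regular graph with at least two edges. Then $R$-free Edge Deletion is NP-complete. Furthermore, $R$-free Edge Deletion is not solvable in time $2^{o(k)}\cdot |G|^{O(1)}$, unless the Exponential Time Hypothesis fails.
   Context: All graphs are simple, finite and undirected. For a fixed graph $H$, the problem $H$-free Edge Deletion is: given $(G,k)$ with $G$ a graph and $k$ a nonnegative integer (the parameter), decide whether there exists a set $F$ of at most $k$ edges of $G$ such that $G-F=(V(G),E(G)\setminus F)$ has no induced subgraph isomorphic to $H$. $|G|$ denotes $|V(G)|+|E(G)|$. A regular graph is a graph all of whose vertices have the same degree $r$ for some nonnegative integer $r$. The Exponential Time Hypothesis (ETH) is the assumption that 3-SAT cannot be solved in time $2^{o(n)}$, where $n$ is the number of variables. *)

theory Defs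
  imports
    "HOL-Library.Landau_Symbols"
    "HOL-Computational_Algebra.Polynomial"
begin

section \<open>Finite simple graphs\<close>

type_synonym 'a ugraph = "'a set \<times> 'a set set"

abbreviation verts :: "'a ugraph \<Rightarrow> 'a set" where "verts \<equiv> fst"
abbreviation edges :: "'a ugraph \<Rightarrow> 'a set set" where "edges \<equiv> snd"

definition simple_graph :: "'a ugraph \<Rightarrow> bool" where
  "simple_graph G \<longleftrightarrow> finite (verts G) \<and> (\<forall>e \<in> edges G. e \<subseteq> verts G \<and> card e = 2)"

definition graph_size :: "'a ugraph \<Rightarrow> nat" where
  "graph_size G = card (verts G) + card (edges G)"

definition degree_of :: "'a ugraph \<Rightarrow> 'a \<Rightarrow> nat" where
  "degree_of G v = card {e \<in> edges G. v \<in> e}"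

definition regular_graph :: "'a ugraph \<Rightarrow> bool" where
  "regular_graph G \<longleftrightarrow> (\<exists>r. \<forall>v \<in> verts G. degree_of G v = r)"

definition connected_graph :: "'a ugraph \<Rightarrow> bool" where
  "connected_graph G \<longleftrightarrow> verts G \<noteq> {} \<and>
     (\<forall>u \<in> verts G. \<forall>v \<in> verts G. (u, v) \<in> {(a, b). {a, b} \<in> edges G}\<^sup>*)"

definition graph_iso :: "'a ugraph \<Rightarrow> 'b ugraph \<Rightarrow> bool" where
  "graph_iso G H \<longleftrightarrow> (\<exists>f. bij_betw f (verts G) (verts H) \<and>
     (\<forall>u \<in> verts G. \<forall>v \<in> verts G. {u, v} \<in> edges G \<longleftrightarrow> {f u, f v} \<in> edges H))"

definition induced_sub :: "'a ugraph \<Rightarrow> 'a set \<Rightarrow> 'a ugraph" where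
  "induced_sub G W = (W, {e \<in> edges G. e \<subseteq> W})"

definition induced_free :: "'b ugraph \<Rightarrow> 'a ugraph \<Rightarrow> bool" where
  "induced_free H G \<longleftrightarrow> \<not> (\<exists>W \<subseteq> verts G. graph_iso (induced_sub G W) H)"

definition delete_edges :: "'a ugraph \<Rightarrow> 'a set set \<Rightarrow> 'a ugraph" where
  "delete_edges G F = (verts G, edges G - F)"

definition free_edge_deletion :: "'b ugraph \<Rightarrow> 'a ugraph \<times> nat \<Rightarrow> bool" where
  "free_edge_deletion H = (\<lambda>(G, k).
     \<exists>F \<subseteq> edges G. card F \<le> k \<and> induced_free H (delete_edges G F))"

section \<open>Deterministic multi-tape Turing machines\<close>

text \<open>States and tape symbols are initial segments of the natural numbers. Symbol 0 is the
  blank, symbols 1 and 2 are the bits False and True; further symbols are work symbols.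
  All tapes are two-way infinite.\<close>

datatype move = MoveLeft | Stay | MoveRight

record tm =
  ntapes :: nat
  nstates :: nat
  nsyms :: nat
  start :: nat
  accept :: nat
  reject :: nat
  delta :: "nat \<Rightarrow> nat list \<Rightarrow> nat \<times> (nat \<times> move) list"

definition wf_tm :: "tm \<Rightarrow> bool" where
  "wf_tm M \<longleftrightarrow> 1 \<le> ntapes M \<and> 3 \<le> nsyms M \<and>
     start M < nstates M \<and> accept M < nstates M \<and> reject M < nstates M \<and>
     accept M \<noteq> reject M \<and>
     (\<forall>q < nstates M. \<forall>xs. length xs = ntapes M \<and> set xs \<subseteq> {..<nsyms M} \<longrightarrow>
        (case delta M q xs of (q', as) \<Rightarrow>
           q' < nstates M \<and> length as = ntapes M \<and> fst ` set as \<subseteq> {..<nsyms M}))"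

text \<open>A tape is its content together with the head position; a configuration is the state
  together with the list of tapes.\<close>

type_synonym tape = "(int \<Rightarrow> nat) \<times> int"
type_synonym config = "nat \<times> tape list"

fun shift :: "move \<Rightarrow> int" where
  "shift MoveLeft = - 1"
| "shift Stay = 0"
| "shift MoveRight = 1"

definition read_tape :: "tape \<Rightarrow> nat" where
  "read_tape = (\<lambda>(c, h). c h)"

definition act_tape :: "tape \<Rightarrow> nat \<times> move \<Rightarrow> tape" where
  "act_tape = (\<lambda>(c, h) (a, m). (c(h := a), h + shift m))"

definition halted :: "tm \<Rightarrow> config \<Rightarrow> bool" where
  "halted M cfg \<longleftrightarrow> fst cfg = accept M \<or> fst cfg = reject M"

definition step :: "tm \<Rightarrow> config \<Rightarrow> config" where
  "step M cfg =
     (if halted M cfg then cfg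
      else case delta M (fst cfg) (map read_tape (snd cfg)) of
             (q', as) \<Rightarrow> (q', map2 act_tape (snd cfg) as))"

fun bit_sym :: "bool \<Rightarrow> nat" where
  "bit_sym False = 1"
| "bit_sym True = 2"

definition input_tape :: "bool list \<Rightarrow> tape" where
  "input_tape x =
     ((\<lambda>i. if 0 \<le> i \<and> i < int (length x) then bit_sym (x ! nat i) else 0), 0)"

text \<open>A machine may receive several input strings, the i-th of them on tape i. The remaining
  tapes are blank.\<close>

definition initial :: "tm \<Rightarrow> bool list list \<Rightarrow> config" where
  "initial M xs =
     (start M, map (\<lambda>i. input_tape (if i < length xs then xs ! i else [])) [0..<ntapes M])"

definition run :: "tm \<Rightarrow> bool list list \<Rightarrow> nat \<Rightarrow> config" where
  "run M xs t = (step M ^^ t) (initial M xs)"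

text \<open>The output string is read off tape 0, from cell 0 up to the first blank.\<close>

definition has_output :: "config \<Rightarrow> bool list \<Rightarrow> bool" where
  "has_output cfg y \<longleftrightarrow>
     (\<forall>i < length y. fst (hd (snd cfg)) (int i) = bit_sym (y ! i)) \<and>
     fst (hd (snd cfg)) (int (length y)) = 0"

section \<open>Polynomial time, NP and NP-completeness\<close>

definition poly_time_computable :: "(bool list \<Rightarrow> bool list) \<Rightarrow> bool" where
  "poly_time_computable f \<longleftrightarrow> (\<exists>M (p :: nat poly). wf_tm M \<and>
     (\<forall>x. \<exists>t \<le> poly p (length x). halted M (run M [x] t) \<and> has_output (run M [x] t) (f x)))"

definition poly_reducible :: "bool list set \<Rightarrow> bool list set \<Rightarrow> bool" where
  "poly_reducible A B \<longleftrightarrow> (\<exists>f. poly_time_computable f \<and> (\<forall>x. x \<in> A \<longleftrightarrow> f x \<in> B))"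

text \<open>Membership in NP: a polynomial-time machine (with the string on tape 0 and a certificate
  on tape 1) that accepts some certificate of polynomial length iff the string is in the
  language.\<close>

definition in_NP :: "bool list set \<Rightarrow> bool" where
  "in_NP L \<longleftrightarrow> (\<exists>M (p :: nat poly) (q :: nat poly). wf_tm M \<and> 2 \<le> ntapes M \<and>
     (\<forall>x w. \<exists>t \<le> poly q (length x + length w). halted M (run M [x, w] t)) \<and>
     (\<forall>x. x \<in> L \<longleftrightarrow>
        (\<exists>w. length w \<le> poly p (length x) \<and> (\<exists>t. fst (run M [x, w] t) = accept M))))"

definition NP_hard :: "bool list set \<Rightarrow> bool" where
  "NP_hard L \<longleftrightarrow> (\<forall>A. in_NP A \<longrightarrow> poly_reducible A L)"

definition NP_complete :: "bool list set \<Rightarrow> bool" where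
  "NP_complete L \<longleftrightarrow> in_NP L \<and> NP_hard L"

section \<open>Solving a decision problem within a time bound\<close>

text \<open>A decision problem is given by its set of instances, their encoding as bit strings, and
  the yes-instances. The time bound is a function of the instance, so that it may refer to a
  parameter of the instance.\<close>

definition solves_in_time ::
  "tm \<Rightarrow> 'i set \<Rightarrow> ('i \<Rightarrow> bool list) \<Rightarrow> ('i \<Rightarrow> bool) \<Rightarrow> ('i \<Rightarrow> real) \<Rightarrow> bool" where
  "solves_in_time M Inst enc yes T \<longleftrightarrow> wf_tm M \<and>
     (\<forall>x \<in> Inst. \<exists>t. real t \<le> T x \<and>
        fst (run M [enc x] t) = (if yes x then accept M else reject M))"

text \<open>Solvability in time $2^{o(\kappa)} \cdot s^{O(1)}$ for a parameter $\kappa$ and a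
  size measure $s$.\<close>

definition subexp_solvable ::
  "'i set \<Rightarrow> ('i \<Rightarrow> bool list) \<Rightarrow> ('i \<Rightarrow> bool) \<Rightarrow> ('i \<Rightarrow> nat) \<Rightarrow> ('i \<Rightarrow> nat) \<Rightarrow> bool" where
  "subexp_solvable Inst enc yes \<kappa> s \<longleftrightarrow>
     (\<exists>M (f :: nat \<Rightarrow> real) (p :: nat poly). f \<in> o(\<lambda>n. real n) \<and>
        solves_in_time M Inst enc yes (\<lambda>x. 2 powr f (\<kappa> x) * real (poly p (s x))))"

section \<open>Encodings of instances\<close>

text \<open>Unary numbers and lists are encoded in a self-delimiting way.\<close>

definition enc_unary :: "nat \<Rightarrow> bool list" where
  "enc_unary n = replicate n True @ [False]"

definition enc_list :: "('a \<Rightarrow> bool list) \<Rightarrow> 'a list \<Rightarrow> bool list" where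
  "enc_list enc xs = concat (map (\<lambda>x. True # enc x) xs) @ [False]"

text \<open>Binary representation, least significant bit first.\<close>

fun enc_binary :: "nat \<Rightarrow> bool list" where
  "enc_binary k = (if k = 0 then [] else odd k # enc_binary (k div 2))"

declare enc_binary.simps [simp del]

text \<open>The instances presented to a machine are the pairs (G, k) where G is a graph on the
  vertices 0, ..., n - 1. Such a pair is encoded by n in unary, the adjacency matrix row by
  row, and k in binary.\<close>

definition edge_deletion_instances :: "(nat ugraph \<times> nat) set" where
  "edge_deletion_instances = {(G, k). simple_graph G \<and> (\<exists>n. verts G = {..<n})}"

definition enc_edge_deletion :: "nat ugraph \<times> nat \<Rightarrow> bool list" where
  "enc_edge_deletion = (\<lambda>(G, k). let n = card (verts G) in
     enc_unary n @ [{i, j} \<in> edges G. i \<leftarrow> [0..<n], j \<leftarrow> [0..<n]] @ enc_binary k)"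

definition free_edge_deletion_language :: "'b ugraph \<Rightarrow> bool list set" where
  "free_edge_deletion_language H =
     enc_edge_deletion ` {x \<in> edge_deletion_instances. free_edge_deletion H x}"

section \<open>3-SAT and the Exponential Time Hypothesis\<close>

text \<open>A literal is a sign (True for positive) and a variable; a formula in conjunctive normal
  form is a list of clauses, each of them a list of literals.\<close>

type_synonym literal = "bool \<times> nat"
type_synonym cnf = "literal list list"

definition three_cnf :: "cnf set" where
  "three_cnf = {\<phi>. \<forall>C \<in> set \<phi>. length C \<le> 3}"

definition cnf_vars :: "cnf \<Rightarrow> nat set" where
  "cnf_vars \<phi> = snd ` (\<Union>C \<in> set \<phi>. set C)"

definition satisfiable :: "cnf \<Rightarrow> bool" where
  "satisfiable \<phi> \<longleftrightarrow>
     (\<exists>\<alpha> :: nat \<Rightarrow> bool. \<forall>C \<in> set \<phi>. \<exists>(b, v) \<in> set C. \<alpha> v = b)"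

definition enc_cnf :: "cnf \<Rightarrow> bool list" where
  "enc_cnf = enc_list (enc_list (\<lambda>(b, v). b # enc_unary v))"

text \<open>The running time $2^{o(n)}$ in the hypothesis is understood up to a factor polynomial in
  the length of the formula, as usual: a formula with n variables can be arbitrarily long
  (repeated clauses, large variable indices), so without this factor no machine could even
  read its input in time. For formulas without repetitions over the variables
  $0, \ldots, n - 1$ that factor is polynomial in n and is absorbed by $2^{o(n)}$.\<close>

definition ETH :: bool where
  "ETH \<longleftrightarrow> \<not> subexp_solvable three_cnf enc_cnf satisfiable
     (\<lambda>\<phi>. card (cnf_vars \<phi>)) (\<lambda>\<phi>. length (enc_cnf \<phi>))"

end

theory Submission
  imports Defs
begin

text \<open>A connected regular graph \<open>R\<close> with at least two edges has a path \<open>0 - 1 - 2\<close> whose removal leaves a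
  connected graph. Given a triangle-free graph \<open>Q\<close>, add an apex and, for every edge \<open>ab\<close> of \<open>Q\<close>, a private
  copy of \<open>R\<close> in which \<open>a\<close>, the apex and \<open>b\<close> play the roles of 0, 1 and 2. Deleting the edges from the apex
  to a vertex cover of \<open>Q\<close> destroys all copies, and regularity and connectedness prevent new ones;
  conversely a deletion set yields a vertex cover that is no larger. Vertex cover in triangle-free graphs
  encodes 3-SAT with a budget linear in the number of variables and clauses.

  For the bound under ETH, formulas are first sparsified to linearly many clauses. The quality
  parameter \<open>j\<close> of the sparsification has to grow with the number of variables at a rate that depends
  on the unknown running time of the assumed solver; therefore all \<open>j\<close> are tried in parallel. Turing
  machines are obtained from functional programs on binary trees, which are compiled to six tapes.\<close>

section \<open>Structured tape programs\<close>

text \<open>Several obstacles shape the development. The copies of \<open>R\<close> overlap in the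
  apex and in vertices of \<open>Q\<close>, so a copy could arise across several of them. A copy
  that contains one private vertex is driven by its degrees to contain the neighbours of that
  vertex, and hence the whole private part if this part is connected: that is why the path must not
  separate \<open>R\<close>. Triangles of \<open>Q\<close> are excluded for the case that 0, 1, 2
  form a triangle of \<open>R\<close>; then \<open>Q\<close> itself is visible in the constructed
  graph, and a triangle of \<open>Q\<close> could be a copy of \<open>R\<close> that avoids the
  apex. ETH speaks of one machine with one exponent in o(n), while a fixed \<open>j\<close> only
  gives the rate of one epsilon. The dovetailed search is a single machine for all epsilon; its
  exponent is found afterwards by diagonalising over bounds on its actual running time. The assumed
  solver is an arbitrary machine with an unknown time bound, so the search has to simulate it step
  by step. Hardness is proved for all languages with a verifying machine, so the tableau of a
  computation is written as a formula from scratch.\<close>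

datatype prog =
    Act "nat list => (nat \<times> move) list"
  | Seq prog prog
  | Ite "nat list => bool" prog prog
  | Whl "nat list => bool" prog

primrec psize :: "prog => nat" where
  "psize (Act f) = 1"
| "psize (Seq P Q) = psize P + psize Q"
| "psize (Ite b P Q) = Suc (psize P + psize Q)"
| "psize (Whl b P) = Suc (psize P)"

definition stay :: "nat list => (nat \<times> move) list" where
  "stay xs = map (\<lambda>a. (a, Stay)) xs"

text \<open>\<open>code_at P a e\<close> is the transition function of \<open>P\<close> placed at the states
  \<open>a, ..., a + psize P - 1\<close>, with entry \<open>a\<close> and exit \<open>e\<close>.\<close>

primrec code_at :: "prog => nat => nat => nat => nat list => nat \<times> (nat \<times> move) list" where
  "code_at (Act f) a e q xs = (e, f xs)"
| "code_at (Seq P Q) a e q xs =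
     (if q < a + psize P then code_at P a (a + psize P) q xs else code_at Q (a + psize P) e q xs)"
| "code_at (Ite b P Q) a e q xs =
     (if q = a then (if b xs then Suc a else Suc a + psize P, stay xs)
      else if q < Suc a + psize P then code_at P (Suc a) e q xs
      else code_at Q (Suc a + psize P) e q xs)"
| "code_at (Whl b P) a e q xs =
     (if q = a then (if b xs then Suc a else e, stay xs) else code_at P (Suc a) a q xs)"

inductive exec :: "prog => tape list => nat => tape list => bool" where
  Act: "exec (Act f) ts 1 (map2 act_tape ts (f (map read_tape ts)))"
| Seq: "exec P ts t ts' ==> exec Q ts' u ts'' ==> exec (Seq P Q) ts (t + u) ts''"
| IteT: "b (map read_tape ts) ==> exec P ts t ts' ==> exec (Ite b P Q) ts (Suc t) ts'"
| IteF: "\<not> b (map read_tape ts) ==> exec Q ts t ts' ==> exec (Ite b P Q) ts (Suc t) ts'"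
| WhlF: "\<not> b (map read_tape ts) ==> exec (Whl b P) ts 1 ts"
| WhlT: "b (map read_tape ts) ==> exec P ts t ts' ==> exec (Whl b P) ts' u ts''
    ==> exec (Whl b P) ts (Suc (t + u)) ts''"

lemma psize_pos: "0 < psize P"
  by (induction P) auto

lemma act_stay: "map2 act_tape ts (stay (map read_tape ts)) = ts"
  by (induction ts) (auto simp: stay_def act_tape_def read_tape_def split: prod.splits)

text \<open>The induction needs address \<open>a\<close> and exit \<open>e\<close> free and demands
  nothing of the state \<open>e\<close> itself: the body of \<open>Whl\<close> is placed with the
  entry of the loop as its exit. The states of the block must differ from accept and reject because
  \<open>step\<close> freezes halted configurations.\<close>

lemma exec_run:
  assumes "exec P ts t ts'"
    and "!!q xs. a <= q ==> q < a + psize P ==>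
      delta M q xs = code_at P a e q xs \<and> q ~= accept M \<and> q ~= reject M"
  shows "(step M ^^ t) (a, ts) = (e, ts')"
  using assms
proof (induction arbitrary: a e rule: exec.induct)
  case (Act f ts)
  then show ?case by (auto simp: step_def halted_def)
next
  case (Seq P ts t ts' Q u ts'')
  have 1: "(step M ^^ t) (a, ts) = (a + psize P, ts')"
    by (rule Seq.IH(1)) (use Seq.prems in \<open>auto\<close>)
  have 2: "(step M ^^ u) (a + psize P, ts') = (e, ts'')"
    by (rule Seq.IH(2)) (use Seq.prems in \<open>auto\<close>)
  show ?case using 1 2 by (metis (no_types) add.commute comp_apply funpow_add)
next
  case (IteT b ts P t ts' Q)
  have 1: "(step M ^^ t) (Suc a, ts) = (e, ts')"
    by (rule IteT.IH) (use IteT.prems in \<open>auto\<close>)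
  have 2: "step M (a, ts) = (Suc a, ts)"
    using IteT.prems[of a] IteT.hyps by (auto simp: step_def halted_def act_stay)
  show ?case by (simp add: funpow_Suc_right 1 2 del: funpow.simps)
next
  case (IteF b ts Q t ts' P)
  have 1: "(step M ^^ t) (Suc a + psize P, ts) = (e, ts')"
    by (rule IteF.IH) (use IteF.prems in \<open>auto\<close>)
  have 2: "step M (a, ts) = (Suc a + psize P, ts)"
    using IteF.prems[of a] IteF.hyps by (auto simp: step_def halted_def act_stay)
  show ?case using 1 by (simp add: funpow_Suc_right 2 del: funpow.simps)
next
  case (WhlF b ts P)
  then show ?case using WhlF.prems[of a] by (auto simp: step_def halted_def act_stay)
next
  case (WhlT b ts P t ts' u ts'')
  have 1: "(step M ^^ t) (Suc a, ts) = (a, ts')"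
    by (rule WhlT.IH(1)) (use WhlT.prems in \<open>auto\<close>)
  have 2: "step M (a, ts) = (Suc a, ts)"
    using WhlT.prems[of a] WhlT.hyps by (auto simp: step_def halted_def act_stay)
  have 3: "(step M ^^ u) (a, ts') = (e, ts'')"
    by (rule WhlT.IH(2)) (use WhlT.prems in \<open>auto\<close>)
  have "(step M ^^ (u + t)) (Suc a, ts) = (e, ts'')"
    using 1 3 by (simp add: funpow_add)
  then show ?case by (simp add: funpow_Suc_right 2 add.commute del: funpow.simps)
qed

section \<open>Well-formed transition functions and the resulting machine\<close>

primrec wfp :: "nat => nat => prog => bool" where
  "wfp K S (Act f) = (\<forall>xs. length xs = K --> set xs \<subseteq> {..<S} -->
      length (f xs) = K \<and> fst ` set (f xs) \<subseteq> {..<S})"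
| "wfp K S (Seq P Q) = (wfp K S P \<and> wfp K S Q)"
| "wfp K S (Ite b P Q) = (wfp K S P \<and> wfp K S Q)"
| "wfp K S (Whl b P) = wfp K S P"

lemma stay_wf: "length (stay xs) = length xs" "fst ` set (stay xs) = set xs"
  by (auto simp: stay_def image_image)

definition okres :: "nat => nat => nat => nat => nat \<times> (nat \<times> move) list => bool" where
  "okres K S e n r \<longleftrightarrow> length (snd r) = K \<and> fst ` set (snd r) \<subseteq> {..<S} \<and> (fst r = e \<or> fst r < n)"

lemma okres_mono: "okres K S e n r ==> (e = e' \<or> e < n') ==> n <= n' ==> okres K S e' n' r"
  by (auto simp: okres_def)

text \<open>Control stays below the end of the block or leaves through \<open>e\<close>. In
  \<open>Seq\<close> the exit of the first part is the entry of the second, which lies below the end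
  because \<open>psize\<close> is positive.\<close>

lemma code_at_wf:
  assumes "wfp K S P" "a <= q" "q < a + psize P" "length xs = K" "set xs \<subseteq> {..<S}"
  shows "okres K S e (a + psize P) (code_at P a e q xs)"
  using assms
proof (induction P arbitrary: a e)
  case (Act f)
  then show ?case by (auto simp: okres_def)
next
  case (Seq P1 P2)
  show ?case
  proof (cases "q < a + psize P1")
    case True
    then have "okres K S (a + psize P1) (a + psize P1) (code_at P1 a (a + psize P1) q xs)"
      using Seq.prems by (intro Seq.IH(1)) auto
    then have "okres K S e (a + psize (Seq P1 P2)) (code_at P1 a (a + psize P1) q xs)"
      by (rule okres_mono) (use psize_pos[of P2] in auto)
    then show ?thesis using True by simp
  next
    case False
    then have "okres K S e (a + psize P1 + psize P2) (code_at P2 (a + psize P1) e q xs)"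
      using Seq.prems by (intro Seq.IH(2)) auto
    then show ?thesis using False by (simp add: add.assoc)
  qed
next
  case (Ite b P Q)
  consider "q = a" | "q ~= a" "q < Suc a + psize P" | "q ~= a" "\<not> q < Suc a + psize P" by blast
  then show ?case
  proof cases
    case 1
    then show ?thesis using Ite.prems psize_pos[of P] psize_pos[of Q] by (simp add: okres_def stay_wf)
  next
    case 2
    then have "okres K S e (Suc a + psize P) (code_at P (Suc a) e q xs)"
      using Ite.prems by (intro Ite.IH(1)) auto
    then have "okres K S e (a + psize (Ite b P Q)) (code_at P (Suc a) e q xs)"
      by (rule okres_mono) auto
    then show ?thesis using 2 by simp
  next
    case 3
    then have "okres K S e (Suc a + psize P + psize Q) (code_at Q (Suc a + psize P) e q xs)"
      using Ite.prems by (intro Ite.IH(2)) auto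
    then show ?thesis using 3 by (simp add: add.assoc)
  qed
next
  case (Whl b P)
  show ?case
  proof (cases "q = a")
    case True
    then show ?thesis using Whl.prems psize_pos[of P] by (simp add: okres_def stay_wf)
  next
    case False
    then have "okres K S a (Suc a + psize P) (code_at P (Suc a) a q xs)"
      using Whl.prems by (intro Whl.IH) auto
    then have "okres K S e (a + psize (Whl b P)) (code_at P (Suc a) a q xs)"
      by (rule okres_mono) auto
    then show ?thesis using False by simp
  qed
qed

text \<open>Besides the program there are three states: the one after it, where \<open>b\<close>
  inspects the symbols under the heads, and the two halting states. Machines that compute a function
  use a constant \<open>b\<close>, machines that decide look at the top of a stack.\<close>

definition machine :: "nat => nat => prog => (nat list => bool) => tm" where
  "machine K S P b = \<lparr>ntapes = K, nstates = psize P + 3, nsyms = S, start = 0,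
     accept = psize P + 1, reject = psize P + 2,
     delta = (\<lambda>q xs. if q < psize P then code_at P 0 (psize P) q xs
        else (if b xs then psize P + 1 else psize P + 2, stay xs))\<rparr>"

lemma machine_wf:
  assumes "wfp K S P" "1 <= K" "3 <= S"
  shows "wf_tm (machine K S P b)"
proof -
  have "case delta (machine K S P b) q xs of (q', as) =>
      q' < nstates (machine K S P b) \<and> length as = K \<and> fst ` set as \<subseteq> {..<S}"
    if "length xs = K" "set xs \<subseteq> {..<S}" for q xs
  proof (cases "q < psize P")
    case True
    then show ?thesis
      using code_at_wf[OF assms(1), of 0 q xs "psize P"] that
      by (cases "code_at P 0 (psize P) q xs") (simp add: machine_def okres_def; linarith)
  next
    case False
    then show ?thesis using that by (auto simp: machine_def stay_wf)
  qed
  then show ?thesis using assms by (auto simp: wf_tm_def machine_def)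
qed

lemma machine_run:
  assumes "exec P ts t ts'" and "initial (machine K S P b) xs = (0, ts)"
  shows "run (machine K S P b) xs (Suc t) =
     (if b (map read_tape ts') then psize P + 1 else psize P + 2, ts')"
proof -
  let ?M = "machine K S P b"
  have "(step ?M ^^ t) (0, ts) = (psize P, ts')"
    by (rule exec_run[OF assms(1)]) (auto simp: machine_def)
  moreover have "step ?M (psize P, ts') = (if b (map read_tape ts') then psize P + 1 else psize P + 2, ts')"
    by (auto simp: step_def machine_def halted_def act_stay)
  ultimately show ?thesis by (simp add: run_def assms(2))
qed

section \<open>Stacks on tapes\<close>

text \<open>The head is on the top of the stack and all cells outside the stack are blank, also on
  the left. With nonzero entries, symbol 0 under the head means that the stack is empty; a pop has
  to erase, and a push finds a blank cell to its left.\<close>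

definition stk :: "tape => nat list => bool" where
  "stk tp xs \<longleftrightarrow> (\<forall>i. fst tp (snd tp + i) = (if 0 <= i \<and> i < int (length xs) then xs ! nat i else 0))"

definition topsym :: "nat list => nat" where
  "topsym xs = (case xs of [] => 0 | x # _ => x)"

lemma topsym_simps [simp]: "topsym [] = 0" "topsym (x # xs) = x"
  by (auto simp: topsym_def)

lemma stk_read: "stk tp xs ==> read_tape tp = topsym xs"
  by (cases tp; cases xs) (auto simp: stk_def read_tape_def dest: spec[of _ 0])

lemma stk_pop: "stk tp xs ==> stk (act_tape tp (0, MoveRight)) (tl xs)"
  unfolding stk_def
proof (intro allI)
  fix i assume a: "\<forall>i. fst tp (snd tp + i) = (if 0 <= i \<and> i < int (length xs) then xs ! nat i else 0)"
  show "fst (act_tape tp (0, MoveRight)) (snd (act_tape tp (0, MoveRight)) + i) =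
    (if 0 <= i \<and> i < int (length (tl xs)) then tl xs ! nat i else 0)"
    using a[rule_format, of "i + 1"]
    by (cases tp; cases xs) (auto simp: act_tape_def nat_add_distrib algebra_simps)
qed

lemma stk_push: "stk tp xs ==>
   stk (act_tape (act_tape tp (topsym xs, MoveLeft)) (a, Stay)) (a # xs)"
  unfolding stk_def
proof (intro allI)
  fix i assume a: "\<forall>i. fst tp (snd tp + i) = (if 0 <= i \<and> i < int (length xs) then xs ! nat i else 0)"
  show "fst (act_tape (act_tape tp (topsym xs, MoveLeft)) (a, Stay))
     (snd (act_tape (act_tape tp (topsym xs, MoveLeft)) (a, Stay)) + i) =
    (if 0 <= i \<and> i < int (length (a # xs)) then (a # xs) ! nat i else 0)"
    using a[rule_format, of "i - 1"]
    by (cases tp; cases xs) (auto simp: act_tape_def nth_Cons' nat_diff_distrib algebra_simps)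
qed

text \<open>The compiled programs use six tapes: tape 0 (input and output) is described explicitly,
  tapes 1 to 5 hold stacks.\<close>

type_synonym conf = "tape \<times> (nat => nat list)"

section \<open>Timed triples for programs on stacks\<close>

definition conf_of :: "tape list => conf => bool" where
  "conf_of ts c \<longleftrightarrow> length ts = 6 \<and> ts ! 0 = fst c \<and> (\<forall>i\<in>{1..<6}. stk (ts ! i) (snd c i))"

definition tops :: "conf => nat list" where
  "tops c = map (\<lambda>i. if i = 0 then read_tape (fst c) else topsym (snd c i)) [0..<6]"

lemma conf_of_tops: "conf_of ts c ==> map read_tape ts = tops c"
  by (rule nth_equalityI) (auto simp: conf_of_def tops_def stk_read)

lemma tops_nth [simp]:
  "tops c ! 0 = read_tape (fst c)"
  "0 < i ==> i < 6 ==> tops c ! i = topsym (snd c i)"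
  by (auto simp: tops_def nth_map_upt simp del: upt_Suc upt_conv_Cons upt_rec_numeral)

text \<open>A Hoare triple with a time bound and one configuration on either side. A configuration
  forgets where the heads of the stack tapes stand, hence the quantification over all tape lists
  that represent it.\<close>

definition ht :: "prog => conf => nat => conf => bool" where
  "ht P c n c' \<longleftrightarrow> (\<forall>ts. conf_of ts c --> (\<exists>t\<le>n. \<exists>ts'. exec P ts t ts' \<and> conf_of ts' c'))"

lemma ht_conseq: "ht P c n c' ==> n <= m ==> c' = c'' ==> ht P c m c''"
  unfolding ht_def by (meson order_trans)

lemma ht_Seq: "ht P c n c' ==> ht Q c' m c'' ==> ht (Seq P Q) c (n + m) c''"
  unfolding ht_def by (meson add_mono exec.Seq)

lemma ht_Ite:
  assumes "b (tops c) ==> ht P c n c'" "\<not> b (tops c) ==> ht Q c n c'"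
  shows "ht (Ite b P Q) c (Suc n) c'"
  unfolding ht_def
proof (intro allI impI)
  fix ts assume ts: "conf_of ts c"
  show "\<exists>t\<le>Suc n. \<exists>ts'. exec (Ite b P Q) ts t ts' \<and> conf_of ts' c'"
    using assms ts conf_of_tops[OF ts] unfolding ht_def
    by (metis Suc_le_mono exec.IteF exec.IteT)
qed

lemma ht_WhlF: "\<not> b (tops c) ==> ht (Whl b P) c 1 c"
  unfolding ht_def by (metis conf_of_tops exec.WhlF order_refl)

lemma ht_WhlT: "b (tops c) ==> ht P c n c' ==> ht (Whl b P) c' m c'' ==> ht (Whl b P) c (Suc (n + m)) c''"
  unfolding ht_def
proof (intro allI impI)
  fix ts assume a: "b (tops c)" "conf_of ts c"
    "\<forall>ts. conf_of ts c --> (\<exists>t\<le>n. \<exists>ts'. exec P ts t ts' \<and> conf_of ts' c')"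
    "\<forall>ts. conf_of ts c' --> (\<exists>t\<le>m. \<exists>ts'. exec (Whl b P) ts t ts' \<and> conf_of ts' c'')"
  then obtain t ts' u ts'' where "t <= n" "exec P ts t ts'" "conf_of ts' c'" "u <= m"
    "exec (Whl b P) ts' u ts''" "conf_of ts'' c''" by metis
  then show "\<exists>t\<le>Suc (n + m). \<exists>ts'. exec (Whl b P) ts t ts' \<and> conf_of ts' c''"
    using a conf_of_tops[OF a(2)]
    by (intro exI[of _ "Suc (t + u)"] exI[of _ ts''] conjI exec.WhlT[of b ts P t ts' u ts'']) auto
qed

definition on :: "nat => (nat => nat \<times> move) => prog" where
  "on i f = Act (\<lambda>xs. (stay xs)[i := f (xs ! i)])"

definition Pop :: "nat => prog" where "Pop i = on i (\<lambda>_. (0, MoveRight))"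
definition Push :: "nat => nat => prog" where
  "Push i a = Seq (on i (\<lambda>x. (x, MoveLeft))) (on i (\<lambda>_. (a, Stay)))"

lemma exec_on:
  assumes "i < length ts"
  shows "exec (on i f) ts 1 (ts[i := act_tape (ts ! i) (f (read_tape (ts ! i)))])"
proof -
  have "map2 act_tape ts ((stay (map read_tape ts))[i := f (map read_tape ts ! i)]) =
    ts[i := act_tape (ts ! i) (f (read_tape (ts ! i)))]"
    using assms
    by (intro nth_equalityI)
      (auto simp: stay_def nth_list_update act_tape_def read_tape_def split: prod.splits)
  then show ?thesis
    using exec.Act[of "\<lambda>xs. (stay xs)[i := f (xs ! i)]" ts] by (simp add: on_def)
qed

lemma ht_on0: "ht (on 0 f) (tp, \<sigma>) 1 (act_tape tp (f (read_tape tp)), \<sigma>)"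
  unfolding ht_def
proof (intro allI impI)
  fix ts assume c: "conf_of ts (tp, \<sigma>)"
  then have "exec (on 0 f) ts 1 (ts[0 := act_tape tp (f (read_tape tp))])"
    using exec_on[of 0 ts f] by (auto simp: conf_of_def)
  moreover have "conf_of (ts[0 := act_tape tp (f (read_tape tp))]) (act_tape tp (f (read_tape tp)), \<sigma>)"
    using c by (auto simp: conf_of_def)
  ultimately show "\<exists>t\<le>1. \<exists>ts'. exec (on 0 f) ts t ts' \<and> conf_of ts' (act_tape tp (f (read_tape tp)), \<sigma>)"
    by blast
qed

lemma ht_Pop:
  assumes "0 < i" "i < 6"
  shows "ht (Pop i) (tp, \<sigma>) 1 (tp, \<sigma>(i := tl (\<sigma> i)))"
  unfolding ht_def
proof (intro allI impI)
  fix ts assume c: "conf_of ts (tp, \<sigma>)"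
  let ?ts = "ts[i := act_tape (ts ! i) (0, MoveRight)]"
  have "exec (Pop i) ts 1 ?ts"
    using exec_on[of i ts "\<lambda>_. (0, MoveRight)"] c assms by (auto simp: conf_of_def Pop_def)
  moreover have "conf_of ?ts (tp, \<sigma>(i := tl (\<sigma> i)))"
    using c assms by (auto simp: conf_of_def nth_list_update stk_pop)
  ultimately show "\<exists>t\<le>1. \<exists>ts'. exec (Pop i) ts t ts' \<and> conf_of ts' (tp, \<sigma>(i := tl (\<sigma> i)))"
    by blast
qed

lemma ht_Push:
  assumes "0 < i" "i < 6"
  shows "ht (Push i a) (tp, \<sigma>) 2 (tp, \<sigma>(i := a # \<sigma> i))"
  unfolding ht_def
proof (intro allI impI)
  fix ts assume c: "conf_of ts (tp, \<sigma>)"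
  let ?ts = "ts[i := act_tape (ts ! i) (topsym (\<sigma> i), MoveLeft)]"
  let ?us = "ts[i := act_tape (act_tape (ts ! i) (topsym (\<sigma> i), MoveLeft)) (a, Stay)]"
  have i: "i < length ts" and s: "stk (ts ! i) (\<sigma> i)" using c assms by (auto simp: conf_of_def)
  have "exec (on i (\<lambda>x. (x, MoveLeft))) ts 1 ?ts"
    using exec_on[of i ts "\<lambda>x. (x, MoveLeft)"] i stk_read[OF s] by simp
  moreover have "exec (on i (\<lambda>_. (a, Stay))) ?ts 1 ?us"
    using exec_on[of i ?ts "\<lambda>_. (a, Stay)"] i by simp
  ultimately have "exec (Push i a) ts 2 ?us"
    unfolding Push_def using exec.Seq by (metis one_add_one)
  moreover have "conf_of ?us (tp, \<sigma>(i := a # \<sigma> i))"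
    using c assms by (auto simp: conf_of_def nth_list_update stk_push)
  ultimately show "\<exists>t\<le>2. \<exists>ts'. exec (Push i a) ts t ts' \<and> conf_of ts' (tp, \<sigma>(i := a # \<sigma> i))"
    by blast
qed

lemma wfp_on: "i < K ==> (!!x. x < S ==> fst (f x) < S) ==> wfp K S (on i f)"
  by (auto simp: on_def stay_wf dest!: set_update_subset_insert[THEN subsetD])
    (auto simp: stay_def subset_iff)

lemma wfp_Pop: "i < K ==> 0 < S ==> wfp K S (Pop i)"
  unfolding Pop_def by (rule wfp_on) auto

lemma wfp_Push: "i < K ==> a < S ==> wfp K S (Push i a)"
  unfolding Push_def by (auto intro!: wfp_on)

section \<open>Tree combinators and their compilation\<close>

datatype tree = Lf | Nd tree tree

text \<open>Preorder, hence self-delimiting: several trees can lie on one stack, and the end of the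
  top one is found by counting. The blank stays free to mark the bottom, and the first symbol alone
  tells a leaf from a node.\<close>

primrec ser :: "tree => nat list" where
  "ser Lf = [1]"
| "ser (Nd l r) = 2 # ser l @ ser r"

primrec sz :: "tree => nat" where
  "sz Lf = 1"
| "sz (Nd l r) = Suc (sz l + sz r)"

primrec hd_tree :: "tree => tree" where
  "hd_tree Lf = Lf"
| "hd_tree (Nd l r) = l"

primrec tl_tree :: "tree => tree" where
  "tl_tree Lf = Lf"
| "tl_tree (Nd l r) = r"

lemma length_ser [simp]: "length (ser x) = sz x"
  by (induction x) auto

lemma sz_pos [simp]: "0 < sz x"
  by (induction x) auto

lemma set_ser: "set (ser x) \<subseteq> {1, 2}"
  by (induction x) auto

datatype comb = CId | CNil | CHd | CTl | CSeq comb comb | CPair comb comb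
  | CIf comb comb comb | CWhile comb comb

text \<open>The charges are the sizes of the trees that the compiled program copies, swaps or drops,
  so that machine time is at most 60 times the cost. Every rule but \<open>Sq\<close>, whose
  compilation adds no step, charges some size; sizes are positive and thus absorb additive
  constants.\<close>

inductive cev :: "comb => tree => nat => tree => bool" where
  Id: "cev CId x (sz x) x"
| Nil: "cev CNil x (sz x) Lf"
| Hd: "cev CHd x (sz x) (hd_tree x)"
| Tl: "cev CTl x (sz x) (tl_tree x)"
| Sq: "cev f x t y ==> cev g y u z ==> cev (CSeq f g) x (t + u) z"
| Pair: "cev f x t y ==> cev g x u z ==> cev (CPair f g) x (t + u + sz x + sz y + sz z) (Nd y z)"
| IfT: "cev p x t b ==> b ~= Lf ==> cev f x u y ==> cev (CIf p f g) x (t + u + sz x + sz b) y"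
| IfF: "cev p x t Lf ==> cev g x u y ==> cev (CIf p f g) x (t + u + sz x) y"
| WhileT: "cev p x t b ==> b ~= Lf ==> cev f x u y ==> cev (CWhile p f) y v z
    ==> cev (CWhile p f) x (t + u + v + sz x + sz b) z"
| WhileF: "cev p x t Lf ==> cev (CWhile p f) x (t + sz x) x"

lemma sz_hd_tl: "sz (hd_tree x) <= sz x" "sz (tl_tree x) <= sz x"
  by (cases x; simp)+

text \<open>A run cannot produce more than it received and spent. This turns time bounds into size
  bounds when programs are composed.\<close>

lemma cev_size: "cev c x t y ==> sz y <= sz x + t"
proof (induction rule: cev.induct)
  case (Hd x)
  then show ?case using sz_hd_tl(1)[of x] by linarith
next
  case (Tl x)
  then show ?case using sz_hd_tl(2)[of x] by linarith
qed (auto simp: Suc_le_eq)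

text \<open>Tape 1 holds the second input, tape 2 the data stack; tapes 3 and 4 are scratch space and
  tape 5 counts the subtrees still to be read while one tree is moved.\<close>

abbreviation (input) "tJ \<equiv> (1::nat)"
abbreviation (input) "tS \<equiv> (2::nat)"
abbreviation (input) "tA \<equiv> (3::nat)"
abbreviation (input) "tB \<equiv> (4::nat)"
abbreviation (input) "tC \<equiv> (5::nat)"

abbreviation isat :: "nat => nat => nat list => bool" where "isat i a \<equiv> \<lambda>xs. xs ! i = a"
abbreviation nonempty :: "nat => nat list => bool" where "nonempty i \<equiv> \<lambda>xs. xs ! i ~= 0"

definition MvLoop :: "nat => prog" where
  "MvLoop y = Whl (nonempty tC) (Ite (isat tS 2)
     (Seq (Pop tS) (Seq (Push y 2) (Push tC 1))) (Seq (Pop tS) (Seq (Push y 1) (Pop tC))))"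

definition Mv :: "nat => prog" where "Mv y = Seq (Push tC 1) (MvLoop y)"

definition Tr :: "nat => nat => prog" where
  "Tr x y = Whl (nonempty x) (Ite (isat x 2) (Seq (Pop x) (Push y 2)) (Seq (Pop x) (Push y 1)))"

definition Clear :: "nat => prog" where "Clear x = Whl (nonempty x) (Pop x)"

definition Drop :: prog where "Drop = Seq (Mv tB) (Clear tB)"

definition Split :: prog where
  "Split = Whl (nonempty tA) (Ite (isat tA 2) (Seq (Pop tA) (Seq (Push tS 2) (Push tB 2)))
     (Seq (Pop tA) (Seq (Push tS 1) (Push tB 1))))"

definition Dup :: prog where
  "Dup = Seq (Mv tA) (Seq Split (Seq (Tr tB tA) (Tr tA tS)))"

definition Swap :: prog where
  "Swap = Seq (Mv tA) (Seq (Mv tB) (Seq (Tr tA tS) (Tr tB tS)))"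

definition Skip :: prog where "Skip = on 0 (\<lambda>x. (x, Stay))"

text \<open>Stated with a continuation: \<open>k\<close> describes the loop after the tree has been
  moved. The loop makes no pause between the two subtrees of a node, so the node case chains the
  induction hypotheses, the run on the right subtree being the continuation of the run on the left
  one.\<close>

lemma ht_MvLoop:
  assumes "y = tA \<or> y = tB" and S: "\<sigma> tS = ser x @ s" and C: "\<sigma> tC = 1 # c"
    and k: "ht (MvLoop y) (tp, \<sigma>(tS := s, tC := c, y := rev (ser x) @ \<sigma> y)) n fin"
  shows "ht (MvLoop y) (tp, \<sigma>) (n + 8 * sz x) fin"
  using S C k
proof (induction x arbitrary: \<sigma> s c n)
  case Lf
  let ?\<sigma> = "\<sigma>(tS := s, tC := c, y := 1 # \<sigma> y)"
  have "ht (Seq (Pop tS) (Seq (Push y 1) (Pop tC))) (tp, \<sigma>) (1 + (2 + 1)) (tp, ?\<sigma>)"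
    by (rule ht_conseq[OF ht_Seq[OF ht_Pop ht_Seq[OF ht_Push ht_Pop]] order_refl])
      (use assms(1) Lf in \<open>auto simp: fun_eq_iff\<close>)
  then have *: "ht (Ite (isat tS 2) (Seq (Pop tS) (Seq (Push y 2) (Push tC 1))) (Seq (Pop tS) (Seq (Push y 1) (Pop tC))))
     (tp, \<sigma>) (Suc (1 + (2 + 1))) (tp, ?\<sigma>)"
    by (intro ht_Ite) (use Lf in auto)
  have f: "ht (MvLoop y) (tp, ?\<sigma>) n fin" using Lf(3) by (simp add: fun_upd_def)
  have "ht (MvLoop y) (tp, \<sigma>) (Suc (Suc (1 + (2 + 1)) + n)) fin"
    unfolding MvLoop_def by (rule ht_WhlT[OF _ *]) (use Lf f in \<open>auto simp: MvLoop_def\<close>)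
  then show ?case by (rule ht_conseq) auto
next
  case (Nd l r)
  let ?\<sigma> = "\<sigma>(tS := ser l @ ser r @ s, tC := 1 # 1 # c, y := 2 # \<sigma> y)"
  have "ht (Seq (Pop tS) (Seq (Push y 2) (Push tC 1))) (tp, \<sigma>) (1 + (2 + 2)) (tp, ?\<sigma>)"
    by (rule ht_conseq[OF ht_Seq[OF ht_Pop ht_Seq[OF ht_Push ht_Push]] order_refl])
      (use assms(1) Nd.prems in \<open>auto simp: fun_eq_iff\<close>)
  then have *: "ht (Ite (isat tS 2) (Seq (Pop tS) (Seq (Push y 2) (Push tC 1))) (Seq (Pop tS) (Seq (Push y 1) (Pop tC))))
     (tp, \<sigma>) (Suc (1 + (2 + 2))) (tp, ?\<sigma>)"
    by (intro ht_Ite) (use Nd.prems in auto)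
  let ?\<tau> = "?\<sigma>(tS := ser r @ s, tC := 1 # c, y := rev (ser l) @ ?\<sigma> y)"
  have e: "?\<tau>(tS := s, tC := c, y := rev (ser r) @ ?\<tau> y) =
    \<sigma>(tS := s, tC := c, y := rev (ser (Nd l r)) @ \<sigma> y)"
    using assms(1) by (auto simp: fun_eq_iff)
  have k2: "ht (MvLoop y) (tp, ?\<tau>(tS := s, tC := c, y := rev (ser r) @ ?\<tau> y)) n fin"
    unfolding e by (rule Nd.prems(3))
  have "ht (MvLoop y) (tp, ?\<tau>) (n + 8 * sz r) fin"
    by (rule Nd.IH(2)[OF _ _ k2]) (use assms(1) in auto)
  then have "ht (MvLoop y) (tp, ?\<sigma>) (n + 8 * sz r + 8 * sz l) fin"
    by (rule Nd.IH(1)[rotated 2]) (use assms(1) in auto)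
  then have "ht (MvLoop y) (tp, \<sigma>) (Suc (Suc (1 + (2 + 2)) + (n + 8 * sz r + 8 * sz l))) fin"
    unfolding MvLoop_def by (intro ht_WhlT[OF _ *]) (use Nd.prems in auto)
  then show ?case by (rule ht_conseq) auto
qed

lemma ht_Mv:
  assumes "y = tA \<or> y = tB" "\<sigma> tS = ser x @ s" "\<sigma> tC = []"
  shows "ht (Mv y) (tp, \<sigma>) (8 * sz x + 3) (tp, \<sigma>(tS := s, y := rev (ser x) @ \<sigma> y))"
proof -
  let ?\<sigma> = "\<sigma>(tC := [1])"
  let ?\<tau> = "?\<sigma>(tS := s, tC := [], y := rev (ser x) @ ?\<sigma> y)"
  have "ht (MvLoop y) (tp, ?\<tau>) 1 (tp, ?\<tau>)"
    unfolding MvLoop_def by (rule ht_WhlF) (use assms in auto)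
  then have "ht (MvLoop y) (tp, ?\<sigma>) (1 + 8 * sz x) (tp, ?\<tau>)"
    by (rule ht_MvLoop[rotated -1]) (use assms in auto)
  then have "ht (Mv y) (tp, \<sigma>) (2 + (1 + 8 * sz x)) (tp, ?\<tau>)"
    unfolding Mv_def by (intro ht_Seq[rotated]) (use ht_Push[of tC 1 tp \<sigma>] assms in auto)
  then show ?thesis by (rule ht_conseq) (use assms in \<open>auto simp: fun_eq_iff\<close>)
qed

lemma ht_Tr:
  assumes "0 < x" "x < 6" "0 < y" "y < 6" "x ~= y" "set l \<subseteq> {1, 2}" "\<sigma> x = l"
  shows "ht (Tr x y) (tp, \<sigma>) (5 * length l + 1) (tp, \<sigma>(x := [], y := rev l @ \<sigma> y))"
  using assms(6,7)
proof (induction l arbitrary: \<sigma>)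
  case Nil
  have "ht (Tr x y) (tp, \<sigma>) 1 (tp, \<sigma>)"
    unfolding Tr_def by (rule ht_WhlF) (use assms Nil in auto)
  then show ?case by (rule ht_conseq) (use Nil in \<open>auto simp: fun_eq_iff\<close>)
next
  case (Cons a l)
  have 1: "ht (Seq (Pop x) (Push y b)) (tp, \<sigma>) (1 + 2) (tp, \<sigma>(x := l, y := b # \<sigma> y))" for b
    by (rule ht_conseq[OF ht_Seq[OF ht_Pop ht_Push] order_refl])
      (use assms Cons in \<open>auto simp: fun_eq_iff\<close>)
  have 2: "ht (Ite (isat x 2) (Seq (Pop x) (Push y 2)) (Seq (Pop x) (Push y 1))) (tp, \<sigma>)
    (Suc (1 + 2)) (tp, \<sigma>(x := l, y := a # \<sigma> y))"
    by (intro ht_Ite) (use 1[of a] assms(1-5) Cons in auto)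
  have 3: "ht (Tr x y) (tp, \<sigma>(x := l, y := a # \<sigma> y)) (5 * length l + 1)
    (tp, \<sigma>(x := [], y := rev (a # l) @ \<sigma> y))"
    by (rule ht_conseq[OF Cons.IH order_refl]) (use assms(1-5) Cons.prems in \<open>auto simp: fun_eq_iff\<close>)
  have "ht (Tr x y) (tp, \<sigma>) (Suc (Suc (1 + 2) + (5 * length l + 1))) (tp, \<sigma>(x := [], y := rev (a # l) @ \<sigma> y))"
    unfolding Tr_def
    by (rule ht_WhlT[OF _ 2 3[unfolded Tr_def]]) (use assms(1-5) Cons.prems in auto)
  then show ?case by (rule ht_conseq) auto
qed

lemma ht_Clear:
  assumes "0 < x" "x < 6" "0 \<notin> set l" "\<sigma> x = l"
  shows "ht (Clear x) (tp, \<sigma>) (2 * length l + 1) (tp, \<sigma>(x := []))"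
  using assms(3,4)
proof (induction l arbitrary: \<sigma>)
  case Nil
  have "ht (Clear x) (tp, \<sigma>) 1 (tp, \<sigma>)"
    unfolding Clear_def by (rule ht_WhlF) (use assms Nil in auto)
  then show ?case by (rule ht_conseq) (use Nil in \<open>auto simp: fun_eq_iff\<close>)
next
  case (Cons a l)
  have 3: "ht (Clear x) (tp, \<sigma>(x := tl (\<sigma> x))) (2 * length l + 1) (tp, \<sigma>(x := []))"
    by (rule ht_conseq[OF Cons.IH order_refl]) (use Cons.prems in \<open>auto simp: fun_eq_iff\<close>)
  have "ht (Clear x) (tp, \<sigma>) (Suc (1 + (2 * length l + 1))) (tp, \<sigma>(x := []))"
    unfolding Clear_def
    by (rule ht_WhlT[OF _ ht_Pop 3[unfolded Clear_def]]) (use assms(1,2) Cons.prems in auto)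
  then show ?case by (rule ht_conseq) auto
qed

lemma zero_notin_ser: "0 \<notin> set (ser x)"
  using set_ser[of x] by auto

lemma ht_Drop:
  assumes "\<sigma> tS = ser x @ s" "\<sigma> tC = []" "\<sigma> tB = []"
  shows "ht Drop (tp, \<sigma>) (10 * sz x + 4) (tp, \<sigma>(tS := s))"
proof -
  let ?\<sigma> = "\<sigma>(tS := s, tB := rev (ser x))"
  have 1: "ht (Mv tB) (tp, \<sigma>) (8 * sz x + 3) (tp, ?\<sigma>)"
    using ht_Mv[of tB \<sigma> x s tp] assms by simp
  have 2: "ht (Clear tB) (tp, ?\<sigma>) (2 * sz x + 1) (tp, ?\<sigma>(tB := []))"
    using ht_Clear[of tB "rev (ser x)" ?\<sigma> tp] zero_notin_ser[of x] by simp
  show ?thesis unfolding Drop_def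
    by (rule ht_conseq[OF ht_Seq[OF 1 2]]) (use assms in \<open>auto simp: fun_eq_iff\<close>)
qed

lemma ht_Split:
  assumes "set l \<subseteq> {1, 2}" "\<sigma> tA = l"
  shows "ht Split (tp, \<sigma>) (7 * length l + 1)
    (tp, \<sigma>(tA := [], tS := rev l @ \<sigma> tS, tB := rev l @ \<sigma> tB))"
  using assms
proof (induction l arbitrary: \<sigma>)
  case Nil
  have "ht Split (tp, \<sigma>) 1 (tp, \<sigma>)"
    unfolding Split_def by (rule ht_WhlF) (use Nil in auto)
  then show ?case by (rule ht_conseq) (use Nil in \<open>auto simp: fun_eq_iff\<close>)
next
  case (Cons a l)
  let ?\<sigma> = "\<sigma>(tA := l, tS := a # \<sigma> tS, tB := a # \<sigma> tB)"
  have 1: "ht (Seq (Pop tA) (Seq (Push tS b) (Push tB b))) (tp, \<sigma>) (1 + (2 + 2))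
    (tp, \<sigma>(tA := l, tS := b # \<sigma> tS, tB := b # \<sigma> tB))" for b
    by (rule ht_conseq[OF ht_Seq[OF ht_Pop ht_Seq[OF ht_Push ht_Push]] order_refl])
      (use Cons in \<open>auto simp: fun_eq_iff\<close>)
  have 2: "ht (Ite (isat tA 2) (Seq (Pop tA) (Seq (Push tS 2) (Push tB 2)))
     (Seq (Pop tA) (Seq (Push tS 1) (Push tB 1)))) (tp, \<sigma>) (Suc (1 + (2 + 2))) (tp, ?\<sigma>)"
    by (intro ht_Ite) (use 1[of a] Cons in auto)
  have 3: "ht Split (tp, ?\<sigma>) (7 * length l + 1)
    (tp, \<sigma>(tA := [], tS := rev (a # l) @ \<sigma> tS, tB := rev (a # l) @ \<sigma> tB))"
    by (rule ht_conseq[OF Cons.IH order_refl]) (use Cons.prems in \<open>auto simp: fun_eq_iff\<close>)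
  have "ht Split (tp, \<sigma>) (Suc (Suc (1 + (2 + 2)) + (7 * length l + 1)))
    (tp, \<sigma>(tA := [], tS := rev (a # l) @ \<sigma> tS, tB := rev (a # l) @ \<sigma> tB))"
    unfolding Split_def
    by (rule ht_WhlT[OF _ 2 3[unfolded Split_def]]) (use Cons.prems in auto)
  then show ?case by (rule ht_conseq) auto
qed

lemma set_rev_ser: "set (rev (ser x)) \<subseteq> {1, 2}"
  using set_ser[of x] by simp

text \<open>Every transfer reverses. \<open>Split\<close> undoes the reversal made by
  \<open>Mv\<close> on both of its targets, so the second copy needs two further transfers to arrive
  on the data stack in the right order.\<close>

lemma ht_Dup:
  assumes "\<sigma> tS = ser x @ s" "\<sigma> tC = []" "\<sigma> tB = []" "\<sigma> tA = []"
  shows "ht Dup (tp, \<sigma>) (25 * sz x + 6) (tp, \<sigma>(tS := ser x @ ser x @ s))"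
proof -
  let ?\<sigma>1 = "\<sigma>(tS := s, tA := rev (ser x))"
  let ?\<sigma>2 = "\<sigma>(tS := ser x @ s, tB := ser x)"
  let ?\<sigma>3 = "\<sigma>(tS := ser x @ s, tA := rev (ser x))"
  have 1: "ht (Mv tA) (tp, \<sigma>) (8 * sz x + 3) (tp, ?\<sigma>1)"
    using ht_Mv[of tA \<sigma> x s tp] assms by simp
  have 2: "ht Split (tp, ?\<sigma>1) (7 * sz x + 1) (tp, ?\<sigma>2)"
    by (rule ht_conseq[OF ht_Split[OF set_rev_ser[of x]]]) (use assms in \<open>auto simp: fun_eq_iff\<close>)
  have 3: "ht (Tr tB tA) (tp, ?\<sigma>2) (5 * sz x + 1) (tp, ?\<sigma>3)"
    by (rule ht_conseq[OF ht_Tr[OF _ _ _ _ _ set_ser[of x]]]) (use assms in \<open>auto simp: fun_eq_iff\<close>)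
  have 4: "ht (Tr tA tS) (tp, ?\<sigma>3) (5 * sz x + 1) (tp, \<sigma>(tS := ser x @ ser x @ s))"
    by (rule ht_conseq[OF ht_Tr[OF _ _ _ _ _ set_rev_ser[of x]]]) (use assms in \<open>auto simp: fun_eq_iff\<close>)
  show ?thesis unfolding Dup_def
    by (rule ht_conseq[OF ht_Seq[OF 1 ht_Seq[OF 2 ht_Seq[OF 3 4]]]]) auto
qed

lemma ht_Swap:
  assumes "\<sigma> tS = ser x @ ser y @ s" "\<sigma> tC = []" "\<sigma> tB = []" "\<sigma> tA = []"
  shows "ht Swap (tp, \<sigma>) (13 * sz x + 13 * sz y + 8) (tp, \<sigma>(tS := ser y @ ser x @ s))"
proof -
  let ?\<sigma>1 = "\<sigma>(tS := ser y @ s, tA := rev (ser x))"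
  let ?\<sigma>2 = "\<sigma>(tS := s, tA := rev (ser x), tB := rev (ser y))"
  let ?\<sigma>3 = "\<sigma>(tS := ser x @ s, tB := rev (ser y))"
  have 1: "ht (Mv tA) (tp, \<sigma>) (8 * sz x + 3) (tp, ?\<sigma>1)"
    using ht_Mv[of tA \<sigma> x "ser y @ s" tp] assms by simp
  have 2: "ht (Mv tB) (tp, ?\<sigma>1) (8 * sz y + 3) (tp, ?\<sigma>2)"
    by (rule ht_conseq[OF ht_Mv[of tB _ y s]]) (use assms in \<open>auto simp: fun_eq_iff\<close>)
  have 3: "ht (Tr tA tS) (tp, ?\<sigma>2) (5 * sz x + 1) (tp, ?\<sigma>3)"
    by (rule ht_conseq[OF ht_Tr[OF _ _ _ _ _ set_rev_ser[of x]]]) (use assms in \<open>auto simp: fun_eq_iff\<close>)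
  have 4: "ht (Tr tB tS) (tp, ?\<sigma>3) (5 * sz y + 1) (tp, \<sigma>(tS := ser y @ ser x @ s))"
    by (rule ht_conseq[OF ht_Tr[OF _ _ _ _ _ set_rev_ser[of y]]]) (use assms in \<open>auto simp: fun_eq_iff\<close>)
  show ?thesis unfolding Swap_def
    by (rule ht_conseq[OF ht_Seq[OF 1 ht_Seq[OF 2 ht_Seq[OF 3 4]]]]) auto
qed

lemma ht_Skip: "ht Skip (tp, \<sigma>) 1 (tp, \<sigma>)"
  unfolding Skip_def using ht_on0[of "\<lambda>x. (x, Stay)" tp \<sigma>]
  by (auto simp: act_tape_def read_tape_def split: prod.splits)

section \<open>Compilation of combinators and its time bound\<close>

primrec compile :: "comb => prog" where
  "compile CId = Skip"
| "compile CNil = Seq Drop (Push tS 1)"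
| "compile CHd = Ite (isat tS 2) (Seq (Pop tS) (Seq (Mv tA) (Seq Drop (Tr tA tS)))) Skip"
| "compile CTl = Ite (isat tS 2) (Seq (Pop tS) Drop) Skip"
| "compile (CSeq f g) = Seq (compile f) (compile g)"
| "compile (CPair f g) = Seq Dup (Seq (compile f) (Seq Swap (Seq (compile g) (Seq Swap (Push tS 2)))))"
| "compile (CIf p f g) = Seq Dup (Seq (compile p)
     (Ite (isat tS 2) (Seq Drop (compile f)) (Seq (Pop tS) (compile g))))"
| "compile (CWhile p f) = Seq Dup (Seq (compile p)
     (Seq (Whl (isat tS 2) (Seq Drop (Seq (compile f) (Seq Dup (compile p))))) (Pop tS)))"

definition idle :: "(nat => nat list) => bool" where
  "idle \<sigma> \<longleftrightarrow> \<sigma> tA = [] \<and> \<sigma> tB = [] \<and> \<sigma> tC = []"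

lemma idle_upd [simp]: "idle (\<sigma>(tS := s)) = idle \<sigma>" "idle (\<sigma>(tJ := s)) = idle \<sigma>"
  by (auto simp: idle_def)

definition impl :: "prog => tree => nat => tree => bool" where
  "impl P x n y \<longleftrightarrow> (\<forall>tp \<sigma> s. idle \<sigma> --> ht P (tp, \<sigma>(tS := ser x @ s)) n (tp, \<sigma>(tS := ser y @ s)))"

lemma implD: "impl P x n y ==> idle \<sigma> ==> ht P (tp, \<sigma>(tS := ser x @ s)) n (tp, \<sigma>(tS := ser y @ s))"
  unfolding impl_def by blast

lemma upd2_ht_Dup: "idle \<sigma> ==>
  ht Dup (tp, \<sigma>(tS := ser x @ s)) (25 * sz x + 6) (tp, \<sigma>(tS := ser x @ ser x @ s))"
  by (rule ht_conseq[OF ht_Dup]) (auto simp: idle_def)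

lemma upd2_ht_Drop: "idle \<sigma> ==>
  ht Drop (tp, \<sigma>(tS := ser x @ s)) (10 * sz x + 4) (tp, \<sigma>(tS := s))"
  by (rule ht_conseq[OF ht_Drop]) (auto simp: idle_def)

lemma upd2_ht_Swap: "idle \<sigma> ==>
  ht Swap (tp, \<sigma>(tS := ser x @ ser y @ s)) (13 * sz x + 13 * sz y + 8) (tp, \<sigma>(tS := ser y @ ser x @ s))"
  by (rule ht_conseq[OF ht_Swap]) (auto simp: idle_def)

lemma upd2_ht_Push: "ht (Push tS a) (tp, \<sigma>(tS := s)) 2 (tp, \<sigma>(tS := a # s))"
  by (rule ht_conseq[OF ht_Push]) auto

lemma upd2_ht_Pop: "ht (Pop tS) (tp, \<sigma>(tS := a # s)) 1 (tp, \<sigma>(tS := s))"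
  by (rule ht_conseq[OF ht_Pop]) auto

lemma topsym_ser: "topsym (ser x @ s) = 2 \<longleftrightarrow> x ~= Lf"
  by (cases x) auto

text \<open>The induction on \<open>cev\<close> meets the loop at its head, but a compiled body ends
  with duplicating the state and evaluating the next test. Hence a statement about the bare
  \<open>Whl\<close> is carried along: it starts with the test value \<open>b\<close> above the
  state, and \<open>k\<close> and \<open>m\<close> divide the budget between the test and the
  loop.\<close>

definition wloop :: "comb => tree => nat => tree => bool" where
  "wloop c x n z \<longleftrightarrow> (\<forall>p f. c = CWhile p f --> (\<exists>b k m. 25 * sz x + 6 + k + m + 1 <= n \<and> impl (compile p) x k b \<and>
     (\<forall>tp \<sigma> s. idle \<sigma> --> ht (Whl (isat tS 2) (Seq Drop (Seq (compile f) (Seq Dup (compile p)))))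
        (tp, \<sigma>(tS := ser b @ ser x @ s)) m (tp, \<sigma>(tS := 1 # ser z @ s)))))"

lemma wloop_impl:
  assumes "wloop (CWhile p f) x n z"
  shows "impl (compile (CWhile p f)) x n z"
proof -
  obtain b k m where 1: "25 * sz x + 6 + k + m + 1 <= n" "impl (compile p) x k b"
    "!!tp \<sigma> s. idle \<sigma> ==> ht (Whl (isat tS 2) (Seq Drop (Seq (compile f) (Seq Dup (compile p)))))
        (tp, \<sigma>(tS := ser b @ ser x @ s)) m (tp, \<sigma>(tS := 1 # ser z @ s))"
    using assms by (auto simp: wloop_def)
  have le: "25 * sz x + 6 + (k + (m + 1)) <= n" using 1 by simp
  show ?thesis unfolding impl_def compile.simps
    using ht_conseq[OF ht_Seq[OF upd2_ht_Dup ht_Seq[OF implD[OF 1(2)] ht_Seq[OF 1(3) upd2_ht_Pop]]] le refl]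
    by blast
qed

lemma compile_correct_loop: "cev c x t y ==> impl (compile c) x (60 * t) y \<and> wloop c x (60 * t) y"
proof (induction rule: cev.induct)
  case (Id x)
  show ?case unfolding impl_def wloop_def
    by (auto intro!: ht_conseq[OF ht_Skip] simp: Suc_le_eq)
next
  case (Nil x)
  have "10 * sz x + 4 + 2 <= 60 * sz x" using sz_pos[of x] unfolding distrib_left by linarith
  then show ?case unfolding impl_def wloop_def
    by (auto intro!: ht_conseq[OF ht_Seq[OF upd2_ht_Drop upd2_ht_Push]])
next
  case (Hd x)
  show ?case
  proof (cases x)
    case Lf
    then show ?thesis unfolding impl_def wloop_def
      by (auto intro!: ht_conseq[OF ht_Ite[OF _ ht_Skip]])
  next
    case [simp]: (Nd l r)
    have "ht (Seq (Pop tS) (Seq (Mv tA) (Seq Drop (Tr tA tS)))) (tp, \<sigma>(tS := ser x @ s))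
        (1 + (8 * sz l + 3 + (10 * sz r + 4 + (5 * sz l + 1)))) (tp, \<sigma>(tS := ser l @ s))"
      if i: "idle \<sigma>" for tp \<sigma> s
    proof -
      let ?\<sigma>1 = "\<sigma>(tS := ser l @ ser r @ s)"
      let ?\<sigma>2 = "\<sigma>(tS := ser r @ s, tA := rev (ser l))"
      let ?\<sigma>3 = "\<sigma>(tS := s, tA := rev (ser l))"
      have 1: "ht (Pop tS) (tp, \<sigma>(tS := ser x @ s)) 1 (tp, ?\<sigma>1)"
        using upd2_ht_Pop[of tp \<sigma> 2 "ser l @ ser r @ s"] by simp
      have 2: "ht (Mv tA) (tp, ?\<sigma>1) (8 * sz l + 3) (tp, ?\<sigma>2)"
        by (rule ht_conseq[OF ht_Mv[of tA _ l]]) (use i in \<open>auto simp: idle_def\<close>)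
      have 3: "ht Drop (tp, ?\<sigma>2) (10 * sz r + 4) (tp, ?\<sigma>3)"
        by (rule ht_conseq[OF ht_Drop]) (use i in \<open>auto simp: idle_def fun_eq_iff\<close>)
      have 4: "ht (Tr tA tS) (tp, ?\<sigma>3) (5 * sz l + 1) (tp, \<sigma>(tS := ser l @ s))"
        by (rule ht_conseq[OF ht_Tr[OF _ _ _ _ _ set_rev_ser[of l]]])
          (use i in \<open>auto simp: idle_def fun_eq_iff\<close>)
      show ?thesis by (rule ht_Seq[OF 1 ht_Seq[OF 2 ht_Seq[OF 3 4]]])
    qed
    then show ?thesis unfolding impl_def wloop_def
      by (auto intro!: ht_conseq[OF ht_Ite])
  qed
next
  case (Tl x)
  show ?case
  proof (cases x)
    case Lf
    then show ?thesis unfolding impl_def wloop_def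
      by (auto intro!: ht_conseq[OF ht_Ite[OF _ ht_Skip]])
  next
    case [simp]: (Nd l r)
    have "ht (Seq (Pop tS) Drop) (tp, \<sigma>(tS := ser x @ s)) (1 + (10 * sz l + 4)) (tp, \<sigma>(tS := ser r @ s))"
      if i: "idle \<sigma>" for tp \<sigma> s
      using ht_Seq[OF upd2_ht_Pop[of tp \<sigma> 2 "ser l @ ser r @ s"] upd2_ht_Drop[OF i, of tp l "ser r @ s"]]
      by simp
    then show ?thesis unfolding impl_def wloop_def
      by (auto intro!: ht_conseq[OF ht_Ite])
  qed
next
  case (Sq f x t y g u z)
  then show ?case unfolding impl_def wloop_def
    by (auto intro!: ht_conseq[OF ht_Seq])
next
  case (Pair f x t y g u z)
  \<comment> \<open>Duplication and the first swap cost 25 and 13 per symbol of \<open>x\<close>,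
    the two swaps together 26 per symbol of \<open>y\<close>. The remaining constant 24 fits into
    the slack that the factor 60 leaves for \<open>x\<close> and \<open>y\<close>.\<close>
  have le: "25 * sz x + 6 + (60 * t + (13 * sz y + 13 * sz x + 8 + (60 * u + (13 * sz z + 13 * sz y + 8 + 2))))
     <= 60 * (t + u + sz x + sz y + sz z)"
  proof -
    have "1 <= sz x" "1 <= sz y" by (simp_all add: Suc_leI)
    then have "24 <= 22 * sz x + 34 * sz y" by simp
    then show ?thesis by simp
  qed
  have "impl (compile (CPair f g)) x (60 * (t + u + sz x + sz y + sz z)) (Nd y z)"
    unfolding impl_def compile.simps
  proof (intro allI impI)
    fix tp \<sigma> s assume i: "idle \<sigma>"
    show "ht (Seq Dup (Seq (compile f) (Seq Swap (Seq (compile g) (Seq Swap (Push tS 2))))))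
        (tp, \<sigma>(tS := ser x @ s)) (60 * (t + u + sz x + sz y + sz z)) (tp, \<sigma>(tS := ser (Nd y z) @ s))"
      by (rule ht_conseq[OF ht_Seq[OF upd2_ht_Dup[OF i] ht_Seq[OF implD[OF conjunct1[OF Pair.IH(1)] i]
            ht_Seq[OF upd2_ht_Swap[OF i] ht_Seq[OF implD[OF conjunct1[OF Pair.IH(2)] i]
            ht_Seq[OF upd2_ht_Swap[OF i] upd2_ht_Push]]]]] le]) simp
  qed
  then show ?case by (simp add: wloop_def)
next
  case (IfT p x t b f u y g)
  have le: "25 * sz x + 6 + (60 * t + Suc (10 * sz b + 4 + 60 * u)) <= 60 * (t + u + sz x + sz b)"
    using sz_pos[of x] sz_pos[of b] unfolding distrib_left by linarith
  have "impl (compile (CIf p f g)) x (60 * (t + u + sz x + sz b)) y"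
    unfolding impl_def compile.simps
  proof (intro allI impI)
    fix tp \<sigma> s assume i: "idle \<sigma>"
    have 1: "ht (Ite (isat tS 2) (Seq Drop (compile f)) (Seq (Pop tS) (compile g))) (tp, \<sigma>(tS := ser b @ ser x @ s))
        (Suc (10 * sz b + 4 + 60 * u)) (tp, \<sigma>(tS := ser y @ s))"
      by (rule ht_Ite[OF ht_Seq[OF upd2_ht_Drop[OF i] implD[OF conjunct1[OF IfT.IH(2)] i]]])
        (use IfT.hyps in \<open>auto simp: topsym_ser\<close>)
    show "ht (Seq Dup (Seq (compile p) (Ite (isat tS 2) (Seq Drop (compile f)) (Seq (Pop tS) (compile g)))))
        (tp, \<sigma>(tS := ser x @ s)) (60 * (t + u + sz x + sz b)) (tp, \<sigma>(tS := ser y @ s))"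
      by (rule ht_conseq[OF ht_Seq[OF upd2_ht_Dup[OF i] ht_Seq[OF implD[OF conjunct1[OF IfT.IH(1)] i] 1]] le refl])
  qed
  then show ?case by (simp add: wloop_def)
next
  case (IfF p x t g u y f)
  have le: "25 * sz x + 6 + (60 * t + Suc (1 + 60 * u)) <= 60 * (t + u + sz x)"
    using sz_pos[of x] unfolding distrib_left by linarith
  have "impl (compile (CIf p f g)) x (60 * (t + u + sz x)) y"
    unfolding impl_def compile.simps
  proof (intro allI impI)
    fix tp \<sigma> s assume i: "idle \<sigma>"
    have 1: "ht (Pop tS) (tp, \<sigma>(tS := ser Lf @ ser x @ s)) 1 (tp, \<sigma>(tS := ser x @ s))"
      using upd2_ht_Pop[of tp \<sigma> 1 "ser x @ s"] by simp
    have 2: "ht (Ite (isat tS 2) (Seq Drop (compile f)) (Seq (Pop tS) (compile g))) (tp, \<sigma>(tS := ser Lf @ ser x @ s))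
        (Suc (1 + 60 * u)) (tp, \<sigma>(tS := ser y @ s))"
      by (rule ht_Ite[OF _ ht_Seq[OF 1 implD[OF conjunct1[OF IfF.IH(2)] i]]]) simp
    show "ht (Seq Dup (Seq (compile p) (Ite (isat tS 2) (Seq Drop (compile f)) (Seq (Pop tS) (compile g)))))
        (tp, \<sigma>(tS := ser x @ s)) (60 * (t + u + sz x)) (tp, \<sigma>(tS := ser y @ s))"
      by (rule ht_conseq[OF ht_Seq[OF upd2_ht_Dup[OF i] ht_Seq[OF implD[OF conjunct1[OF IfF.IH(1)] i] 2]] le refl])
  qed
  then show ?case by (simp add: wloop_def)
next
  case (WhileT p x t b f u y v z)
  let ?W = "Whl (isat tS 2) (Seq Drop (Seq (compile f) (Seq Dup (compile p))))"
  obtain b' k m where 1: "25 * sz y + 6 + k + m + 1 <= 60 * v" "impl (compile p) y k b'"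
    "!!tp \<sigma> s. idle \<sigma> ==> ht ?W (tp, \<sigma>(tS := ser b' @ ser y @ s)) m (tp, \<sigma>(tS := 1 # ser z @ s))"
    using WhileT.IH(3) by (auto simp: wloop_def)
  let ?m = "Suc ((10 * sz b + 4 + (60 * u + (25 * sz y + 6 + k))) + m)"
  have W: "ht ?W (tp, \<sigma>(tS := ser b @ ser x @ s)) ?m (tp, \<sigma>(tS := 1 # ser z @ s))" if i: "idle \<sigma>" for tp \<sigma> s
    by (rule ht_WhlT[OF _ ht_Seq[OF upd2_ht_Drop[OF i] ht_Seq[OF implD[OF conjunct1[OF WhileT.IH(2)] i]
          ht_Seq[OF upd2_ht_Dup[OF i] implD[OF 1(2) i]]]] 1(3)[OF i]])
      (use WhileT.hyps in \<open>simp add: topsym_ser\<close>)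
  have "25 * sz x + 6 + 60 * t + ?m + 1 <= 60 * (t + u + v + sz x + sz b)"
    using 1(1) sz_pos[of x] sz_pos[of b] unfolding distrib_left by linarith
  then have "wloop (CWhile p f) x (60 * (t + u + v + sz x + sz b)) z"
    using W WhileT.IH(1) unfolding wloop_def by blast
  then show ?case using wloop_impl by blast
next
  case (WhileF p x t f)
  have W: "ht (Whl (isat tS 2) (Seq Drop (Seq (compile f) (Seq Dup (compile p)))))
      (tp, \<sigma>(tS := ser Lf @ ser x @ s)) 1 (tp, \<sigma>(tS := 1 # ser x @ s))" for tp \<sigma> s
    by (rule ht_conseq[OF ht_WhlF]) auto
  have "25 * sz x + 6 + 60 * t + 1 + 1 <= 60 * (t + sz x)"
    using sz_pos[of x] unfolding distrib_left by linarith
  then have "wloop (CWhile p f) x (60 * (t + sz x)) x"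
    using W conjunct1[OF WhileF.IH] unfolding wloop_def by blast
  then show ?case using wloop_impl by blast
qed

lemmas compile_correct = compile_correct_loop[THEN conjunct1]

section \<open>Values as trees; input and output of the compiled machines\<close>

class code =
  fixes code :: "'a => tree"
  assumes code_inj: "code x = code y ==> x = y"

lemma code_eq [simp]: "code x = code y \<longleftrightarrow> x = y"
  using code_inj by blast

instantiation bool :: code begin
definition "code_bool b = (if b then Nd Lf Lf else Lf)"
instance by standard (auto simp: code_bool_def split: if_splits)
end

instantiation unit :: code begin
definition "code_unit (u::unit) = Lf"
instance by standard auto
end

text \<open>Unary, because the numbers inside the programs are counters or polynomial in the input;
  a budget given in binary is only read up to a cap. A number then has the code of a list of units,
  which turns arithmetic into list processing.\<close>

instantiation nat :: code begin
primrec code_nat :: "nat => tree" where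
  "code_nat 0 = Lf" | "code_nat (Suc n) = Nd Lf (code_nat n)"
instance
proof
  fix x y :: nat
  assume "code x = code y"
  then show "x = y"
  proof (induction x arbitrary: y)
    case 0
    then show ?case by (cases y) auto
  next
    case (Suc x)
    then show ?case by (cases y) auto
  qed
qed
end

instantiation tree :: code begin
definition "code_tree (t::tree) = t"
instance by standard (auto simp: code_tree_def)
end

instantiation prod :: (code, code) code begin
definition "code_prod p = Nd (code (fst p)) (code (snd p))"
instance by standard (auto simp: code_prod_def prod_eq_iff dest: code_inj)
end

instantiation list :: (code) code begin
primrec code_list :: "'a list => tree" where
  "code_list [] = Lf" | "code_list (x # xs) = Nd (code x) (code_list xs)"
instance
proof
  fix x y :: "'a list"
  assume "code x = code y"
  then show "x = y"
  proof (induction x arbitrary: y)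
    case Nil
    then show ?case by (cases y) auto
  next
    case (Cons a x)
    then show ?case by (cases y) (auto dest: code_inj)
  qed
qed
end

section \<open>Conversion between bit strings on tapes and trees on the data stack\<close>

definition BuildLoop :: prog where
  "BuildLoop = Whl (nonempty tA) (Ite (isat tA 2)
     (Seq (Pop tA) (Seq (Push tS 1) (Seq (Push tS 1) (Seq (Push tS 2) (Push tS 2)))))
     (Seq (Pop tA) (Seq (Push tS 1) (Push tS 2))))"

definition Build :: prog where "Build = Seq (Push tS 1) BuildLoop"

definition Scan :: prog where
  "Scan = Whl (nonempty 0) (Seq (Ite (isat 0 2) (Push tA 2) (Push tA 1)) (on 0 (\<lambda>x. (x, MoveRight))))"

definition Back :: prog where
  "Back = Seq (on 0 (\<lambda>x. (x, MoveLeft)))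
     (Seq (Whl (nonempty 0) (on 0 (\<lambda>x. (x, MoveLeft)))) (on 0 (\<lambda>x. (x, MoveRight))))"

definition Input :: prog where
  "Input = Seq (Tr tJ tA) (Seq Build (Seq Scan (Seq Back (Seq Build (Push tS 2)))))"

text \<open>The output overwrites the input from cell 0 on; the blank written last cuts off the
  remainder of a longer input.\<close>

definition Output :: prog where
  "Output = Seq (Whl (isat tS 2) (Seq (Pop tS) (Ite (isat tS 2)
       (Seq (Pop tS) (Seq (Pop tS) (Seq (Pop tS) (on 0 (\<lambda>_. (2, MoveRight))))))
       (Seq (Pop tS) (on 0 (\<lambda>_. (1, MoveRight)))))))
     (on 0 (\<lambda>_. (0, Stay)))"

lemma bit_sym_eq [simp]: "bit_sym b = 2 \<longleftrightarrow> b" "bit_sym b ~= 0" "bit_sym b = Suc 0 \<longleftrightarrow> \<not> b"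
  by (cases b; simp)+

lemma set_bits: "set (map bit_sym l) \<subseteq> {1, 2}"
  by (auto elim: bit_sym.elims)

text \<open>The tree of a list grows at the front, so the bits must arrive last one first. Pushing
  them while scanning the tape from left to right delivers them in this order.\<close>

lemma ht_BuildLoop:
  "\<sigma> tA = map bit_sym l ==> \<sigma> tS = ser (code m) @ s ==>
   ht BuildLoop (tp, \<sigma>) (11 * length l + 1) (tp, \<sigma>(tA := [], tS := ser (code (rev l @ m)) @ s))"
proof (induction l arbitrary: \<sigma> m)
  case Nil
  have "ht BuildLoop (tp, \<sigma>) 1 (tp, \<sigma>)"
    unfolding BuildLoop_def by (rule ht_WhlF) (use Nil in auto)
  then show ?case by (rule ht_conseq) (use Nil in \<open>auto simp: fun_eq_iff\<close>)
next
  case (Cons b l)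
  let ?\<sigma> = "\<sigma>(tA := map bit_sym l, tS := ser (code (b # m)) @ s)"
  let ?P = "Seq (Pop tA) (Seq (Push tS 1) (Seq (Push tS 1) (Seq (Push tS 2) (Push tS 2))))"
  let ?Q = "Seq (Pop tA) (Seq (Push tS 1) (Push tS 2))"
  have 1: "ht ?P (tp, \<sigma>) (1 + (2 + (2 + (2 + 2)))) (tp, ?\<sigma>)" if b
    by (rule ht_conseq[OF ht_Seq[OF ht_Pop ht_Seq[OF ht_Push ht_Seq[OF ht_Push ht_Seq[OF ht_Push ht_Push]]]] order_refl])
      (use Cons.prems that in \<open>auto simp: fun_eq_iff code_bool_def\<close>)
  have 2: "ht ?Q (tp, \<sigma>) (1 + (2 + (2 + (2 + 2)))) (tp, ?\<sigma>)" if "\<not> b"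
    by (rule ht_conseq[OF ht_Seq[OF ht_Pop ht_Seq[OF ht_Push ht_Push]]])
      (use Cons.prems that in \<open>auto simp: fun_eq_iff code_bool_def\<close>)
  have 3: "ht (Ite (isat tA 2) ?P ?Q) (tp, \<sigma>) (Suc (1 + (2 + (2 + (2 + 2))))) (tp, ?\<sigma>)"
    by (intro ht_Ite) (use 1 2 Cons.prems in auto)
  have 4: "ht BuildLoop (tp, ?\<sigma>) (11 * length l + 1)
    (tp, \<sigma>(tA := [], tS := ser (code (rev (b # l) @ m)) @ s))"
    by (rule ht_conseq[OF Cons.IH[where m = "b # m"] order_refl]) (auto simp: fun_eq_iff)
  have "ht BuildLoop (tp, \<sigma>) (Suc (Suc (1 + (2 + (2 + (2 + 2)))) + (11 * length l + 1)))
    (tp, \<sigma>(tA := [], tS := ser (code (rev (b # l) @ m)) @ s))"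
    unfolding BuildLoop_def
    by (rule ht_WhlT[OF _ 3 4[unfolded BuildLoop_def]]) (use Cons.prems in auto)
  then show ?case by (rule ht_conseq) auto
qed

lemma ht_Build:
  assumes "\<sigma> tA = rev (map bit_sym l)"
  shows "ht Build (tp, \<sigma>) (11 * length l + 3) (tp, \<sigma>(tA := [], tS := ser (code l) @ \<sigma> tS))"
  unfolding Build_def
  by (rule ht_conseq[OF ht_Seq[OF ht_Push ht_BuildLoop[where l = "rev l" and m = "[]" and s = "\<sigma> tS"]]])
    (use assms in \<open>auto simp: rev_map fun_eq_iff\<close>)

definition itp :: "bool list => int => tape" where
  "itp x i = (fst (input_tape x), i)"

lemma act_itp: "act_tape (itp x i) (read_tape (itp x i), m) = itp x (i + shift m)"
  by (auto simp: act_tape_def read_tape_def itp_def)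

lemma read_itp: "read_tape (itp x i) = (if 0 <= i \<and> i < int (length x) then bit_sym (x ! nat i) else 0)"
  by (auto simp: read_tape_def itp_def input_tape_def)

lemma ht_move: "ht (on 0 (\<lambda>x. (x, m))) (itp x i, \<sigma>) 1 (itp x (i + shift m), \<sigma>)"
  using ht_on0[of "\<lambda>x. (x, m)" "itp x i" \<sigma>] by (simp add: act_itp)

lemma ht_Scan:
  "x = u @ v ==> \<sigma> tA = rev (map bit_sym u) ==>
   ht Scan (itp x (int (length u)), \<sigma>) (5 * length v + 1)
     (itp x (int (length x)), \<sigma>(tA := rev (map bit_sym x)))"
proof (induction v arbitrary: u \<sigma>)
  case Nil
  have "ht Scan (itp x (int (length u)), \<sigma>) 1 (itp x (int (length u)), \<sigma>)"
    unfolding Scan_def by (rule ht_WhlF) (use Nil in \<open>auto simp: read_itp\<close>)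
  then show ?case by (rule ht_conseq) (use Nil in \<open>auto simp: fun_eq_iff\<close>)
next
  case (Cons b v)
  let ?\<sigma> = "\<sigma>(tA := bit_sym b # \<sigma> tA)"
  have r: "read_tape (itp x (int (length u))) = bit_sym b"
    using Cons.prems by (auto simp: read_itp)
  have b: "bit_sym b = (if b then 2 else 1)" by auto
  have 1: "ht (Ite (isat 0 2) (Push tA 2) (Push tA 1)) (itp x (int (length u)), \<sigma>) (Suc 2)
      (itp x (int (length u)), ?\<sigma>)"
    by (rule ht_Ite) (use r b ht_Push[of tA _ "itp x (int (length u))" \<sigma>] in \<open>auto\<close>)
  have 2: "ht (Seq (Ite (isat 0 2) (Push tA 2) (Push tA 1)) (on 0 (\<lambda>x. (x, MoveRight))))
     (itp x (int (length u)), \<sigma>) (Suc 2 + 1) (itp x (int (length (u @ [b]))), ?\<sigma>)"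
    using ht_Seq[OF 1 ht_move[of MoveRight x "int (length u)" ?\<sigma>]] by (simp add: add.commute)
  have 3: "ht Scan (itp x (int (length (u @ [b]))), ?\<sigma>) (5 * length v + 1)
    (itp x (int (length x)), \<sigma>(tA := rev (map bit_sym x)))"
    by (rule ht_conseq[OF Cons.IH order_refl]) (use Cons.prems in \<open>auto simp: fun_eq_iff\<close>)
  have "ht Scan (itp x (int (length u)), \<sigma>) (Suc (Suc 2 + 1 + (5 * length v + 1)))
     (itp x (int (length x)), \<sigma>(tA := rev (map bit_sym x)))"
    unfolding Scan_def by (rule ht_WhlT[OF _ 2 3[unfolded Scan_def]]) (use r in auto)
  then show ?case by (rule ht_conseq) auto
qed

lemma ht_Back:
  "ht Back (itp x (int (length x)), \<sigma>) (2 * length x + 3) (itp x 0, \<sigma>)"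
proof -
  have loop: "k <= length x ==> ht (Whl (nonempty 0) (on 0 (\<lambda>x. (x, MoveLeft))))
     (itp x (int k - 1), \<sigma>) (2 * k + 1) (itp x (- 1), \<sigma>)" for k
  proof (induction k)
    case 0
    show ?case by (rule ht_conseq[OF ht_WhlF]) (auto simp: read_itp)
  next
    case (Suc k)
    have "ht (Whl (nonempty 0) (on 0 (\<lambda>x. (x, MoveLeft)))) (itp x (int (Suc k) - 1), \<sigma>)
      (Suc (1 + (2 * k + 1))) (itp x (- 1), \<sigma>)"
      by (rule ht_WhlT[OF _ ht_move]) (use Suc in \<open>auto simp: read_itp\<close>)
    then show ?case by (rule ht_conseq) auto
  qed
  show ?thesis unfolding Back_def
    by (rule ht_conseq[OF ht_Seq[OF ht_move ht_Seq[OF _ ht_move]]])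
      (use loop[of "length x"] in \<open>auto\<close>)
qed

definition conf0 :: "bool list => bool list => conf" where
  "conf0 x w = (itp x 0, \<lambda>i. if i = tJ then map bit_sym w else [])"

lemma ht_Input:
  "ht Input (conf0 x w) (18 * length x + 18 * length w + 20)
     (itp x 0, (\<lambda>_. [])(tS := ser (code (x, w)) @ []))"
proof -
  let ?e = "\<lambda>_::nat. []::nat list"
  have 1: "ht (Tr tJ tA) (conf0 x w) (5 * length w + 1) (itp x 0, ?e(tA := rev (map bit_sym w)))"
    unfolding conf0_def
    by (rule ht_conseq[OF ht_Tr[OF _ _ _ _ _ set_bits[of w]]]) (auto simp: fun_eq_iff)
  have 2: "ht Build (itp x 0, ?e(tA := rev (map bit_sym w))) (11 * length w + 3)
      (itp x 0, ?e(tS := ser (code w)))"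
    by (rule ht_conseq[OF ht_Build]) (auto simp: fun_eq_iff)
  have 3: "ht Scan (itp x 0, ?e(tS := ser (code w))) (5 * length x + 1)
      (itp x (int (length x)), ?e(tS := ser (code w), tA := rev (map bit_sym x)))"
    using ht_Scan[of x "[]" x "?e(tS := ser (code w))"] by simp
  have 4: "ht Back (itp x (int (length x)), ?e(tS := ser (code w), tA := rev (map bit_sym x)))
      (2 * length x + 3) (itp x 0, ?e(tS := ser (code w), tA := rev (map bit_sym x)))"
    by (rule ht_Back)
  have 5: "ht Build (itp x 0, ?e(tS := ser (code w), tA := rev (map bit_sym x))) (11 * length x + 3)
      (itp x 0, ?e(tS := ser (code x) @ ser (code w)))"
    by (rule ht_conseq[OF ht_Build]) (auto simp: fun_eq_iff)
  show ?thesis unfolding Input_def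
    by (rule ht_conseq[OF ht_Seq[OF 1 ht_Seq[OF 2 ht_Seq[OF 3 ht_Seq[OF 4 ht_Seq[OF 5 upd2_ht_Push]]]]]])
      (auto simp: fun_eq_iff code_prod_def)
qed

lemma ht_Output_loop:
  "\<exists>c'. ht (Whl (isat tS 2) (Seq (Pop tS) (Ite (isat tS 2)
       (Seq (Pop tS) (Seq (Pop tS) (Seq (Pop tS) (on 0 (\<lambda>_. (2, MoveRight))))))
       (Seq (Pop tS) (on 0 (\<lambda>_. (1, MoveRight)))))))
     ((c, int k), \<sigma>(tS := ser (code ys) @ s)) (7 * length ys + 1)
     ((c', int (k + length ys)), \<sigma>(tS := 1 # s)) \<and>
     (\<forall>i<k. c' (int i) = c (int i)) \<and> (\<forall>i<length ys. c' (int (k + i)) = bit_sym (ys ! i))"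
    (is "\<exists>c'. ht ?W _ _ _ \<and> _")
proof (induction ys arbitrary: c k)
  case Nil
  show ?case by (intro exI[of _ c] conjI ht_conseq[OF ht_WhlF]) auto
next
  case (Cons b ys)
  let ?c = "c(int k := bit_sym b)"
  obtain c' where c': "ht ?W ((?c, int (Suc k)), \<sigma>(tS := ser (code ys) @ s)) (7 * length ys + 1)
     ((c', int (Suc k + length ys)), \<sigma>(tS := 1 # s))"
     "\<forall>i<Suc k. c' (int i) = ?c (int i)" "\<forall>i<length ys. c' (int (Suc k + i)) = bit_sym (ys ! i)"
    using Cons.IH[of ?c "Suc k"] by blast
  let ?P = "Seq (Pop tS) (Seq (Pop tS) (Seq (Pop tS) (on 0 (\<lambda>_. (2, MoveRight)))))"
  let ?Q = "Seq (Pop tS) (on 0 (\<lambda>_. (1, MoveRight)))"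
  let ?t = "ser (code ys) @ s"
  have w: "ht (on 0 (\<lambda>_. (a, MoveRight))) ((c, int k), \<tau>) 1 ((c(int k := a), int (Suc k)), \<tau>)" for a \<tau>
    using ht_on0[of "\<lambda>_. (a, MoveRight)" "(c, int k)" \<tau>] by (simp add: act_tape_def add.commute)
  have p: "ht ?P ((c, int k), \<sigma>(tS := 2 # 1 # 1 # ?t)) 4 ((?c, int (Suc k)), \<sigma>(tS := ?t))" if b
    by (rule ht_conseq[OF ht_Seq[OF upd2_ht_Pop ht_Seq[OF upd2_ht_Pop ht_Seq[OF upd2_ht_Pop w]]]])
      (use that in auto)
  have q: "ht ?Q ((c, int k), \<sigma>(tS := 1 # ?t)) 4 ((?c, int (Suc k)), \<sigma>(tS := ?t))" if "\<not> b"
    by (rule ht_conseq[OF ht_Seq[OF upd2_ht_Pop w]]) (use that in auto)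
  have s: "ser (code (b # ys)) @ s = 2 # (if b then 2 # 1 # 1 # ?t else 1 # ?t)"
    by (auto simp: code_bool_def)
  have "ht (Ite (isat tS 2) ?P ?Q) ((c, int k), \<sigma>(tS := if b then 2 # 1 # 1 # ?t else 1 # ?t)) (Suc 4)
      ((?c, int (Suc k)), \<sigma>(tS := ?t))"
    by (rule ht_Ite) (use p q in \<open>auto split: if_splits\<close>)
  from ht_Seq[OF upd2_ht_Pop this]
  have "ht (Seq (Pop tS) (Ite (isat tS 2) ?P ?Q)) ((c, int k), \<sigma>(tS := ser (code (b # ys)) @ s)) (1 + Suc 4)
      ((?c, int (Suc k)), \<sigma>(tS := ?t))"
    unfolding s .
  from ht_WhlT[OF _ this c'(1)]
  have "ht ?W ((c, int k), \<sigma>(tS := ser (code (b # ys)) @ s)) (7 * length (b # ys) + 1)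
     ((c', int (k + length (b # ys))), \<sigma>(tS := 1 # s))"
    by (rule ht_conseq) auto
  moreover have "c' (int (k + i)) = bit_sym ((b # ys) ! i)" if "i < length (b # ys)" for i
    using that c'(2,3) by (cases i) auto
  moreover have "\<forall>i<k. c' (int i) = c (int i)" using c'(2) by auto
  ultimately show ?case by blast
qed

lemma ht_Output:
  "\<exists>c'. ht Output ((c, 0), \<sigma>(tS := ser (code ys) @ s)) (7 * length ys + 2)
     ((c', int (length ys)), \<sigma>(tS := 1 # s)) \<and>
     c' (int (length ys)) = 0 \<and> (\<forall>i<length ys. c' (int i) = bit_sym (ys ! i))"
proof -
  obtain c' where c': "ht (Whl (isat tS 2) (Seq (Pop tS) (Ite (isat tS 2)
       (Seq (Pop tS) (Seq (Pop tS) (Seq (Pop tS) (on 0 (\<lambda>_. (2, MoveRight))))))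
       (Seq (Pop tS) (on 0 (\<lambda>_. (1, MoveRight)))))))
     ((c, 0), \<sigma>(tS := ser (code ys) @ s)) (7 * length ys + 1)
     ((c', int (length ys)), \<sigma>(tS := 1 # s))" "\<forall>i<length ys. c' (int i) = bit_sym (ys ! i)"
    using ht_Output_loop[of c 0 \<sigma> ys s] by auto
  let ?c = "c'(int (length ys) := 0)"
  have "ht (on 0 (\<lambda>_. (0, Stay))) ((c', int (length ys)), \<sigma>(tS := 1 # s)) 1
     ((?c, int (length ys)), \<sigma>(tS := 1 # s))"
    using ht_on0[of "\<lambda>_. (0, Stay)" "(c', int (length ys))"] by (simp add: act_tape_def)
  from ht_Seq[OF c'(1) this] have "ht Output ((c, 0), \<sigma>(tS := ser (code ys) @ s)) (7 * length ys + 2)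
     ((?c, int (length ys)), \<sigma>(tS := 1 # s))"
    unfolding Output_def by (rule ht_conseq) auto
  then show ?thesis using c'(2) by (intro exI[of _ ?c]) auto
qed

lemma wfp_parts:
  "wfp 6 3 Input" "wfp 6 3 Output" "wfp 6 3 (compile c)"
proof -
  have on: "wfp 6 3 (on i f)" if "i < 6" "!!x. x < 3 ==> fst (f x) < 3" for i f
    using that by (rule wfp_on)
  show "wfp 6 3 Input" "wfp 6 3 Output"
    by (auto simp: Input_def Output_def Tr_def Build_def BuildLoop_def Scan_def Back_def
        intro!: wfp_Pop wfp_Push on)
  show "wfp 6 3 (compile c)"
    by (induction c) (auto simp: Dup_def Swap_def Drop_def Clear_def Split_def Tr_def Mv_def MvLoop_def Skip_def
        intro!: wfp_Pop wfp_Push on)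
qed

lemma stk_input_tape: "stk (input_tape w) (map bit_sym w)"
  by (auto simp: stk_def input_tape_def)

lemma initial_conf0:
  assumes "ntapes M = 6"
  shows "initial M [x, w] = (start M, snd (initial M [x, w]))" "conf_of (snd (initial M [x, w])) (conf0 x w)"
proof -
  show "initial M [x, w] = (start M, snd (initial M [x, w]))" by (simp add: initial_def)
  have 1: "input_tape y = itp y 0" for y by (simp add: itp_def input_tape_def)
  have 2: "stk (input_tape []) []" using stk_input_tape[of "[]"] by simp
  have "stk (input_tape (if i < 2 then [x, w] ! i else [])) (snd (conf0 x w) i)" if "0 < i" "i < 6" for i
  proof (cases "i = 1")
    case True
    then show ?thesis using stk_input_tape[of w] by (simp add: conf0_def)
  next
    case False
    then show ?thesis using 2 that by (simp add: conf0_def)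
  qed
  then show "conf_of (snd (initial M [x, w])) (conf0 x w)"
    using assms stk_input_tape[of w] 2 unfolding 1
    by (auto simp: conf_of_def initial_def conf0_def 1 simp del: upt_rec_numeral)
qed

text \<open>A missing second input is an empty one, so the machines built for two inputs also serve
  for one.\<close>

lemma initial_single: "2 <= ntapes M ==> initial M [x] = initial M [x, []]"
  by (auto simp: initial_def less_Suc_eq numeral_2_eq_2)

lemma run_single: "2 <= ntapes M ==> run M [x] t = run M [x, []] t"
  by (simp add: run_def initial_single)

lemma machine_ht:
  assumes "ht P (conf0 x w) n c'" "M = machine 6 3 P b"
  shows "\<exists>T\<le>Suc n. \<exists>ts. conf_of ts c' \<and>
    run M [x, w] T = (if b (tops c') then accept M else reject M, ts)"
proof -
  have s: "initial M [x, w] = (0, snd (initial M [x, w]))" "conf_of (snd (initial M [x, w])) (conf0 x w)"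
    using initial_conf0[of M x w] by (auto simp: assms(2) machine_def)
  then obtain t ts where "t <= n" "exec P (snd (initial M [x, w])) t ts" "conf_of ts c'"
    using assms(1) unfolding ht_def by blast
  then show ?thesis
    using machine_run[of P _ t ts 6 3 b "[x, w]"] s(1) conf_of_tops[of ts c']
    by (intro exI[of _ "Suc t"] conjI exI[of _ ts]) (auto simp: assms(2) machine_def)
qed

theorem comb_computes:
  obtains M where "wf_tm M" "ntapes M = 6"
    "!!(x :: bool list) (w :: bool list) t y. cev c (code (x, w)) t (code (y :: bool list)) ==>
      \<exists>T \<le> 60 * t + 20 * (length x + length w + length y) + 30.
        halted M (run M [x, w] T) \<and> has_output (run M [x, w] T) y"
proof -
  let ?P = "Seq Input (Seq (compile c) Output)"
  let ?M = "machine 6 3 ?P (\<lambda>_. True)"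
  show ?thesis
  proof (rule that[of ?M])
    show "wf_tm ?M" by (rule machine_wf) (auto simp: wfp_parts)
    show "ntapes ?M = 6" by (simp add: machine_def)
    fix x w :: "bool list" and t y assume c: "cev c (code (x, w)) t (code (y :: bool list))"
    let ?e = "\<lambda>_::nat. []::nat list"
    have 1: "ht (compile c) (itp x 0, ?e(tS := ser (code (x, w)) @ [])) (60 * t) (itp x 0, ?e(tS := ser (code y) @ []))"
      by (rule implD[OF compile_correct[OF c]]) (simp add: idle_def)
    obtain c' where c': "ht Output (itp x 0, ?e(tS := ser (code y) @ [])) (7 * length y + 2)
        ((c', int (length y)), ?e(tS := [1]))" "c' (int (length y)) = 0" "\<forall>i<length y. c' (int i) = bit_sym (y ! i)"
      using ht_Output[of _ ?e y "[]"] unfolding itp_def by blast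
    have "ht ?P (conf0 x w) (18 * length x + 18 * length w + 20 + (60 * t + (7 * length y + 2))) ((c', int (length y)), ?e(tS := [1]))"
      by (rule ht_Seq[OF ht_Input ht_Seq[OF 1 c'(1)]])
    from machine_ht[OF this refl, of "\<lambda>_. True"] obtain T ts where
      T: "T <= Suc (18 * length x + 18 * length w + 20 + (60 * t + (7 * length y + 2)))"
      "conf_of ts ((c', int (length y)), ?e(tS := [1]))" "run ?M [x, w] T = (accept ?M, ts)"
      by auto
    have "hd ts = (c', int (length y))" using T(2) by (cases ts) (auto simp: conf_of_def)
    then show "\<exists>T \<le> 60 * t + 20 * (length x + length w + length y) + 30.
        halted ?M (run ?M [x, w] T) \<and> has_output (run ?M [x, w] T) y"
      using T c' by (intro exI[of _ T]) (auto simp: halted_def has_output_def)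
  qed
qed

theorem comb_decides:
  obtains M where "wf_tm M" "ntapes M = 6"
    "!!(x :: bool list) (w :: bool list) t b. cev c (code (x, w)) t (code (b :: bool)) ==>
      \<exists>T \<le> 60 * t + 20 * (length x + length w) + 30.
        fst (run M [x, w] T) = (if b then accept M else reject M)"
proof -
  let ?P = "Seq Input (compile c)"
  let ?M = "machine 6 3 ?P (isat tS 2)"
  show ?thesis
  proof (rule that[of ?M])
    show "wf_tm ?M" by (rule machine_wf) (auto simp: wfp_parts)
    show "ntapes ?M = 6" by (simp add: machine_def)
    fix x w :: "bool list" and t b assume c: "cev c (code (x, w)) t (code (b :: bool))"
    let ?e = "\<lambda>_::nat. []::nat list"
    have 1: "ht (compile c) (itp x 0, ?e(tS := ser (code (x, w)) @ [])) (60 * t) (itp x 0, ?e(tS := ser (code b) @ []))"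
      by (rule implD[OF compile_correct[OF c]]) (simp add: idle_def)
    have "ht ?P (conf0 x w) (18 * length x + 18 * length w + 20 + 60 * t) (itp x 0, ?e(tS := ser (code b) @ []))"
      by (rule ht_Seq[OF ht_Input 1])
    from machine_ht[OF this refl, of "isat tS 2"] obtain T where
      T: "T <= Suc (18 * length x + 18 * length w + 20 + 60 * t)"
      "fst (run ?M [x, w] T) = (if b then accept ?M else reject ?M)"
      by (auto simp: topsym_ser code_bool_def split: if_splits)
    then show "\<exists>T \<le> 60 * t + 20 * (length x + length w) + 30.
        fst (run ?M [x, w] T) = (if b then accept ?M else reject ?M)"
      by (intro exI[of _ T]) auto
  qed
qed

section \<open>Polynomial-time functions\<close>

definition csize :: "'a::code => nat" where
  "csize x = sz (code x)"

lemma csize_pos [simp]: "0 < csize x" "csize x ~= 0"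
  using sz_pos[of "code x"] by (simp_all add: csize_def)

lemma csize_prod [simp]: "csize (x, y) = Suc (csize x + csize y)"
  by (simp add: csize_def code_prod_def)

lemma csize_fst_snd: "csize (fst p) <= csize p" "csize (snd p) <= csize p"
  by (cases p; simp)+

lemma csize_Nil [simp]: "csize [] = 1"
  by (simp add: csize_def)

lemma csize_Cons [simp]: "csize (x # xs) = Suc (csize x + csize xs)"
  by (simp add: csize_def)

lemma csize_nat [simp]: "csize (n::nat) = 2 * n + 1"
  by (induction n) (auto simp: csize_def)

lemma csize_bool: "csize (b::bool) <= 3"
  by (simp add: csize_def code_bool_def)

lemma csize_append: "csize (xs @ ys) = csize xs + csize ys - 1"
  by (induction xs) (auto simp: Suc_diff_le Suc_leI)

lemma csize_append_le: "csize (xs @ ys) <= csize xs + csize ys"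
  by (simp add: csize_append)

lemma csize_rev [simp]: "csize (rev xs) = csize xs"
  by (induction xs) (auto simp: csize_append)

lemma length_le_csize: "length xs <= csize xs"
  by (induction xs) auto

lemma csize_mem: "x \<in> set xs ==> csize x <= csize xs"
  by (induction xs) auto

lemma csize_list_le: "(!!x. x \<in> set xs ==> csize x <= b) ==> csize xs <= 1 + length xs * (b + 1)"
proof (induction xs)
  case (Cons a xs)
  have "csize a <= b" "csize xs <= 1 + length xs * (b + 1)" using Cons by auto
  then show ?case by simp
qed simp

lemma csize_le_nat: "(n::nat) <= csize n"
  by simp

lemma poly_mono_nat: "m <= n ==> poly p m <= poly p n" for p :: "nat poly"
  by (induction p) (auto intro!: add_mono mult_mono)

section \<open>Polynomial bounds and closure rules for polynomial-time functions\<close>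

definition pbo :: "('a::code => nat) => bool" where
  "pbo g \<longleftrightarrow> (\<exists>p. \<forall>x. g x <= poly p (csize x))"

named_theorems pbo_intros

lemma pbo_const [pbo_intros]: "pbo (\<lambda>_. k)"
  unfolding pbo_def by (intro exI[of _ "[:k:]"]) auto

lemma pbo_add [pbo_intros]: "pbo f ==> pbo g ==> pbo (\<lambda>x. f x + g x)"
  unfolding pbo_def by (metis add_mono poly_add)

lemma pbo_mult [pbo_intros]: "pbo f ==> pbo g ==> pbo (\<lambda>x. f x * g x)"
  unfolding pbo_def by (metis mult_le_mono poly_mult)

lemma pbo_Suc [pbo_intros]: "pbo f ==> pbo (\<lambda>x. Suc (f x))"
  using pbo_add[of f "\<lambda>_. 1"] pbo_const[of 1] by simp

lemma pbo_poly [pbo_intros]: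
  fixes p :: "nat poly"
  assumes "pbo f"
  shows "pbo (\<lambda>x. poly p (f x))"
proof -
  obtain q where "\<forall>x. f x <= poly q (csize x)" using assms by (auto simp: pbo_def)
  then have "\<forall>x. poly p (f x) <= poly (p \<circ>\<^sub>p q) (csize x)" by (simp add: poly_pcompose poly_mono_nat)
  then show ?thesis unfolding pbo_def by blast
qed

lemma pbo_csize [pbo_intros]: "pbo csize"
  unfolding pbo_def by (intro exI[of _ "[:0, 1:]"]) auto

lemma pbo_le: "pbo g ==> (!!x. f x <= g x) ==> pbo f"
  unfolding pbo_def by (meson le_trans)

text \<open>Polynomial time in the tree language, measured in the size of the coded argument. The
  rules in \<open>fp_intros\<close> are closure properties; most later programs exist because their
  defining terms are built from such functions.\<close>

definition fp :: "('a::code => 'b::code) => bool" where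
  "fp f \<longleftrightarrow> (\<exists>c b. pbo b \<and> (\<forall>x. \<exists>t\<le>b x. cev c (code x) t (code (f x))))"

named_theorems fp_intros

lemma fpI:
  assumes "pbo b" "!!x. \<exists>t\<le>b x. cev c (code x) t (code (f x))"
  shows "fp f"
  using assms unfolding fp_def by blast

lemma fpE:
  assumes "fp f"
  obtains c p where "!!x. \<exists>t\<le>poly p (csize x). cev c (code x) t (code (f x))"
proof -
  obtain c b where "pbo b" "\<forall>x. \<exists>t\<le>b x. cev c (code x) t (code (f x))"
    using assms unfolding fp_def by blast
  moreover obtain p where "\<forall>x. b x <= poly p (csize x)" using \<open>pbo b\<close> unfolding pbo_def by blast
  ultimately show ?thesis using that by (meson le_trans)
qed

lemma fp_size:
  assumes "fp f"
  obtains p where "!!x. csize (f x) <= poly p (csize x)"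
proof -
  obtain c p where c: "!!x. \<exists>t\<le>poly p (csize x). cev c (code x) t (code (f x))"
    using fpE[OF assms] by metis
  have "csize (f x) <= poly ([:0, 1:] + p) (csize x)" for x
    using c[of x] cev_size[of c "code x" _ "code (f x)"] by (fastforce simp: csize_def)
  then show ?thesis using that by blast
qed

lemma pbo_comp:
  assumes "fp f" "pbo b"
  shows "pbo (\<lambda>x. b (f x))"
proof -
  obtain p where p: "!!x. csize (f x) <= poly p (csize x)" using fp_size[OF assms(1)] by metis
  obtain q where q: "\<forall>x. b x <= poly q (csize x)" using assms(2) by (auto simp: pbo_def)
  have "pbo (\<lambda>x. poly q (poly p (csize x)))" by (intro pbo_intros)
  then show ?thesis by (rule pbo_le) (meson p q poly_mono_nat le_trans)
qed

lemma pbo_size [pbo_intros]: "fp f ==> pbo (\<lambda>x. csize (f x))"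
  by (rule pbo_comp[OF _ pbo_csize])

lemma pbo_length [pbo_intros]: "fp f ==> pbo (\<lambda>x. length (f x))"
  by (rule pbo_le[OF pbo_size]) (auto intro: length_le_csize)

lemma pbo_nat: "fp f ==> pbo (\<lambda>x. f x :: nat)"
  by (rule pbo_le[OF pbo_size]) (auto intro: csize_le_nat)

lemma fp_comp:
  assumes "fp f" "fp g"
  shows "fp (\<lambda>x. f (g x))"
proof -
  obtain c b where c: "pbo b" "!!x. \<exists>t\<le>b x. cev c (code x) t (code (f x))"
    using assms(1) unfolding fp_def by blast
  obtain d b' where d: "pbo b'" "!!x. \<exists>t\<le>b' x. cev d (code x) t (code (g x))"
    using assms(2) unfolding fp_def by blast
  show ?thesis
  proof (rule fpI)
    show "pbo (\<lambda>x. b' x + b (g x))" by (intro pbo_intros d pbo_comp[OF assms(2) c(1)])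
    show "\<exists>t\<le>b' x + b (g x). cev (CSeq d c) (code x) t (code (f (g x)))" for x
      using c(2)[of "g x"] d(2)[of x] by (meson add_mono cev.Sq)
  qed
qed

lemma fp_cong: "fp f ==> (!!x. f x = g x) ==> fp g"
  by (subst ext[of g f]) auto

lemma fp_id [fp_intros]: "fp (\<lambda>x. x)"
  by (rule fpI[OF pbo_csize, where c = CId]) (auto simp: csize_def intro: cev.Id)

text \<open>Used where two types share their trees: a pair and a list cell, a successor and a pair
  of a unit with a number, a number and a list of units.\<close>

lemma fp_coerce:
  assumes "!!x. code (f x) = code x"
  shows "fp f"
  by (rule fpI[OF pbo_csize, where c = CId]) (use assms cev.Id in \<open>auto simp: csize_def\<close>)

lemma fp_Pair [fp_intros]:
  assumes "fp f" "fp g"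
  shows "fp (\<lambda>x. (f x, g x))"
proof -
  obtain c b where c: "pbo b" "!!x. \<exists>t\<le>b x. cev c (code x) t (code (f x))"
    using assms(1) unfolding fp_def by blast
  obtain d b' where d: "pbo b'" "!!x. \<exists>t\<le>b' x. cev d (code x) t (code (g x))"
    using assms(2) unfolding fp_def by blast
  show ?thesis
  proof (rule fpI)
    show "pbo (\<lambda>x. b x + b' x + csize x + csize (f x) + csize (g x))"
      by (intro pbo_intros d c assms)
    fix x
    obtain t u where t: "t <= b x" "u <= b' x" "cev c (code x) t (code (f x))" "cev d (code x) u (code (g x))"
      using c(2)[of x] d(2)[of x] by auto
    show "\<exists>t\<le>b x + b' x + csize x + csize (f x) + csize (g x). cev (CPair c d) (code x) t (code (f x, g x))"
      using cev.Pair[OF t(3,4)] t(1,2)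
      by (intro exI[of _ "t + u + csize x + csize (f x) + csize (g x)"]) (auto simp: csize_def code_prod_def)
  qed
qed

primrec kst :: "tree => comb" where
  "kst Lf = CNil"
| "kst (Nd l r) = CPair (kst l) (kst r)"

lemma cev_kst: "\<exists>k. \<forall>x. \<exists>t\<le>k * sz x. cev (kst y) x t y"
proof (induction y)
  case Lf
  show ?case by (intro exI[of _ 1]) (auto intro: cev.Nil)
next
  case (Nd l r)
  then obtain k k' where k: "!!x. \<exists>t\<le>k * sz x. cev (kst l) x t l" "!!x. \<exists>t\<le>k' * sz x. cev (kst r) x t r"
    by blast
  have "\<exists>t\<le>(k + k' + 1 + sz l + sz r) * sz x. cev (kst (Nd l r)) x t (Nd l r)" for x
  proof -
    obtain t u where t: "t <= k * sz x" "u <= k' * sz x" "cev (kst l) x t l" "cev (kst r) x u r"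
      using k by meson
    have "sz l <= sz l * sz x" "sz r <= sz r * sz x" using sz_pos[of x] by (simp_all add: Suc_leI)
    then have "t + u + sz x + sz l + sz r <= (k + k' + 1 + sz l + sz r) * sz x"
      using t(1,2) unfolding add_mult_distrib mult_1 by linarith
    then show ?thesis unfolding kst.simps using cev.Pair[OF t(3,4)] by blast
  qed
  then show ?case by blast
qed

lemma fp_const [fp_intros]: "fp (\<lambda>_::'e::code. y)"
proof -
  obtain k where "\<forall>x. \<exists>t\<le>k * sz x. cev (kst (code y)) x t (code y)" using cev_kst by blast
  then have *: "\<exists>t\<le>k * csize x. cev (kst (code y)) (code x) t (code y)" for x :: 'e by (auto simp: csize_def)
  show ?thesis
    by (rule fpI[where b = "\<lambda>x. k * csize x" and c = "kst (code y)"]) (intro pbo_intros *)+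
qed

lemma fp_fst_base: "fp fst"
  by (rule fpI[OF pbo_csize, where c = CHd]) (metis cev.Hd code_prod_def csize_def hd_tree.simps(2) order_refl)

lemma fp_snd_base: "fp snd"
  by (rule fpI[OF pbo_csize, where c = CTl]) (metis cev.Tl code_prod_def csize_def tl_tree.simps(2) order_refl)

lemmas fp_fst [fp_intros] = fp_comp[OF fp_fst_base]
lemmas fp_snd [fp_intros] = fp_comp[OF fp_snd_base]

lemma fp_comp2:
  assumes "fp (\<lambda>p. f (fst p) (snd p))" "fp g" "fp h"
  shows "fp (\<lambda>x. f (g x) (h x))"
  using fp_comp[OF assms(1) fp_Pair[OF assms(2,3)]] by simp

lemma fp_comp3:
  assumes "fp (\<lambda>p. f (fst p) (fst (snd p)) (snd (snd p)))" "fp g" "fp h" "fp k"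
  shows "fp (\<lambda>x. f (g x) (h x) (k x))"
  using fp_comp[OF assms(1) fp_Pair[OF assms(2) fp_Pair[OF assms(3,4)]]] by simp

lemma fp_if [fp_intros]:
  assumes "fp p" "fp f" "fp g"
  shows "fp (\<lambda>x. if p x then f x else g x)"
proof -
  obtain cp bp where p: "pbo bp" "!!x. \<exists>t\<le>bp x. cev cp (code x) t (code (p x))"
    using assms(1) unfolding fp_def by blast
  obtain c b where c: "pbo b" "!!x. \<exists>t\<le>b x. cev c (code x) t (code (f x))"
    using assms(2) unfolding fp_def by blast
  obtain d b' where d: "pbo b'" "!!x. \<exists>t\<le>b' x. cev d (code x) t (code (g x))"
    using assms(3) unfolding fp_def by blast
  show ?thesis
  proof (rule fpI)
    show "pbo (\<lambda>x. bp x + b x + b' x + csize x + 3)"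
      by (intro pbo_intros d c p)
    fix x
    obtain t where t: "t <= bp x" "cev cp (code x) t (code (p x))" using p(2)[of x] by auto
    obtain u where u: "u <= b x" "cev c (code x) u (code (f x))" using c(2)[of x] by auto
    obtain v where v: "v <= b' x" "cev d (code x) v (code (g x))" using d(2)[of x] by auto
    show "\<exists>t\<le>bp x + b x + b' x + csize x + 3. cev (CIf cp c d) (code x) t (code (if p x then f x else g x))"
    proof (cases "p x")
      case True
      then have "cev (CIf cp c d) (code x) (t + u + sz (code x) + sz (code True)) (code (f x))"
        using t(2) u(2) by (intro cev.IfT) (auto simp: code_bool_def)
      then show ?thesis using True t(1) u(1)
        by (intro exI[of _ "t + u + sz (code x) + sz (code True)"]) (auto simp: csize_def code_bool_def)
    next
      case False
      then have "cev (CIf cp c d) (code x) (t + v + sz (code x)) (code (g x))"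
        using t(2) v(2) by (intro cev.IfF) (auto simp: code_bool_def)
      then show ?thesis using False t(1) v(1)
        by (intro exI[of _ "t + v + sz (code x)"]) (auto simp: csize_def)
    qed
  qed
qed

lemma fp_conj [fp_intros]: "fp p ==> fp q ==> fp (\<lambda>x. p x \<and> q x)"
  by (rule fp_cong[OF fp_if[of p q "\<lambda>_. False"]]) (auto intro: fp_const)

lemma fp_not [fp_intros]: "fp p ==> fp (\<lambda>x. \<not> p x)"
  by (rule fp_cong[OF fp_if[of p "\<lambda>_. False" "\<lambda>_. True"]]) (auto intro: fp_const)

lemma fp_disj [fp_intros]: "fp p ==> fp q ==> fp (\<lambda>x. p x \<or> q x)"
  by (rule fp_cong[OF fp_if[of p "\<lambda>_. True" q]]) (auto intro: fp_const)

lemma fp_imp [fp_intros]: "fp p ==> fp q ==> fp (\<lambda>x. p x --> q x)"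
  by (rule fp_cong[OF fp_if[of p q "\<lambda>_. True"]]) (auto intro: fp_const)

lemma fp_iff [fp_intros]: "fp p ==> fp q ==> fp (\<lambda>x. p x \<longleftrightarrow> q x)"
  by (rule fp_cong[OF fp_if[of p q "\<lambda>x. \<not> q x"]]) (auto intro: fp_not)

lemma fp_Cons [fp_intros]: "fp f ==> fp g ==> fp (\<lambda>x. f x # g x)"
  using fp_comp[OF fp_coerce[of "\<lambda>p. fst p # snd p"] fp_Pair[of f g]] by (simp add: code_prod_def)

lemma fp_Suc [fp_intros]: "fp f ==> fp (\<lambda>x. Suc (f x))"
  using fp_comp[OF fp_coerce[of "\<lambda>p::unit \<times> nat. Suc (snd p)"] fp_Pair[OF fp_const[of "()"], of f]]
  by (simp add: code_prod_def code_unit_def)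

lemma fp_nonleaf:
  fixes P :: "'a::code => bool"
  assumes "!!x. P x \<longleftrightarrow> code x ~= Lf"
  shows "fp P"
proof (rule fpI)
  show "pbo (\<lambda>x. csize x + (csize x + csize x + csize x + 1 + 1) + csize x + csize x)" by (intro pbo_intros)
  fix x :: 'a
  have k: "cev (CPair CNil CNil) (code x) (sz (code x) + sz (code x) + sz (code x) + sz Lf + sz Lf) (Nd Lf Lf)"
    by (intro cev.Pair cev.Nil)
  show "\<exists>t\<le>csize x + (csize x + csize x + csize x + 1 + 1) + csize x + csize x.
    cev (CIf CId (CPair CNil CNil) CNil) (code x) t (code (P x))"
  proof (cases "P x")
    case True
    then show ?thesis using cev.IfT[OF cev.Id _ k] assms[of x]
      by (intro exI conjI[rotated]) (auto simp: code_bool_def csize_def)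
  next
    case False
    then have l: "code x = Lf" using assms by blast
    have "cev CId (code x) (sz (code x)) Lf" using cev.Id[of "code x"] l by simp
    from cev.IfF[OF this cev.Nil, of "CPair CNil CNil"] show ?thesis using False l
      by (intro exI conjI[rotated]) (auto simp: code_bool_def csize_def)
  qed
qed

lemma fp_nonempty: "fp xs ==> fp (\<lambda>x. xs x ~= [])"
proof (rule fp_comp[of "\<lambda>l. l ~= []"])
  show "fp (\<lambda>l::'b list. l ~= [])"
  proof (rule fp_nonleaf)
    show "l ~= [] \<longleftrightarrow> code l ~= Lf" for l :: "'b list" by (cases l) auto
  qed
qed

lemma fp_null [fp_intros]: "fp xs ==> fp (\<lambda>x. xs x = [])"
  using fp_not[OF fp_nonempty, of xs] by simp

lemma fp_tl [fp_intros]: "fp xs ==> fp (\<lambda>x. tl (xs x))"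
proof (rule fp_comp[of tl])
  have "cev CTl (code l) (sz (code l)) (code (tl l))" for l :: "'b list"
    using cev.Tl[of "code l"] by (cases l) auto
  then show "fp (tl :: 'b list => 'b list)"
    by (intro fpI[OF pbo_csize, where c = CTl]) (auto simp: csize_def)
qed

text \<open>A nonempty list has the tree of the pair of its head and tail. Pairing the environment
  with the list itself therefore already gives the argument \<open>(e, y, ys)\<close> of the second
  branch.\<close>

lemma fp_case_list [fp_intros]:
  fixes xs :: "'e::code => 'x::code list" and a :: "'e => 'r::code"
  assumes "fp xs" "fp a" "fp (\<lambda>p. b (fst p) (fst (snd p)) (snd (snd p)))"
  shows "fp (\<lambda>e. case xs e of [] => a e | y # ys => b e y ys)"
proof -
  obtain cp bp where p: "pbo bp" "!!x. \<exists>t\<le>bp x. cev cp (code x) t (code (xs x))"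
    using assms(1) unfolding fp_def by blast
  obtain c ba where c: "pbo ba" "!!x. \<exists>t\<le>ba x. cev c (code x) t (code (a x))"
    using assms(2) unfolding fp_def by blast
  obtain d pd where d: "!!x. \<exists>t\<le>poly pd (csize x). cev d (code x) t (code (b (fst x) (fst (snd x)) (snd (snd x))))"
    using fpE[OF assms(3)] by metis
  show ?thesis
  proof (rule fpI)
    let ?s = "\<lambda>x. Suc (csize x + csize (xs x))"
    let ?b = "\<lambda>x. bp x + (csize x + bp x + csize x + csize x + csize (xs x) + poly pd (?s x)) + ba x + csize x + csize (xs x)"
    show "pbo ?b" by (intro pbo_intros c p assms)
    fix x
    obtain t where t: "t <= bp x" "cev cp (code x) t (code (xs x))" using p(2)[of x] by auto
    show "\<exists>t\<le>?b x. cev (CIf cp (CSeq (CPair CId cp) d) c) (code x) t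
         (code (case xs x of [] => a x | y # ys => b x y ys))"
    proof (cases "xs x")
      case Nil
      obtain u where u: "u <= ba x" "cev c (code x) u (code (a x))" using c(2)[of x] by auto
      have "cev (CIf cp (CSeq (CPair CId cp) d) c) (code x) (t + u + sz (code x)) (code (a x))"
        using t(2) u(2) Nil by (intro cev.IfF) auto
      then show ?thesis using t(1) u(1) Nil by (intro exI[of _ "t + u + sz (code x)"]) (auto simp: csize_def)
    next
      case (Cons y ys)
      obtain u where u: "u <= poly pd (?s x)" "cev d (code (x, y, ys)) u (code (b x y ys))"
        using d[of "(x, y, ys)"] Cons by auto
      have e: "code (x, y, ys) = Nd (code x) (code (xs x))" using Cons by (simp add: code_prod_def)
      have "cev (CPair CId cp) (code x) (sz (code x) + t + sz (code x) + sz (code x) + sz (code (xs x))) (code (x, y, ys))"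
        unfolding e by (rule cev.Pair[OF cev.Id t(2)])
      from cev.IfT[OF t(2) _ cev.Sq[OF this u(2)]]
      have "cev (CIf cp (CSeq (CPair CId cp) d) c) (code x) (t + (sz (code x) + t + sz (code x) + sz (code x) + sz (code (xs x)) + u) + sz (code x) + sz (code (xs x))) (code (b x y ys))"
        using Cons by auto
      then show ?thesis using t(1) u(1) unfolding Cons csize_def
        by (intro exI conjI[rotated]) (simp, auto simp: csize_def)
    qed
  qed
qed

lemma cev_while:
  fixes s :: "'s::code" and P :: "'s => bool" and b :: "'s => 's"
  assumes p: "!!x. \<exists>t\<le>poly pp (csize x). cev cp (code x) t (code (P x))"
    and b: "!!x. \<exists>t\<le>poly pb (csize x). cev cb (code x) t (code (b x))"
    and "!!i. i < N ==> P ((b ^^ i) s)" "\<not> P ((b ^^ N) s)" "!!i. i <= N ==> csize ((b ^^ i) s) <= S"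
  shows "\<exists>t\<le>Suc N * (poly pp S + poly pb S + S + 3). cev (CWhile cp cb) (code s) t (code ((b ^^ N) s))"
  using assms(3-)
proof (induction N arbitrary: s)
  case 0
  obtain t where t: "t <= poly pp (csize s)" "cev cp (code s) t (code (P s))" using p by blast
  have "cev (CWhile cp cb) (code s) (t + sz (code s)) (code s)"
    using t(2) 0 by (intro cev.WhileF) (auto simp: code_bool_def)
  moreover have "t + sz (code s) <= poly pp S + S"
    using t(1) 0(3)[of 0] poly_mono_nat[of "csize s" S pp] by (auto simp: csize_def)
  ultimately show ?case by (intro exI[of _ "t + sz (code s)"]) auto
next
  case (Suc N)
  obtain t where t: "t <= poly pp (csize s)" "cev cp (code s) t (code (P s))" using p by blast
  obtain u where u: "u <= poly pb (csize s)" "cev cb (code s) u (code (b s))" using b by blast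
  have it: "(b ^^ i) (b s) = (b ^^ Suc i) s" for i by (simp add: funpow_swap1)
  obtain v where v: "v <= Suc N * (poly pp S + poly pb S + S + 3)"
    "cev (CWhile cp cb) (code (b s)) v (code ((b ^^ N) (b s)))"
  proof -
    have "\<exists>t\<le>Suc N * (poly pp S + poly pb S + S + 3). cev (CWhile cp cb) (code (b s)) t (code ((b ^^ N) (b s)))"
      by (rule Suc.IH) (use Suc.prems in \<open>auto simp: it simp del: funpow.simps\<close>)
    then show ?thesis using that by blast
  qed
  have Ps: "P s" using Suc.prems(1)[of 0] by simp
  then have c3: "code (P s) ~= Lf" "sz (code (P s)) = 3" by (auto simp: code_bool_def)
  have "cev (CWhile cp cb) (code s) (t + u + v + sz (code s) + sz (code (P s))) (code ((b ^^ N) (b s)))"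
    by (rule cev.WhileT[OF t(2) c3(1) u(2) v(2)])
  moreover have "csize s <= S" using Suc.prems(3)[of 0] by simp
  then have "t + u + v + sz (code s) + sz (code (P s)) <= Suc (Suc N) * (poly pp S + poly pb S + S + 3)"
    using t(1) u(1) v(1) poly_mono_nat[of "csize s" S pp] poly_mono_nat[of "csize s" S pb] c3(2)
    by (simp add: csize_def)
  ultimately show ?case using it[of N] by (metis (no_types, lifting))
qed

text \<open>Polynomially many rounds of a polynomial-time step may take exponential time, since the
  state can grow in each round. Hence the separate bound \<open>S\<close> on all intermediate
  states.\<close>

lemma fp_iterate:
  fixes b :: "'s::code => 's" and s :: "'e::code => 's" and N :: "'e => nat"
  assumes "fp P" "fp b" "fp s" "pbo N" "pbo S"
    and "!!e i. i < N e ==> P ((b ^^ i) (s e))" "!!e. \<not> P ((b ^^ N e) (s e))"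
    and "!!e i. i <= N e ==> csize ((b ^^ i) (s e)) <= S e"
  shows "fp (\<lambda>e. (b ^^ N e) (s e))"
proof -
  obtain cp pp where p: "!!x. \<exists>t\<le>poly pp (csize x). cev cp (code x) t (code (P x))" using fpE[OF assms(1)] by metis
  obtain cb pb where b: "!!x. \<exists>t\<le>poly pb (csize x). cev cb (code x) t (code (b x))" using fpE[OF assms(2)] by metis
  obtain cs bs where s: "pbo bs" "!!x. \<exists>t\<le>bs x. cev cs (code x) t (code (s x))" using assms(3) unfolding fp_def by blast
  show ?thesis
  proof (rule fpI)
    show "pbo (\<lambda>e. bs e + Suc (N e) * (poly pp (S e) + poly pb (S e) + S e + 3))"
      by (intro pbo_intros s assms)
    fix e
    obtain t where t: "t <= Suc (N e) * (poly pp (S e) + poly pb (S e) + S e + 3)"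
      "cev (CWhile cp cb) (code (s e)) t (code ((b ^^ N e) (s e)))"
      using cev_while[OF p b, of "N e" "s e" "S e"] assms(6-8) by blast
    obtain u where u: "u <= bs e" "cev cs (code e) u (code (s e))" using s(2) by blast
    show "\<exists>t\<le>bs e + Suc (N e) * (poly pp (S e) + poly pb (S e) + S e + 3).
       cev (CSeq cs (CWhile cp cb)) (code e) t (code ((b ^^ N e) (s e)))"
      using cev.Sq[OF u(2) t(2)] u(1) t(1) by (meson add_mono)
  qed
qed

text \<open>The environment \<open>e\<close> travels in the state of the loop, so that
  \<open>g\<close> may depend on it. The rules for \<open>map\<close>, \<open>filter\<close> and
  bounded quantifiers need this, as their bodies are terms with free variables.\<close>

lemma fp_foldl:
  fixes xs :: "'e::code => 'x::code list" and i :: "'e => 'a::code"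
  assumes "fp xs" "fp i" "fp (\<lambda>p. g (fst p) (fst (snd p)) (snd (snd p)))" "pbo B"
    and bound: "!!e ys zs. xs e = ys @ zs ==> csize (foldl (g e) (i e) ys) <= B e"
  shows "fp (\<lambda>e. foldl (g e) (i e) (xs e))"
proof -
  define b :: "'e \<times> 'a \<times> 'x list => 'e \<times> 'a \<times> 'x list" where
    "b p = (case snd (snd p) of [] => p | y # ys => (fst p, g (fst p) (fst (snd p)) y, ys))" for p
  have fb: "fp b" unfolding b_def by (intro fp_intros fp_comp3[OF assms(3)])
  let ?s = "\<lambda>e. (e, i e, xs e)"
  have it: "k <= length (xs e) ==>
    (b ^^ k) (?s e) = (e, foldl (g e) (i e) (take k (xs e)), drop k (xs e))" for k e
  proof (induction k)
    case (Suc k)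
    then obtain y where y: "drop k (xs e) = y # drop (Suc k) (xs e)" "xs e ! k = y"
      by (metis Cons_nth_drop_Suc Suc_le_lessD)
    show ?case using Suc y by (simp add: b_def take_Suc_conv_app_nth)
  qed simp
  have "fp (\<lambda>e. (b ^^ length (xs e)) (?s e))"
  proof (rule fp_iterate[where P = "\<lambda>p. snd (snd p) ~= []" and S = "\<lambda>e. csize e + B e + csize (xs e) + 2"])
    show "pbo (\<lambda>e. csize e + B e + csize (xs e) + 2)" "pbo (\<lambda>e. length (xs e))"
      by (intro pbo_intros assms)+
    show "fp (\<lambda>p::'e \<times> 'a \<times> 'x list. snd (snd p) ~= [])" by (intro fp_intros)
    fix e k assume "k <= length (xs e)"
    moreover have "csize (drop k l) <= csize l" for l :: "'x list"
      by (induction l arbitrary: k) (auto simp: drop_Cons' intro: le_SucI trans_le_add2)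
    ultimately show "csize ((b ^^ k) (e, i e, xs e)) <= csize e + B e + csize (xs e) + 2"
      using bound[of e "take k (xs e)" "drop k (xs e)"] by (simp add: it add_mono)
  qed (use it fb assms in \<open>auto intro!: fp_intros\<close>)
  from fp_fst[OF fp_snd[OF this]] show ?thesis by (simp add: it)
qed

subsection \<open>Closure under list and arithmetic operations\<close>

lemma csize_append_ge: "csize ys <= csize (ys @ zs)"
  by (induction ys) (auto simp: Suc_leI)

lemma fp_rev [fp_intros]: "fp xs ==> fp (\<lambda>e. rev (xs e))"
proof (rule fp_comp[of rev])
  have f: "foldl (\<lambda>a y. y # a) [] ys = rev ys" for ys :: "'b list"
    by (induction ys rule: rev_induct) auto
  have "fp (\<lambda>l::'b list. foldl (\<lambda>a y. y # a) [] l)"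
  proof (rule fp_foldl[where B = csize])
    show "csize (foldl (\<lambda>a y. y # a) [] ys) <= csize l" if "l = ys @ zs" for l ys zs :: "'b list"
      using that csize_append_ge[of ys zs] by (simp add: f)
  qed (intro fp_intros pbo_intros)+
  then show "fp (rev :: 'b list => 'b list)" by (simp add: f)
qed

lemma fp_append [fp_intros]: "fp xs ==> fp ys ==> fp (\<lambda>e. xs e @ ys e)"
proof (rule fp_comp2[of "(@)"])
  have f: "foldl (\<lambda>a y. y # a) v u = rev u @ v" for u v :: "'b list"
    by (induction u arbitrary: v) auto
  have "fp (\<lambda>p. foldl (\<lambda>a y. y # a) (snd p) (rev (fst p :: 'b list)))"
  proof (rule fp_foldl[where B = csize])
    show "csize (foldl (\<lambda>a y. y # a) (snd p) us) <= csize p" if "rev (fst p) = us @ vs" for p :: "'b list \<times> 'b list" and us vs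
    proof -
      have "csize (fst p) = csize (rev (fst p))" by simp
      also have "... = csize us + csize vs - 1" using that by (simp only: csize_append)
      finally have "csize us <= csize (fst p)" using csize_pos[of vs] by linarith
      then show ?thesis using csize_append_le[of "rev us" "snd p"] csize_prod[of "fst p" "snd p"]
        by (simp add: f)
    qed
  qed (intro fp_intros pbo_intros)+
  then show "fp (\<lambda>p. fst p @ (snd p :: 'b list))" by (simp add: f)
qed

lemma fp_map [fp_intros]:
  fixes xs :: "'e::code => 'x::code list" and f :: "'e => 'x => 'y::code"
  assumes "fp xs" "fp (\<lambda>p. f (fst p) (snd p))"
  shows "fp (\<lambda>e. map (\<lambda>y. f e y) (xs e))"
proof -
  obtain q where q: "!!p. csize (f (fst p) (snd p)) <= poly q (csize p)" using fp_size[OF assms(2)] by metis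
  have f: "foldl (\<lambda>a y. f e y # a) [] ys = rev (map (f e) ys)" for e ys
    by (induction ys rule: rev_induct) auto
  let ?B = "\<lambda>e. 1 + length (xs e) * (poly q (Suc (csize e + csize (xs e))) + 1)"
  have "fp (\<lambda>e. foldl (\<lambda>a y. f e y # a) [] (xs e))"
  proof (rule fp_foldl[where B = ?B])
    show "pbo ?B" by (intro pbo_intros assms)
    show "fp (\<lambda>p. f (fst p) (snd (snd p)) # fst (snd p))" by (intro fp_intros fp_comp2[OF assms(2)])
    fix e ys zs assume x: "xs e = ys @ zs"
    have "csize (f e y) <= poly q (Suc (csize e + csize (xs e)))" if "y \<in> set (xs e)" for y
      using q[of "(e, y)"] csize_mem[OF that] poly_mono_nat[of "csize (e, y)" "Suc (csize e + csize (xs e))" q]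
      by simp
    then have "csize (map (f e) ys) <= 1 + length ys * (poly q (Suc (csize e + csize (xs e))) + 1)"
      using csize_list_le[of "map (f e) ys" "poly q (Suc (csize e + csize (xs e)))"] x by auto
    also have "... <= ?B e" using x by (intro add_mono mult_le_mono) auto
    finally show "csize (foldl (\<lambda>a y. f e y # a) [] ys) <= ?B e" by (simp add: f)
  qed (intro fp_intros assms)+
  from fp_rev[OF this] show ?thesis by (simp add: f)
qed

lemma fp_concat [fp_intros]: "fp xss ==> fp (\<lambda>e. concat (xss e))"
proof (rule fp_comp[of concat])
  have f: "foldl (\<lambda>a y. a @ y) [] l = concat l" for l :: "'b list list"
    by (induction l rule: rev_induct) auto
  have c: "csize (concat l) <= csize l" for l :: "'b list list"
    by (induction l) (auto simp: csize_append)
  have "fp (\<lambda>l :: 'b list list. foldl (\<lambda>a y. a @ y) [] l)"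
  proof (rule fp_foldl[where B = csize])
    fix l ys zs :: "'b list list" assume "l = ys @ zs"
    then have "csize ys <= csize l" by (simp add: csize_append_ge)
    then show "csize (foldl (\<lambda>a y. a @ y) [] ys) <= csize l" using c[of ys] by (simp add: f)
  qed (intro fp_intros pbo_intros)+
  then show "fp (concat :: 'b list list => _)" by (simp add: f)
qed

lemma fp_filter [fp_intros]:
  fixes xs :: "'e::code => 'x::code list"
  assumes "fp xs" "fp (\<lambda>p. P (fst p) (snd p))"
  shows "fp (\<lambda>e. filter (\<lambda>y. P e y) (xs e))"
proof -
  have "fp (\<lambda>e. concat (map (\<lambda>y. if P e y then [y] else []) (xs e)))" by (intro fp_intros assms)
  moreover have "concat (map (\<lambda>y. if P e y then [y] else []) l) = filter (\<lambda>y. P e y) l" for e l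
    by (induction l) auto
  ultimately show ?thesis by simp
qed

lemma fp_ball [fp_intros]:
  fixes xs :: "'e::code => 'x::code list"
  assumes "fp xs" "fp (\<lambda>p. P (fst p) (snd p))"
  shows "fp (\<lambda>e. \<forall>y\<in>set (xs e). P e y)"
proof -
  have "fp (\<lambda>e. filter (\<lambda>y. \<not> P e y) (xs e) = [])" by (intro fp_intros assms)
  then show ?thesis by (rule fp_cong) (auto simp: filter_empty_conv)
qed

lemma fp_bex [fp_intros]:
  fixes xs :: "'e::code => 'x::code list"
  assumes "fp xs" "fp (\<lambda>p. P (fst p) (snd p))"
  shows "fp (\<lambda>e. \<exists>y\<in>set (xs e). P e y)"
proof -
  have "fp (\<lambda>e. \<not> (\<forall>y\<in>set (xs e). \<not> P e y))" by (intro fp_intros assms)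
  then show ?thesis by (rule fp_cong) auto
qed

lemma code_replicate_unit: "code (replicate n ()) = code n"
  by (induction n) (auto simp: code_unit_def)

lemma fp_units: "fp n ==> fp (\<lambda>e. replicate (n e) ())"
  by (rule fp_comp[OF fp_coerce[of "\<lambda>n. replicate n ()"]]) (rule code_replicate_unit)

lemma foldl_replicate: "foldl (\<lambda>a _. g a) i (replicate n ()) = (g ^^ n) i"
  by (induction n arbitrary: i) (auto simp: funpow_swap1)

text \<open>A number is a list of units, so iterating is folding over that list.\<close>

lemma fp_funpow:
  fixes n :: "'e::code => nat" and i :: "'e => 'a::code" and g :: "'e => 'a => 'a"
  assumes "fp n" "fp i" "fp (\<lambda>p. g (fst p) (snd p))" "pbo B"
    and "!!e k. k <= n e ==> csize ((g e ^^ k) (i e)) <= B e"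
  shows "fp (\<lambda>e. (g e ^^ n e) (i e))"
proof -
  have "fp (\<lambda>e. foldl (\<lambda>a _. g e a) (i e) (replicate (n e) ()))"
  proof (rule fp_foldl[where B = B])
    fix e ys zs assume "replicate (n e) () = ys @ zs"
    then have "ys = replicate (length ys) ()" "length ys <= n e"
      by (metis UNIV_I UNIV_unit replicate_length_same singletonD)
        (metis \<open>replicate (n e) () = ys @ zs\<close> le_add1 length_append length_replicate)
    then show "csize (foldl (\<lambda>a _. g e a) (i e) ys) <= B e"
      by (metis assms(5) foldl_replicate)
  qed (intro fp_units fp_intros assms fp_comp2[OF assms(3)])+
  then show ?thesis by (simp add: foldl_replicate)
qed

lemma fp_length [fp_intros]: "fp xs ==> fp (\<lambda>e. length (xs e))"
proof (rule fp_comp[of length])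
  have "code (length l) = code l" for l :: "unit list"
    using code_replicate_unit[of "length l"] replicate_length_same[of l "()"] by simp
  then have 1: "fp (\<lambda>l::unit list. length l)" by (rule fp_coerce)
  have "fp (\<lambda>l::'b list. length (map (\<lambda>_. ()) l))" by (intro fp_comp[OF 1] fp_intros)
  then show "fp (length :: 'b list => nat)" by simp
qed

lemma fp_add [fp_intros]: "fp m ==> fp n ==> fp (\<lambda>e. m e + n e :: nat)"
proof -
  assume a: "fp m" "fp n"
  have "fp (\<lambda>e. length (replicate (m e) () @ replicate (n e) ()))" by (intro fp_intros fp_units a)
  then show ?thesis by simp
qed

lemma fp_mult [fp_intros]: "fp m ==> fp n ==> fp (\<lambda>e. m e * n e :: nat)"
proof -
  assume a: "fp m" "fp n"
  have "fp (\<lambda>e. length (concat (map (\<lambda>_. replicate (m e) ()) (replicate (n e) ()))))"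
    by (intro fp_intros fp_units a fp_comp[OF a(1)])
  then show ?thesis by (simp add: length_concat sum_list_replicate mult.commute)
qed

lemma fp_drop [fp_intros]: "fp n ==> fp xs ==> fp (\<lambda>e. drop (n e) (xs e))"
proof (rule fp_comp2[of drop])
  have f: "(tl ^^ k) l = drop k l" for k and l :: "'b list"
    by (induction k arbitrary: l) (auto simp: drop_Suc tl_drop)
  have c: "csize (drop k l) <= csize l" for l :: "'b list" and k
    by (induction l arbitrary: k) (auto simp: drop_Cons' intro: le_SucI trans_le_add2)
  have "fp (\<lambda>p. (tl ^^ fst p) (snd p :: 'b list))"
  proof (rule fp_funpow[where B = csize])
    show "csize ((tl ^^ k) (snd p)) <= csize p" for k and p :: "nat \<times> 'b list"
      using c[of k "snd p"] csize_fst_snd(2)[of p] by (simp add: f)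
  qed (intro fp_intros pbo_intros)+
  then show "fp (\<lambda>p. drop (fst p) (snd p :: 'b list))" by (simp add: f)
qed

lemma fp_diff [fp_intros]: "fp m ==> fp n ==> fp (\<lambda>e. m e - n e :: nat)"
proof -
  assume a: "fp m" "fp n"
  have "fp (\<lambda>e. length (drop (n e) (replicate (m e) ())))" by (intro fp_intros fp_units a)
  then show ?thesis by simp
qed

lemma fp_le [fp_intros]: "fp m ==> fp n ==> fp (\<lambda>e. m e <= (n e :: nat))"
proof -
  assume a: "fp m" "fp n"
  have "fp (\<lambda>e. replicate (m e - n e) () = [])" by (intro fp_intros fp_units a)
  then show ?thesis by (rule fp_cong) auto
qed

lemma fp_less [fp_intros]: "fp m ==> fp n ==> fp (\<lambda>e. m e < (n e :: nat))"
  using fp_le[OF fp_Suc[of m], of n] by (simp add: Suc_le_eq)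

lemma fp_nth_default [fp_intros]:
  fixes xs :: "'e::code => 'x::code list"
  assumes a: "fp d" "fp xs" "fp i"
  shows "fp (\<lambda>e. nth_default (d e) (xs e) (i e))"
proof -
  have "fp (\<lambda>e. case drop (i e) (xs e) of [] => d e | y # ys => y)"
    by (intro fp_intros a)
  moreover have "(case drop k l of [] => c | y # ys => y) = nth_default c l k" for k c and l :: "'x list"
    by (induction l arbitrary: k) (auto simp: drop_Cons split: nat.split)
  ultimately show ?thesis by simp
qed

lemma fp_upt0: "fp n ==> fp (\<lambda>e. [0..<n e])"
proof (rule fp_comp[of "\<lambda>n. [0..<n]"])
  have f: "((\<lambda>a. a @ [length a]) ^^ k) [] = [0..<k]" for k
    by (induction k) auto
  have "fp (\<lambda>n::nat. ((\<lambda>a. a @ [length a]) ^^ n) [])"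
  proof (rule fp_funpow[where B = "\<lambda>n. 1 + n * (2 * n + 1 + 1)"])
    show "pbo (\<lambda>n::nat. 1 + n * (2 * n + 1 + 1))" by (intro pbo_intros pbo_nat fp_id)
    show "csize (((\<lambda>a. a @ [length a]) ^^ k) []) <= 1 + n * (2 * n + 1 + 1)" if "k <= n" for k n :: nat
    proof -
      have "csize [0..<k] <= 1 + length [0..<k] * (2 * n + 1 + 1)"
        by (rule csize_list_le) (use that in auto)
      also have "... <= 1 + n * (2 * n + 1 + 1)" using mult_le_mono1[OF that, of "2 * n + 2"] by simp
      finally show ?thesis by (simp add: f)
    qed
  qed (intro fp_intros)+
  then show "fp (\<lambda>n. [0..<n])" by (simp add: f)
qed

lemma fp_upt [fp_intros]: "fp m ==> fp n ==> fp (\<lambda>e. [m e..<n e])"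
proof -
  assume a: "fp m" "fp n"
  have "fp (\<lambda>e. drop (m e) [0..<n e])" by (intro fp_intros fp_upt0 a)
  then show ?thesis by (simp add: drop_upt)
qed

text \<open>\<open>k\<close> is a constant of the program: unrolling the recursion yields
  \<open>length (xs e) ^ k\<close> lists, a polynomial number for each fixed
  \<open>k\<close>.\<close>

lemma fp_n_lists: "fp xs ==> fp (\<lambda>e. List.n_lists k (xs e))"
proof (induction k)
  case (Suc k)
  have "fp (\<lambda>e. concat (map (\<lambda>ys. map (\<lambda>y. y # ys) (xs e)) (List.n_lists k (xs e))))"
    by (intro fp_intros Suc.IH Suc.prems fp_comp[OF Suc.prems])
  then show ?case by simp
qed (simp add: fp_const)

subsection \<open>Equality\<close>

lemma fp_hd_tree [fp_intros]: "fp t ==> fp (\<lambda>e. hd_tree (t e))"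
  by (rule fp_comp[of hd_tree], rule fpI[OF pbo_csize, where c = CHd])
    (auto simp: csize_def code_tree_def intro: cev.Hd)

lemma fp_tl_tree [fp_intros]: "fp t ==> fp (\<lambda>e. tl_tree (t e))"
  by (rule fp_comp[of tl_tree], rule fpI[OF pbo_csize, where c = CTl])
    (auto simp: csize_def code_tree_def intro: cev.Tl)

lemma fp_is_Lf [fp_intros]: "fp t ==> fp (\<lambda>e. t e = Lf)"
  by (rule fp_cong[OF fp_not[OF fp_comp[OF fp_nonleaf[of "\<lambda>t. t ~= Lf"]]]]) (auto simp: code_tree_def)

lemma fp_code [fp_intros]: "fp f ==> fp (\<lambda>e. code (f e))"
  by (rule fp_comp[OF fp_coerce[of code]]) (simp add: code_tree_def)

definition eq_step :: "bool \<times> (tree \<times> tree) list => bool \<times> (tree \<times> tree) list" where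
  "eq_step s = (case snd s of [] => s | p # r =>
     if fst p = Lf then (if snd p = Lf then (fst s, r) else (False, []))
     else if snd p = Lf then (False, [])
     else (fst s, (hd_tree (fst p), hd_tree (snd p)) # (tl_tree (fst p), tl_tree (snd p)) # r))"

lemma csize_tree: "csize (t::tree) = sz t"
  by (simp add: csize_def code_tree_def)

text \<open>In the node case the two nodes that disappear pay exactly for the additional pair and
  list cell.\<close>

lemma eq_step_csize: "csize (eq_step s) <= csize s"
proof (cases "snd s")
  case (Cons p r)
  obtain f a b where s: "s = (f, (a, b) # r)" using Cons by (cases s; cases p) auto
  have f: "csize False = 1" "Suc 0 <= csize f" by (auto simp: csize_def code_bool_def)
  show ?thesis using f unfolding s
    by (cases a; cases b) (auto simp: eq_step_def csize_tree)
qed (simp add: eq_step_def)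

lemma eq_step_steps:
  "\<exists>k \<le> (\<Sum>p\<leftarrow>ws. sz (fst p)). snd ((eq_step ^^ k) (True, ws)) = [] \<and>
     fst ((eq_step ^^ k) (True, ws)) = (\<forall>p\<in>set ws. fst p = snd p)"
proof (induction "\<Sum>p\<leftarrow>ws. sz (fst p)" arbitrary: ws rule: less_induct)
  case less
  show ?case
  proof (cases ws)
    case Nil
    then show ?thesis by (intro exI[of _ 0]) auto
  next
    case (Cons p r)
    have "1 <= sz (fst p)" by (simp add: Suc_leI)
    then have pos: "1 <= (\<Sum>p\<leftarrow>ws. sz (fst p))" using Cons by simp
    consider (bad) "(fst p = Lf) ~= (snd p = Lf)" | (leaf) "fst p = Lf" "snd p = Lf"
      | (node) "fst p ~= Lf" "snd p ~= Lf" by blast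
    then show ?thesis
    proof cases
      case bad
      then have "eq_step (True, ws) = (False, [])" "fst p ~= snd p" using Cons by (auto simp: eq_step_def)
      then show ?thesis using pos Cons by (intro exI[of _ 1]) auto
    next
      case leaf
      have e: "eq_step (True, ws) = (True, r)" using leaf Cons by (auto simp: eq_step_def)
      obtain k where "k <= (\<Sum>p\<leftarrow>r. sz (fst p))" "snd ((eq_step ^^ k) (True, r)) = []"
        "fst ((eq_step ^^ k) (True, r)) = (\<forall>p\<in>set r. fst p = snd p)"
        using less[of r] Cons leaf by auto
      then show ?thesis using Cons leaf e
        by (intro exI[of _ "Suc k"]) (auto simp: funpow_Suc_right simp del: funpow.simps)
    next
      case node
      obtain l1 r1 l2 r2 where p: "p = (Nd l1 r1, Nd l2 r2)"
        using node by (cases p; cases "fst p"; cases "snd p") auto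
      let ?ws = "(l1, l2) # (r1, r2) # r"
      have e: "eq_step (True, ws) = (True, ?ws)" using p Cons by (auto simp: eq_step_def)
      obtain k where "k <= (\<Sum>p\<leftarrow>?ws. sz (fst p))" "snd ((eq_step ^^ k) (True, ?ws)) = []"
        "fst ((eq_step ^^ k) (True, ?ws)) = (\<forall>p\<in>set ?ws. fst p = snd p)"
        using less[of ?ws] Cons p by auto
      then show ?thesis using Cons p e
        by (intro exI[of _ "Suc k"]) (auto simp: funpow_Suc_right simp del: funpow.simps)
    qed
  qed
qed

lemma fp_eq [fp_intros]: "fp f ==> fp g ==> fp (\<lambda>e. f e = g e)"
proof -
  assume fg: "fp f" "fp g"
  have st: "fp eq_step" unfolding eq_step_def by (intro fp_intros)
  let ?s = "\<lambda>p::tree \<times> tree. (True, [p])"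
  \<comment> \<open>The number of rounds depends on where the trees first differ. It is taken as the
    first time at which the work list is empty, and the size of the first tree bounds it.\<close>
  define N where "N p = (LEAST k. snd ((eq_step ^^ k) (?s p)) = [])" for p
  have N: "snd ((eq_step ^^ N p) (?s p)) = []" "N p <= csize p"
    "fst ((eq_step ^^ N p) (?s p)) = (fst p = snd p)" "!!i. i < N p ==> snd ((eq_step ^^ i) (?s p)) ~= []" for p
  proof -
    obtain k where k: "k <= sz (fst p)" "snd ((eq_step ^^ k) (?s p)) = []"
      "fst ((eq_step ^^ k) (?s p)) = (fst p = snd p)"
      using eq_step_steps[of "[p]"] by auto
    show 1: "snd ((eq_step ^^ N p) (?s p)) = []" unfolding N_def by (rule LeastI[of _ k]) (rule k)
    have le: "N p <= k" unfolding N_def by (rule Least_le) (rule k)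
    then show "N p <= csize p" using k(1) csize_fst_snd(1)[of p] by (simp add: csize_tree)
    have id: "(eq_step ^^ j) x = x" if "snd x = []" for j x
      using that by (induction j) (auto simp: eq_step_def)
    have "(eq_step ^^ k) (?s p) = (eq_step ^^ (k - N p)) ((eq_step ^^ N p) (?s p))"
      using le by (metis comp_apply funpow_add le_add_diff_inverse2)
    then show "fst ((eq_step ^^ N p) (?s p)) = (fst p = snd p)" using k(3) id[OF 1] by simp
    show "!!i. i < N p ==> snd ((eq_step ^^ i) (?s p)) ~= []" unfolding N_def using not_less_Least by blast
  qed
  have sz: "csize ((eq_step ^^ k) x) <= csize x" for k x
    by (induction k) (auto intro: order_trans[OF eq_step_csize])
  have "fp (\<lambda>p. (eq_step ^^ N p) (?s p))"
  proof (rule fp_iterate[where P = "\<lambda>s. snd s ~= []" and S = "\<lambda>p. csize (?s p)"])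
    show "pbo N" by (rule pbo_le[OF pbo_csize N(2)])
    show "pbo (\<lambda>p. csize (?s p))" by (intro pbo_intros fp_intros)
    show "fp (\<lambda>s::bool \<times> (tree \<times> tree) list. snd s ~= [])" "fp ?s" by (intro fp_intros)+
    show "csize ((eq_step ^^ i) (?s p)) <= csize (?s p)" for p i by (rule sz)
    show "\<not> snd ((eq_step ^^ N p) (?s p)) ~= []" for p using N(1) by simp
  qed (use N(4) st in auto)
  from fp_fst[OF this] have "fp (\<lambda>p::tree \<times> tree. fst p = snd p)" by (simp add: N)
  from fp_comp[OF this fp_Pair[OF fp_code[OF fg(1)] fp_code[OF fg(2)]]] show ?thesis by simp
qed

lemma fp_mem [fp_intros]: "fp x ==> fp xs ==> fp (\<lambda>e. x e \<in> set (xs e))"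
proof -
  assume a: "fp x" "fp xs"
  have "fp (\<lambda>e. \<exists>y\<in>set (xs e). y = x e)" by (intro fp_intros a fp_comp[OF a(1)])
  then show ?thesis by (rule fp_cong) auto
qed

subsection \<open>From polynomial-time functions to Turing machines\<close>

lemma csize_bools: "csize (x :: bool list) <= 1 + 4 * length x"
  by (induction x) (auto simp: csize_def code_bool_def)

lemma halted_step: "halted M c ==> (step M ^^ t) c = c"
  by (induction t) (auto simp: step_def)

lemma run_stable:
  assumes "halted M (run M xs t)" "t <= u"
  shows "run M xs u = run M xs t"
proof -
  have "run M xs u = (step M ^^ (u - t)) (run M xs t)"
    unfolding run_def using assms(2) by (metis comp_apply funpow_add le_add_diff_inverse2)
  then show ?thesis using halted_step[OF assms(1)] by simp
qed

lemma run_accept_unique: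
  assumes "wf_tm M" "fst (run M xs t) = (if b then accept M else reject M)"
  shows "(\<exists>u. fst (run M xs u) = accept M) \<longleftrightarrow> b"
proof
  assume "\<exists>u. fst (run M xs u) = accept M"
  then obtain u where u: "fst (run M xs u) = accept M" by blast
  have h: "halted M (run M xs t)" "halted M (run M xs u)" using assms(2) u by (auto simp: halted_def)
  have "run M xs t = run M xs u"
    using run_stable[OF h(1), of u] run_stable[OF h(2), of t] by (cases "t <= u") auto
  then show b using assms u by (auto simp: wf_tm_def split: if_splits)
qed (use assms in auto)

lemma fp_poly_time:
  fixes f :: "bool list => bool list"
  assumes "fp f"
  shows "poly_time_computable f"
proof -
  have "fp (\<lambda>p :: bool list \<times> bool list. f (fst p))" by (intro fp_comp[OF assms] fp_intros)
  then obtain c p where c: "!!x :: bool list \<times> bool list. \<exists>t\<le>poly p (csize x). cev c (code x) t (code (f (fst x)))"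
    using fpE by metis
  obtain s where s: "!!x. csize (f x) <= poly s (csize x)" using fp_size[OF assms] by metis
  obtain M where M: "wf_tm M" "ntapes M = 6"
    "!!(x :: bool list) (w :: bool list) t y. cev c (code (x, w)) t (code (y :: bool list)) ==>
      \<exists>T \<le> 60 * t + 20 * (length x + length w + length y) + 30.
        halted M (run M [x, w] T) \<and> has_output (run M [x, w] T) y"
    using comb_computes[of c] by metis
  let ?q = "smult 60 (p \<circ>\<^sub>p [:3, 4:]) + smult 20 ([:0, 1:] + (s \<circ>\<^sub>p [:1, 4:])) + [:30:]"
  have "\<exists>t\<le>poly ?q (length x). halted M (run M [x] t) \<and> has_output (run M [x] t) (f x)" for x
  proof -
    obtain t where t: "t <= poly p (csize (x, [] :: bool list))" "cev c (code (x, [] :: bool list)) t (code (f x))"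
      using c[of "(x, [])"] by auto
    have "csize (x, [] :: bool list) <= 3 + 4 * length x" using csize_bools[of x] by simp
    then have t1: "t <= poly p (3 + 4 * length x)" using t(1) poly_mono_nat le_trans by blast
    have l: "length (f x) <= poly s (1 + 4 * length x)"
      using length_le_csize[of "f x"] s[of x] poly_mono_nat[OF csize_bools[of x], of s] by linarith
    obtain T where T: "T <= 60 * t + 20 * (length x + length ([] :: bool list) + length (f x)) + 30"
      "halted M (run M [x, []] T)" "has_output (run M [x, []] T) (f x)" using M(3)[OF t(2)] by blast
    have "T <= poly ?q (length x)" using T(1) t1 l by (simp add: poly_pcompose mult.commute)
    then show ?thesis using T run_single[of M x T] M(2) by auto
  qed
  then show ?thesis unfolding poly_time_computable_def using M(1) by blast
qed

lemma fp_decides: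
  fixes V :: "bool list => bool list => bool"
  assumes "fp (\<lambda>p. V (fst p) (snd p))"
  obtains M and q :: "nat poly" where "wf_tm M" "2 <= ntapes M"
    "!!x w. \<exists>t\<le>poly q (length x + length w). fst (run M [x, w] t) = (if V x w then accept M else reject M)"
proof -
  obtain c p where c: "!!x. \<exists>t\<le>poly p (csize x). cev c (code x) t (code (V (fst x) (snd x)))"
    using fpE[OF assms] by metis
  obtain M where M: "wf_tm M" "ntapes M = 6"
    "!!(x :: bool list) (w :: bool list) t b. cev c (code (x, w)) t (code (b :: bool)) ==>
      \<exists>T \<le> 60 * t + 20 * (length x + length w) + 30. fst (run M [x, w] T) = (if b then accept M else reject M)"
    using comb_decides[of c] by metis
  let ?q = "smult 60 (p \<circ>\<^sub>p [:3, 4:]) + [:30, 20:]"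
  have "\<exists>t\<le>poly ?q (length x + length w). fst (run M [x, w] t) = (if V x w then accept M else reject M)" for x w
  proof -
    obtain t where t: "t <= poly p (csize (x, w))" "cev c (code (x, w)) t (code (V x w))"
      using c[of "(x, w)"] by auto
    have "csize (x, w) <= 3 + 4 * (length x + length w)" using csize_bools[of x] csize_bools[of w] by simp
    then have t1: "t <= poly p (3 + 4 * (length x + length w))" using t(1) poly_mono_nat le_trans by blast
    obtain T where T: "T <= 60 * t + 20 * (length x + length w) + 30"
      "fst (run M [x, w] T) = (if V x w then accept M else reject M)" using M(3)[OF t(2)] by blast
    have "T <= poly ?q (length x + length w)" using T(1) t1 by (simp add: poly_pcompose mult.commute)
    then show ?thesis using T(2) by blast
  qed
  then show ?thesis using that[of M ?q] M by simp
qed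

text \<open>Here the number \<open>N\<close> of rounds and the size bound \<open>S\<close> belong to
  a single run and may exceed every polynomial in the input, while \<open>q\<close> depends on the
  loop alone. In this way a search of subexponential length becomes a machine of comparable running
  time.\<close>

lemma fp_loop_decides:
  fixes init :: "bool list => 's::code" and b :: "'s => 's" and P out :: "'s => bool"
  assumes "fp init" "fp P" "fp b" "fp out"
  obtains M and q :: "nat poly" where "wf_tm M"
    "!!x N S. (!!i. i < N ==> P ((b ^^ i) (init x))) ==> \<not> P ((b ^^ N) (init x)) ==>
       (!!i. i <= N ==> csize ((b ^^ i) (init x)) <= S) ==>
       \<exists>t\<le>poly q (N + S + length x). fst (run M [x] t) = (if out ((b ^^ N) (init x)) then accept M else reject M)"
proof -
  obtain cp pp where p: "!!x. \<exists>t\<le>poly pp (csize x). cev cp (code x) t (code (P x))" using fpE[OF assms(2)] by metis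
  obtain cb pb where b: "!!x. \<exists>t\<le>poly pb (csize x). cev cb (code x) t (code (b x))" using fpE[OF assms(3)] by metis
  obtain co po where o: "!!x. \<exists>t\<le>poly po (csize x). cev co (code x) t (code (out x))" using fpE[OF assms(4)] by metis
  have "fp (\<lambda>p :: bool list \<times> bool list. init (fst p))" by (intro fp_comp[OF assms(1)] fp_intros)
  then obtain ci pi where i: "!!x :: bool list \<times> bool list. \<exists>t\<le>poly pi (csize x). cev ci (code x) t (code (init (fst x)))"
    using fpE by metis
  obtain M where M: "wf_tm M" "ntapes M = 6"
    "!!(x :: bool list) (w :: bool list) t r. cev (CSeq ci (CSeq (CWhile cp cb) co)) (code (x, w)) t (code (r :: bool)) ==>
      \<exists>T \<le> 60 * t + 20 * (length x + length w) + 30. fst (run M [x, w] T) = (if r then accept M else reject M)"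
    using comb_decides[of "CSeq ci (CSeq (CWhile cp cb) co)"] by metis
  let ?q = "smult 60 ((pi \<circ>\<^sub>p [:3, 4:]) + ([:1, 1:] * (pp + pb + [:3, 1:]) + po)) + [:30, 20:]"
  show ?thesis
  proof (rule that[of M ?q])
    fix x N S
    assume a: "!!i. i < N ==> P ((b ^^ i) (init x))" "\<not> P ((b ^^ N) (init x))"
      "!!i. i <= N ==> csize ((b ^^ i) (init x)) <= S"
    let ?n = "N + S + length x"
    let ?r = "(b ^^ N) (init x)"
    obtain ti where ti: "ti <= poly pi (csize (x, [] :: bool list))" "cev ci (code (x, [] :: bool list)) ti (code (init x))"
      using i[of "(x, [])"] by auto
    obtain tw where tw: "tw <= Suc N * (poly pp S + poly pb S + S + 3)"
      "cev (CWhile cp cb) (code (init x)) tw (code ?r)"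
      using cev_while[OF p b a] by blast
    obtain tt where tt: "tt <= poly po (csize ?r)" "cev co (code ?r) tt (code (out ?r))" using o by blast
    have "cev (CSeq ci (CSeq (CWhile cp cb) co)) (code (x, [] :: bool list)) (ti + (tw + tt)) (code (out ?r))"
      by (intro cev.Sq[OF ti(2)] cev.Sq[OF tw(2)] tt(2))
    from M(3)[OF this] obtain T where T: "T <= 60 * (ti + (tw + tt)) + 20 * (length x + length ([]::bool list)) + 30"
      "fst (run M [x, []] T) = (if out ?r then accept M else reject M)" by blast
    have "csize (x, [] :: bool list) <= 3 + 4 * ?n" using csize_bools[of x] by simp
    then have 1: "ti <= poly pi (3 + 4 * ?n)" using ti(1) poly_mono_nat le_trans by blast
    have "poly pp S + poly pb S + S + 3 <= poly pp ?n + poly pb ?n + ?n + 3"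
      by (intro add_mono poly_mono_nat) auto
    then have "Suc N * (poly pp S + poly pb S + S + 3) <= Suc ?n * (poly pp ?n + poly pb ?n + ?n + 3)"
      by (intro mult_le_mono) auto
    then have 2: "tw <= Suc ?n * (poly pp ?n + poly pb ?n + ?n + 3)" using tw(1) by linarith
    have 3: "tt <= poly po ?n" using tt(1) a(3)[of N] poly_mono_nat[of "csize ?r" ?n po] by simp
    have e: "poly ?q ?n = 60 * (poly pi (3 + 4 * ?n) + (Suc ?n * (poly pp ?n + poly pb ?n + ?n + 3) + poly po ?n)) + 20 * ?n + 30"
      by (simp add: poly_pcompose algebra_simps)
    have "T <= poly ?q ?n" unfolding e using T(1) 1 2 3 by (simp del: mult_Suc)
    then show "\<exists>t\<le>poly ?q ?n. fst (run M [x] t) = (if out ?r then accept M else reject M)"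
      using T(2) run_single[of M x T] M(2) by auto
  qed (rule M)
qed

section \<open>A non-separating path of three vertices in a regular graph\<close>

text \<open>Connectedness as the absence of an uncrossed cut. The empty set counts as connected,
  which covers the case that the path exhausts the graph.\<close>

definition cutconn :: "('v => 'v => bool) => 'v set => bool" where
  "cutconn A X \<longleftrightarrow> (\<forall>Y. Y \<subseteq> X --> Y ~= {} --> Y ~= X --> (\<exists>y\<in>Y. \<exists>z\<in>X - Y. A y z))"

lemma cutconn_insert:
  assumes "cutconn A X" "x \<in> X" "A x t" "A t x"
  shows "cutconn A (insert t X)"
  unfolding cutconn_def
proof (intro allI impI)
  fix Y assume Y: "Y \<subseteq> insert t X" "Y ~= {}" "Y ~= insert t X"
  consider "t \<in> X" | "t \<notin> X" "Y \<inter> X = {}" | "t \<notin> X" "Y \<inter> X = X" | "t \<notin> X" "Y \<inter> X ~= {}" "Y \<inter> X ~= X" by blast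
  then show "\<exists>y\<in>Y. \<exists>z\<in>insert t X - Y. A y z"
  proof cases
    case 1
    then have "insert t X = X" by blast
    then show ?thesis using assms(1) Y unfolding cutconn_def by metis
  next
    case 2
    then have "Y = {t}" using Y by blast
    then show ?thesis using assms 2 by blast
  next
    case 3
    then have "Y = X" using Y by blast
    then show ?thesis using assms 3 by blast
  next
    case 4
    then obtain y z where "y \<in> Y \<inter> X" "z \<in> X - Y \<inter> X" "A y z"
      using assms(1) unfolding cutconn_def by (metis inf_le2)
    then show ?thesis by blast
  qed
qed

text \<open>Among all paths \<open>T\<close> of three vertices and all connected sets \<open>X\<close> outside \<open>T\<close> choose a pair
  with \<open>X\<close> as large as possible. If \<open>X\<close> missed a vertex outside \<open>T\<close>, then a vertex \<open>t\<close> of \<open>T\<close>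
  adjacent to \<open>X\<close> could be moved to \<open>X\<close>, unless every vertex outside \<open>insert t X\<close> has at most
  one neighbour there.\<close>

lemma nonseparating_path:
  fixes A :: "'v => 'v => bool"
  assumes fin: "finite V" and sym: "!!x y. A x y ==> A y x" and irr: "!!x. \<not> A x x"
    and inV: "!!x y. A x y ==> x \<in> V" and conn: "cutconn A V"
    and reg: "!!x. x \<in> V ==> card {y. A x y} = r" and r: "2 <= r" and ne: "V ~= {}"
  obtains u c v where "u ~= v" "A u c" "A c v" "cutconn A (V - {u, c, v})"
proof -
  have finN: "finite {y. A x y}" for x
    by (rule finite_subset[OF _ fin]) (use inV sym in blast)
  have two: "\<exists>y z. y ~= z \<and> A x y \<and> A x z" if "x \<in> V" for x
  proof -
    have "\<not> card {y. A x y} <= Suc 0" using reg[OF that] r by simp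
    then show ?thesis using card_le_Suc0_iff_eq[OF finN, of x] by blast
  qed
  define good where "good p \<longleftrightarrow> (case p of (u, c, v, X) => u ~= v \<and> A u c \<and> A c v \<and>
     X \<subseteq> V - {u, c, v} \<and> X ~= {} \<and> cutconn A X)" for p :: "'v \<times> 'v \<times> 'v \<times> 'v set"
  obtain c0 where "c0 \<in> V" using ne by blast
  then obtain u0 v0 where p0: "u0 ~= v0" "A u0 c0" "A c0 v0" using two sym by meson
  show ?thesis
  proof (cases "V \<subseteq> {u0, c0, v0}")
    case True
    then have "V - {u0, c0, v0} = {}" by blast
    then have "cutconn A (V - {u0, c0, v0})" unfolding cutconn_def by blast
    then show ?thesis using that[OF p0] by blast
  next
    case False
    then obtain x0 where x0: "x0 \<in> V" "x0 \<notin> {u0, c0, v0}" by blast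
    have g0: "good (u0, c0, v0, {x0})" using p0 x0 by (auto simp: good_def cutconn_def)
    let ?m = "\<lambda>p :: 'v \<times> 'v \<times> 'v \<times> 'v set. card (snd (snd (snd p)))"
    have "\<forall>p. good p --> ?m p < Suc (card V)"
      using fin by (auto simp: good_def less_Suc_eq_le intro!: card_mono)
    from ex_has_greatest_nat[of good, OF g0 this]
    obtain p where p: "good p" "\<forall>q. good q --> ?m q <= ?m p" by blast
    obtain u c v X where peq: "p = (u, c, v, X)" by (cases p) auto
    have g: "u ~= v" "A u c" "A c v" "X \<subseteq> V - {u, c, v}" "X ~= {}" "cutconn A X"
      using p(1) peq by (auto simp: good_def)
    have mx: "card Y <= card X" if "good (u', c', v', Y)" for u' c' v' Y
      using p(2) that peq by fastforce
    have finX: "finite X" using g(4) fin finite_subset by blast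
    have "X = V - {u, c, v}"
    proof (rule ccontr)
      assume "X ~= V - {u, c, v}"
      then obtain y where y: "y \<in> V" "y \<notin> {u, c, v}" "y \<notin> X" using g(4) by blast
      have noadj: "\<not> A x z" if "x \<in> X" "z \<in> V" "z \<notin> {u, c, v}" "z \<notin> X" for x z
      proof
        assume "A x z"
        then have "good (u, c, v, insert z X)" using g that sym cutconn_insert[of A X x z] by (auto simp: good_def)
        from mx[OF this] show False using that finX by simp
      qed
      have "X ~= V" "X \<subseteq> V" using y g(4) by auto
      then obtain x t where xt: "x \<in> X" "t \<in> V - X" "A x t" using conn g(5) unfolding cutconn_def by meson
      have tT: "t \<in> {u, c, v}" using noadj xt by blast
      have nopath: "\<not> (y1 ~= y3 \<and> A y1 y2 \<and> A y2 y3)"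
        if "y1 \<in> V - insert t X" "y2 \<in> V - insert t X" "y3 \<in> V - insert t X" for y1 y2 y3
      proof
        assume a: "y1 ~= y3 \<and> A y1 y2 \<and> A y2 y3"
        have "good (y1, y2, y3, insert t X)"
          using a that xt g sym cutconn_insert[of A X x t] by (auto simp: good_def)
        from mx[OF this] show False using xt finX by simp
      qed
      let ?N = "{z. A y z} \<inter> (V - insert t X)"
      have yZ: "y \<in> V - insert t X" using y tT by auto
      have "card ?N <= Suc 0"
      proof -
        have "z = z'" if "z \<in> ?N" "z' \<in> ?N" for z z'
          using nopath[of z y z'] that yZ sym by blast
        then show ?thesis using card_le_Suc0_iff_eq[of ?N] finN[of y] by auto
      qed
      moreover have sub: "{z. A y z} \<subseteq> insert t ?N"
      proof
        fix z assume "z \<in> {z. A y z}"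
        then have "A z y" using sym by blast
        then have "z \<notin> X" "z \<in> V" using noadj y inV by blast+
        then show "z \<in> insert t ?N" using \<open>z \<in> {z. A y z}\<close> by blast
      qed
      \<comment> \<open>No neighbour of \<open>y\<close> lies in \<open>X\<close> and at most one
        lies outside \<open>insert t X\<close>. So the degree is at most 2, and to reach it
        \<open>y\<close> must be adjacent to \<open>t\<close>.\<close>
      ultimately have r2: "r = 2" "A y t"
      proof -
        have f: "finite ?N" using finN by auto
        have "r <= card (insert t ?N)" using card_mono[OF _ sub] f reg[OF y(1)] by auto
        also have "... <= Suc (card ?N)" by (simp add: card_insert_le_m1 card_insert_if f)
        finally show "r = 2" using \<open>card ?N <= Suc 0\<close> r by linarith
        show "A y t"
        proof (rule ccontr)
          assume "\<not> A y t"
          then have "{z. A y z} \<subseteq> ?N" using sub by blast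
          then have "r <= card ?N" using card_mono[OF f] reg[OF y(1)] by metis
          then show False using \<open>card ?N <= Suc 0\<close> r by linarith
        qed
      qed
      \<comment> \<open>Now \<open>t\<close> has a neighbour \<open>x\<close> in \<open>X\<close>, a
        neighbour \<open>t'\<close> on the path and the neighbour \<open>y\<close> outside both, too
        many for a 2-regular graph.\<close>
      obtain t' where t': "t' \<in> {u, c, v}" "A t t'" using tT g sym by blast
      have "{x, t', y} \<subseteq> {z. A t z}" using xt t' r2 sym by blast
      moreover have "card {x, t', y} = 3"
        using t' y xt g(4) by (auto simp: card_insert_if)
      ultimately have "3 <= card {z. A t z}" using card_mono[OF finN[of t]] by metis
      then show False using reg[of t] xt r2 by auto
    qed
    then show ?thesis using that[OF g(1-3)] g(6) by simp
  qed
qed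

section \<open>From vertex cover to edge deletion\<close>

text \<open>Vertices of the constructed graph: the apex \<open>(0, [])\<close>, one vertex \<open>(1, [a])\<close> for every vertex
  \<open>a\<close> of \<open>Q\<close>, and for every edge \<open>(a, b)\<close> of \<open>Q\<close> (oriented arbitrarily) private vertices
  \<open>(i, [a, b])\<close> with \<open>3 <= i < h\<close>. The graph \<open>R\<close> lives on \<open>{..<h}\<close>, its path \<open>0 - 1 - 2\<close> being
  the non-separating one; \<open>emb a b\<close> is its copy for the edge \<open>(a, b)\<close>.\<close>

type_synonym 'w gvert = "nat \<times> 'w list"

definition emb :: "'w => 'w => nat => 'w gvert" where
  "emb a b i = (if i = 0 then (1, [a]) else if i = 1 then (0, []) else if i = 2 then (1, [b]) else (i, [a, b]))"

lemma emb_simps [simp]: "emb a b 0 = (1, [a])" "emb a b (Suc 0) = (0, [])" "emb a b 2 = (1, [b])"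
  "3 <= i ==> emb a b i = (i, [a, b])"
  by (auto simp: emb_def)

lemma nat_cases4: obtains "i = 0" | "i = Suc 0" | "i = 2" | "3 <= (i::nat)"
  by linarith

lemma emb_inj: "a ~= b ==> emb a b i = emb a b j \<longleftrightarrow> i = j"
  by (cases i rule: nat_cases4; cases j rule: nat_cases4) auto

lemma emb_eq_priv: "3 <= i ==> (i, [a, b]) = emb a' b' j \<longleftrightarrow> a' = a \<and> b' = b \<and> j = i"
  "3 <= i ==> emb a' b' j = (i, [a, b]) \<longleftrightarrow> a' = a \<and> b' = b \<and> j = i"
  by (cases j rule: nat_cases4; auto)+

lemma emb_eq_apex: "(0, []) = emb a b j \<longleftrightarrow> j = 1" "emb a b j = (0, []) \<longleftrightarrow> j = 1"
  by (cases j rule: nat_cases4; auto)+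

lemma emb_eq_U: "(Suc 0, [w]) = emb a b j \<longleftrightarrow> (j = 0 \<and> w = a \<or> j = 2 \<and> w = b)"
  "emb a b j = (Suc 0, [w]) \<longleftrightarrow> (j = 0 \<and> w = a \<or> j = 2 \<and> w = b)"
  by (cases j rule: nat_cases4; auto)+

definition gverts :: "nat => 'w set => ('w \<times> 'w) set => 'w gvert set" where
  "gverts h VQ EQ = {(0, [])} \<union> (\<lambda>a. (1, [a])) ` VQ \<union> {(i, [a, b]) | i a b. (a, b) \<in> EQ \<and> 3 <= i \<and> i < h}"

definition gadj :: "(nat => nat => bool) => ('w \<times> 'w) set => 'w gvert => 'w gvert => bool" where
  "gadj N EQ x y \<longleftrightarrow> (\<exists>a b i j. (a, b) \<in> EQ \<and> N i j \<and> x = emb a b i \<and> y = emb a b j)"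

definition graph_on :: "'v set => ('v => 'v => bool) => 'v ugraph" where
  "graph_on V A = (V, {{x, y} | x y. A x y})"

definition covered :: "('w \<times> 'w) set => nat => bool" where
  "covered EQ k \<longleftrightarrow> (\<exists>S. finite S \<and> card S <= k \<and> (\<forall>(a, b)\<in>EQ. a \<in> S \<or> b \<in> S))"

locale pattern =
  fixes h r :: nat and N :: "nat => nat => bool"
  assumes Nsym: "N i j ==> N j i" and Nirr: "\<not> N i i" and Nh: "N i j ==> i < h"
    and Nreg: "i < h ==> card {j. N i j} = r" and Nconn: "cutconn N {..<h}"
    and r2: "2 <= r" and h3: "3 <= h" and N01: "N 0 1" and N12: "N 1 2"
    and Npriv: "cutconn N {3..<h}"

definition triangle_free :: "('w \<times> 'w) set => bool" where
  "triangle_free EQ \<longleftrightarrow> (let B = (\<lambda>a b. (a, b) \<in> EQ \<or> (b, a) \<in> EQ) in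
     \<not> (\<exists>a b c. B a b \<and> B b c \<and> B a c))"

locale gadget = pattern +
  fixes VQ :: "'w set" and EQ :: "('w \<times> 'w) set"
  assumes finVQ: "finite VQ" and EQV: "(a, b) \<in> EQ ==> a \<in> VQ \<and> b \<in> VQ"
    and EQirr: "(a, a) \<notin> EQ" and EQasym: "(a, b) \<in> EQ ==> (b, a) \<notin> EQ"
    and EQtf: "triangle_free EQ"
begin

abbreviation "A \<equiv> gadj N EQ"
abbreviation "G \<equiv> graph_on (gverts h VQ EQ) A"

lemma finN: "finite {j. N i j}"
  by (rule finite_subset[of _ "{..<h}"]) (use Nh Nsym in blast)+

lemma A_sym: "A x y ==> A y x"
  unfolding gadj_def using Nsym by blast

lemma EQ_neq: "(a, b) \<in> EQ ==> a ~= b"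
  using EQirr by blast

lemma A_irr: "\<not> A x x"
proof
  assume "A x x"
  then obtain a b i j where "(a, b) \<in> EQ" "N i j" "emb a b i = emb a b j" unfolding gadj_def by metis
  then show False using emb_inj[OF EQ_neq] Nirr by metis
qed

lemma A_verts: "A x y ==> x \<in> gverts h VQ EQ"
proof -
  assume "A x y"
  then obtain a b i j where e: "(a, b) \<in> EQ" "N i j" "x = emb a b i" unfolding gadj_def by metis
  then show ?thesis using EQV[OF e(1)] Nh[OF e(2)]
    by (cases i rule: nat_cases4) (auto simp: gverts_def)
qed

lemma A_priv: "3 <= i ==> A (i, [a, b]) y \<longleftrightarrow> (a, b) \<in> EQ \<and> (\<exists>j. N i j \<and> y = emb a b j)"
  unfolding gadj_def by (auto simp: emb_eq_priv)

text \<open>The copy of \<open>R\<close> for an edge of \<open>Q\<close> is induced: copies for two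
  different edges share at most the apex and one vertex of \<open>Q\<close>, and these are adjacent
  in every copy by \<open>N01\<close> and \<open>N12\<close>.\<close>

lemma A_emb: "(a, b) \<in> EQ ==> A (emb a b i) (emb a b j) \<longleftrightarrow> N i j"
proof
  assume e: "(a, b) \<in> EQ" and "A (emb a b i) (emb a b j)"
  then obtain a' b' i' j' where *: "(a', b') \<in> EQ" "N i' j'" "emb a b i = emb a' b' i'" "emb a b j = emb a' b' j'"
    unfolding gadj_def by blast
  have ne: "a ~= b" "a' ~= b'" using EQ_neq e *(1) by blast+
  show "N i j"
  proof (cases "(a', b') = (a, b)")
    case True
    then show ?thesis using * emb_inj[OF ne(1)] by auto
  next
    case False
    have "(a', b') ~= (b, a)" using * e EQasym by blast
    then have "i' = 1 \<and> i = 1 \<or> j' = 1 \<and> j = 1 \<or> i' = j' "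
      using *(3,4) ne False N01
      by (cases i rule: nat_cases4; cases j rule: nat_cases4) (auto simp: emb_eq_priv emb_eq_apex emb_eq_U)
    moreover have "i' ~= j'" using * Nirr by metis
    ultimately have "(i = 1 \<and> (j = 0 \<or> j = 2)) \<or> (j = 1 \<and> (i = 0 \<or> i = 2))"
      using *(2-4) ne False Nirr
      by (cases i rule: nat_cases4; cases j rule: nat_cases4) (auto simp: emb_eq_priv emb_eq_apex emb_eq_U)
    then show ?thesis using N01 N12 Nsym by auto
  qed
qed (auto simp: gadj_def)

lemma A_UU: "A (Suc 0, [a]) (Suc 0, [b]) \<longleftrightarrow> N 0 2 \<and> ((a, b) \<in> EQ \<or> (b, a) \<in> EQ)"
proof
  assume "N 0 2 \<and> ((a, b) \<in> EQ \<or> (b, a) \<in> EQ)"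
  then consider "N 0 2" "(a, b) \<in> EQ" | "N 2 0" "(b, a) \<in> EQ" using Nsym by blast
  then show "A (Suc 0, [a]) (Suc 0, [b])"
  proof cases
    case 1
    then show ?thesis unfolding gadj_def by (intro exI[of _ a] exI[of _ b] exI[of _ 0] exI[of _ 2]) simp
  next
    case 2
    then show ?thesis unfolding gadj_def by (intro exI[of _ b] exI[of _ a] exI[of _ 2] exI[of _ 0]) simp
  qed
qed (use Nsym Nirr in \<open>auto simp: emb_eq_U gadj_def\<close>)

lemma A_UP: "3 <= i ==> A (Suc 0, [w]) (i, [a, b]) \<longleftrightarrow> (a, b) \<in> EQ \<and> (w = a \<and> N 0 i \<or> w = b \<and> N 2 i)"
  unfolding gadj_def by (auto simp: emb_eq_U emb_eq_priv)

lemma gvert_cases: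
  assumes "x \<in> gverts h VQ EQ"
  obtains "x = (0, [])" | w where "w \<in> VQ" "x = (Suc 0, [w])"
    | i a b where "(a, b) \<in> EQ" "3 <= i" "i < h" "x = (i, [a, b])"
  using assms unfolding gverts_def by auto

lemma edgeG: "{x, y} \<in> edges G \<longleftrightarrow> A x y"
  unfolding graph_on_def snd_conv mem_Collect_eq by (metis A_sym doubleton_eq_iff)

lemma finEQ: "finite EQ"
  by (rule finite_subset[of _ "VQ \<times> VQ"]) (use EQV finVQ in auto)

lemma finG: "finite (gverts h VQ EQ)"
proof -
  have "{(i, [a, b]) | i a b. (a, b) \<in> EQ \<and> 3 <= i \<and> i < h} \<subseteq> (\<lambda>((a, b), i). (i, [a, b])) ` (EQ \<times> {..<h})"
    by force
  then have "finite {(i, [a, b]) | i a b. (a, b) \<in> EQ \<and> 3 <= i \<and> i < h}"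
    by (rule finite_subset) (use finEQ in auto)
  then show ?thesis unfolding gverts_def using finVQ by auto
qed

lemma simple_G: "simple_graph G"
proof -
  have "e \<subseteq> gverts h VQ EQ \<and> card e = 2" if "e \<in> edges G" for e
  proof -
    obtain x y where xy: "e = {x, y}" "A x y" using \<open>e \<in> edges G\<close> unfolding graph_on_def by auto
    then have "x ~= y" using A_irr by blast
    then show ?thesis using xy A_verts[OF xy(2)] A_verts[OF A_sym[OF xy(2)]] by simp
  qed
  then show ?thesis using finG by (auto simp: simple_graph_def graph_on_def)
qed

text \<open>An edge \<open>{apex, (1, [w])}\<close> is charged to \<open>w\<close>; every other edge belongs to the copies of a
  single edge of \<open>Q\<close> and is charged to the first endpoint of that edge.\<close>

lemma cover_if_deletion:
  assumes "free_edge_deletion (graph_on {..<h} N) (G, k)"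
  shows "covered EQ k"
proof -
  obtain F where F: "F \<subseteq> edges G" "card F <= k" "induced_free (graph_on {..<h} N) (delete_edges G F)"
    using assms unfolding free_edge_deletion_def by auto
  have finF: "finite F"
  proof (rule finite_subset[of _ "Pow (gverts h VQ EQ)"])
    show "F \<subseteq> Pow (gverts h VQ EQ)"
    proof
      fix e assume "e \<in> F"
      then have "e \<subseteq> verts G" using F(1) simple_G unfolding simple_graph_def by blast
      then show "e \<in> Pow (gverts h VQ EQ)" by (simp add: graph_on_def)
    qed
  qed (use finG in auto)
  define pick where "pick e = (if \<exists>w. e = {(0, []), (Suc 0, [w])} then (SOME w. e = {(0, []), (Suc 0, [w])})
     else (SOME a. \<exists>b i j. (a, b) \<in> EQ \<and> N i j \<and> e = {emb a b i, emb a b j}))" for e :: "'w gvert set"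
  have "a \<in> pick ` F \<or> b \<in> pick ` F" if e: "(a, b) \<in> EQ" for a b
  proof -
    note ne = EQ_neq[OF e]
    \<comment> \<open>Otherwise the copy for \<open>(a, b)\<close> would survive, as it is induced
      in \<open>G\<close> by \<open>A_emb\<close>.\<close>
    obtain i j where ij: "N i j" "{emb a b i, emb a b j} \<in> F"
    proof -
      let ?W = "emb a b ` {..<h}"
      have "?W \<subseteq> gverts h VQ EQ"
        using EQV[OF e] e by (auto simp: gverts_def emb_def)
      then have "\<not> graph_iso (induced_sub (delete_edges G F) ?W) (graph_on {..<h} N)"
        using F(3) unfolding induced_free_def by (auto simp: delete_edges_def graph_on_def)
      moreover have "graph_iso (induced_sub (delete_edges G F) ?W) (graph_on {..<h} N)"
        if no: "\<forall>i j. N i j --> {emb a b i, emb a b j} \<notin> F"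
        unfolding graph_iso_def
      proof (intro exI conjI ballI)
        let ?f = "the_inv_into {..<h} (emb a b)"
        have inj: "inj_on (emb a b) {..<h}" using emb_inj[OF ne] by (auto simp: inj_on_def)
        show "bij_betw ?f (verts (induced_sub (delete_edges G F) ?W)) (verts (graph_on {..<h} N))"
          using inj by (simp add: induced_sub_def graph_on_def bij_betw_the_inv_into inj_on_imp_bij_betw)
        fix x y assume "x \<in> verts (induced_sub (delete_edges G F) ?W)" "y \<in> verts (induced_sub (delete_edges G F) ?W)"
        then obtain i j where x: "x = emb a b i" "y = emb a b j" "i < h" "j < h" by (auto simp: induced_sub_def)
        have "{x, y} \<in> edges (induced_sub (delete_edges G F) ?W) \<longleftrightarrow> A x y \<and> {x, y} \<notin> F"
          using x edgeG[of x y] by (auto simp: induced_sub_def delete_edges_def)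
        also have "... \<longleftrightarrow> N i j" using no A_emb[OF e] x by auto
        also have "... \<longleftrightarrow> {?f x, ?f y} \<in> edges (graph_on {..<h} N)"
          using x the_inv_into_f_f[OF inj] Nsym by (auto simp: graph_on_def doubleton_eq_iff)
        finally show "{x, y} \<in> edges (induced_sub (delete_edges G F) ?W) \<longleftrightarrow> {?f x, ?f y} \<in> edges (graph_on {..<h} N)" .
      qed
      ultimately show ?thesis using that by blast
    qed
    let ?e = "{emb a b i, emb a b j}"
    have "pick ?e \<in> {a, b}"
    proof (cases "\<exists>w. ?e = {(0, []), (Suc 0, [w])}")
      case True
      define w where "w = (SOME w. ?e = {(0, []), (Suc 0, [w])})"
      have "?e = {(0, []), (Suc 0, [w])}" using someI_ex[OF True] unfolding w_def .
      then have "w \<in> {a, b}" by (auto simp: doubleton_eq_iff emb_eq_U)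
      then show ?thesis using True unfolding pick_def w_def by simp
    next
      case False
      define a' where "a' = (SOME a'. \<exists>b' i' j'. (a', b') \<in> EQ \<and> N i' j' \<and> ?e = {emb a' b' i', emb a' b' j'})"
      have "\<exists>a' b' i' j'. (a', b') \<in> EQ \<and> N i' j' \<and> ?e = {emb a' b' i', emb a' b' j'}" using e ij by blast
      from someI_ex[OF this] obtain b' i' j' where
        *: "(a', b') \<in> EQ" "N i' j'" "?e = {emb a' b' i', emb a' b' j'}" unfolding a'_def by blast
      have "i ~= 1 \<and> j ~= 1 \<or> 3 <= i \<or> 3 <= j"
        using False ij Nirr[of 1] by (cases i rule: nat_cases4; cases j rule: nat_cases4) (auto simp: insert_commute)
      moreover have ijne: "i ~= j" "i' ~= j'" using ij *(2) Nirr by metis+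
      ultimately have "a' \<in> {a, b}"
        using *(3) ne ijne by (cases i rule: nat_cases4; cases j rule: nat_cases4)
          (auto simp: doubleton_eq_iff emb_eq_priv emb_eq_U emb_eq_apex)
      then show ?thesis using False unfolding pick_def a'_def by simp
    qed
    then show ?thesis using ij(2) by force
  qed
  moreover have "card (pick ` F) <= k" using card_image_le[OF finF] F(2) le_trans by blast
  ultimately show ?thesis unfolding covered_def using finF by blast
qed

text \<open>After the deletion every edge of \<open>Q\<close> has an endpoint that is not adjacent
  to the apex. Let \<open>W\<close> induce \<open>R\<close>. If \<open>W\<close> contains a private
  vertex, degrees and the size \<open>h\<close> make it the copy of one edge, up to at most one
  vertex. Otherwise it lies among the apex and \<open>Q\<close>: if 0 and 2 are not adjacent,
  vertices of \<open>Q\<close> have degree at most 1 there, and if they are, the triangle 0, 1, 2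
  finds no place.\<close>

lemma deletion_if_cover:
  assumes "covered EQ k"
  shows "free_edge_deletion (graph_on {..<h} N) (G, k)"
proof -
  obtain S where S: "finite S" "card S <= k" "!!a b. (a, b) \<in> EQ ==> a \<in> S \<or> b \<in> S"
    using assms unfolding covered_def by blast
  \<comment> \<open>The second conjunct keeps \<open>F\<close> among the edges of \<open>G\<close>,
    since \<open>S\<close> may contain vertices that are isolated in \<open>Q\<close> or outside of
    it.\<close>
  define F where "F = {e. \<exists>a\<in>S. e = {(0, []), (Suc 0, [a])} \<and> A (0, []) (Suc 0, [a])}"
  have F1: "F \<subseteq> edges G" unfolding F_def graph_on_def by auto
  have "F \<subseteq> (\<lambda>a. {(0, []), (Suc 0, [a])}) ` S" unfolding F_def by auto
  then have F2: "card F <= k" using surj_card_le[OF S(1)] S(2) le_trans by blast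
  define B where "B x y \<longleftrightarrow> A x y \<and> {x, y} \<notin> F" for x y
  have B_sym: "B x y ==> B y x" for x y unfolding B_def using A_sym by (simp add: insert_commute)
  have apex: "\<not> (B (0, []) (Suc 0, [a]) \<and> B (0, []) (Suc 0, [b]))" if "(a, b) \<in> EQ" for a b
    using S(3)[OF that] unfolding B_def F_def by blast
  have B_priv: "B (i, [a, b]) y \<longleftrightarrow> A (i, [a, b]) y" if "3 <= i" for i a b y
    unfolding B_def F_def using that by (auto simp: doubleton_eq_iff)
  have "\<not> graph_iso (induced_sub (delete_edges G F) W) (graph_on {..<h} N)" if W: "W \<subseteq> gverts h VQ EQ" for W
  proof
    assume "graph_iso (induced_sub (delete_edges G F) W) (graph_on {..<h} N)"
    then obtain f where f: "bij_betw f W {..<h}"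
      "!!x y. x \<in> W ==> y \<in> W ==>
         {x, y} \<in> edges (induced_sub (delete_edges G F) W) \<longleftrightarrow> {f x, f y} \<in> edges (graph_on {..<h} N)"
      unfolding graph_iso_def by (auto simp: induced_sub_def graph_on_def)
    have iso: "B x y \<longleftrightarrow> N (f x) (f y)" if "x \<in> W" "y \<in> W" for x y
    proof -
      have "{x, y} \<in> edges (induced_sub (delete_edges G F) W) \<longleftrightarrow> B x y"
        using that edgeG[of x y] by (auto simp: induced_sub_def delete_edges_def B_def)
      moreover have "{f x, f y} \<in> edges (graph_on {..<h} N) \<longleftrightarrow> N (f x) (f y)"
        using Nsym by (auto simp: graph_on_def doubleton_eq_iff)
      ultimately show ?thesis using f(2)[OF that] by simp
    qed
    have finW: "finite W" using W finG finite_subset by blast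
    have cardW: "card W = h" using bij_betw_same_card[OF f(1)] by simp
    have deg: "card {y \<in> W. B x y} = r" if x: "x \<in> W" for x
    proof -
      have "bij_betw f {y \<in> W. B x y} {j. N (f x) j}"
      proof (rule bij_betw_subset[OF f(1), of "{y \<in> W. B x y}", THEN bij_betw_cong[THEN iffD1, rotated], rotated])
        show "f ` {y \<in> W. B x y} = {j. N (f x) j}"
        proof
          show "{j. N (f x) j} \<subseteq> f ` {y \<in> W. B x y}"
          proof
            fix j assume "j \<in> {j. N (f x) j}"
            then have j: "N (f x) j" "j < h" using Nh Nsym by blast+
            then have "j \<in> f ` W" using f(1) by (simp add: bij_betw_def)
            then obtain y where "y \<in> W" "f y = j" by blast
            moreover from this have "B x y" using iso[OF x, of y] j by simp
            ultimately show "j \<in> f ` {y \<in> W. B x y}" by blast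
          qed
          show "f ` {y \<in> W. B x y} \<subseteq> {j. N (f x) j}" using iso[OF x] by blast
        qed
      qed auto
      then have "card {y \<in> W. B x y} = card {j. N (f x) j}" by (rule bij_betw_same_card)
      then show ?thesis using Nreg f(1) x by (auto simp: bij_betw_def)
    qed
    \<comment> \<open>A private vertex has only \<open>r\<close> neighbours in \<open>G\<close>, all
      in its own copy, so its degree \<open>r\<close> within \<open>W\<close> forces all of them
      into \<open>W\<close>.\<close>
    have all_nb: "emb a b j \<in> W" if "(i, [a, b]) \<in> W" "3 <= i" "N i j" for a b i j
    proof -
      have e: "(a, b) \<in> EQ" using that W by (auto elim: gvert_cases)
      have "{y \<in> W. B (i, [a, b]) y} \<subseteq> emb a b ` {j. N i j}"
        using B_priv A_priv that by auto
      moreover have "card (emb a b ` {j. N i j}) = r"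
        using card_image[of "emb a b" "{j. N i j}"] emb_inj[OF EQ_neq[OF e]] Nreg[OF Nh[OF that(3)]]
        by (auto simp: inj_on_def)
      ultimately have "{y \<in> W. B (i, [a, b]) y} = emb a b ` {j. N i j}"
        using card_subset_eq[of "emb a b ` {j. N i j}"] finN deg[OF that(1)] by auto
      then show ?thesis using that(3) by blast
    qed
    show False
    proof (cases "\<exists>i a b. (i, [a, b]) \<in> W \<and> 3 <= i")
      case True
      then obtain i0 a b where i0: "(i0, [a, b]) \<in> W" "3 <= i0" by blast
      have e: "(a, b) \<in> EQ" and i0h: "i0 < h" using i0 W by (auto elim: gvert_cases)
      note ne = EQ_neq[OF e]
      let ?I = "{i \<in> {3..<h}. (i, [a, b]) \<in> W}"
      \<comment> \<open>Here the choice of the path pays: the private part is connected, and a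
        neighbour of a vertex of \<open>?I\<close> is again in \<open>W\<close>.\<close>
      have I: "?I = {3..<h}"
      proof (rule ccontr)
        assume "?I ~= {3..<h}"
        moreover have "?I \<subseteq> {3..<h}" "?I ~= {}" using i0 i0h by auto
        ultimately have "\<exists>i\<in>?I. \<exists>j\<in>{3..<h} - ?I. N i j"
          using Npriv[unfolded cutconn_def, rule_format, of ?I] by blast
        then obtain i j where ij: "i \<in> ?I" "j \<in> {3..<h}" "j \<notin> ?I" "N i j" by blast
        then have "(i, [a, b]) \<in> W" "3 <= i" "3 <= j" "(j, [a, b]) \<notin> W" by simp_all
        then show False using all_nb[of i a b j] ij(4) by simp
      qed
      have priv: "(i, [a, b]) \<in> W" if "3 <= i" "i < h" for i
      proof -
        have "i \<in> ?I" unfolding I using that by simp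
        then show ?thesis by blast
      qed
      have toW: "emb a b t \<in> W" if "N t i" "3 <= i" for t i
        using all_nb[OF priv[OF that(2)] that(2), of t] that Nsym Nh by blast
      show False
      proof (cases "N 0 2")
        case False
        have nb0: "{j. N t j} = insert 1 {j. N t j \<and> 3 <= j}" if "t = 0 \<or> t = 2" for t
        proof -
          have "j = 1 \<or> 3 <= j" if "N t j" for j
            using that \<open>t = 0 \<or> t = 2\<close> False Nirr Nsym by (cases j rule: nat_cases4) auto
          moreover have "N t 1" using that N01 N12 Nsym by auto
          ultimately show ?thesis by auto
        qed
        have cnt: "card {j. N t j \<and> 3 <= j} = r - 1" if "t = 0 \<or> t = 2" for t
        proof -
          have "finite {j. N t j \<and> 3 <= j}" using finN[of t] by (auto intro: finite_subset)
          then have "card {j. N t j} = Suc (card {j. N t j \<and> 3 <= j})"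
            by (subst nb0[OF that]) (auto simp: card_insert_if)
          then show ?thesis using Nreg[of t] that h3 by auto
        qed
        \<comment> \<open>Of the \<open>r\<close> neighbours of 0 and of 2 only the apex is not
          private, and \<open>r - 1\<close> is positive.\<close>
        have U: "emb a b t \<in> W" if "t = 0 \<or> t = 2" for t
        proof -
          have "{j. N t j \<and> 3 <= j} ~= {}" using cnt[OF that] r2 by (intro notI) simp
          then show ?thesis using toW by blast
        qed
        \<comment> \<open>These are \<open>h - 1\<close> of the \<open>h\<close> vertices of
          \<open>W\<close>. The single vertex left over has to supply the missing neighbour of both
          \<open>a\<close> and \<open>b\<close>.\<close>
        let ?W = "emb a b ` ({..<h} - {1})"
        have sub: "?W \<subseteq> W"
        proof
          fix x assume "x \<in> ?W"
          then obtain t where t: "x = emb a b t" "t < h" "t ~= 1" by auto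
          then show "x \<in> W" using U[of t] priv[of t] by (cases t rule: nat_cases4) auto
        qed
        have cW: "card ?W = h - 1"
        proof -
          have "card ?W = card ({..<h} - {1})" using emb_inj[OF ne] by (intro card_image) (auto simp: inj_on_def)
          then show ?thesis using h3 by simp
        qed
        have "card (W - ?W) = card W - card ?W"
          by (rule card_Diff_subset[OF finite_subset[OF sub finW] sub])
        then have "card (W - ?W) = 1" unfolding cW cardW using h3 by simp
        then obtain z where z: "W - ?W = {z}" by (rule card_1_singletonE)
        have Bz: "B (emb a b t) z" if t: "t = 0 \<or> t = 2" for t
        proof (rule ccontr)
          assume nB: "\<not> B (emb a b t) z"
          have "{y \<in> W. B (emb a b t) y} \<subseteq> emb a b ` {j. N t j \<and> 3 <= j}"
          proof
            fix y assume y: "y \<in> {y \<in> W. B (emb a b t) y}"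
            then have "y ~= z" using nB by blast
            then have "y \<notin> W - ?W" unfolding z by simp
            then have "y \<in> ?W" using y by blast
            then obtain j where j: "y = emb a b j" "j ~= 1" by blast
            then have "N t j" using y A_emb[OF e] by (auto simp: B_def)
            then show "y \<in> emb a b ` {j. N t j \<and> 3 <= j}" using j nb0[OF t] by blast
          qed
          moreover have f3: "finite {j. N t j \<and> 3 <= j}" using finN[of t] by (auto intro: finite_subset)
          ultimately have "card {y \<in> W. B (emb a b t) y} <= card {j. N t j \<and> 3 <= j}"
            using surj_card_le by blast
          then show False using deg[OF U[OF t]] cnt[OF t] r2 by simp
        qed
        have Bab: "B (Suc 0, [a]) z" "B (Suc 0, [b]) z" using Bz[of 0] Bz[of 2] by auto
        have zW: "z \<in> W" "z \<notin> ?W" using z by auto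
        \<comment> \<open>Two vertices of \<open>Q\<close> are never adjacent in this case, and a
          private vertex adjacent to both \<open>a\<close> and \<open>b\<close> belongs to the edge
          \<open>(a, b)\<close>, so it is already in \<open>?W\<close>.\<close>
        have "z = (0, [])"
        proof -
          have "z \<in> gverts h VQ EQ" using zW W by blast
          then show ?thesis
          proof (cases rule: gvert_cases)
            case (2 w)
            then show ?thesis using Bab A_UU False by (auto simp: B_def)
          next
            case (3 i a' b')
            then have "(w = a' \<or> w = b')" if "w = a \<or> w = b" for w
              using Bab that A_UP by (auto simp: B_def)
            then have "a' = a \<and> b' = b" using ne 3 e EQasym by metis
            then have "z \<in> ?W" using 3 by (intro image_eqI[of _ _ i]) auto
            then show ?thesis using zW by blast
          qed
        qed
        then show False using apex[OF e] Bab B_sym by blast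
      next
        case N02: True
        \<comment> \<open>Without a private neighbour \<open>t\<close> has degree 2, so
          \<open>r\<close> is 2 and the triangle 0, 1, 2 leaves its vertices no further neighbour.
          Then \<open>R\<close> would be disconnected, as it has the vertex \<open>i0\<close>
          outside the triangle.\<close>
        have nb: "\<exists>i\<ge>3. N t i" if "t < 3" for t
        proof (rule ccontr)
          assume no: "\<not> (\<exists>i\<ge>3. N t i)"
          have "{j. N t j} \<subseteq> {0, 1, 2} - {t}"
          proof
            fix j assume "j \<in> {j. N t j}"
            then have "N t j" "\<not> 3 <= j" using no by auto
            moreover from this have "j = 0 \<or> j = 1 \<or> j = 2" by linarith
            ultimately show "j \<in> {0, 1, 2} - {t}" using Nirr by auto
          qed
          then have "card {j. N t j} <= card ({0, 1, 2} - {t})" by (intro card_mono) auto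
          also have "... <= 2" using that by (auto simp: card_insert_if less_Suc_eq numeral_3_eq_3 insert_Diff_if)
          finally have "r = 2" using Nreg[of t] that h3 r2 by simp
          have "\<not> N s i" if "s < 3" "3 <= i" for s i
          proof
            assume "N s i"
            have "s' < 3 ==> s' ~= s ==> N s s'" for s'
              using \<open>s < 3\<close> N01 N12 N02 Nsym by (auto simp: less_Suc_eq numeral_3_eq_3 numeral_2_eq_2)
            then have "insert i ({0, 1, 2} - {s}) \<subseteq> {j. N s j}" using \<open>N s i\<close> by auto
            then have "card (insert i ({0, 1, 2} - {s})) <= card {j. N s j}" by (rule card_mono[OF finN])
            moreover have "card {j. N s j} = r" using Nreg[of s] that h3 by simp
            moreover have "s = 0 \<or> s = 1 \<or> s = 2" using \<open>s < 3\<close> by linarith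
            then have "card (insert i ({0, 1, 2} - {s})) = 3"
              using \<open>3 <= i\<close> by (auto simp: card_insert_if insert_Diff_if)
            ultimately show False using \<open>r = 2\<close> by simp
          qed
          moreover have "\<exists>s\<in>{..<3}. \<exists>i\<in>{..<h} - {..<3}. N s i"
          proof -
            have "({..<3} :: nat set) ~= {..<h}" using i0h i0(2) by auto
            moreover have "{..<3} \<subseteq> {..<h}" "({..<3} :: nat set) ~= {}" using h3 by (auto simp: lessThan_empty_iff)
            ultimately show ?thesis using Nconn unfolding cutconn_def by meson
          qed
          ultimately show False by auto
        qed
        have sub: "emb a b ` {..<h} \<subseteq> W"
        proof
          fix x assume "x \<in> emb a b ` {..<h}"
          then obtain t where t: "x = emb a b t" "t < h" by auto
          then show "x \<in> W" using priv[of t] nb[of t] toW[of t] by (cases "t < 3") auto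
        qed
        have inj: "inj_on (emb a b) {..<h}" using emb_inj[OF ne] by (auto simp: inj_on_def)
        have WW: "W = emb a b ` {..<h}"
          using card_subset_eq[OF finW sub] card_image[OF inj] cardW by simp
        \<comment> \<open>\<open>W\<close> is the complete copy, whose degrees leave no room for a
          deleted edge; yet the cover has removed an apex edge at \<open>a\<close> or at
          \<open>b\<close>.\<close>
        have BC: "B (emb a b t) (0, [])" if t: "t = 0 \<or> t = 2" for t
        proof -
          have th: "t < h" using t h3 by auto
          have "{y \<in> W. B (emb a b t) y} \<subseteq> emb a b ` {j. N t j}"
            using A_emb[OF e] unfolding WW B_def by auto
          moreover have "card (emb a b ` {j. N t j}) = r"
            using card_image[of "emb a b" "{j. N t j}"] emb_inj[OF ne] Nreg[OF th] by (auto simp: inj_on_def)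
          moreover have "emb a b t \<in> W" using th WW by auto
          ultimately have "{y \<in> W. B (emb a b t) y} = emb a b ` {j. N t j}"
            using card_subset_eq[of "emb a b ` {j. N t j}"] finN deg by auto
          moreover have "(0, []) \<in> emb a b ` {j. N t j}"
            using t N01 N12 Nsym by (intro image_eqI[of _ _ 1]) auto
          ultimately show ?thesis by blast
        qed
        show False using apex[OF e] BC[of 0] BC[of 2] B_sym by auto
      qed
    next
      case False
      then have base: "x = (0, []) \<or> (\<exists>w. x = (Suc 0, [w]))" if "x \<in> W" for x
        using W that by (auto elim!: gvert_cases dest!: subsetD)
      show False
      proof (cases "N 0 2")
        case noN: False
        have "W \<subseteq> {(0, [])}"
        proof
          fix x assume x: "x \<in> W"
          have False if "x = (Suc 0, [w])" for w
          proof -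
            have "{y \<in> W. B x y} \<subseteq> {(0, [])}" using base A_UU noN that by (auto simp: B_def)
            from card_mono[OF _ this] have "card {y \<in> W. B x y} <= 1" by simp
            then show False using deg[OF x] r2 by linarith
          qed
          then show "x \<in> {(0, [])}" using base[OF x] by blast
        qed
        then have "card W <= 1" using card_mono[of "{(0, [])}" W] by simp
        then show False using cardW h3 by simp
      next
        case N02: True
        have ex: "\<exists>x\<in>W. f x = t" if "t < 3" for t
        proof -
          have "t \<in> f ` W" using f(1) that h3 by (simp add: bij_betw_def)
          then show ?thesis by blast
        qed
        obtain x where x: "x \<in> W" "f x = 0" using ex[of 0] by auto
        obtain y where y: "y \<in> W" "f y = 1" using ex[of 1] by auto
        obtain z where z: "z \<in> W" "f z = 2" using ex[of 2] by auto
        have tri: "B x y" "B y z" "B x z"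
          using iso[OF x(1) y(1)] iso[OF y(1) z(1)] iso[OF x(1) z(1)] x y z N01 N12 N02 by simp_all
        \<comment> \<open>A triangle through the apex would use both apex edges of an edge of
          \<open>Q\<close>, one of which is deleted. A triangle avoiding the apex is one of
          \<open>Q\<close>.\<close>
        have two: False if "B (0, []) (Suc 0, [p])" "B (0, []) (Suc 0, [q])" "B (Suc 0, [p]) (Suc 0, [q])" for p q
        proof -
          have "(p, q) \<in> EQ \<or> (q, p) \<in> EQ" using that(3) A_UU unfolding B_def by blast
          then show False using apex[of p q] apex[of q p] that(1,2) by blast
        qed
        have irr: "\<not> B s s" for s using A_irr by (simp add: B_def)
        consider "x = (0, [])" | "y = (0, [])" | "z = (0, [])"
          | p q s where "x = (Suc 0, [p])" "y = (Suc 0, [q])" "z = (Suc 0, [s])"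
          using base[OF x(1)] base[OF y(1)] base[OF z(1)] by blast
        then show False
        proof cases
          case 1
          then obtain p q where "y = (Suc 0, [p])" "z = (Suc 0, [q])"
            using base[OF y(1)] base[OF z(1)] tri irr by metis
          then show ?thesis using two[of p q] tri 1 by simp
        next
          case 2
          then obtain p q where "x = (Suc 0, [p])" "z = (Suc 0, [q])"
            using base[OF x(1)] base[OF z(1)] tri irr by metis
          then show ?thesis using two[of p q] tri B_sym[of x y] 2 by simp
        next
          case 3
          then obtain p q where "x = (Suc 0, [p])" "y = (Suc 0, [q])"
            using base[OF x(1)] base[OF y(1)] tri irr by metis
          then show ?thesis using two[of p q] tri B_sym[of x z] B_sym[of y z] 3 by simp
        next
          case 4
          then have "(p, q) \<in> EQ \<or> (q, p) \<in> EQ" "(q, s) \<in> EQ \<or> (s, q) \<in> EQ" "(p, s) \<in> EQ \<or> (s, p) \<in> EQ"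
            using tri A_UU unfolding B_def by simp_all
          then show ?thesis using EQtf unfolding triangle_free_def Let_def by blast
        qed
      qed
    qed
  qed
  then have "induced_free (graph_on {..<h} N) (delete_edges G F)"
    unfolding induced_free_def by (auto simp: delete_edges_def graph_on_def)
  then show ?thesis using F1 F2 unfolding free_edge_deletion_def by auto
qed

theorem deletion_iff_cover: "free_edge_deletion (graph_on {..<h} N) (G, k) \<longleftrightarrow> covered EQ k"
  using deletion_if_cover cover_if_deletion by blast

end

section \<open>Invariance under isomorphism\<close>

lemma graph_iso_trans: "graph_iso G H ==> graph_iso H K ==> graph_iso G K"
  unfolding graph_iso_def
proof (elim exE conjE)
  fix f g assume f: "bij_betw f (verts G) (verts H)" "\<forall>u\<in>verts G. \<forall>v\<in>verts G. ({u, v} \<in> edges G) = ({f u, f v} \<in> edges H)"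
    and g: "bij_betw g (verts H) (verts K)" "\<forall>u\<in>verts H. \<forall>v\<in>verts H. ({u, v} \<in> edges H) = ({g u, g v} \<in> edges K)"
  have m: "f u \<in> verts H" if "u \<in> verts G" for u using f(1) that by (auto simp: bij_betw_def)
  show "\<exists>f. bij_betw f (verts G) (verts K) \<and> (\<forall>u\<in>verts G. \<forall>v\<in>verts G. ({u, v} \<in> edges G) = ({f u, f v} \<in> edges K))"
    using bij_betw_trans[OF f(1) g(1)] f(2) g(2) m by (intro exI[of _ "g \<circ> f"]) auto
qed

lemma graph_iso_sym: "graph_iso G H ==> graph_iso H G"
  unfolding graph_iso_def
proof (elim exE conjE)
  fix f assume f: "bij_betw f (verts G) (verts H)" "\<forall>u\<in>verts G. \<forall>v\<in>verts G. ({u, v} \<in> edges G) = ({f u, f v} \<in> edges H)"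
  let ?g = "the_inv_into (verts G) f"
  have g: "bij_betw ?g (verts H) (verts G)" by (rule bij_betw_the_inv_into[OF f(1)])
  have m: "?g u \<in> verts G" "f (?g u) = u" if "u \<in> verts H" for u
    using g that f_the_inv_into_f_bij_betw[OF f(1)] by (auto simp: bij_betw_def)
  show "\<exists>f. bij_betw f (verts H) (verts G) \<and> (\<forall>u\<in>verts H. \<forall>v\<in>verts H. ({u, v} \<in> edges H) = ({f u, f v} \<in> edges G))"
    using g f(2) m by (intro exI[of _ ?g]) auto
qed

lemma free_edge_deletion_pattern:
  assumes "graph_iso H R"
  shows "free_edge_deletion R = free_edge_deletion H"
proof -
  have "graph_iso X R \<longleftrightarrow> graph_iso X H" for X :: "'c ugraph"
    using graph_iso_trans graph_iso_sym assms by metis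
  then show ?thesis by (simp add: free_edge_deletion_def induced_free_def fun_eq_iff)
qed

lemma free_edge_deletion_iso:
  assumes "graph_iso G G'" "simple_graph G" "simple_graph G'" "free_edge_deletion H (G, k)"
  shows "free_edge_deletion H (G', k)"
proof -
  obtain f where f: "bij_betw f (verts G) (verts G')"
    "!!u v. u \<in> verts G ==> v \<in> verts G ==> ({u, v} \<in> edges G) = ({f u, f v} \<in> edges G')"
    using assms(1) unfolding graph_iso_def by blast
  obtain F where F: "F \<subseteq> edges G" "card F <= k" "induced_free H (delete_edges G F)"
    using assms(4) unfolding free_edge_deletion_def by auto
  have "finite (Pow (verts G))" "edges G \<subseteq> Pow (verts G)" using assms(2) by (auto simp: simple_graph_def)
  then have finF: "finite F" using F(1) by (meson finite_subset)
  have inj: "inj_on f (verts G)" and im: "f ` verts G = verts G'" using f(1) by (auto simp: bij_betw_def)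
  let ?F = "(`) f ` F"
  have pair: "\<exists>u v. e = {u, v} \<and> u \<in> verts G \<and> v \<in> verts G" if "e \<in> edges G" for e
  proof -
    have "card e = 2" "e \<subseteq> verts G" using that assms(2) by (auto simp: simple_graph_def)
    then show ?thesis by (auto simp: card_2_iff)
  qed
  have "?F \<subseteq> edges G'"
  proof
    fix e' assume "e' \<in> ?F"
    then obtain e where e: "e \<in> F" "e' = f ` e" by blast
    then obtain u v where uv: "e = {u, v}" "u \<in> verts G" "v \<in> verts G" using pair F(1) by blast
    then show "e' \<in> edges G'" using f(2)[OF uv(2,3)] e F(1) by auto
  qed
  moreover have "card ?F <= k" using card_image_le[OF finF, of "(`) f"] F(2) by linarith
  moreover have "induced_free H (delete_edges G' ?F)"
    unfolding induced_free_def
  proof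
    assume "\<exists>W\<subseteq>verts (delete_edges G' ?F). graph_iso (induced_sub (delete_edges G' ?F) W) H"
    then obtain W' where W': "W' \<subseteq> verts G'" "graph_iso (induced_sub (delete_edges G' ?F) W') H"
      by (auto simp: delete_edges_def)
    define W where "W = {v \<in> verts G. f v \<in> W'}"
    have W: "W \<subseteq> verts G" by (auto simp: W_def)
    have memF: "f ` e \<in> ?F \<longleftrightarrow> e \<in> F" if "e \<subseteq> verts G" for e
    proof
      assume "f ` e \<in> ?F"
      then obtain e2 where e2: "e2 \<in> F" "f ` e = f ` e2" by blast
      then have "e2 \<subseteq> verts G" using F(1) assms(2) by (auto simp: simple_graph_def)
      then show "e \<in> F" using e2 inj_on_image_eq_iff[OF inj that, of e2] by simp
    qed blast
    have "graph_iso (induced_sub (delete_edges G F) W) (induced_sub (delete_edges G' ?F) W')"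
      unfolding graph_iso_def
    proof (intro exI[of _ f] conjI ballI)
      have "f ` W = W'" using W'(1) im by (auto simp: W_def)
      then show "bij_betw f (verts (induced_sub (delete_edges G F) W)) (verts (induced_sub (delete_edges G' ?F) W'))"
        using inj_on_subset[OF inj W] by (simp add: induced_sub_def bij_betw_def)
      fix u v assume "u \<in> verts (induced_sub (delete_edges G F) W)" "v \<in> verts (induced_sub (delete_edges G F) W)"
      then have uv: "u \<in> W" "v \<in> W" by (auto simp: induced_sub_def)
      then have uv': "u \<in> verts G" "v \<in> verts G" "f u \<in> W'" "f v \<in> W'" by (auto simp: W_def)
      have "{f u, f v} = f ` {u, v}" by simp
      then have "{f u, f v} \<in> ?F \<longleftrightarrow> {u, v} \<in> F" using memF[of "{u, v}"] uv'(1,2) by simp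
      then show "({u, v} \<in> edges (induced_sub (delete_edges G F) W)) = ({f u, f v} \<in> edges (induced_sub (delete_edges G' ?F) W'))"
        using uv uv' f(2)[OF uv'(1,2)] by (simp add: induced_sub_def delete_edges_def)
    qed
    then have "graph_iso (induced_sub (delete_edges G F) W) H" using W'(2) graph_iso_trans by blast
    then show False using F(3) W unfolding induced_free_def by (auto simp: delete_edges_def)
  qed
  ultimately show ?thesis unfolding free_edge_deletion_def by blast
qed

lemma cutconn_pull:
  assumes "bij_betw g I X" "!!i j. i \<in> I ==> j \<in> I ==> A (g i) (g j) ==> N i j" "cutconn A X"
  shows "cutconn N I"
  unfolding cutconn_def
proof (intro allI impI)
  fix Y assume Y: "Y \<subseteq> I" "Y ~= {}" "Y ~= I"
  have inj: "inj_on g I" and im: "g ` I = X" using assms(1) by (auto simp: bij_betw_def)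
  have "g ` Y \<subseteq> X" "g ` Y ~= {}" using Y im by auto
  moreover have "g ` Y ~= X" using Y im inj_on_image_eq_iff[OF inj Y(1) order_refl] by simp
  ultimately obtain y z where yz: "y \<in> g ` Y" "z \<in> X - g ` Y" "A y z" using assms(3) unfolding cutconn_def by meson
  obtain i where i: "i \<in> Y" "y = g i" using yz(1) by blast
  obtain j where j: "j \<in> I" "z = g j" using yz(2) im by blast
  have "j \<in> I - Y" using j yz(2) by blast
  then show "\<exists>y\<in>Y. \<exists>z\<in>I - Y. N y z" using assms(2)[of i j] i j Y(1) yz(3) by blast
qed

lemma rtrancl_crossing:
  assumes "(u, v) \<in> r\<^sup>*" "u \<in> Y" "v \<notin> Y"
  shows "\<exists>a b. (a, b) \<in> r \<and> a \<in> Y \<and> b \<notin> Y"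
  using assms by (induction rule: rtrancl_induct) blast+

lemma pattern_exists:
  assumes "simple_graph R" "connected_graph R" "regular_graph R" "card (edges R) \<ge> 2"
  obtains h r N where "pattern h r N" "graph_iso (graph_on {..<h} N) R"
proof -
  let ?V = "verts R"
  define A where "A x y \<longleftrightarrow> {x, y} \<in> edges R" for x y
  have fin: "finite ?V" using assms(1) by (simp add: simple_graph_def)
  have sym: "A y x" if "A x y" for x y using that by (simp add: A_def insert_commute)
  have e2: "card e = 2" "e \<subseteq> ?V" if "e \<in> edges R" for e using that assms(1) by (auto simp: simple_graph_def)
  have irr: "\<not> A x x" for x using e2[of "{x, x}"] by (auto simp: A_def)
  have inV: "x \<in> ?V" if "A x y" for x y using e2(2)[of "{x, y}"] that by (auto simp: A_def)
  have ne: "?V ~= {}" using assms(2) by (simp add: connected_graph_def)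
  have conn: "cutconn A ?V"
    unfolding cutconn_def
  proof (intro allI impI)
    fix Y assume Y: "Y \<subseteq> ?V" "Y ~= {}" "Y ~= ?V"
    then obtain u v where "u \<in> Y" "v \<in> ?V" "v \<notin> Y" by blast
    then have "\<exists>a b. (a, b) \<in> {(a, b). {a, b} \<in> edges R} \<and> a \<in> Y \<and> b \<notin> Y"
      using assms(2) Y(1) unfolding connected_graph_def by (intro rtrancl_crossing[of u v]) auto
    then obtain a b where "A a b" "a \<in> Y" "b \<notin> Y" by (auto simp: A_def)
    then show "\<exists>y\<in>Y. \<exists>z\<in>?V - Y. A y z" using inV[OF sym] by blast
  qed
  have finA: "finite {y. A x y}" for x
    by (rule finite_subset[OF _ fin]) (use inV sym in blast)
  have deg: "degree_of R x = card {y. A x y}" for x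
  proof -
    have "{e \<in> edges R. x \<in> e} = (\<lambda>y. {x, y}) ` {y. A x y}"
    proof
      show "{e \<in> edges R. x \<in> e} \<subseteq> (\<lambda>y. {x, y}) ` {y. A x y}"
      proof
        fix e assume e: "e \<in> {e \<in> edges R. x \<in> e}"
        then obtain p q where pq: "e = {p, q}" using e2(1)[of e] by (auto simp: card_2_iff)
        then have "e = {x, if x = p then q else p}" using e by auto
        then show "e \<in> (\<lambda>y. {x, y}) ` {y. A x y}" using e unfolding A_def by blast
      qed
    qed (auto simp: A_def)
    moreover have "inj_on (\<lambda>y. {x, y}) {y. A x y}" by (auto simp: inj_on_def doubleton_eq_iff)
    ultimately show ?thesis unfolding degree_of_def by (simp add: card_image)
  qed
  obtain r where reg: "!!x. x \<in> ?V ==> card {y. A x y} = r"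
    using assms(3) deg unfolding regular_graph_def by metis
  \<comment> \<open>With degrees at most 1 an edge would form a component by itself, and by
    connectedness it would be the only edge.\<close>
  have r2: "2 <= r"
  proof (rule ccontr)
    assume "\<not> 2 <= r"
    then have one: "y = z" if "A x y" "A x z" for x y z
      using reg[OF inV[OF that(1)]] card_le_Suc0_iff_eq[OF finA, of x] that by auto
    have "\<exists>e e'. e \<in> edges R \<and> e' \<in> edges R \<and> e ~= e'"
    proof (rule ccontr)
      assume "\<not> ?thesis"
      then have "\<forall>x\<in>edges R. \<forall>y\<in>edges R. x = y" by blast
      then have "card (edges R) <= Suc 0"
        using card_le_Suc0_iff_eq[of "edges R"] assms(4) card.infinite[of "edges R"] by fastforce
      then show False using assms(4) by simp
    qed
    then obtain e e' where e: "e \<in> edges R" "e' \<in> edges R" "e ~= e'" by blast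
    obtain x y where xy: "e = {x, y}" "x ~= y" using e2(1)[OF e(1)] by (auto simp: card_2_iff)
    then have "A x y" "A y x" using e(1) sym by (auto simp: A_def)
    show False
    proof (cases "{x, y} = ?V")
      case True
      have "card e' = card {x, y}" using e2(1)[OF e(2)] xy(2) by simp
      moreover have "e' \<subseteq> {x, y}" using e2(2)[OF e(2)] True by simp
      ultimately have "e' = {x, y}" by (intro card_subset_eq) auto
      then show ?thesis using e xy by simp
    next
      case False
      have "{x, y} \<subseteq> ?V" using e2(2)[OF e(1)] xy by simp
      then obtain a b where "a \<in> {x, y}" "b \<notin> {x, y}" "A a b"
        using conn False unfolding cutconn_def by (metis Diff_iff insert_not_empty)
      then show ?thesis using one \<open>A x y\<close> \<open>A y x\<close> by blast
    qed
  qed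
  obtain u c v where ucv: "u ~= v" "A u c" "A c v" "cutconn A (?V - {u, c, v})"
  proof (rule nonseparating_path[of ?V A r])
    show "A x y ==> A y x" for x y by (rule sym)
    show "A x y ==> x \<in> ?V" for x y by (rule inV)
  qed (use fin irr conn reg r2 ne in auto)
  have d: "u ~= c" "c ~= v" using ucv irr by metis+
  have inT: "{u, c, v} \<subseteq> ?V" using ucv inV sym by blast
  let ?h = "card ?V"
  have c3: "card {u, c, v} = 3" using d ucv(1) by simp
  then have h3: "3 <= ?h" using card_mono[OF fin inT] by simp
  have "card {3..<?h} = card (?V - {u, c, v})"
    using card_Diff_subset[OF _ inT] c3 by simp
  then obtain g' where g': "bij_betw g' {3..<?h} (?V - {u, c, v})"
    using finite_same_card_bij[of "{3..<?h}" "?V - {u, c, v}"] fin by auto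
  \<comment> \<open>The path becomes 0, 1, 2; the order of the other vertices is arbitrary.\<close>
  define g where "g i = (if i = 0 then u else if i = 1 then c else if i = 2 then v else g' i)" for i :: nat
  have g3: "bij_betw g {3..<?h} (?V - {u, c, v})"
    by (rule bij_betw_cong[THEN iffD1, OF _ g']) (auto simp: g_def)
  have g0: "bij_betw g {0, 1, 2} {u, c, v}"
    using d ucv(1) by (auto simp: bij_betw_def inj_on_def g_def)
  have "bij_betw g ({0, 1, 2} \<union> {3..<?h}) ({u, c, v} \<union> (?V - {u, c, v}))"
    by (rule bij_betw_combine[OF g0 g3]) auto
  moreover have "{0, 1, 2} \<union> {3..<?h} = {..<?h}" using h3 by auto
  moreover have "{u, c, v} \<union> (?V - {u, c, v}) = ?V" using inT by blast
  ultimately have g: "bij_betw g {..<?h} ?V" by simp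
  define N where "N i j \<longleftrightarrow> i < ?h \<and> j < ?h \<and> A (g i) (g j)" for i j
  have gV: "g i \<in> ?V" if "i < ?h" for i using g that by (auto simp: bij_betw_def)
  show ?thesis
  proof (rule that[of ?h r N])
    show "pattern ?h r N"
    proof
      show "N i j ==> N j i" for i j using sym by (auto simp: N_def)
      show "\<not> N i i" for i using irr by (auto simp: N_def)
      show "N i j ==> i < ?h" for i j by (auto simp: N_def)
      show "card {j. N i j} = r" if i: "i < ?h" for i
      proof -
        have "bij_betw g {j. N i j} {y. A (g i) y}"
          unfolding bij_betw_def
        proof
          show "inj_on g {j. N i j}" using g by (auto simp: bij_betw_def N_def inj_on_def)
          show "g ` {j. N i j} = {y. A (g i) y}"
          proof
            show "{y. A (g i) y} \<subseteq> g ` {j. N i j}"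
            proof
              fix y assume y: "y \<in> {y. A (g i) y}"
              then have "y \<in> g ` {..<?h}" using g inV[OF sym] by (auto simp: bij_betw_def)
              then show "y \<in> g ` {j. N i j}" using y i by (auto simp: N_def)
            qed
          qed (auto simp: N_def)
        qed
        then show ?thesis using reg[OF gV[OF i]] by (simp add: bij_betw_same_card)
      qed
      show "cutconn N {..<?h}" by (rule cutconn_pull[OF g _ conn]) (auto simp: N_def)
      show "cutconn N {3..<?h}" by (rule cutconn_pull[OF g3 _ ucv(4)]) (auto simp: N_def)
      show "N 0 1" "N 1 2" using h3 ucv by (auto simp: N_def g_def)
    qed (use r2 h3 in auto)
    show "graph_iso (graph_on {..<?h} N) R"
      unfolding graph_iso_def
    proof (intro exI[of _ g] conjI ballI)
      show "bij_betw g (verts (graph_on {..<?h} N)) (verts R)" using g by (simp add: graph_on_def)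
      show "({i, j} \<in> edges (graph_on {..<?h} N)) = ({g i, g j} \<in> edges R)"
        if "i \<in> verts (graph_on {..<?h} N)" "j \<in> verts (graph_on {..<?h} N)" for i j
        using that sym by (auto simp: graph_on_def N_def doubleton_eq_iff A_def)
    qed
  qed
qed

section \<open>From 3-SAT to vertex cover in triangle-free graphs\<close>

text \<open>Every variable gives an edge between its two literals and every clause a cycle of length 9,
  whose vertices 0, 3, 6 are joined to the literals of the clause. A cover needs one vertex per
  variable and five per cycle; five suffice only if one of the vertices 0, 3, 6 is left out.\<close>

type_synonym 'v qvert = "nat \<times> nat \<times> 'v list"

definition litv :: "bool \<times> 'v => 'v qvert" where
  "litv l = (0, if fst l then 1 else 0, [snd l])"

definition cyc :: "nat => nat => 'v qvert" where
  "cyc j i = (Suc j, i, [])"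

definition satP :: "(bool \<times> 'v) list list => bool" where
  "satP \<phi> \<longleftrightarrow> (\<exists>\<alpha>. \<forall>C\<in>set \<phi>. \<exists>(b, v)\<in>set C. \<alpha> v = b)"

text \<open>A clause with fewer than three literals repeats its first one, so that every cycle has
  exactly three links.\<close>

definition pick3 :: "'a list => nat => 'a" where
  "pick3 C t = nth_default (hd C) C t"

definition vlist :: "(bool \<times> 'v) list list => 'v list" where
  "vlist \<phi> = remdups (map snd (concat \<phi>))"

text \<open>The cycle is the familiar clause triangle with each edge subdivided by two vertices.
  Such a subdivision raises the cover number by one per edge, from 2 to 5, and destroys the
  triangle.\<close>

definition clause_edges :: "nat => (bool \<times> 'v) list => ('v qvert \<times> 'v qvert) list" where
  "clause_edges j C = map (\<lambda>i. (cyc j i, cyc j (if i < 8 then Suc i else 0))) [0..<9] @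
     map (\<lambda>t. (cyc j (3 * t), litv (pick3 C t))) [0..<3]"

definition elist :: "(bool \<times> 'v) list list => ('v qvert \<times> 'v qvert) list" where
  "elist \<phi> = map (\<lambda>v. (litv (True, v), litv (False, v))) (vlist \<phi>) @
     concat (map (\<lambda>j. clause_edges j (\<phi> ! j)) [0..<length \<phi>])"

definition qlist :: "(bool \<times> 'v) list list => 'v qvert list" where
  "qlist \<phi> = concat (map (\<lambda>v. [litv (True, v), litv (False, v)]) (vlist \<phi>)) @
     concat (map (\<lambda>j. map (cyc j) [0..<9]) [0..<length \<phi>])"

definition clauses_ok :: "(bool \<times> 'v) list list => bool" where
  "clauses_ok \<phi> \<longleftrightarrow> (\<forall>C\<in>set \<phi>. C ~= [] \<and> length C <= 3)"

lemma litv_eq [simp]: "litv l = litv l' \<longleftrightarrow> l = l'" "litv l ~= cyc j i" "cyc j i ~= litv l"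
  "cyc j i = cyc j' i' \<longleftrightarrow> j = j' \<and> i = i'"
  by (auto simp: litv_def cyc_def prod_eq_iff split: if_splits)

lemma set_vlist: "set (vlist \<phi>) = snd ` (\<Union>C\<in>set \<phi>. set C)"
  by (auto simp: vlist_def)

lemma pick3_mem: "C ~= [] ==> pick3 C t \<in> set C"
  by (auto simp: pick3_def nth_default_def)

lemma pick3_all: "length C <= 3 ==> l \<in> set C ==> \<exists>t<3. pick3 C t = l"
  by (auto simp: pick3_def nth_default_def in_set_conv_nth)

lemma set_elist: "(x, y) \<in> set (elist \<phi>) \<longleftrightarrow>
    (\<exists>v\<in>set (vlist \<phi>). x = litv (True, v) \<and> y = litv (False, v)) \<or>
    (\<exists>j<length \<phi>. \<exists>i<9. x = cyc j i \<and> y = cyc j (if i < 8 then Suc i else 0)) \<or>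
    (\<exists>j<length \<phi>. \<exists>t<3. x = cyc j (3 * t) \<and> y = litv (pick3 (\<phi> ! j) t))"
proof -
  have 1: "(x, y) \<in> set (clause_edges j C) \<longleftrightarrow>
    (\<exists>i<9. x = cyc j i \<and> y = cyc j (if i < 8 then Suc i else 0)) \<or>
    (\<exists>t<3. x = cyc j (3 * t) \<and> y = litv (pick3 C t))" for j C
    unfolding clause_edges_def
    by (simp only: set_append set_map set_upt Un_iff image_iff Bex_def atLeastLessThan_iff prod.inject zero_le simp_thms)
  have "(x, y) \<in> set (elist \<phi>) \<longleftrightarrow> (\<exists>v\<in>set (vlist \<phi>). x = litv (True, v) \<and> y = litv (False, v)) \<or>
    (\<exists>j<length \<phi>. (x, y) \<in> set (clause_edges j (\<phi> ! j)))"
    unfolding elist_def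
    by (auto simp only: set_append set_map set_concat set_upt Un_iff image_iff UN_iff Bex_def atLeastLessThan_iff prod.inject zero_le simp_thms)
  then show ?thesis unfolding 1 by blast
qed

text \<open>There are no triangles: a literal is adjacent to no literal but its negation, a cycle
  vertex to at most one literal, and of two adjacent cycle vertices at most one is among 0, 3,
  6.\<close>

lemma elist_props:
  assumes "clauses_ok \<phi>"
  shows "(x, y) \<in> set (elist \<phi>) ==> x \<in> set (qlist \<phi>) \<and> y \<in> set (qlist \<phi>)"
    "(x, x) \<notin> set (elist \<phi>)" "(x, y) \<in> set (elist \<phi>) ==> (y, x) \<notin> set (elist \<phi>)"
    "triangle_free (set (elist \<phi>))"
proof -
  show "(x, x) \<notin> set (elist \<phi>)" by (auto simp: set_elist split: if_splits)
  show "(x, y) \<in> set (elist \<phi>) ==> (y, x) \<notin> set (elist \<phi>)"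
    by (auto simp: set_elist split: if_splits)
  show "x \<in> set (qlist \<phi>) \<and> y \<in> set (qlist \<phi>)" if xy: "(x, y) \<in> set (elist \<phi>)"
  proof -
    have lit: "litv l \<in> set (qlist \<phi>)" if "snd l \<in> set (vlist \<phi>)" for l
      using that by (cases l; cases "fst l") (auto simp: qlist_def)
    have cy: "cyc j i \<in> set (qlist \<phi>)" if "j < length \<phi>" "i < 9" for j i
      using that by (auto simp: qlist_def simp del: upt_rec_numeral intro!: bexI[of _ j])
    have pk: "snd (pick3 (\<phi> ! j) t) \<in> set (vlist \<phi>)" if "j < length \<phi>" for j t
    proof -
      have "pick3 (\<phi> ! j) t \<in> set (\<phi> ! j)" using assms that by (intro pick3_mem) (auto simp: clauses_ok_def)
      then show ?thesis using that unfolding set_vlist by (intro imageI) (auto intro!: bexI[of _ "\<phi> ! j"])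
    qed
    show ?thesis using xy unfolding set_elist
    proof (elim disjE bexE exE conjE)
      fix v assume "v \<in> set (vlist \<phi>)" "x = litv (True, v)" "y = litv (False, v)"
      then show ?thesis using lit[of "(True, v)"] lit[of "(False, v)"] by simp
    next
      fix j i assume "j < length \<phi>" "i < 9" "x = cyc j i" "y = cyc j (if i < 8 then Suc i else 0)"
      then show ?thesis using cy by simp
    next
      fix j t assume "j < length \<phi>" "t < 3" "x = cyc j (3 * t)" "y = litv (pick3 (\<phi> ! j) t)"
      then show ?thesis using cy[of j "3 * t"] lit[OF pk] by simp
    qed
  qed
  define B where "B a b \<longleftrightarrow> (a, b) \<in> set (elist \<phi>) \<or> (b, a) \<in> set (elist \<phi>)" for a b
  have kind: "(\<exists>l. x = litv l) \<or> (\<exists>j i. i < 9 \<and> x = cyc j i)" if "B x y" for x y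
    using that unfolding B_def set_elist
  proof (elim disjE bexE exE conjE)
    fix j i assume "i < 9" "y = cyc j i" "x = cyc j (if i < 8 then Suc i else 0)"
    then show ?thesis by (intro disjI2 exI[of _ j] exI[of _ "if i < 8 then Suc i else 0"]) auto
  next
    fix j t assume "t < (3::nat)" "x = cyc j (3 * t)"
    then show ?thesis by (intro disjI2 exI[of _ j] exI[of _ "3 * t"]) auto
  qed blast+
  have ll: "snd l = snd l' \<and> fst l ~= fst l'" if "B (litv l) (litv l')" for l l'
    using that unfolding B_def set_elist by auto
  have cl: "i = 0 \<or> i = 3 \<or> i = 6" if "B (cyc j i) (litv l)" for j i l
  proof -
    have "\<exists>t<3. i = 3 * t" using that unfolding B_def set_elist by simp blast
    then obtain t where "t < 3" "i = 3 * t" by blast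
    moreover from this have "t = 0 \<or> t = 1 \<or> t = 2" by linarith
    ultimately show ?thesis by auto
  qed
  have cl1: "l = l'" if "B (cyc j i) (litv l)" "B (cyc j i) (litv l')" for j i l l'
    using that unfolding B_def set_elist by auto
  have cc: "j = j' \<and> (i' = (if i < 8 then Suc i else 0) \<or> i = (if i' < 8 then Suc i' else 0))"
    if "B (cyc j i) (cyc j' i')" for j i j' i'
    using that unfolding B_def set_elist by (simp only: litv_eq) blast
  have sym: "B y x" if "B x y" for x y using that by (auto simp: B_def)
  have no: False if "B x y" "B y z" "B x z" for x y z
    using kind[OF that(1)] kind[OF that(2)] kind[OF sym[OF that(3)]]
  proof (elim disjE exE conjE)
    fix l l' l'' assume "x = litv l" "y = litv l'" "z = litv l''"
    then show False using ll that by blast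
  next
    fix l l' j i assume "x = litv l" "y = litv l'" "z = cyc j i"
    then show False using ll[of l l'] cl1[of j i l l'] sym that by blast
  next
    fix l l' j i assume "x = litv l" "y = cyc j i" "z = litv l'"
    then show False using ll[of l l'] cl1[of j i l l'] sym that by blast
  next
    fix l l' j i assume "x = cyc j i" "y = litv l" "z = litv l'"
    then show False using ll[of l l'] cl1[of j i l l'] sym that by blast
  next
    fix l j i j' i' assume e: "x = litv l" "y = cyc j i" "z = cyc j' i'"
    then show False using cl[of j i l] cl[of j' i' l] cc[of j i j' i'] sym that by (auto split: if_splits)
  next
    fix l j i j' i' assume e: "x = cyc j i" "y = litv l" "z = cyc j' i'"
    then show False using cl[of j i l] cl[of j' i' l] cc[of j i j' i'] sym that by (auto split: if_splits)
  next
    fix l j i j' i' assume e: "x = cyc j i" "y = cyc j' i'" "z = litv l"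
    then show False using cl[of j i l] cl[of j' i' l] cc[of j i j' i'] sym that by (auto split: if_splits)
  next
    fix i j i' j' i'' j'' assume e: "x = cyc j i" "y = cyc j' i'" "z = cyc j'' i''"
    show False using cc[of j i j' i'] cc[of j' i' j'' i''] cc[of j i j'' i''] that unfolding e
      by (auto split: if_splits)
  qed
  then show "triangle_free (set (elist \<phi>))" unfolding triangle_free_def Let_def B_def by blast
qed

text \<open>The set 1, 3, 5, 6, 8 covers the cycle, omits 0 and contains 3 and 6. Rotating by
  \<open>3 * t\<close> moves the omitted vertex to \<open>3 * t\<close>, the link whose literal is
  true.\<close>

definition cov :: "nat => nat list" where
  "cov t = map (\<lambda>x. (x + 3 * t) mod 9) [1, 3, 5, 6, 8]"

lemma cov_props:
  assumes "t < 3"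
  shows "i < 9 ==> i \<in> set (cov t) \<or> (if i < 8 then Suc i else 0) \<in> set (cov t)"
    "s < 3 ==> s ~= t ==> 3 * s \<in> set (cov t)"
proof -
  have t: "t = 0 \<or> t = 1 \<or> t = 2" using assms by linarith
  show "i \<in> set (cov t) \<or> (if i < 8 then Suc i else 0) \<in> set (cov t)" if "i < 9"
  proof -
    have "i = 0 \<or> i = 1 \<or> i = 2 \<or> i = 3 \<or> i = 4 \<or> i = 5 \<or> i = 6 \<or> i = 7 \<or> i = 8" using that by linarith
    then show ?thesis using t by (elim disjE) (simp_all add: cov_def)
  qed
  show "3 * s \<in> set (cov t)" if "s < 3" "s ~= t"
  proof -
    have "s = 0 \<or> s = 1 \<or> s = 2" using that by linarith
    then show ?thesis using t that by (elim disjE) (simp_all add: cov_def)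
  qed
qed

lemma covered_if_sat:
  assumes "clauses_ok \<phi>" "satP \<phi>"
  shows "covered (set (elist \<phi>)) (length (vlist \<phi>) + 5 * length \<phi>)"
proof -
  obtain \<alpha> where \<alpha>: "!!C. C \<in> set \<phi> ==> \<exists>(b, v)\<in>set C. \<alpha> v = b" using assms(2) unfolding satP_def by blast
  have "\<exists>t<3. \<alpha> (snd (pick3 (\<phi> ! j) t)) = fst (pick3 (\<phi> ! j) t)" if j: "j < length \<phi>" for j
  proof -
    have m: "\<phi> ! j \<in> set \<phi>" using j by simp
    obtain b v where bv: "(b, v) \<in> set (\<phi> ! j)" "\<alpha> v = b" using \<alpha>[OF m] by blast
    obtain t where "t < 3" "pick3 (\<phi> ! j) t = (b, v)"
      using pick3_all[OF _ bv(1)] assms(1) m unfolding clauses_ok_def by blast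
    then show ?thesis using bv(2) by (intro exI[of _ t]) simp
  qed
  then obtain T where T: "!!j. j < length \<phi> ==> T j < 3 \<and> \<alpha> (snd (pick3 (\<phi> ! j) (T j))) = fst (pick3 (\<phi> ! j) (T j))"
    by metis
  define sl where "sl = map (\<lambda>v. litv (\<alpha> v, v)) (vlist \<phi>) @ concat (map (\<lambda>j. map (cyc j) (cov (T j))) [0..<length \<phi>])"
  have len: "length sl = length (vlist \<phi>) + 5 * length \<phi>"
    by (simp add: sl_def length_concat o_def cov_def sum_list_triv)
  have lit: "litv l \<in> set sl" if "snd l \<in> set (vlist \<phi>)" "\<alpha> (snd l) = fst l" for l
    using that by (cases l) (auto simp: sl_def)
  have cy: "cyc j i \<in> set sl \<longleftrightarrow> i \<in> set (cov (T j))" if "j < length \<phi>" for i j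
    using that by (auto simp: sl_def)
  have pk: "snd (pick3 (\<phi> ! j) t) \<in> set (vlist \<phi>)" if "j < length \<phi>" for j t
  proof -
    have "pick3 (\<phi> ! j) t \<in> set (\<phi> ! j)" using assms that by (intro pick3_mem) (auto simp: clauses_ok_def)
    then show ?thesis using that unfolding set_vlist by (intro imageI) (auto intro!: bexI[of _ "\<phi> ! j"])
  qed
  have *: "x \<in> set sl \<or> y \<in> set sl" if "(x, y) \<in> set (elist \<phi>)" for x y
    using that unfolding set_elist
  proof (elim disjE bexE exE conjE)
    fix v assume "v \<in> set (vlist \<phi>)" "x = litv (True, v)" "y = litv (False, v)"
    then show ?thesis using lit[of "(True, v)"] lit[of "(False, v)"] by (cases "\<alpha> v") auto
  next
    fix j i assume "j < length \<phi>" "i < 9" "x = cyc j i" "y = cyc j (if i < 8 then Suc i else 0)"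
    then show ?thesis using cov_props(1)[of "T j" i] T[of j] cy by metis
  next
    fix j t assume a: "j < length \<phi>" "t < 3" "x = cyc j (3 * t)" "y = litv (pick3 (\<phi> ! j) t)"
    show ?thesis
    proof (cases "t = T j")
      case True
      then show ?thesis using lit[of "pick3 (\<phi> ! j) t"] pk T a by auto
    next
      case False
      then show ?thesis using cov_props(2)[of "T j" t] T a cy by auto
    qed
  qed
  have "\<forall>(x, y)\<in>set (elist \<phi>). x \<in> set sl \<or> y \<in> set sl"
  proof
    fix e assume "e \<in> set (elist \<phi>)"
    then show "case e of (x, y) => x \<in> set sl \<or> y \<in> set sl"
      unfolding case_prod_beta by (intro *) (simp only: prod.collapse)
  qed
  moreover have "card (set sl) <= length (vlist \<phi>) + 5 * length \<phi>" using card_length[of sl] len by simp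
  ultimately show ?thesis unfolding covered_def by blast
qed

lemma sat_if_covered:
  fixes \<phi> :: "(bool \<times> 'v) list list"
  assumes "clauses_ok \<phi>" "covered (set (elist \<phi>)) (length (vlist \<phi>) + 5 * length \<phi>)"
  shows "satP \<phi>"
proof -
  obtain S where S: "finite S" "card S <= length (vlist \<phi>) + 5 * length \<phi>"
    "!!x y. (x, y) \<in> set (elist \<phi>) ==> x \<in> S \<or> y \<in> S"
    using assms(2) unfolding covered_def by blast
  let ?n = "length (vlist \<phi>)" and ?m = "length \<phi>"
  define I where "I = (\<lambda>v. (0::nat, [v])) ` set (vlist \<phi>) \<union> (\<lambda>j. (Suc j, [])) ` {..<?m}"
  \<comment> \<open>The blocks are the literal pairs and the cycles; forgetting the middle component
    of a vertex names its block. A cover needs at least \<open>low p\<close> vertices in block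
    \<open>p\<close>, and these minima add up to the budget, so equality holds in every
    block.\<close>
  define blk where "blk p = {x \<in> S. (fst x, snd (snd x)) = p}" for p
  define low where "low p = (if fst p = 0 then 1 else 5 :: nat)" for p :: "nat \<times> 'v list"
  have finI: "finite I" by (simp add: I_def)
  have bl0: "1 <= card (blk (0, [v]))" if "v \<in> set (vlist \<phi>)" for v
  proof -
    have "litv (True, v) \<in> S \<or> litv (False, v) \<in> S" using that S(3) unfolding set_elist by blast
    then have "blk (0, [v]) ~= {}" by (auto simp: blk_def litv_def)
    then show ?thesis using S(1) by (simp add: blk_def Suc_le_eq card_gt_0_iff)
  qed
  define s where "s j i = (if cyc j i \<in> S then 1 else 0 :: nat)" for j i
  have blS: "(\<Sum>i<9. s j i) <= card (blk (Suc j, []))" for j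
  proof -
    have "(\<Sum>i<9. s j i) = card {i \<in> {..<9}. cyc j i \<in> S}"
      unfolding s_def by (simp add: sum.If_cases Int_def)
    also have "... = card ((cyc j :: nat => 'v qvert) ` {i \<in> {..<9}. cyc j i \<in> S})"
      by (rule card_image[symmetric]) (auto simp: inj_on_def)
    also have "... <= card (blk (Suc j, []))"
      by (rule card_mono) (use S(1) in \<open>auto simp: blk_def cyc_def\<close>)
    finally show ?thesis .
  qed
  have edge: "1 <= s j i + s j (if i < 8 then Suc i else 0)" if "j < ?m" "i < 9" for i j
    using S(3)[of "cyc j i" "cyc j (if i < 8 then Suc i else 0)"] that unfolding set_elist s_def by (auto split: if_splits)
  have e: "1 <= s j 0 + s j 1" "1 <= s j 1 + s j 2" "1 <= s j 2 + s j 3" "1 <= s j 3 + s j 4" "1 <= s j 4 + s j 5"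
    "1 <= s j 5 + s j 6" "1 <= s j 6 + s j 7" "1 <= s j 7 + s j 8" "1 <= s j 8 + s j 0" if "j < ?m" for j
    using edge[OF that, of 0] edge[OF that, of 1] edge[OF that, of 2] edge[OF that, of 3] edge[OF that, of 4]
      edge[OF that, of 5] edge[OF that, of 6] edge[OF that, of 7] edge[OF that, of 8]
    by (simp_all add: numeral_eq_Suc)
  have sum9: "(\<Sum>i<9. s j i) = s j 0 + s j 1 + s j 2 + s j 3 + s j 4 + s j 5 + s j 6 + s j 7 + s j 8" for j
    by (simp add: numeral_eq_Suc)
  have bl5: "5 <= card (blk (Suc j, []))" if "j < ?m" for j
    using e[OF that] blS[of j] unfolding sum9 by linarith
  have low: "low p <= card (blk p)" if "p \<in> I" for p
    using that bl0 bl5 by (auto simp: I_def low_def)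
  have "(\<Sum>p\<in>I. low p) = (\<Sum>p\<in>(\<lambda>v. (0::nat, [v])) ` set (vlist \<phi>). low p) + (\<Sum>p\<in>(\<lambda>j. (Suc j, [])) ` {..<?m}. low p)"
    unfolding I_def by (rule sum.union_disjoint) auto
  also have "(\<Sum>p\<in>(\<lambda>v. (0::nat, [v])) ` set (vlist \<phi>). low p) = ?n"
  proof -
    have "card (set (vlist \<phi>)) = ?n" by (simp add: vlist_def length_remdups_card_conv)
    then show ?thesis by (subst sum.reindex) (auto simp: inj_on_def low_def)
  qed
  also have "(\<Sum>p\<in>(\<lambda>j. (Suc j, [])) ` {..<?m}. low p) = 5 * ?m"
    by (subst sum.reindex) (auto simp: inj_on_def low_def)
  finally have suml: "(\<Sum>p\<in>I. low p) = ?n + 5 * ?m" .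
  have "(\<Sum>p\<in>I. card (blk p)) = card (\<Union>p\<in>I. blk p)"
    by (rule card_UN_disjoint[symmetric]) (use finI S(1) in \<open>auto simp: blk_def\<close>)
  also have "... <= card S" by (rule card_mono[OF S(1)]) (auto simp: blk_def)
  finally have "(\<Sum>p\<in>I. card (blk p)) <= (\<Sum>p\<in>I. low p)" using S(2) suml by simp
  then have eq: "card (blk p) = low p" if "p \<in> I" for p
  proof -
    assume le: "(\<Sum>p\<in>I. card (blk p)) <= (\<Sum>p\<in>I. low p)"
    have "(\<Sum>p\<in>I. low p) <= (\<Sum>p\<in>I. card (blk p))" by (rule sum_mono[OF low])
    then show ?thesis using sum_mono_inv[of low I "\<lambda>p. card (blk p)" p] le low that finI by simp
  qed
  define \<alpha> where "\<alpha> v \<longleftrightarrow> litv (True, v) \<in> S" for v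
  have "\<exists>(b, v)\<in>set (\<phi> ! j). \<alpha> v = b" if j: "j < ?m" for j
  proof -
    have "card (blk (Suc j, [])) = 5" using eq[of "(Suc j, [])"] j by (auto simp: I_def low_def)
    then have le5: "(\<Sum>i<9. s j i) <= 5" using blS[of j] by simp
    \<comment> \<open>If 0, 3 and 6 were all chosen, the disjoint edges 1-2, 4-5 and 7-8 would still
      cost three more vertices, six in total.\<close>
    have "\<exists>t<3. s j (3 * t) = 0"
    proof (rule ccontr)
      assume "\<not> ?thesis"
      then have nz: "\<forall>t<3. s j (3 * t) ~= 0" by simp
      have "s j 0 ~= 0" "s j 3 ~= 0" "s j 6 ~= 0"
        using nz[rule_format, of 0] nz[rule_format, of 1] nz[rule_format, of 2] by simp_all
      then have "1 <= s j 0" "1 <= s j 3" "1 <= s j 6" by linarith+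
      then show False using e(2)[OF j] e(5)[OF j] e(8)[OF j] le5 unfolding sum9 by linarith
    qed
    then obtain t where t: "t < 3" "cyc j (3 * t) \<notin> S" by (auto simp: s_def split: if_splits)
    have "(cyc j (3 * t), litv (pick3 (\<phi> ! j) t)) \<in> set (elist \<phi>)" unfolding set_elist using j t by blast
    then have l: "litv (pick3 (\<phi> ! j) t) \<in> S" using S(3) t(2) by blast
    obtain b v where bv: "pick3 (\<phi> ! j) t = (b, v)" by (cases "pick3 (\<phi> ! j) t") auto
    have mem: "(b, v) \<in> set (\<phi> ! j)" using pick3_mem[of "\<phi> ! j" t] assms(1) j bv by (auto simp: clauses_ok_def)
    then have v: "v \<in> set (vlist \<phi>)" using j unfolding set_vlist by force
    have "\<alpha> v = b"
    proof (cases b)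
      case True
      then show ?thesis using l bv by (simp add: \<alpha>_def)
    next
      case False
      have "\<not> litv (True, v) \<in> S"
      proof
        assume "litv (True, v) \<in> S"
        then have "{litv (True, v), litv (False, v)} \<subseteq> blk (0, [v])"
          using l bv False by (auto simp: blk_def litv_def)
        then have "card {litv (True, v), litv (False, v)} <= card (blk (0, [v]))"
          by (rule card_mono[rotated]) (use S(1) in \<open>simp add: blk_def\<close>)
        moreover have "card {litv (True, v), litv (False, v)} = 2" by simp
        moreover have "card (blk (0, [v])) = 1" using eq[of "(0, [v])"] v by (auto simp: I_def low_def)
        ultimately show False by simp
      qed
      then show ?thesis using False by (simp add: \<alpha>_def)
    qed
    then show ?thesis using mem by blast
  qed
  then have "\<forall>C\<in>set \<phi>. \<exists>(b, v)\<in>set C. \<alpha> v = b" by (auto simp: in_set_conv_nth)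
  then show ?thesis unfolding satP_def by blast
qed

section \<open>Computing the instance\<close>

lemma fp_remdups [fp_intros]: "fp xs ==> fp (\<lambda>e. remdups (xs e))"
proof (rule fp_comp[of remdups])
  have f: "foldl (\<lambda>a y. if y \<in> set a then a else y # a) [] (rev l) = remdups l" for l :: "'b list"
    by (induction l) auto
  have c: "csize (remdups l) <= csize l" for l :: "'b list"
    by (induction l) (auto intro: le_SucI trans_le_add2)
  have "fp (\<lambda>l :: 'b list. foldl (\<lambda>a y. if y \<in> set a then a else y # a) [] (rev l))"
  proof (rule fp_foldl[where B = csize])
    show "csize (foldl (\<lambda>a y. if y \<in> set a then a else y # a) [] us) <= csize l"
      if "rev l = us @ vs" for l us vs :: "'b list"
    proof -
      have "csize (remdups (rev us)) <= csize us" using c[of "rev us"] by simp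
      also have "... <= csize (rev l)" unfolding that by (rule csize_append_ge)
      finally show ?thesis using f[of "rev us"] by simp
    qed
  qed (intro fp_intros pbo_intros)+
  then show "fp (remdups :: 'b list => 'b list)" by (simp add: f)
qed

lemma fp_hd [fp_intros]: "fp xs ==> fp (\<lambda>e. hd (xs e))"
proof (rule fp_comp[of hd])
  have "fp (\<lambda>l::'b list. case l of [] => hd [] | y # ys => y)" by (intro fp_intros)
  then show "fp (hd :: 'b list => 'b)" by (rule fp_cong) (auto split: list.split)
qed

lemma fp_replicate [fp_intros]:
  fixes x :: "'e::code => 'x::code"
  assumes "fp n" "fp x"
  shows "fp (\<lambda>e. replicate (n e) (x e))"
proof -
  have "fp (\<lambda>e. map (\<lambda>_. x e) [0..<n e])" by (intro fp_intros assms fp_comp[OF assms(2)])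
  then show ?thesis by (simp add: map_replicate_const)
qed

lemma fp_min [fp_intros]: "fp m ==> fp n ==> fp (\<lambda>e. min (m e) (n e :: nat))"
  unfolding min_def by (intro fp_intros)

definition half_step :: "nat \<times> bool => nat \<times> bool" where
  "half_step p = (if snd p then (Suc (fst p), False) else (fst p, True))"

lemma half_step: "(half_step ^^ n) (0, False) = (n div 2, odd n)"
  by (induction n) (auto simp: half_step_def)

lemma fp_half: "fp n ==> fp (\<lambda>e. (n e div 2, odd (n e :: nat)))"
proof (rule fp_comp[of "\<lambda>n::nat. (n div 2, odd n)"])
  have "fp (\<lambda>n::nat. (half_step ^^ n) (0, False))"
  proof (rule fp_funpow[where B = "\<lambda>n. 2 * n + 5"])
    show "fp (\<lambda>p::nat \<times> nat \<times> bool. half_step (snd p))" unfolding half_step_def by (intro fp_intros)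
    show "pbo (\<lambda>n::nat. 2 * n + 5)" by (intro pbo_intros pbo_nat fp_intros)
    show "csize ((half_step ^^ k) (0, False)) <= 2 * n + 5" if "k <= n" for k n :: nat
      using csize_bool[of "odd k"] that by (simp add: half_step)
  qed (intro fp_intros)+
  then show "fp (\<lambda>n::nat. (n div 2, odd n))" by (simp add: half_step)
qed

lemma fp_div2 [fp_intros]: "fp n ==> fp (\<lambda>e. n e div (2::nat))"
  using fp_fst[OF fp_half] by simp

lemma fp_odd [fp_intros]: "fp n ==> fp (\<lambda>e. odd (n e :: nat))"
  using fp_snd[OF fp_half] by simp

lemma enc_binary_0 [simp]: "enc_binary 0 = []"
  by (simp add: enc_binary.simps)

lemma enc_binary_pos: "k ~= 0 ==> enc_binary k = odd k # enc_binary (k div 2)"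
  by (subst enc_binary.simps) simp

definition bin_step :: "nat \<times> bool list => nat \<times> bool list" where
  "bin_step p = (if fst p = 0 then p else (fst p div 2, odd (fst p) # snd p))"

text \<open>The number of rounds only has to be large enough because \<open>bin_step\<close> rests
  at 0. It may be the number itself, which is affordable in unary.\<close>

lemma bin_step: "k <= m ==> (bin_step ^^ m) (k, acc) = (0, rev (enc_binary k) @ acc)"
proof (induction m arbitrary: k acc)
  case 0
  then show ?case by simp
next
  case (Suc m)
  show ?case
  proof (cases "k = 0")
    case True
    have "(bin_step ^^ n) (0, acc) = (0, acc)" for n by (induction n) (auto simp: bin_step_def)
    then show ?thesis using True by (simp del: funpow.simps)
  next
    case False
    then have "k div 2 <= m" using Suc.prems by linarith
    then have "(bin_step ^^ m) (bin_step (k, acc)) = (0, rev (enc_binary k) @ acc)"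
      using Suc.IH[of "k div 2" "odd k # acc"] False
      by (subst bin_step_def) (simp add: enc_binary_pos)
    then show ?thesis by (simp add: funpow_Suc_right del: funpow.simps)
  qed
qed

lemma fp_enc_binary [fp_intros]: "fp n ==> fp (\<lambda>e. enc_binary (n e))"
proof (rule fp_comp[of enc_binary])
  have "fp (\<lambda>n::nat. (bin_step ^^ n) (n, []))"
  proof (rule fp_funpow[where B = "\<lambda>n. 2 * n + 1 + (1 + n * (3 + 1)) + 1"])
    show "fp (\<lambda>p::nat \<times> nat \<times> bool list. bin_step (snd p))" unfolding bin_step_def by (intro fp_intros)
    show "pbo (\<lambda>n::nat. 2 * n + 1 + (1 + n * (3 + 1)) + 1)" by (intro pbo_intros pbo_nat fp_intros)
    show "csize ((bin_step ^^ k) (n, [])) <= 2 * n + 1 + (1 + n * (3 + 1)) + 1" if k: "k <= n" for k n :: nat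
    proof -
      have "fst ((bin_step ^^ k) (n, [])) <= n \<and> length (snd ((bin_step ^^ k) (n, []))) <= k"
        by (induction k) (auto simp: bin_step_def)
      then have 1: "fst ((bin_step ^^ k) (n, [])) <= n" "length (snd ((bin_step ^^ k) (n, []))) <= n" using k by auto
      have "csize (snd ((bin_step ^^ k) (n, []))) <= 1 + length (snd ((bin_step ^^ k) (n, []))) * (3 + 1)"
        by (rule csize_list_le) (rule csize_bool)
      also have "... <= 1 + n * (3 + 1)" using 1(2) by simp
      finally have "csize (snd ((bin_step ^^ k) (n, []))) <= 1 + n * (3 + 1)" .
      then show ?thesis using 1(1) csize_prod[of "fst ((bin_step ^^ k) (n, []))" "snd ((bin_step ^^ k) (n, []))"]
        by simp
    qed
  qed (intro fp_intros)+
  then have "fp (\<lambda>n::nat. rev (snd ((bin_step ^^ n) (n, []))))" by (intro fp_rev fp_snd)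
  then show "fp enc_binary" by (rule fp_cong) (simp add: bin_step)
qed

lemma fp_enc_unary [fp_intros]: "fp n ==> fp (\<lambda>e. enc_unary (n e))"
  unfolding enc_unary_def by (intro fp_intros)

section \<open>Graphs on an initial segment and the injectivity of their encoding\<close>

definition ngraph :: "nat => (nat => nat => bool) => nat ugraph" where
  "ngraph n a = ({..<n}, {{i, j} | i j. i < n \<and> j < n \<and> a i j})"

lemma ngraph_edge:
  assumes "!!i j. i < n ==> j < n ==> a i j ==> a j i"
  shows "{i, j} \<in> edges (ngraph n a) \<longleftrightarrow> i < n \<and> j < n \<and> a i j"
  using assms by (auto simp: ngraph_def doubleton_eq_iff)

lemma ngraph_simple:
  assumes "!!i. i < n ==> \<not> a i i"
  shows "simple_graph (ngraph n a)"
proof -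
  have "e \<subseteq> {..<n} \<and> card e = 2" if "e \<in> edges (ngraph n a)" for e
  proof -
    have "\<exists>i j. e = {i, j} \<and> i < n \<and> j < n \<and> a i j" using that unfolding ngraph_def by simp
    then obtain i j where e: "e = {i, j}" "i < n" "j < n" "a i j" by blast
    then have "i ~= j" using assms by metis
    then show ?thesis using e by simp
  qed
  then show ?thesis by (auto simp: simple_graph_def ngraph_def)
qed

lemma map_cong_concat: "(!!x. x \<in> set xs ==> f x = g x) ==> concat (map f xs) = concat (map g xs)"
  by (metis map_cong)

lemma enc_ngraph:
  assumes "!!i j. i < n ==> j < n ==> a i j ==> a j i"
  shows "enc_edge_deletion (ngraph n a, k) =
    enc_unary n @ concat (map (\<lambda>i. map (a i) [0..<n]) [0..<n]) @ enc_binary k"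
proof -
  have "concat (map (\<lambda>i. map (\<lambda>j. {i, j} \<in> edges (ngraph n a)) [0..<n]) [0..<n]) =
     concat (map (\<lambda>i. map (a i) [0..<n]) [0..<n])"
    by (intro map_cong_concat map_cong refl) (use ngraph_edge[of n a] assms in auto)
  then show ?thesis by (simp add: enc_edge_deletion_def Let_def ngraph_def)
qed

lemma instance_ngraph:
  assumes "x \<in> edge_deletion_instances"
  obtains n a k where "x = (ngraph n a, k)" "!!i j. a i j ==> a j i" "!!i. \<not> a i i" "!!i j. a i j ==> i < n"
proof -
  obtain G k n where x: "x = (G, k)" "simple_graph G" "verts G = {..<n}"
    using assms by (auto simp: edge_deletion_instances_def)
  let ?a = "\<lambda>i j. {i, j} \<in> edges G"
  have e: "e \<subseteq> {..<n} \<and> card e = 2" if "e \<in> edges G" for e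
    using x that by (auto simp: simple_graph_def)
  have "edges G = {{i, j} | i j. i < n \<and> j < n \<and> ?a i j}"
  proof
    show "edges G \<subseteq> {{i, j} | i j. i < n \<and> j < n \<and> ?a i j}"
    proof
      fix e' assume e': "e' \<in> edges G"
      then obtain i j where "e' = {i, j}" using e[OF e'] by (auto simp: card_2_iff)
      then show "e' \<in> {{i, j} | i j. i < n \<and> j < n \<and> ?a i j}" using e[OF e'] e' by auto
    qed
  qed auto
  then have "G = ngraph n ?a" using x by (auto simp: ngraph_def prod_eq_iff)
  then show ?thesis
    using that[of n ?a k] x(1) e by (force simp: insert_commute)
qed

lemma enc_unary_inj: "enc_unary m @ xs = enc_unary n @ ys ==> m = n \<and> xs = ys"
proof (induction m arbitrary: n)
  case 0
  then show ?case by (cases n) (auto simp: enc_unary_def)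
next
  case (Suc m)
  then show ?case by (cases n) (auto simp: enc_unary_def)
qed

fun bval :: "bool list => nat" where
  "bval [] = 0"
| "bval (b # bs) = (if b then 1 else 0) + 2 * bval bs"

lemma bval_enc_binary: "bval (enc_binary k) = k"
proof (induction k rule: less_induct)
  case (less k)
  show ?case
  proof (cases "k = 0")
    case False
    then have "bval (enc_binary (k div 2)) = k div 2" using less by simp
    then show ?thesis using False by (simp add: enc_binary_pos; presburger)
  qed simp
qed

lemma enc_binary_last: "enc_binary k = [] \<or> last (enc_binary k)"
proof (induction k rule: less_induct)
  case (less k)
  show ?case
  proof (cases "k = 0")
    case False
    then have IH: "enc_binary (k div 2) = [] \<or> last (enc_binary (k div 2))" using less by simp
    have "enc_binary (k div 2) = [] ==> k div 2 = 0" using bval_enc_binary[of "k div 2"] by simp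
    then have "enc_binary (k div 2) = [] ==> odd k" using False by presburger
    then show ?thesis using IH False by (auto simp: enc_binary_pos)
  qed simp
qed

lemma enc_binary_bval: "bs = [] \<or> last bs ==> enc_binary (bval bs) = bs"
proof (induction bs)
  case (Cons b bs)
  then have IH: "enc_binary (bval bs) = bs" by (cases bs) auto
  have "bval (b # bs) ~= 0"
  proof
    assume "bval (b # bs) = 0"
    then have "\<not> b" "bval bs = 0" by (auto split: if_splits)
    then have "bs = []" using IH by simp
    then show False using Cons.prems \<open>\<not> b\<close> by simp
  qed
  then show ?case using IH by (subst enc_binary_pos) auto
qed simp

lemma nth_concat_const:
  assumes "!!x. x \<in> set xs ==> length (f x) = n" "i < length xs" "j < n"
  shows "concat (map f xs) ! (i * n + j) = f (xs ! i) ! j"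
  using assms
proof (induction xs arbitrary: i)
  case (Cons x xs)
  then show ?case by (cases i) (auto simp: nth_append add.assoc)
qed simp

lemma length_concat_const: "(!!x. x \<in> set xs ==> length (f x) = n) ==> length (concat (map f xs)) = length xs * n"
  by (induction xs) auto

lemma matrix_nth:
  assumes "i < n" "j < n"
  shows "concat (map (\<lambda>i. map (a i) [0..<n]) [0..<n]) ! (i * n + j) = a i j"
  using nth_concat_const[of "[0..<n]" "\<lambda>i. map (a i) [0..<n]" n i j] assms by simp

lemma matrix_length: "length (concat (map (\<lambda>i. map (a i) [0..<n]) [0..<n])) = n * n"
  using length_concat_const[of "[0..<n]" "\<lambda>i. map (a i) [0..<n]" n] by simp

lemma index_less: "i < n ==> j < n ==> i * n + j < n * (n::nat)"
  by (metis add_less_cancel_left less_le_trans mult_Suc Suc_leI mult_le_mono1 add.commute)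

text \<open>The unary prefix determines \<open>n\<close> and thereby the length of the matrix; what
  remains is the budget. Since the language is an image under the encoding, injectivity is what lets
  membership of a code decide about its instance.\<close>

lemma enc_edge_deletion_inj:
  assumes "x \<in> edge_deletion_instances" "y \<in> edge_deletion_instances"
    "enc_edge_deletion x = enc_edge_deletion y"
  shows "x = y"
proof -
  obtain n a k where x: "x = (ngraph n a, k)" "!!i j. a i j ==> a j i" using instance_ngraph[OF assms(1)] by metis
  obtain m b l where y: "y = (ngraph m b, l)" "!!i j. b i j ==> b j i" using instance_ngraph[OF assms(2)] by metis
  have ex: "enc_edge_deletion x = enc_unary n @ concat (map (\<lambda>i. map (a i) [0..<n]) [0..<n]) @ enc_binary k"
    unfolding x(1) by (rule enc_ngraph) (rule x(2))
  have ey: "enc_edge_deletion y = enc_unary m @ concat (map (\<lambda>i. map (b i) [0..<m]) [0..<m]) @ enc_binary l"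
    unfolding y(1) by (rule enc_ngraph) (rule y(2))
  have 1: "n = m" and 2: "concat (map (\<lambda>i. map (a i) [0..<n]) [0..<n]) @ enc_binary k =
     concat (map (\<lambda>i. map (b i) [0..<m]) [0..<m]) @ enc_binary l"
    using enc_unary_inj assms(3) unfolding ex ey by blast+
  let ?M = "\<lambda>a. concat (map (\<lambda>i. map (a i) [0..<n]) [0..<n])"
  have "?M a @ enc_binary k = ?M b @ enc_binary l" using 2 unfolding 1 .
  moreover have "length (?M a) = length (?M b)" unfolding matrix_length ..
  ultimately have 3: "?M a = ?M b" "enc_binary k = enc_binary l"
    using append_eq_append_conv[of "?M a" "?M b" "enc_binary k" "enc_binary l"] by simp_all
  have "a i j = b i j" if "i < n" "j < n" for i j
    using matrix_nth[OF that, of a] matrix_nth[OF that, of b] 3(1) by simp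
  then have "ngraph n a = ngraph m b" unfolding ngraph_def 1[symmetric] by auto
  moreover have "k = l" using bval_enc_binary 3(2) by metis
  ultimately show ?thesis using x y by simp
qed

section \<open>The instance produced by the reduction\<close>

definition gvl :: "nat => (bool \<times> 'v) list list => 'v qvert gvert list" where
  "gvl h \<phi> = remdups ((0, []) # map (\<lambda>a. (1, [a])) (qlist \<phi>) @
     concat (map (\<lambda>e. map (\<lambda>i. (i, [fst e, snd e])) [3..<h]) (elist \<phi>)))"

definition inst :: "nat => (nat => nat => bool) => (bool \<times> 'v) list list => nat ugraph \<times> nat" where
  "inst h N \<phi> = (ngraph (length (gvl h \<phi>)) (\<lambda>i j. gadj N (set (elist \<phi>)) (gvl h \<phi> ! i) (gvl h \<phi> ! j)),
     length (vlist \<phi>) + 5 * length \<phi>)"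

lemma mem_concat_map: "e \<in> set E ==> x \<in> set (f e) ==> x \<in> set (concat (map f E))"
  by auto

lemma set_gvl: "set (gvl h \<phi>) = gverts h (set (qlist \<phi>)) (set (elist \<phi>))"
proof -
  have c: "set (concat (map (\<lambda>e. map (\<lambda>i. (i, [fst e, snd e])) [3..<h]) E)) =
     {(i, [a, b]) | i a b. (a, b) \<in> set E \<and> 3 <= i \<and> i < h}" for E :: "('a qvert \<times> 'a qvert) list"
  proof (intro set_eqI iffI)
    fix x assume "x \<in> set (concat (map (\<lambda>e. map (\<lambda>i. (i, [fst e, snd e])) [3..<h]) E))"
    then obtain e where "e \<in> set E" "x \<in> set (map (\<lambda>i. (i, [fst e, snd e])) [3..<h])"
      by (auto simp only: set_concat set_map UN_iff)
    moreover from this obtain i where "i \<in> set [3..<h]" "x = (i, [fst e, snd e])"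
      unfolding set_map by blast
    ultimately have "e \<in> set E" "i \<in> set [3..<h]" "x = (i, [fst e, snd e])" by simp_all
    then show "x \<in> {(i, [a, b]) | i a b. (a, b) \<in> set E \<and> 3 <= i \<and> i < h}"
      by (intro CollectI exI[of _ i] exI[of _ "fst e"] exI[of _ "snd e"]) simp
  next
    fix x assume "x \<in> {(i, [a, b]) | i a b. (a, b) \<in> set E \<and> 3 <= i \<and> i < h}"
    then obtain i a b where *: "(a, b) \<in> set E" "3 <= i" "i < h" "x = (i, [a, b])" by blast
    then have "x \<in> set (map (\<lambda>i. (i, [fst (a, b), snd (a, b)])) [3..<h])" unfolding set_map by (intro image_eqI[of _ _ i]) auto
    then show "x \<in> set (concat (map (\<lambda>e. map (\<lambda>i. (i, [fst e, snd e])) [3..<h]) E))"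
      by (rule mem_concat_map[OF *(1)])
  qed
  show ?thesis
    by (simp only: gvl_def gverts_def set_remdups list.set set_append set_map c Un_insert_left Un_empty_left Un_assoc)
qed

lemma inst_correct:
  assumes "pattern h r N" "clauses_ok \<phi>"
  shows "inst h N \<phi> \<in> edge_deletion_instances"
    "free_edge_deletion (graph_on {..<h} N) (inst h N \<phi>) \<longleftrightarrow> satP \<phi>"
    "enc_edge_deletion (inst h N \<phi>) = enc_unary (length (gvl h \<phi>)) @
       concat (map (\<lambda>x. map (\<lambda>y. gadj N (set (elist \<phi>)) x y) (gvl h \<phi>)) (gvl h \<phi>)) @
       enc_binary (length (vlist \<phi>) + 5 * length \<phi>)"
proof -
  interpret pattern h r N by (rule assms)
  note ep = elist_props[OF assms(2)]
  interpret g: gadget h r N "set (qlist \<phi>)" "set (elist \<phi>)"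
    by unfold_locales (use ep in blast)+
  let ?vs = "gvl h \<phi>" and ?A = "gadj N (set (elist \<phi>))"
  let ?a = "\<lambda>i j. ?A (?vs ! i) (?vs ! j)" and ?n = "length (gvl h \<phi>)"
  have sym: "?a i j ==> ?a j i" for i j using g.A_sym by blast
  have irr: "\<not> ?a i i" for i using g.A_irr by blast
  have simple: "simple_graph (ngraph ?n ?a)" by (rule ngraph_simple) (rule irr)
  then show "inst h N \<phi> \<in> edge_deletion_instances"
    by (auto simp: edge_deletion_instances_def inst_def ngraph_def)
  have iso: "graph_iso (ngraph ?n ?a) g.G"
    unfolding graph_iso_def
  proof (intro exI[of _ "(!) ?vs"] conjI ballI)
    have "distinct ?vs" by (simp add: gvl_def)
    then show "bij_betw ((!) ?vs) (verts (ngraph ?n ?a)) (verts g.G)"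
      by (simp add: ngraph_def graph_on_def bij_betw_nth set_gvl[symmetric])
    fix i j assume "i \<in> verts (ngraph ?n ?a)" "j \<in> verts (ngraph ?n ?a)"
    then show "({i, j} \<in> edges (ngraph ?n ?a)) = ({?vs ! i, ?vs ! j} \<in> edges g.G)"
      unfolding g.edgeG using ngraph_edge[of ?n ?a i j] sym by (simp add: ngraph_def)
  qed
  have "free_edge_deletion (graph_on {..<h} N) (inst h N \<phi>) \<longleftrightarrow>
     free_edge_deletion (graph_on {..<h} N) (g.G, length (vlist \<phi>) + 5 * length \<phi>)"
    unfolding inst_def using free_edge_deletion_iso[OF iso simple g.simple_G]
      free_edge_deletion_iso[OF graph_iso_sym[OF iso] g.simple_G simple] by blast
  also have "... \<longleftrightarrow> covered (set (elist \<phi>)) (length (vlist \<phi>) + 5 * length \<phi>)"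
    by (rule g.deletion_iff_cover)
  also have "... \<longleftrightarrow> satP \<phi>" using covered_if_sat[OF assms(2)] sat_if_covered[OF assms(2)] by blast
  finally show "free_edge_deletion (graph_on {..<h} N) (inst h N \<phi>) \<longleftrightarrow> satP \<phi>" .
  have "concat (map (\<lambda>x. map (\<lambda>y. ?A x y) ?vs) ?vs) = concat (map (\<lambda>i. map (?a i) [0..<?n]) [0..<?n])"
    by (subst (2 1) map_nth[symmetric]) (simp add: o_def del: map_nth)
  then show "enc_edge_deletion (inst h N \<phi>) = enc_unary (length (gvl h \<phi>)) @
       concat (map (\<lambda>x. map (\<lambda>y. gadj N (set (elist \<phi>)) x y) (gvl h \<phi>)) (gvl h \<phi>)) @
       enc_binary (length (vlist \<phi>) + 5 * length \<phi>)"
    unfolding inst_def using enc_ngraph[of ?n ?a] sym by simp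
qed

lemma fp_vlist [fp_intros]: "fp f ==> fp (\<lambda>e. vlist (f e))"
  unfolding vlist_def by (intro fp_intros)

lemma fp_litv [fp_intros]: "fp f ==> fp (\<lambda>e. litv (f e))"
  unfolding litv_def by (intro fp_intros)

lemma fp_cyc [fp_intros]: "fp f ==> fp g ==> fp (\<lambda>e. cyc (f e) (g e))"
  unfolding cyc_def by (intro fp_intros)

lemma fp_pick3 [fp_intros]: "fp f ==> fp g ==> fp (\<lambda>e. pick3 (f e) (g e))"
  unfolding pick3_def by (intro fp_intros)

lemma fp_elist [fp_intros]:
  fixes f :: "'e::code => (bool \<times> 'b::code) list list"
  shows "fp f ==> fp (\<lambda>e. elist (f e))"
proof (rule fp_comp[of elist])
  have e: "elist \<phi> = map (\<lambda>v. (litv (True, v), litv (False, v))) (vlist \<phi>) @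
     concat (map (\<lambda>j. clause_edges j (nth_default [] \<phi> j)) [0..<length \<phi>])" for \<phi> :: "(bool \<times> 'b) list list"
    unfolding elist_def by (intro arg_cong2[of _ _ _ _ "(@)"] refl map_cong_concat) (simp add: nth_default_nth)
  have f: "fp (\<lambda>\<phi> :: (bool \<times> 'b) list list. map (\<lambda>v. (litv (True, v), litv (False, v))) (vlist \<phi>) @
     concat (map (\<lambda>j. clause_edges j (nth_default [] \<phi> j)) [0..<length \<phi>]))"
    unfolding clause_edges_def by (intro fp_intros)
  show "fp (elist :: (bool \<times> 'b) list list => _)" by (rule fp_cong[OF f]) (rule e[symmetric])
qed

lemma fp_qlist [fp_intros]: "fp f ==> fp (\<lambda>e. qlist (f e))"
  unfolding qlist_def by (intro fp_intros)

lemma fp_gvl [fp_intros]: "fp f ==> fp (\<lambda>e. gvl h (f e))"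
  unfolding gvl_def by (intro fp_intros)

lemma fp_emb [fp_intros]: "fp f ==> fp g ==> fp i ==> fp (\<lambda>e. emb (f e) (g e) (i e))"
  unfolding emb_def by (intro fp_intros)

text \<open>\<open>N\<close> is an arbitrary predicate and comes without a program. It enters the
  program as a constant, the finite list of its pairs.\<close>

lemma fp_gadj:
  assumes "pattern h r N"
  shows "fp E ==> fp x ==> fp y ==> fp (\<lambda>e. gadj N (set (E e)) (x e) (y e))"
proof (rule fp_comp3[of "\<lambda>E x y. gadj N (set E) x y"])
  let ?N = "filter (\<lambda>p. N (fst p) (snd p)) (List.product [0..<h] [0..<h])"
  have "fp (\<lambda>p. \<exists>e\<in>set (fst p :: ('b \<times> 'b) list). \<exists>q\<in>set ?N. fst (snd p) = emb (fst e) (snd e) (fst q) \<and>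
      snd (snd p) = emb (fst e) (snd e) (snd q))"
    by (intro fp_intros)
  moreover have "(\<exists>e\<in>set E. \<exists>q\<in>set ?N. x = emb (fst e) (snd e) (fst q) \<and> y = emb (fst e) (snd e) (snd q)) \<longleftrightarrow>
    gadj N (set E) x y" for E :: "('b \<times> 'b) list" and x y
  proof -
    have "i < h \<and> j < h" if "N i j" for i j using pattern.Nh[OF assms] pattern.Nsym[OF assms] that by blast
    then have "(\<exists>q\<in>set ?N. x = emb (fst e) (snd e) (fst q) \<and> y = emb (fst e) (snd e) (snd q)) \<longleftrightarrow>
       (\<exists>i j. N i j \<and> x = emb (fst e) (snd e) i \<and> y = emb (fst e) (snd e) j)" for e :: "'b \<times> 'b"
      by (auto simp: Bex_def)
    then show ?thesis unfolding gadj_def Bex_def by (auto; metis fst_conv snd_conv)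
  qed
  ultimately show "fp (\<lambda>p. gadj N (set (fst p :: ('b \<times> 'b) list)) (fst (snd p)) (snd (snd p)))" by simp
qed

definition red :: "nat => (nat => nat => bool) => (bool \<times> 'v) list list => bool list" where
  "red h N \<phi> = enc_unary (length (gvl h \<phi>)) @
       concat (map (\<lambda>x. map (\<lambda>y. gadj N (set (elist \<phi>)) x y) (gvl h \<phi>)) (gvl h \<phi>)) @
       enc_binary (length (vlist \<phi>) + 5 * length \<phi>)"

lemma fp_red:
  assumes "pattern h r N"
  shows "fp (red h N :: (bool \<times> 'v::code) list list => _)"
  unfolding red_def by (intro fp_intros fp_gadj[OF assms])

lemma red_in_language:
  assumes "pattern h r N" "graph_iso (graph_on {..<h} N) R" "clauses_ok \<phi>"
  shows "red h N \<phi> \<in> free_edge_deletion_language R \<longleftrightarrow> satP \<phi>"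
proof -
  note ic = inst_correct[OF assms(1,3)]
  have e: "red h N \<phi> = enc_edge_deletion (inst h N \<phi>)" unfolding ic(3) red_def ..
  have f: "free_edge_deletion R (inst h N \<phi>) \<longleftrightarrow> satP \<phi>"
    unfolding free_edge_deletion_pattern[OF assms(2)] by (rule ic(2))
  show ?thesis
  proof
    assume "red h N \<phi> \<in> free_edge_deletion_language R"
    then obtain y where y: "y \<in> edge_deletion_instances" "free_edge_deletion R y" "red h N \<phi> = enc_edge_deletion y"
      unfolding free_edge_deletion_language_def by blast
    then have "inst h N \<phi> = y" using enc_edge_deletion_inj[OF ic(1) y(1)] e by simp
    then show "satP \<phi>" using f y(2) by simp
  next
    assume "satP \<phi>"
    then show "red h N \<phi> \<in> free_edge_deletion_language R"
      unfolding free_edge_deletion_language_def e using f ic(1) by blast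
  qed
qed

section \<open>Membership in NP\<close>

text \<open>The length of the leading run of True, written with a filter and a bounded quantifier so
  that the closure rules apply.\<close>

definition lead :: "bool list => nat" where
  "lead x = length (filter (\<lambda>i. \<forall>j\<in>set [0..<Suc i]. nth_default False x j) [0..<length x])"

lemma lead_enc: "lead (enc_unary n @ r) = n"
proof -
  let ?x = "enc_unary n @ r"
  have nd: "nth_default False ?x j = True" if "j < n" for j
    using that by (simp add: nth_default_def enc_unary_def nth_append)
  have nn: "nth_default False ?x n = False"
    by (simp add: nth_default_def enc_unary_def nth_append)
  have P: "(\<forall>j\<in>set [0..<Suc i]. nth_default False ?x j) \<longleftrightarrow> i < n" for i
  proof
    assume a: "\<forall>j\<in>set [0..<Suc i]. nth_default False ?x j"
    show "i < n"
    proof (rule ccontr)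
      assume "\<not> i < n"
      then have "n \<in> set [0..<Suc i]" by (simp del: upt_Suc)
      then show False using a nn by blast
    qed
  qed (use nd in \<open>auto simp del: upt_Suc\<close>)
  have "filter (\<lambda>i. i < n) [0..<length ?x] = [0..<n]"
  proof -
    have "length ?x = n + Suc (length r)" by (simp add: enc_unary_def)
    then have "[0..<length ?x] = [0..<n] @ [n..<length ?x]"
      using upt_add_eq_append[of 0 n "Suc (length r)"] by (simp del: upt_Suc)
    moreover have "filter (\<lambda>i. i < n) [n..<length ?x] = []" by (simp add: filter_empty_conv)
    ultimately show ?thesis by simp
  qed
  then show ?thesis unfolding lead_def P by simp
qed

definition mat :: "bool list => nat => nat => nat => bool" where
  "mat x n i j = nth_default False (drop (Suc n) x) (i * n + j)"

definition mark :: "bool list => nat => nat => nat => bool" where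
  "mark w n i j \<longleftrightarrow> nth_default False w (i * n + j) \<or> nth_default False w (j * n + i)"

definition lower_pairs :: "nat => (nat \<times> nat) list" where
  "lower_pairs n = concat (map (\<lambda>i. map (\<lambda>j. (i, j)) [0..<i]) [0..<n])"

text \<open>The budget is given in binary and may be exponential, too large for unary numbers.
  Capped at the number \<open>c\<close> of deleted edges it still answers the only question asked,
  whether \<open>c\<close> is within the budget.\<close>

definition capval :: "nat => bool list => nat" where
  "capval c bs = foldl (\<lambda>v b. min c (v + v + (if b then 1 else 0))) 0 (rev bs)"

lemma capval: "capval c bs = min c (bval bs)"
  by (induction bs) (auto simp: capval_def min_def)

lemma fp_capval: "fp c ==> fp bs ==> fp (\<lambda>e. capval (c e) (bs e))"
proof (rule fp_comp2[of capval])
  show "fp (\<lambda>p. capval (fst p) (snd p))"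
    unfolding capval_def
  proof (rule fp_foldl[where B = "\<lambda>p. 2 * fst p + 1"])
    show "pbo (\<lambda>p::nat \<times> bool list. 2 * fst p + 1)" by (intro pbo_intros pbo_nat fp_intros)
    have "foldl (\<lambda>v b. min c (v + v + (if b then 1 else 0))) 0 ys <= (c::nat)" for c ys
      by (induction ys rule: rev_induct) auto
    then show "csize (foldl (\<lambda>v b. min (fst e) (v + v + (if b then 1 else 0))) 0 ys) <= 2 * fst e + 1"
      for e :: "nat \<times> bool list" and ys by simp
  qed (intro fp_intros)+
qed

definition embedding :: "nat => (nat => nat => bool) => (nat => nat => bool) => nat list => bool" where
  "embedding h N d us \<longleftrightarrow> (\<forall>i<h. \<forall>j<h. (i ~= j --> us ! i ~= us ! j) \<and> (N i j \<longleftrightarrow> d (us ! i) (us ! j)))"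

text \<open>Vertex sets become lists of \<open>h\<close> vertices. As \<open>h\<close> is a
  constant, all of them can be tried in polynomial time.\<close>

lemma induced_free_embedding:
  assumes N: "!!i j. N i j ==> N j i" and d: "!!i j. i < n ==> j < n ==> d i j ==> d j i"
  shows "induced_free (graph_on {..<h} N) (ngraph n d) \<longleftrightarrow>
     (\<forall>us\<in>set (List.n_lists h [0..<n]). \<not> embedding h N d us)"
proof -
  have edN: "{i, j} \<in> edges (graph_on {..<h} N) \<longleftrightarrow> N i j" for i j
    using N by (auto simp: graph_on_def doubleton_eq_iff)
  have edW: "{i, j} \<in> edges (induced_sub (ngraph n d) W) \<longleftrightarrow> d i j" if "W \<subseteq> {..<n}" "i \<in> W" "j \<in> W" for i j W
    using ngraph_edge[of n d i j] d that by (auto simp: induced_sub_def)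
  have "(\<exists>W\<subseteq>{..<n}. graph_iso (induced_sub (ngraph n d) W) (graph_on {..<h} N)) \<longleftrightarrow>
    (\<exists>us\<in>set (List.n_lists h [0..<n]). embedding h N d us)"
  proof
    assume "\<exists>W\<subseteq>{..<n}. graph_iso (induced_sub (ngraph n d) W) (graph_on {..<h} N)"
    then obtain W where W: "W \<subseteq> {..<n}" "graph_iso (graph_on {..<h} N) (induced_sub (ngraph n d) W)"
      using graph_iso_sym by blast
    then obtain f where f: "bij_betw f {..<h} W"
      "!!i j. i < h ==> j < h ==> ({i, j} \<in> edges (graph_on {..<h} N)) = ({f i, f j} \<in> edges (induced_sub (ngraph n d) W))"
      unfolding graph_iso_def by (auto simp: graph_on_def induced_sub_def)
    have fW: "f i \<in> W" if "i < h" for i using f(1) that by (auto simp: bij_betw_def)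
    have "map f [0..<h] \<in> set (List.n_lists h [0..<n])"
      using subsetD[OF W(1) fW] by (auto simp: set_n_lists)
    moreover have "embedding h N d (map f [0..<h])"
      unfolding embedding_def
    proof (intro allI impI conjI)
      fix i j assume ij: "i < h" "j < h"
      show "i ~= j ==> map f [0..<h] ! i ~= map f [0..<h] ! j"
        using ij f(1) by (auto simp: bij_betw_def inj_on_def)
      show "N i j \<longleftrightarrow> d (map f [0..<h] ! i) (map f [0..<h] ! j)"
        using f(2)[OF ij] edW[OF W(1) fW[OF ij(1)] fW[OF ij(2)]] ij by (simp add: edN)
    qed
    ultimately show "\<exists>us\<in>set (List.n_lists h [0..<n]). embedding h N d us" by blast
  next
    assume "\<exists>us\<in>set (List.n_lists h [0..<n]). embedding h N d us"
    then obtain us where us: "length us = h" "set us \<subseteq> {..<n}" "embedding h N d us"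
      unfolding set_n_lists set_upt atLeast0LessThan by blast
    have "graph_iso (graph_on {..<h} N) (induced_sub (ngraph n d) (set us))"
      unfolding graph_iso_def
    proof (intro exI[of _ "(!) us"] conjI ballI)
      have "distinct us" using us by (auto simp: distinct_conv_nth embedding_def)
      then show "bij_betw ((!) us) (verts (graph_on {..<h} N)) (verts (induced_sub (ngraph n d) (set us)))"
        using us(1) by (simp add: graph_on_def induced_sub_def bij_betw_nth)
      fix i j assume "i \<in> verts (graph_on {..<h} N)" "j \<in> verts (graph_on {..<h} N)"
      then have "i < h" "j < h" by (auto simp: graph_on_def)
      then show "({i, j} \<in> edges (graph_on {..<h} N)) = ({us ! i, us ! j} \<in> edges (induced_sub (ngraph n d) (set us)))"
        using us edW[OF us(2), of "us ! i" "us ! j"] by (auto simp: edN embedding_def)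
    qed
    then show "\<exists>W\<subseteq>{..<n}. graph_iso (induced_sub (ngraph n d) W) (graph_on {..<h} N)"
      using graph_iso_sym us(2) by blast
  qed
  then show ?thesis unfolding induced_free_def by (simp add: ngraph_def)
qed

lemma ngraph_cong:
  assumes "!!i j. i < n ==> j < n ==> a i j = b i j"
  shows "ngraph n a = ngraph n b"
proof -
  have "(\<exists>i j. e = {i, j} \<and> i < n \<and> j < n \<and> a i j) = (\<exists>i j. e = {i, j} \<and> i < n \<and> j < n \<and> b i j)" for e
    using assms by metis
  then show ?thesis unfolding ngraph_def by simp
qed

text \<open>The language contains encodings only, so these must be recognised as well: the decoded
  matrix is encoded again, symmetry and absence of loops are tested, and the last bit of the budget
  must be True, as binary numbers end with their highest bit. The certificate is the matrix of
  deleted pairs, made symmetric by \<open>mark\<close>.\<close>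

definition checkn :: "nat => (nat => nat => bool) => nat => bool list => bool list => bool" where
  "checkn h N n x w \<longleftrightarrow>
     x = enc_unary n @ concat (map (\<lambda>i. map (\<lambda>j. mat x n i j) [0..<n]) [0..<n]) @ drop (Suc n + n * n) x \<and>
     (\<forall>i\<in>set [0..<n]. \<not> mat x n i i \<and> (\<forall>j\<in>set [0..<n]. mat x n i j --> mat x n j i)) \<and>
     (drop (Suc n + n * n) x = [] \<or> hd (rev (drop (Suc n + n * n) x))) \<and>
     (let c = length (filter (\<lambda>p. mat x n (fst p) (snd p) \<and> mark w n (fst p) (snd p)) (lower_pairs n)) in
        c <= capval c (drop (Suc n + n * n) x)) \<and>
     (\<forall>us\<in>set (List.n_lists h [0..<n]). \<not> embedding h N (\<lambda>i j. mat x n i j \<and> \<not> mark w n i j) us)"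

lemma fp_mat [fp_intros]: "fp x ==> fp n ==> fp i ==> fp j ==> fp (\<lambda>e. mat (x e) (n e) (i e) (j e))"
  unfolding mat_def by (intro fp_intros)

lemma fp_mark [fp_intros]: "fp x ==> fp n ==> fp i ==> fp j ==> fp (\<lambda>e. mark (x e) (n e) (i e) (j e))"
  unfolding mark_def by (intro fp_intros)

lemma fp_lower_pairs [fp_intros]: "fp n ==> fp (\<lambda>e. lower_pairs (n e))"
  unfolding lower_pairs_def by (intro fp_intros)

lemma embedding_alt:
  assumes "length us = h"
  shows "embedding h N d us \<longleftrightarrow> (\<forall>i\<in>set [0..<h]. \<forall>j\<in>set [0..<h].
     (i ~= j --> nth_default 0 us i ~= nth_default 0 us j) \<and>
     ((i, j) \<in> set (filter (\<lambda>p. N (fst p) (snd p)) (List.product [0..<h] [0..<h])) \<longleftrightarrow>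
        d (nth_default 0 us i) (nth_default 0 us j)))"
  using assms by (auto simp: embedding_def nth_default_nth)

lemma fp_checkn: "fp (\<lambda>p. checkn h N (fst p) (fst (snd p)) (snd (snd p)))"
proof -
  have "fp (\<lambda>p :: nat \<times> bool list \<times> bool list. \<forall>us\<in>set (List.n_lists h [0..<fst p]).
     \<not> (\<forall>i\<in>set [0..<h]. \<forall>j\<in>set [0..<h].
     (i ~= j --> nth_default 0 us i ~= nth_default 0 us j) \<and>
     ((i, j) \<in> set (filter (\<lambda>p. N (fst p) (snd p)) (List.product [0..<h] [0..<h])) \<longleftrightarrow>
        mat (fst (snd p)) (fst p) (nth_default 0 us i) (nth_default 0 us j) \<and>
        \<not> mark (snd (snd p)) (fst p) (nth_default 0 us i) (nth_default 0 us j))))"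
    by (intro fp_ball fp_n_lists fp_intros)
  then have *: "fp (\<lambda>p :: nat \<times> bool list \<times> bool list. \<forall>us\<in>set (List.n_lists h [0..<fst p]).
     \<not> embedding h N (\<lambda>i j. mat (fst (snd p)) (fst p) i j \<and> \<not> mark (snd (snd p)) (fst p) i j) us)"
  proof (rule fp_cong)
    fix p :: "nat \<times> bool list \<times> bool list"
    have "length us = h" if "us \<in> set (List.n_lists h [0..<fst p])" for us
      using that by (simp add: set_n_lists)
    then show "(\<forall>us\<in>set (List.n_lists h [0..<fst p]).
     \<not> (\<forall>i\<in>set [0..<h]. \<forall>j\<in>set [0..<h].
     (i ~= j --> nth_default 0 us i ~= nth_default 0 us j) \<and>
     ((i, j) \<in> set (filter (\<lambda>p. N (fst p) (snd p)) (List.product [0..<h] [0..<h])) \<longleftrightarrow>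
        mat (fst (snd p)) (fst p) (nth_default 0 us i) (nth_default 0 us j) \<and>
        \<not> mark (snd (snd p)) (fst p) (nth_default 0 us i) (nth_default 0 us j)))) \<longleftrightarrow>
     (\<forall>us\<in>set (List.n_lists h [0..<fst p]).
     \<not> embedding h N (\<lambda>i j. mat (fst (snd p)) (fst p) i j \<and> \<not> mark (snd (snd p)) (fst p) i j) us)"
      using embedding_alt[of _ h N "\<lambda>i j. mat (fst (snd p)) (fst p) i j \<and> \<not> mark (snd (snd p)) (fst p) i j"]
      by (intro ball_cong refl) blast
  qed
  show ?thesis unfolding checkn_def Let_def
    by (intro fp_conj *) (intro fp_intros fp_capval)+
qed

definition check :: "nat => (nat => nat => bool) => bool list => bool list => bool" where
  "check h N x w = checkn h N (lead x) x w"

lemma fp_check: "fp (\<lambda>p. check h N (fst p) (snd p))"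
proof -
  have "fp (\<lambda>p :: bool list \<times> bool list. lead (fst p))" unfolding lead_def by (intro fp_intros)
  then show ?thesis unfolding check_def
    by (intro fp_comp3[of "checkn h N", OF fp_checkn] fp_intros)
qed

lemma lower_pairs: "set (lower_pairs n) = {(i, j). j < i \<and> i < n}" "distinct (lower_pairs n)"
proof -
  show s: "set (lower_pairs n) = {(i, j). j < i \<and> i < n}" for n
    by (auto simp: lower_pairs_def)
  show "distinct (lower_pairs n)"
  proof (induction n)
    case (Suc n)
    have "lower_pairs (Suc n) = lower_pairs n @ map (\<lambda>j. (n, j)) [0..<n]" by (simp add: lower_pairs_def)
    then show ?case using Suc s[of n] by (auto simp: distinct_map inj_on_def)
  qed (simp add: lower_pairs_def)
qed

lemma delete_ngraph: "delete_edges (ngraph n a) F = ngraph n (\<lambda>i j. a i j \<and> {i, j} \<notin> F)"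
  unfolding delete_edges_def ngraph_def by auto

lemma count_marked:
  assumes "!!i j. i < n ==> j < n ==> a i j ==> a j i" "!!i. i < n ==> \<not> a i i" "!!i j. m i j ==> m j i"
  shows "length (filter (\<lambda>p. a (fst p) (snd p) \<and> m (fst p) (snd p)) (lower_pairs n)) =
     card {{i, j} | i j. i < n \<and> j < n \<and> a i j \<and> m i j}"
proof -
  let ?P = "{p \<in> set (lower_pairs n). a (fst p) (snd p) \<and> m (fst p) (snd p)}"
  have "length (filter (\<lambda>p. a (fst p) (snd p) \<and> m (fst p) (snd p)) (lower_pairs n)) = card ?P"
    using distinct_card[OF distinct_filter[OF lower_pairs(2)]] by (metis set_filter)
  also have "bij_betw (\<lambda>p. {fst p, snd p}) ?P {{i, j} | i j. i < n \<and> j < n \<and> a i j \<and> m i j}"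
    unfolding bij_betw_def
  proof
    show "inj_on (\<lambda>p. {fst p, snd p}) ?P"
      by (auto simp: inj_on_def lower_pairs(1) doubleton_eq_iff)
    show "(\<lambda>p. {fst p, snd p}) ` ?P = {{i, j} | i j. i < n \<and> j < n \<and> a i j \<and> m i j}"
    proof
      show "(\<lambda>p. {fst p, snd p}) ` ?P \<subseteq> {{i, j} | i j. i < n \<and> j < n \<and> a i j \<and> m i j}"
      proof
        fix e assume "e \<in> (\<lambda>p. {fst p, snd p}) ` ?P"
        then obtain p where p: "p \<in> ?P" "e = {fst p, snd p}" by blast
        have "fst p < n" "snd p < n" "a (fst p) (snd p)" "m (fst p) (snd p)" using p(1) by (auto simp: lower_pairs(1))
        then show "e \<in> {{i, j} | i j. i < n \<and> j < n \<and> a i j \<and> m i j}" using p(2) by blast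
      qed
      show "{{i, j} | i j. i < n \<and> j < n \<and> a i j \<and> m i j} \<subseteq> (\<lambda>p. {fst p, snd p}) ` ?P"
      proof
        fix e assume "e \<in> {{i, j} | i j. i < n \<and> j < n \<and> a i j \<and> m i j}"
        then obtain i j where e: "e = {i, j}" "i < n" "j < n" "a i j" "m i j" by blast
        have "i ~= j" using e assms(2) by metis
        then consider "j < i" | "i < j" by linarith
        then show "e \<in> (\<lambda>p. {fst p, snd p}) ` ?P"
        proof cases
          case 1
          then have "(i, j) \<in> ?P" using e by (simp add: lower_pairs(1))
          then show ?thesis using e(1) by (intro image_eqI[of _ _ "(i, j)"]) auto
        next
          case 2
          then have "(j, i) \<in> ?P"
            using e assms(1)[OF e(2,3,4)] assms(3)[OF e(5)] by (simp add: lower_pairs(1))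
          then show ?thesis using e(1) by (intro image_eqI[of _ _ "(j, i)"]) auto
        qed
      qed
    qed
  qed
  then have "card ?P = card {{i, j} | i j. i < n \<and> j < n \<and> a i j \<and> m i j}" by (rule bij_betw_same_card)
  finally show ?thesis .
qed

lemma enc_parts:
  assumes "x = enc_unary n @ concat (map (\<lambda>i. map (a i) [0..<n]) [0..<n]) @ kb"
  shows "lead x = n" "drop (Suc n + n * n) x = kb" "i < n ==> j < n ==> mat x n i j = a i j"
proof -
  let ?M = "concat (map (\<lambda>i. map (a i) [0..<n]) [0..<n])"
  have l: "length (enc_unary n) = Suc n" by (simp add: enc_unary_def)
  show "lead x = n" unfolding assms by (rule lead_enc)
  show "drop (Suc n + n * n) x = kb" unfolding assms using l matrix_length[of a n] by simp
  show "mat x n i j = a i j" if "i < n" "j < n"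
  proof -
    have "drop (Suc n) x = ?M @ kb" unfolding assms using l by simp
    moreover have "i * n + j < length ?M" using matrix_length[of a n] index_less[OF that] by simp
    ultimately show ?thesis using matrix_nth[OF that, of a]
      by (simp add: mat_def nth_default_def nth_append)
  qed
qed

lemma check_sound:
  assumes "pattern h r N" "check h N x w"
  obtains y where "y \<in> edge_deletion_instances" "x = enc_edge_deletion y" "free_edge_deletion (graph_on {..<h} N) y"
proof -
  define n where "n = lead x"
  define kb where "kb = drop (Suc n + n * n) x"
  let ?a = "mat x n" and ?m = "mark w n"
  let ?c = "length (filter (\<lambda>p. ?a (fst p) (snd p) \<and> ?m (fst p) (snd p)) (lower_pairs n))"
  let ?d = "\<lambda>i j. ?a i j \<and> \<not> ?m i j"
  have c: "x = enc_unary n @ concat (map (\<lambda>i. map (?a i) [0..<n]) [0..<n]) @ kb"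
    "!!i. i < n ==> \<not> ?a i i" "!!i j. i < n ==> j < n ==> ?a i j ==> ?a j i"
    "kb = [] \<or> hd (rev kb)" "?c <= capval ?c kb"
    "\<forall>us\<in>set (List.n_lists h [0..<n]). \<not> embedding h N ?d us"
    using assms(2) unfolding check_def checkn_def n_def[symmetric] kb_def[symmetric] Let_def
    by (simp_all del: upt_Suc)
  have m: "?m i j ==> ?m j i" for i j by (auto simp: mark_def)
  have k: "enc_binary (bval kb) = kb" using c(4) by (intro enc_binary_bval) (auto simp: hd_rev)
  let ?y = "(ngraph n ?a, bval kb)"
  let ?F = "{{i, j} | i j. i < n \<and> j < n \<and> ?a i j \<and> ?m i j}"
  have memF: "{i, j} \<in> ?F \<longleftrightarrow> ?a i j \<and> ?m i j" if "i < n" "j < n" for i j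
  proof
    assume "{i, j} \<in> ?F"
    then obtain i' j' where *: "{i, j} = {i', j'}" "i' < n" "j' < n" "?a i' j'" "?m i' j'" by blast
    then show "?a i j \<and> ?m i j" using c(3)[OF *(2-4)] m[OF *(5)] by (auto simp: doubleton_eq_iff)
  qed (use that in blast)
  show ?thesis
  proof (rule that)
    show "?y \<in> edge_deletion_instances"
      using ngraph_simple[of n ?a] c(2) by (auto simp: edge_deletion_instances_def ngraph_def)
    show "x = enc_edge_deletion ?y" using enc_ngraph[of n ?a "bval kb"] c(3) c(1) k by simp
    have "?F \<subseteq> edges (ngraph n ?a)" by (auto simp: ngraph_def)
    moreover have "card ?F <= bval kb"
      using count_marked[of n ?a ?m, OF c(3) c(2) m] c(5) by (simp add: capval)
    moreover have eq: "ngraph n (\<lambda>i j. ?a i j \<and> {i, j} \<notin> ?F) = ngraph n ?d"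
      by (rule ngraph_cong) (simp only: memF, blast)
    have "?d j i" if "i < n" "j < n" "?d i j" for i j using c(3)[OF that(1,2)] m that(3) by blast
    then have "induced_free (graph_on {..<h} N) (ngraph n ?d)"
      using induced_free_embedding[of N n ?d h] pattern.Nsym[OF assms(1)] c(6) by blast
    then have "induced_free (graph_on {..<h} N) (delete_edges (ngraph n ?a) ?F)"
      unfolding delete_ngraph eq .
    ultimately show "free_edge_deletion (graph_on {..<h} N) ?y"
      unfolding free_edge_deletion_def by blast
  qed
qed

lemma check_complete:
  assumes "pattern h r N" "y \<in> edge_deletion_instances" "free_edge_deletion (graph_on {..<h} N) y"
  obtains w where "length w <= length (enc_edge_deletion y) ^ 2" "check h N (enc_edge_deletion y) w"
proof -
  obtain n a k where y: "y = (ngraph n a, k)" "!!i j. a i j ==> a j i" "!!i. \<not> a i i"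
    using instance_ngraph[OF assms(2)] by metis
  obtain F where F: "F \<subseteq> edges (ngraph n a)" "card F <= k" "induced_free (graph_on {..<h} N) (delete_edges (ngraph n a) F)"
    using assms(3) unfolding y free_edge_deletion_def by auto
  define x where "x = enc_edge_deletion y"
  have x: "x = enc_unary n @ concat (map (\<lambda>i. map (a i) [0..<n]) [0..<n]) @ enc_binary k"
    unfolding x_def y(1) by (rule enc_ngraph) (rule y(2))
  note ep = enc_parts[OF x]
  define w where "w = concat (map (\<lambda>i. map (\<lambda>j. {i, j} \<in> F) [0..<n]) [0..<n])"
  have lw: "length w = n * n" unfolding w_def by (rule matrix_length)
  have mw: "mark w n i j \<longleftrightarrow> {i, j} \<in> F" if "i < n" "j < n" for i j
  proof -
    have "nth_default False w (p * n + q) = ({p, q} \<in> F)" if "p < n" "q < n" for p q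
      using matrix_nth[OF that, of "\<lambda>i j. {i, j} \<in> F"] index_less[OF that] lw
      by (simp add: nth_default_def w_def[symmetric])
    then show ?thesis using that by (auto simp: mark_def insert_commute)
  qed
  have md: "mark w n j i" if "mark w n i j" for i j using that by (auto simp: mark_def)
  let ?c = "length (filter (\<lambda>p. mat x n (fst p) (snd p) \<and> mark w n (fst p) (snd p)) (lower_pairs n))"
  have "?c = card {{i, j} | i j. i < n \<and> j < n \<and> mat x n i j \<and> mark w n i j}"
    by (rule count_marked; (rule md; assumption)?) (simp_all add: ep(3) y)
  also have "{{i, j} | i j. i < n \<and> j < n \<and> mat x n i j \<and> mark w n i j} = F"
  proof
    show "F \<subseteq> {{i, j} | i j. i < n \<and> j < n \<and> mat x n i j \<and> mark w n i j}"
    proof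
      fix e assume e: "e \<in> F"
      then have "e \<in> edges (ngraph n a)" using F(1) by blast
      then obtain i j where "e = {i, j}" "i < n" "j < n" "a i j" unfolding ngraph_def by auto
      then show "e \<in> {{i, j} | i j. i < n \<and> j < n \<and> mat x n i j \<and> mark w n i j}" using ep(3) mw e by blast
    qed
  qed (use ep(3) mw in auto)
  finally have c: "?c <= k" using F(2) by simp
  have "checkn h N n x w"
    unfolding checkn_def Let_def ep(2)
  proof (intro conjI)
    have "concat (map (\<lambda>i. map (\<lambda>j. mat x n i j) [0..<n]) [0..<n]) = concat (map (\<lambda>i. map (a i) [0..<n]) [0..<n])"
      by (intro map_cong_concat map_cong refl) (use ep(3) in auto)
    then show "x = enc_unary n @ concat (map (\<lambda>i. map (\<lambda>j. mat x n i j) [0..<n]) [0..<n]) @ enc_binary k"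
      using x by simp
    show "\<forall>i\<in>set [0..<n]. \<not> mat x n i i \<and> (\<forall>j\<in>set [0..<n]. mat x n i j --> mat x n j i)"
      using y(2,3) by (simp add: ep(3))
    show "enc_binary k = [] \<or> hd (rev (enc_binary k))" using enc_binary_last[of k] by (auto simp: hd_rev)
    show "?c <= capval ?c (enc_binary k)" using c by (simp add: capval bval_enc_binary)
    have "induced_free (graph_on {..<h} N) (ngraph n (\<lambda>i j. a i j \<and> {i, j} \<notin> F))"
      using F(3) unfolding delete_ngraph .
    moreover have "ngraph n (\<lambda>i j. a i j \<and> {i, j} \<notin> F) = ngraph n (\<lambda>i j. mat x n i j \<and> \<not> mark w n i j)"
      by (rule ngraph_cong) (simp only: ep(3) mw)
    ultimately have fr: "induced_free (graph_on {..<h} N) (ngraph n (\<lambda>i j. mat x n i j \<and> \<not> mark w n i j))" by simp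
    have "mat x n j i \<and> \<not> mark w n j i" if "i < n" "j < n" "mat x n i j \<and> \<not> mark w n i j" for i j
      using ep(3) y(2) md that by blast
    then show "\<forall>us\<in>set (List.n_lists h [0..<n]). \<not> embedding h N (\<lambda>i j. mat x n i j \<and> \<not> mark w n i j) us"
      using induced_free_embedding[of N n "\<lambda>i j. mat x n i j \<and> \<not> mark w n i j" h]
        pattern.Nsym[OF assms(1)] fr by blast
  qed
  then have "check h N x w" unfolding check_def ep(1) .
  moreover have "n <= length x" unfolding x by (simp add: enc_unary_def)
  then have "length w <= length x ^ 2" unfolding lw power2_eq_square by (intro mult_le_mono)
  ultimately show ?thesis using that unfolding x_def by blast
qed

lemma language_in_NP:
  assumes "pattern h r N" "graph_iso (graph_on {..<h} N) R"
  shows "in_NP (free_edge_deletion_language R)"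
proof -
  obtain M and q :: "nat poly" where M: "wf_tm M" "2 <= ntapes M"
    "!!x w. \<exists>t\<le>poly q (length x + length w). fst (run M [x, w] t) = (if check h N x w then accept M else reject M)"
    using fp_decides[OF fp_check, of h N] by metis
  have lang: "x \<in> free_edge_deletion_language R \<longleftrightarrow>
      (\<exists>w. length w <= poly (monom 1 2) (length x) \<and> check h N x w)" for x
  proof
    assume "x \<in> free_edge_deletion_language R"
    then obtain y where y: "y \<in> edge_deletion_instances" "free_edge_deletion R y" "x = enc_edge_deletion y"
      unfolding free_edge_deletion_language_def by blast
    obtain w where "length w <= length x ^ 2" "check h N x w"
      using check_complete[OF assms(1) y(1)] y(2,3) unfolding free_edge_deletion_pattern[OF assms(2)] by metis
    then show "\<exists>w. length w <= poly (monom 1 2) (length x) \<and> check h N x w" by (auto simp: poly_monom)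
  next
    assume "\<exists>w. length w <= poly (monom 1 2) (length x) \<and> check h N x w"
    then obtain w where "check h N x w" by blast
    from check_sound[OF assms(1) this] show "x \<in> free_edge_deletion_language R"
      unfolding free_edge_deletion_language_def free_edge_deletion_pattern[OF assms(2)] by blast
  qed
  have acc: "(\<exists>t. fst (run M [x, w] t) = accept M) \<longleftrightarrow> check h N x w" for x w
    using M(3)[of x w] run_accept_unique[OF M(1)] by blast
  have halt: "\<exists>t \<le> poly q (length x + length w). halted M (run M [x, w] t)" for x w
    using M(3)[of x w] by (auto simp: halted_def split: if_splits)
  show ?thesis
    unfolding in_NP_def lang using M(1,2) halt acc by blast
qed

section \<open>Reducing a verifier to 3-SAT\<close>

definition holds :: "('v => bool) => (bool \<times> 'v) list => bool" where
  "holds \<alpha> C \<longleftrightarrow> (\<exists>(b, v)\<in>set C. \<alpha> v = b)"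

lemma satP_holds: "satP \<phi> \<longleftrightarrow> (\<exists>\<alpha>. \<forall>C\<in>set \<phi>. holds \<alpha> C)"
  by (simp add: satP_def holds_def)

lemma holds_simps [simp]: "holds \<alpha> [] = False" "holds \<alpha> (l # C) \<longleftrightarrow> \<alpha> (snd l) = fst l \<or> holds \<alpha> C"
  by (simp_all add: holds_def case_prod_beta)

lemma ball_lists:
  "(\<forall>C\<in>set (concat (map f xs)). P C) \<longleftrightarrow> (\<forall>x\<in>set xs. \<forall>C\<in>set (f x). P C)"
  "(\<forall>C\<in>set (map g xs). P C) \<longleftrightarrow> (\<forall>x\<in>set xs. P (g x))"
  "(\<forall>x\<in>set (filter Q xs). R x) \<longleftrightarrow> (\<forall>x\<in>set xs. Q x --> R x)"
  "(\<forall>i\<in>set [0..<n]. S i) \<longleftrightarrow> (\<forall>i<n. S i)"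
  "(\<forall>C\<in>set (ys @ zs). P C) \<longleftrightarrow> (\<forall>C\<in>set ys. P C) \<and> (\<forall>C\<in>set zs. P C)"
  "(\<forall>C\<in>set (y # ys). P C) \<longleftrightarrow> P y \<and> (\<forall>C\<in>set ys. P C)"
  "(\<forall>C\<in>set []. P C) \<longleftrightarrow> True"
  by auto

subsection \<open>Splitting long clauses\<close>

text \<open>The new variable \<open>[1, c, i]\<close> says that none of the first \<open>i\<close> literals of clause number \<open>c\<close> is true;
  an old variable \<open>v\<close> becomes \<open>0 # v\<close>.\<close>

definition split3 :: "nat => (bool \<times> nat list) list => (bool \<times> nat list) list list" where
  "split3 c C = [[(True, [1, c, 0])]] @
     map (\<lambda>i. [(False, [1, c, i]), (fst (nth_default (False, []) C i), 0 # snd (nth_default (False, []) C i)),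
        (True, [1, c, Suc i])]) [0..<length C] @ [[(False, [1, c, length C])]]"

definition to3 :: "(bool \<times> nat list) list list => (bool \<times> nat list) list list" where
  "to3 \<phi> = concat (map (\<lambda>c. split3 c (nth_default [] \<phi> c)) [0..<length \<phi>])"

lemma to3_ok: "clauses_ok (to3 \<phi>)"
  by (auto simp: clauses_ok_def to3_def split3_def)

lemma split3_holds: "(\<forall>D\<in>set (split3 c C). holds \<alpha> D) \<longleftrightarrow>
   \<alpha> [1, c, 0] \<and> \<not> \<alpha> [1, c, length C] \<and>
   (\<forall>i<length C. \<alpha> [1, c, i] --> \<alpha> (0 # snd (C ! i)) = fst (C ! i) \<or> \<alpha> [1, c, Suc i])"
  by (auto simp: split3_def nth_default_nth)

text \<open>If all literals of a clause were false, the truth of \<open>[1, c, 0]\<close> would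
  travel along the chain to its end, where it is forbidden. Conversely each link is true exactly as
  long as no true literal has been met.\<close>

lemma to3_sat: "satP (to3 \<phi>) \<longleftrightarrow> satP \<phi>"
proof
  assume "satP (to3 \<phi>)"
  then obtain \<alpha> where \<alpha>: "\<forall>C\<in>set (to3 \<phi>). holds \<alpha> C" unfolding satP_holds by blast
  have "holds (\<lambda>v. \<alpha> (0 # v)) C" if C: "C \<in> set \<phi>" for C
  proof (rule ccontr)
    assume no: "\<not> holds (\<lambda>v. \<alpha> (0 # v)) C"
    obtain c where c: "c < length \<phi>" "C = \<phi> ! c" using C by (metis in_set_conv_nth)
    have "\<forall>D\<in>set (split3 c C). holds \<alpha> D"
      using \<alpha> c unfolding to3_def by (auto simp: nth_default_nth)
    then have z: "\<alpha> [1, c, 0]" "\<not> \<alpha> [1, c, length C]"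
      "!!i. i < length C ==> \<alpha> [1, c, i] ==> \<alpha> (0 # snd (C ! i)) = fst (C ! i) \<or> \<alpha> [1, c, Suc i]"
      unfolding split3_holds by blast+
    have "i <= length C ==> \<alpha> [1, c, i]" for i
    proof (induction i)
      case (Suc i)
      have "\<alpha> (0 # snd (C ! i)) ~= fst (C ! i)"
        using no Suc.prems unfolding holds_def by (force simp: case_prod_beta)
      then show ?case using z(3)[of i] Suc by auto
    qed (use z in simp)
    then show False using z(2) by blast
  qed
  then show "satP \<phi>" unfolding satP_holds by blast
next
  assume "satP \<phi>"
  then obtain \<alpha> where \<alpha>: "\<forall>C\<in>set \<phi>. holds \<alpha> C" unfolding satP_holds by blast
  define \<beta> where "\<beta> u = (if hd u = 0 then \<alpha> (tl u)
     else \<not> (\<exists>j<u ! 2. \<alpha> (snd (\<phi> ! (u ! 1) ! j)) = fst (\<phi> ! (u ! 1) ! j)))" for u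
  have "holds \<beta> D" if D: "D \<in> set (to3 \<phi>)" for D
  proof -
    obtain c where "c \<in> set [0..<length \<phi>]" "D \<in> set (split3 c (nth_default [] \<phi> c))"
      using D unfolding to3_def set_concat set_map by blast
    then have c: "c < length \<phi>" "D \<in> set (split3 c (\<phi> ! c))" by (auto simp: nth_default_nth)
    let ?C = "\<phi> ! c"
    have b: "\<beta> [1, c, i] \<longleftrightarrow> \<not> (\<exists>j<i. \<alpha> (snd (?C ! j)) = fst (?C ! j))" "\<beta> (0 # v) = \<alpha> v" for i v
      by (auto simp: \<beta>_def)
    have "holds \<alpha> ?C" using \<alpha> c(1) by simp
    then have "\<exists>j<length ?C. \<alpha> (snd (?C ! j)) = fst (?C ! j)"
      unfolding holds_def by (auto simp: in_set_conv_nth) (metis fst_conv snd_conv)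
    then have "\<forall>D\<in>set (split3 c ?C). holds \<beta> D"
      unfolding split3_holds b by (auto simp: less_Suc_eq)
    then show ?thesis using c(2) by blast
  qed
  then show "satP (to3 \<phi>)" unfolding satP_holds by blast
qed

lemma fp_to3: "fp to3"
  unfolding to3_def split3_def by (intro fp_intros)

lemma fp_poly: "fp n ==> fp (\<lambda>e. poly p (n e) :: nat)"
proof (induction p)
  case (pCons a p)
  then show ?case by (auto intro!: fp_intros)
qed (simp add: fp_const)

section \<open>Configurations of a well-formed machine and its transition table\<close>

lemma step_nonhalted:
  assumes "wf_tm M" "\<not> halted M (q, ts)" "q < nstates M" "length ts = ntapes M" "set (map read_tape ts) \<subseteq> {..<nsyms M}"
    and "delta M q (map read_tape ts) = (q', as)"
  shows "step M (q, ts) = (q', map2 act_tape ts as)" "q' < nstates M" "length as = ntapes M" "fst ` set as \<subseteq> {..<nsyms M}"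
proof -
  have "\<forall>q < nstates M. \<forall>xs. length xs = ntapes M \<and> set xs \<subseteq> {..<nsyms M} -->
     (case delta M q xs of (q', as) => q' < nstates M \<and> length as = ntapes M \<and> fst ` set as \<subseteq> {..<nsyms M})"
    using assms(1) unfolding wf_tm_def by (elim conjE)
  from this[rule_format, OF assms(3), of "map read_tape ts"] assms(4,5)
  have "case delta M q (map read_tape ts) of (q', as) =>
     q' < nstates M \<and> length as = ntapes M \<and> fst ` set as \<subseteq> {..<nsyms M}" by simp
  then show "q' < nstates M" "length as = ntapes M" "fst ` set as \<subseteq> {..<nsyms M}"
    unfolding assms(6) prod.case by blast+
  show "step M (q, ts) = (q', map2 act_tape ts as)"
    using assms(2,6) by (simp add: step_def)
qed

definition good_cfg :: "tm => config => bool" where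
  "good_cfg M c \<longleftrightarrow> fst c < nstates M \<and> length (snd c) = ntapes M \<and>
     (\<forall>i<ntapes M. \<forall>p. fst (snd c ! i) p < nsyms M)"

lemma good_read: "good_cfg M c ==> set (map read_tape (snd c)) \<subseteq> {..<nsyms M}"
  by (auto simp: good_cfg_def in_set_conv_nth read_tape_def split: prod.splits) (metis fst_conv)

lemma step_good:
  assumes "wf_tm M" "good_cfg M c"
  shows "good_cfg M (step M c)"
    "i < ntapes M ==> \<bar>snd (snd (step M c) ! i)\<bar> <= \<bar>snd (snd c ! i)\<bar> + 1"
    "i < ntapes M ==> p ~= snd (snd c ! i) ==> fst (snd (step M c) ! i) p = fst (snd c ! i) p"
proof -
  obtain q' as where d: "delta M (fst c) (map read_tape (snd c)) = (q', as)" by fastforce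
  have s: "step M c = (q', map2 act_tape (snd c) as)" "q' < nstates M" "length as = ntapes M" "fst ` set as \<subseteq> {..<nsyms M}"
    if "\<not> halted M c"
    using step_nonhalted[OF assms(1), of "fst c" "snd c" q' as] that d assms(2) good_read[OF assms(2)]
    by (auto simp: good_cfg_def)
  have nth: "snd (step M c) ! i = act_tape (snd c ! i) (as ! i)" if "\<not> halted M c" "i < ntapes M" for i
    using s[OF that(1)] that assms(2) by (simp add: good_cfg_def)
  have act: "act_tape tp a = ((fst tp)(snd tp := fst a), snd tp + shift (snd a))" for tp a
    by (simp add: act_tape_def case_prod_beta)
  have as: "fst (as ! i) < nsyms M" if "\<not> halted M c" "i < ntapes M" for i
    using s(3,4)[OF that(1)] that(2) by (force simp: subset_iff)
  show "good_cfg M (step M c)"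
  proof (cases "halted M c")
    case True
    then show ?thesis using assms(2) by (simp add: step_def)
  next
    case False
    have "fst (snd (step M c) ! i) p < nsyms M" if "i < ntapes M" for i p
      using assms(2) as[OF False that] that unfolding nth[OF False that] act by (simp add: good_cfg_def)
    then show ?thesis using s[OF False] assms(2) by (simp add: good_cfg_def)
  qed
  have sh: "\<bar>shift m\<bar> <= 1" for m by (cases m) auto
  show "\<bar>snd (snd (step M c) ! i)\<bar> <= \<bar>snd (snd c ! i)\<bar> + 1" if "i < ntapes M"
  proof (cases "halted M c")
    case True
    then show ?thesis by (simp add: step_def)
  next
    case False
    then show ?thesis using nth[OF False that] sh[of "snd (as ! i)"] by (simp add: act)
  qed
  show "fst (snd (step M c) ! i) p = fst (snd c ! i) p" if "i < ntapes M" "p ~= snd (snd c ! i)"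
  proof (cases "halted M c")
    case True
    then show ?thesis by (simp add: step_def)
  next
    case False
    then show ?thesis using nth[OF False that(1)] that(2) by (simp add: act)
  qed
qed

lemma initial_good:
  assumes "wf_tm M"
  shows "good_cfg M (initial M xs)"
proof -
  have b: "bit_sym b < nsyms M" for b using assms by (cases b) (auto simp: wf_tm_def)
  have "fst (input_tape x) p < nsyms M" for x p
    using b[of "x ! nat p"] b[of True] by (auto simp: input_tape_def)
  then show ?thesis using assms by (auto simp: good_cfg_def initial_def wf_tm_def)
qed

lemma run_good:
  assumes "wf_tm M"
  shows "good_cfg M (run M xs t)" "i < ntapes M ==> \<bar>snd (snd (run M xs t) ! i)\<bar> <= int t"
proof (induction t)
  case 0
  { case 1 show ?case using initial_good[OF assms] by (simp add: run_def) }
  { case 2 then show ?case by (simp add: run_def initial_def input_tape_def) }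
next
  case (Suc t)
  have s: "run M xs (Suc t) = step M (run M xs t)" by (simp add: run_def)
  { case 1 show ?case unfolding s by (rule step_good(1)[OF assms Suc(1)]) }
  { case 2 then show ?case unfolding s using step_good(2)[OF assms Suc(1) 2] Suc(2)[OF 2] by simp }
qed

locale wf_machine =
  fixes M :: tm
  assumes wf: "wf_tm M"
begin

abbreviation "K \<equiv> ntapes M"

definition mvc :: "move => nat" where
  "mvc m = (case m of MoveLeft => 0 | Stay => 1 | MoveRight => 2)"

text \<open>The transition function as a finite list, which programs can contain as a constant.
  Halting states are left out, so nothing is derived from a halted configuration; moves are shifted
  by one to become natural numbers.\<close>

definition table :: "(nat \<times> nat list \<times> nat \<times> nat list \<times> nat list) list" where
  "table = map (\<lambda>(s, ss). (s, ss, fst (delta M s ss), map fst (snd (delta M s ss)), map (mvc \<circ> snd) (snd (delta M s ss))))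
     (List.product (filter (\<lambda>s. s ~= accept M \<and> s ~= reject M) [0..<nstates M]) (List.n_lists K [0..<nsyms M]))"

abbreviation "hdp c i \<equiv> snd (snd c ! i)"
abbreviation "cont c i \<equiv> fst (snd c ! i)"

lemma table_entry:
  assumes "good_cfg M c" "\<not> halted M c"
  obtains d where "d \<in> set table" "fst d = fst c" "!!i. i < K ==> nth_default 0 (fst (snd d)) i = cont c i (hdp c i)"
    "fst (snd (snd d)) = fst (step M c)"
    "!!i. i < K ==> nth_default 0 (fst (snd (snd (snd d)))) i = cont (step M c) i (hdp c i)"
    "!!i. i < K ==> int (nth_default 0 (snd (snd (snd (snd d)))) i) - 1 = hdp (step M c) i - hdp c i"
proof -
  let ?ss = "map read_tape (snd c)"
  obtain q' as where d: "delta M (fst c) ?ss = (q', as)" by fastforce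
  have g: "fst c < nstates M" "length (snd c) = K" using assms(1) by (auto simp: good_cfg_def)
  note s = step_nonhalted[OF wf, of "fst c" "snd c" q' as, unfolded prod.collapse, OF assms(2) g good_read[OF assms(1)] d]
  let ?d = "(fst c, ?ss, q', map fst as, map (mvc \<circ> snd) as)"
  have "?ss \<in> set (List.n_lists K [0..<nsyms M])"
    using g good_read[OF assms(1)] unfolding set_n_lists set_upt atLeast0LessThan by simp
  then have "(fst c, ?ss) \<in> set (List.product (filter (\<lambda>s. s ~= accept M \<and> s ~= reject M) [0..<nstates M])
      (List.n_lists K [0..<nsyms M]))"
    using g assms(2) by (auto simp: halted_def)
  then have "?d \<in> set table" unfolding table_def set_map using d by (intro image_eqI[of _ _ "(fst c, ?ss)"]) auto
  moreover have nth: "snd (step M c) ! i = ((cont c i)(hdp c i := fst (as ! i)), hdp c i + shift (snd (as ! i)))" if "i < K" for i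
    using s that g by (simp add: act_tape_def case_prod_beta)
  have mv: "int (mvc m) - 1 = shift m" for m by (cases m) (auto simp: mvc_def)
  have "nth_default 0 ?ss i = cont c i (hdp c i)" if "i < K" for i
    using that g by (simp add: nth_default_nth read_tape_def case_prod_beta)
  moreover have "nth_default 0 (map fst as) i = cont (step M c) i (hdp c i)" if "i < K" for i
    using that s(3) nth[OF that] by (simp add: nth_default_nth)
  moreover have "int (nth_default 0 (map (mvc \<circ> snd) as) i) - 1 = hdp (step M c) i - hdp c i" if "i < K" for i
    using that s(3) nth[OF that] by (simp add: nth_default_nth mv)
  ultimately show ?thesis using that[of ?d] s(1) by simp
qed

text \<open>Determinism: the entry for the current state and scanned symbols is unique, so any entry
  that matches describes the step.\<close>

lemma table_entry_rev:
  assumes "d \<in> set table" "good_cfg M c" "fst d = fst c" "!!i. i < K ==> nth_default 0 (fst (snd d)) i = cont c i (hdp c i)"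
  shows "fst (snd (snd d)) = fst (step M c)"
    "i < K ==> nth_default 0 (fst (snd (snd (snd d)))) i = cont (step M c) i (hdp c i)"
    "i < K ==> int (nth_default 0 (snd (snd (snd (snd d)))) i) - 1 = hdp (step M c) i - hdp c i"
proof -
  obtain s ss where d: "d = (s, ss, fst (delta M s ss), map fst (snd (delta M s ss)), map (mvc \<circ> snd) (snd (delta M s ss)))"
    "s ~= accept M" "s ~= reject M" "length ss = K"
    using assms(1) unfolding table_def by (auto simp: set_n_lists)
  have nh: "\<not> halted M c" using d assms(3) by (auto simp: halted_def)
  obtain d' where d': "d' \<in> set table" "fst d' = fst c" "!!i. i < K ==> nth_default 0 (fst (snd d')) i = cont c i (hdp c i)"
    "fst (snd (snd d')) = fst (step M c)"
    "!!i. i < K ==> nth_default 0 (fst (snd (snd (snd d')))) i = cont (step M c) i (hdp c i)"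
    "!!i. i < K ==> int (nth_default 0 (snd (snd (snd (snd d')))) i) - 1 = hdp (step M c) i - hdp c i"
    using table_entry[OF assms(2) nh] by metis
  obtain s' ss' where e: "d' = (s', ss', fst (delta M s' ss'), map fst (snd (delta M s' ss')), map (mvc \<circ> snd) (snd (delta M s' ss')))"
    "length ss' = K"
    using d'(1) unfolding table_def by (auto simp: set_n_lists)
  have "s = s'" using d(1) e(1) assms(3) d'(2) by simp
  moreover have "ss = ss'"
  proof (rule nth_equalityI)
    fix i assume "i < length ss"
    then show "ss ! i = ss' ! i" using assms(4)[of i] d'(3)[of i] d e by (simp add: nth_default_nth)
  qed (use d e in simp)
  ultimately have "d = d'" using d(1) e(1) by simp
  then show "fst (snd (snd d)) = fst (step M c)"
    "i < K ==> nth_default 0 (fst (snd (snd (snd d)))) i = cont (step M c) i (hdp c i)"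
    "i < K ==> int (nth_default 0 (snd (snd (snd (snd d)))) i) - 1 = hdp (step M c) i - hdp c i"
    using d' by blast+
qed

end

section \<open>The tableau of an accepting computation\<close>

locale verifier = wf_machine +
  fixes p q :: "nat poly"
  assumes K2: "2 <= ntapes M"
    and halts: "\<exists>t \<le> poly q (length x + length w). halted M (run M [x, w] t)"
begin

definition lw :: "bool list => nat" where "lw x = poly p (length x)"
definition tb :: "bool list => nat" where "tb x = poly q (length x + lw x)"

text \<open>Variables: \<open>[0, t, s]\<close> means that the state at time \<open>t\<close> is \<open>s\<close>, \<open>[1, t, i, a]\<close> that head \<open>i\<close> is at
  cell \<open>a\<close>, \<open>[2, t, i, a, s]\<close> that cell \<open>a\<close> of tape \<open>i\<close> contains \<open>s\<close>, \<open>[3, j]\<close> that the certificate has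
  length at most \<open>j\<close>, and \<open>[4, j]\<close> is its bit \<open>j\<close>. Cells are numbered from \<open>- T\<close>, that is, shifted by the
  time bound \<open>T\<close>.\<close>

definition prem :: "nat => nat \<times> nat list \<times> nat \<times> nat list \<times> nat list => nat list => nat list list" where
  "prem t d ps = [0, t, fst d] # map (\<lambda>i. [1, t, i, nth_default 0 ps i]) [0..<K] @
     map (\<lambda>i. [2, t, i, nth_default 0 ps i, nth_default 0 (fst (snd d)) i]) [0..<K]"

definition concl :: "nat => nat \<times> nat list \<times> nat \<times> nat list \<times> nat list => nat list => nat list list" where
  "concl t d ps = [0, Suc t, fst (snd (snd d))] #
     map (\<lambda>i. [1, Suc t, i, nth_default 0 ps i + nth_default 0 (snd (snd (snd (snd d)))) i - 1]) [0..<K] @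
     map (\<lambda>i. [2, Suc t, i, nth_default 0 ps i, nth_default 0 (fst (snd (snd (snd d)))) i]) [0..<K]"

definition isym :: "bool list => nat => nat => nat => nat" where
  "isym x T i a = (if i = 0 \<and> T <= a \<and> a < T + length x
     then (if nth_default False x (a - T) then 2 else 1) else 0)"

definition cl_init :: "bool list => nat => (bool \<times> nat list) list list" where
  "cl_init x T = [[(True, [0, 0, start M])]] @ map (\<lambda>i. [(True, [1, 0, i, T])]) [0..<K] @
     concat (map (\<lambda>i. map (\<lambda>a. [(True, [2, 0, i, a, isym x T i a])]) [0..<Suc (T + T)])
       (filter (\<lambda>i. i ~= 1) [0..<K]))"

definition cl_cert :: "nat => nat => (bool \<times> nat list) list list" where
  "cl_cert L T = map (\<lambda>a. [(True, [2, 0, 1, a, 0])]) (filter (\<lambda>a. a < T \<or> T + L <= a) [0..<Suc (T + T)]) @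
     concat (map (\<lambda>j. [[(False, [3, j]), (True, [3, Suc j])], [(False, [3, j]), (True, [2, 0, 1, T + j, 0])],
        [(True, [3, j]), (False, [4, j]), (True, [2, 0, 1, T + j, 2])],
        [(True, [3, j]), (True, [4, j]), (True, [2, 0, 1, T + j, 1])]]) [0..<L])"

definition cl_step :: "nat => (bool \<times> nat list) list list" where
  "cl_step T = concat (map (\<lambda>t. concat (map (\<lambda>d. concat (map (\<lambda>ps.
     map (\<lambda>c. map (\<lambda>a. (False, a)) (prem t d ps) @ [(True, c)]) (concl t d ps))
       (List.n_lists K [0..<Suc (T + T)]))) table)) [0..<T])"

definition cl_inert :: "nat => (bool \<times> nat list) list list" where
  "cl_inert T = concat (map (\<lambda>t. concat (map (\<lambda>i. concat (map (\<lambda>a. concat (map (\<lambda>b.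
     map (\<lambda>s. [(False, [1, t, i, b]), (False, [2, t, i, a, s]), (True, [2, Suc t, i, a, s])]) [0..<nsyms M])
       (filter (\<lambda>b. b ~= a) [0..<Suc (T + T)]))) [0..<Suc (T + T)])) [0..<K])) [0..<T])"

definition cl_rej :: "nat => (bool \<times> nat list) list list" where
  "cl_rej T = map (\<lambda>t. [(False, [0, t, reject M])]) [0..<Suc T]"

definition formula :: "bool list => (bool \<times> nat list) list list" where
  "formula x = cl_init x (tb x) @ cl_cert (lw x) (tb x) @ cl_step (tb x) @ cl_inert (tb x) @ cl_rej (tb x)"

lemma fp_formula: "fp formula"
proof -
  have tb: "fp tb" and lw: "fp lw" unfolding tb_def lw_def by (intro fp_poly fp_intros)+
  have 1: "fp (\<lambda>x. cl_init x (tb x))" unfolding cl_init_def isym_def by (intro fp_intros fp_comp[OF tb])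
  have 2: "fp (\<lambda>x. cl_cert (lw x) (tb x))" unfolding cl_cert_def by (intro fp_intros fp_comp[OF tb] fp_comp[OF lw])
  have 3: "fp (\<lambda>x. cl_step (tb x))" unfolding cl_step_def prem_def concl_def
    by (intro fp_intros fp_n_lists fp_comp[OF tb])
  have 4: "fp (\<lambda>x. cl_inert (tb x))" unfolding cl_inert_def by (intro fp_intros fp_comp[OF tb])
  have 5: "fp (\<lambda>x. cl_rej (tb x))" unfolding cl_rej_def by (intro fp_intros fp_comp[OF tb])
  show ?thesis unfolding formula_def by (intro fp_append 1 2 3 4 5)
qed

lemma holds_horn: "holds \<alpha> (map (\<lambda>a. (False, a)) P @ [(True, c)]) \<longleftrightarrow> ((\<forall>a\<in>set P. \<alpha> a) --> \<alpha> c)"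
  by (auto simp: holds_def)

lemma init_holds: "(\<forall>C\<in>set (cl_init x T). holds \<alpha> C) \<longleftrightarrow>
    \<alpha> [0, 0, start M] \<and> (\<forall>i<K. \<alpha> [1, 0, i, T]) \<and>
    (\<forall>i<K. i ~= 1 --> (\<forall>a\<le>T + T. \<alpha> [2, 0, i, a, isym x T i a]))"
  unfolding cl_init_def
  by (simp only: ball_lists holds_simps holds_horn fst_conv snd_conv less_Suc_eq_le simp_thms disj_not1 imp_disjL)

lemma cert_holds: "(\<forall>C\<in>set (cl_cert L T). holds \<alpha> C) \<longleftrightarrow>
    (\<forall>a\<le>T + T. a < T \<or> T + L <= a --> \<alpha> [2, 0, 1, a, 0]) \<and>
    (\<forall>j<L. (\<alpha> [3, j] --> \<alpha> [3, Suc j]) \<and> (\<alpha> [3, j] --> \<alpha> [2, 0, 1, T + j, 0]) \<and>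
       (\<not> \<alpha> [3, j] --> \<alpha> [4, j] --> \<alpha> [2, 0, 1, T + j, 2]) \<and>
       (\<not> \<alpha> [3, j] --> \<not> \<alpha> [4, j] --> \<alpha> [2, 0, 1, T + j, 1]))"
  unfolding cl_cert_def
  by (simp only: ball_lists holds_simps holds_horn fst_conv snd_conv less_Suc_eq_le simp_thms disj_not1 imp_disjL) blast

lemma step_holds: "(\<forall>C\<in>set (cl_step T). holds \<alpha> C) \<longleftrightarrow>
    (\<forall>t<T. \<forall>d\<in>set table. \<forall>ps\<in>set (List.n_lists K [0..<Suc (T + T)]).
       (\<forall>a\<in>set (prem t d ps). \<alpha> a) --> (\<forall>c\<in>set (concl t d ps). \<alpha> c))"
  unfolding cl_step_def
  by (simp only: ball_lists holds_simps holds_horn fst_conv snd_conv less_Suc_eq_le simp_thms disj_not1 imp_disjL) blast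

lemma inert_holds: "(\<forall>C\<in>set (cl_inert T). holds \<alpha> C) \<longleftrightarrow>
    (\<forall>t<T. \<forall>i<K. \<forall>a\<le>T + T. \<forall>b\<le>T + T. b ~= a --> (\<forall>s<nsyms M.
       \<alpha> [1, t, i, b] --> \<alpha> [2, t, i, a, s] --> \<alpha> [2, Suc t, i, a, s]))"
  unfolding cl_inert_def
  by (simp only: ball_lists holds_simps holds_horn fst_conv snd_conv less_Suc_eq_le simp_thms disj_not1 imp_disjL)

lemma rej_holds: "(\<forall>C\<in>set (cl_rej T). holds \<alpha> C) \<longleftrightarrow> (\<forall>t\<le>T. \<not> \<alpha> [0, t, reject M])"
  unfolding cl_rej_def
  by (simp only: ball_lists holds_simps holds_horn fst_conv snd_conv less_Suc_eq_le simp_thms disj_not1 imp_disjL)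

lemma initial_tapes:
  "fst (initial M [x, w]) = start M" "i < K ==> hdp (initial M [x, w]) i = 0"
  "i < K ==> cont (initial M [x, w]) i a =
     (if i = 0 \<and> 0 <= a \<and> a < int (length x) then bit_sym (x ! nat a)
      else if i = 1 \<and> 0 <= a \<and> a < int (length w) then bit_sym (w ! nat a) else 0)"
  by (auto simp: initial_def input_tape_def less_Suc_eq numeral_2_eq_2)

lemma formula_complete:
  assumes "length w <= lw x" "fst (run M [x, w] u) = accept M"
  shows "satP (formula x)"
proof -
  let ?T = "tb x" and ?c = "\<lambda>t. run M [x, w] t"
  have g: "good_cfg M (?c t)" for t by (rule run_good(1)[OF wf])
  have hb: "\<bar>hdp (?c t) i\<bar> <= int t" if "i < K" for t i by (rule run_good(2)[OF wf that])
  define \<alpha> where "\<alpha> v = (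
     if hd v = 0 then fst (?c (v ! 1)) = v ! 2
     else if hd v = 1 then int (v ! 3) = int ?T + hdp (?c (v ! 1)) (v ! 2)
     else if hd v = 2 then cont (?c (v ! 1)) (v ! 2) (int (v ! 3) - int ?T) = v ! 4
     else if hd v = 3 then length w <= v ! 1
     else w ! (v ! 1))" for v :: "nat list"
  have a: "\<alpha> [0, t, s] \<longleftrightarrow> fst (?c t) = s" "\<alpha> [1, t, i, b] \<longleftrightarrow> int b = int ?T + hdp (?c t) i"
    "\<alpha> [2, t, i, b, s] \<longleftrightarrow> cont (?c t) i (int b - int ?T) = s" "\<alpha> [3, b] \<longleftrightarrow> length w <= b" "\<alpha> [4, b] \<longleftrightarrow> w ! b"
    for t s i b by (simp_all add: \<alpha>_def)
  have c0: "?c 0 = initial M [x, w]" by (simp add: run_def)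
  have sc: "?c (Suc t) = step M (?c t)" for t by (simp add: run_def)
  have K: "0 < K" "1 < K" using K2 by auto
  have 1: "\<forall>C\<in>set (cl_init x ?T). holds \<alpha> C"
    unfolding init_holds a c0 by (auto simp: isym_def initial_tapes nth_default_nth nat_diff_distrib)
  have 2: "\<forall>C\<in>set (cl_cert (lw x) ?T). holds \<alpha> C"
    unfolding cert_holds a c0 using assms(1) K by (auto simp: initial_tapes)
  have 3: "\<forall>C\<in>set (cl_step ?T). holds \<alpha> C"
    unfolding step_holds
  proof (intro allI ballI impI)
    fix t d ps v
    assume t: "t < ?T" and d: "d \<in> set table" and pr: "\<forall>a\<in>set (prem t d ps). \<alpha> a" and v: "v \<in> set (concl t d ps)"
    have p1: "fst (?c t) = fst d" using pr a(1)[of t "fst d"] by (simp add: prem_def)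
    have p2: "int (nth_default 0 ps i) = int ?T + hdp (?c t) i" if "i < K" for i
      using pr a(2)[of t i "nth_default 0 ps i"] that by (simp add: prem_def)
    have p3: "nth_default 0 (fst (snd d)) i = cont (?c t) i (hdp (?c t) i)" if "i < K" for i
      using pr a(3)[of t i "nth_default 0 ps i" "nth_default 0 (fst (snd d)) i"] that p2[OF that] by (simp add: prem_def)
    have r1: "fst (snd (snd d)) = fst (step M (?c t))"
      by (rule table_entry_rev(1)[OF d g p1[symmetric]]) (rule p3)
    have r2: "nth_default 0 (fst (snd (snd (snd d)))) i = cont (step M (?c t)) i (hdp (?c t) i)" if "i < K" for i
      by (rule table_entry_rev(2)[OF d g p1[symmetric] _ that]) (rule p3)
    have r3: "int (nth_default 0 (snd (snd (snd (snd d)))) i) - 1 = hdp (step M (?c t)) i - hdp (?c t) i" if "i < K" for i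
      by (rule table_entry_rev(3)[OF d g p1[symmetric] _ that]) (rule p3)
    consider "v = [0, Suc t, fst (snd (snd d))]"
      | i where "i < K" "v = [1, Suc t, i, nth_default 0 ps i + nth_default 0 (snd (snd (snd (snd d)))) i - 1]"
      | i where "i < K" "v = [2, Suc t, i, nth_default 0 ps i, nth_default 0 (fst (snd (snd (snd d)))) i]"
      using v unfolding concl_def by auto
    then show "\<alpha> v"
    proof cases
      case 1
      then show ?thesis using r1 by (simp add: a sc)
    next
      case (2 i)
      \<comment> \<open>The new position is computed with truncated subtraction. This is harmless
        because before time \<open>T\<close> no head has reached the leftmost cell of the
        tableau.\<close>
      have "0 < nth_default 0 ps i" using p2[OF 2(1)] hb[OF 2(1), of t] t by linarith
      then show ?thesis using r3[OF 2(1)] p2[OF 2(1)] unfolding 2(2) a sc by linarith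
    next
      case (3 i)
      then show ?thesis using r2[OF 3(1)] p2[OF 3(1)] by (simp add: a sc)
    qed
  qed
  have 4: "\<forall>C\<in>set (cl_inert ?T). holds \<alpha> C"
    unfolding inert_holds a
  proof (intro allI impI)
    fix t i aa b s assume "i < K" "b ~= aa" "int b = int ?T + hdp (?c t) i" "cont (?c t) i (int aa - int ?T) = s"
    then show "cont (?c (Suc t)) i (int aa - int ?T) = s"
      using step_good(3)[OF wf g[of t] \<open>i < K\<close>, of "int aa - int ?T"] unfolding sc by auto
  qed
  have acc: "fst (?c t) ~= reject M" for t
  proof
    assume r: "fst (?c t) = reject M"
    have "halted M (?c t)" "halted M (?c u)" using r assms(2) by (auto simp: halted_def)
    then have "?c t = ?c u" by (metis run_stable nat_le_linear)
    then show False using r assms(2) wf by (simp add: wf_tm_def)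
  qed
  have 5: "\<forall>C\<in>set (cl_rej ?T). holds \<alpha> C" unfolding rej_holds a using acc by blast
  show ?thesis unfolding satP_holds formula_def set_append using 1 2 3 4 5 by blast
qed

text \<open>No clause says that a state, position or symbol is unique, so \<open>\<alpha>\<close>
  itself need not describe a run. But it makes true every fact about the run on the certificate read
  off from it, and this carries the ban on rejection over to that run.\<close>

lemma formula_sound:
  assumes "satP (formula x)"
  obtains w t where "length w <= lw x" "fst (run M [x, w] t) = accept M"
proof -
  let ?T = "tb x" and ?L = "lw x"
  obtain \<alpha> where \<alpha>: "\<forall>C\<in>set (formula x). holds \<alpha> C" using assms unfolding satP_holds by blast
  have 1: "\<forall>C\<in>set (cl_init x ?T). holds \<alpha> C" and 2: "\<forall>C\<in>set (cl_cert ?L ?T). holds \<alpha> C"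
    and 3: "\<forall>C\<in>set (cl_step ?T). holds \<alpha> C" and 4: "\<forall>C\<in>set (cl_inert ?T). holds \<alpha> C"
    and 5: "\<forall>C\<in>set (cl_rej ?T). holds \<alpha> C"
    using \<alpha> unfolding formula_def set_append by blast+
  \<comment> \<open>Below the bound the variables \<open>[3, j]\<close> are monotone in
    \<open>j\<close>. The first true one marks the end of the certificate; if there is none, the
    certificate has full length.\<close>
  define n where "n = (if \<exists>j<?L. \<alpha> [3, j] then LEAST j. \<alpha> [3, j] else ?L)"
  have nL: "n <= ?L"
    unfolding n_def using Least_le[of "\<lambda>j. \<alpha> [3, j]"] by (auto intro: le_trans less_imp_le)
  have below: "\<not> \<alpha> [3, j]" if "j < n" for j
    using that not_less_Least[of j "\<lambda>j. \<alpha> [3, j]"] nL unfolding n_def by (auto split: if_splits)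
  have above: "\<alpha> [3, j]" if "n <= j" "j < ?L" for j
  proof -
    have ex: "\<exists>j<?L. \<alpha> [3, j]" using that by (auto simp: n_def split: if_splits)
    then have "\<alpha> [3, n]" unfolding n_def by (auto intro: LeastI)
    moreover have "j' <= ?L ==> n <= j' ==> \<alpha> [3, n] ==> \<alpha> [3, j']" for j'
    proof (induction j')
      case (Suc j')
      then show ?case using 2 unfolding cert_holds by (cases "n = Suc j'") auto
    qed simp
    ultimately show ?thesis using that by auto
  qed
  define w where "w = map (\<lambda>j. \<alpha> [4, j]) [0..<n]"
  have lw: "length w = n" by (simp add: w_def)
  let ?c = "\<lambda>t. run M [x, w] t"
  have g: "good_cfg M (?c t)" for t by (rule run_good(1)[OF wf])
  have hb: "\<bar>hdp (?c t) i\<bar> <= int t" if "i < K" for t i by (rule run_good(2)[OF wf that])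
  have c0: "?c 0 = initial M [x, w]" by (simp add: run_def)
  have sc: "?c (Suc t) = step M (?c t)" for t by (simp add: run_def)
  have inv: "\<alpha> [0, t, fst (?c t)] \<and> (\<forall>i<K. \<alpha> [1, t, i, nat (int ?T + hdp (?c t) i)]) \<and>
     (\<forall>i<K. \<forall>a\<le>?T + ?T. \<alpha> [2, t, i, a, cont (?c t) i (int a - int ?T)])"
    if "t <= ?T" "!!u. u < t ==> \<not> halted M (?c u)" for t
    using that
  proof (induction t)
    case 0
    have "\<alpha> [2, 0, i, a, cont (?c 0) i (int a - int ?T)]" if i: "i < K" and a: "a <= ?T + ?T" for i a
    proof (cases "i = 1")
      case False
      have e: "cont (?c 0) i (int a - int ?T) = isym x ?T i a"
        using False i unfolding c0 initial_tapes(3)[OF i]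
        by (auto simp: isym_def nth_default_nth nat_diff_distrib elim!: bit_sym.elims)
      show ?thesis using 1 i False a unfolding init_holds e by blast
    next
      case True
      consider "a < ?T \<or> ?T + ?L <= a" | j where "a = ?T + j" "j < ?L"
        by (metis add_diff_inverse_nat less_diff_conv2 not_le add.commute nat_add_left_cancel_less)
      then show ?thesis
      proof cases
        case 1
        then have "cont (?c 0) 1 (int a - int ?T) = 0"
          using i True nL unfolding c0 initial_tapes(3)[OF i[unfolded True]] lw by auto
        then show ?thesis using 2 a 1 True unfolding cert_holds by auto
      next
        case (2 j)
        have e: "cont (?c 0) 1 (int a - int ?T) = (if j < n then bit_sym (\<alpha> [4, j]) else 0)"
          using i 2 unfolding c0 True initial_tapes(3)[OF i[unfolded True]] lw by (simp add: w_def)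
        have cj: "(\<alpha> [3, j] --> \<alpha> [2, 0, 1, ?T + j, 0])" "(\<not> \<alpha> [3, j] --> \<alpha> [4, j] --> \<alpha> [2, 0, 1, ?T + j, 2])"
          "(\<not> \<alpha> [3, j] --> \<not> \<alpha> [4, j] --> \<alpha> [2, 0, 1, ?T + j, 1])"
          using \<open>\<forall>C\<in>set (cl_cert ?L ?T). holds \<alpha> C\<close> 2(2) unfolding cert_holds by blast+
        show ?thesis
        proof (cases "j < n")
          case True
          then show ?thesis using cj(2,3) below[OF True] \<open>i = 1\<close> 2(1) unfolding e[unfolded \<open>i = 1\<close>[symmetric]]
            by (cases "\<alpha> [4, j]") auto
        next
          case False
          then show ?thesis using cj(1) above[of j] 2 \<open>i = 1\<close> e by simp
        qed
      qed
    qed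
    moreover have "\<alpha> [0, 0, fst (?c 0)]" using 1 unfolding init_holds c0 initial_tapes by blast
    moreover have "\<alpha> [1, 0, i, nat (int ?T + hdp (?c 0) i)]" if "i < K" for i
      using 1 that unfolding init_holds c0 initial_tapes(2)[OF that] by simp
    ultimately show ?case by blast
  next
    case (Suc t)
    have t: "t < ?T" and nh: "\<not> halted M (?c t)" using Suc.prems by auto
    have IH: "\<alpha> [0, t, fst (?c t)]" "!!i. i < K ==> \<alpha> [1, t, i, nat (int ?T + hdp (?c t) i)]"
      "!!i a. i < K ==> a <= ?T + ?T ==> \<alpha> [2, t, i, a, cont (?c t) i (int a - int ?T)]"
      using Suc by auto
    obtain d where d: "d \<in> set table" "fst d = fst (?c t)" "!!i. i < K ==> nth_default 0 (fst (snd d)) i = cont (?c t) i (hdp (?c t) i)"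
      "fst (snd (snd d)) = fst (step M (?c t))"
      "!!i. i < K ==> nth_default 0 (fst (snd (snd (snd d)))) i = cont (step M (?c t)) i (hdp (?c t) i)"
      "!!i. i < K ==> int (nth_default 0 (snd (snd (snd (snd d)))) i) - 1 = hdp (step M (?c t)) i - hdp (?c t) i"
      using table_entry[OF g nh] by metis
    define ps where "ps = map (\<lambda>i. nat (int ?T + hdp (?c t) i)) [0..<K]"
    have psi: "nth_default 0 ps i = nat (int ?T + hdp (?c t) i)" "int (nth_default 0 ps i) = int ?T + hdp (?c t) i"
      "nth_default 0 ps i <= ?T + ?T" if "i < K" for i
    proof -
      show e: "nth_default 0 ps i = nat (int ?T + hdp (?c t) i)" using that by (simp add: ps_def nth_default_nth)
      show "int (nth_default 0 ps i) = int ?T + hdp (?c t) i" "nth_default 0 ps i <= ?T + ?T"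
        unfolding e using hb[OF that, of t] t by linarith+
    qed
    have "ps \<in> set (List.n_lists K [0..<Suc (?T + ?T)])"
    proof -
      have "set ps \<subseteq> {..<Suc (?T + ?T)}"
      proof
        fix y assume "y \<in> set ps"
        then obtain i where "i < K" "y = nat (int ?T + hdp (?c t) i)" by (auto simp: ps_def)
        then show "y \<in> {..<Suc (?T + ?T)}" using psi(1,3)[of i] by simp
      qed
      then show ?thesis unfolding set_n_lists set_upt atLeast0LessThan by (simp add: ps_def)
    qed
    moreover have "\<forall>a\<in>set (prem t d ps). \<alpha> a"
    proof
      fix v assume "v \<in> set (prem t d ps)"
      then consider "v = [0, t, fst d]" | i where "i < K" "v = [1, t, i, nth_default 0 ps i]"
        | i where "i < K" "v = [2, t, i, nth_default 0 ps i, nth_default 0 (fst (snd d)) i]"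
        unfolding prem_def by auto
      then show "\<alpha> v"
      proof cases
        case 1
        then show ?thesis using IH(1) d(2) by simp
      next
        case (2 i)
        then show ?thesis using IH(2) psi(1) by simp
      next
        case (3 i)
        have "int (nth_default 0 ps i) - int ?T = hdp (?c t) i" using psi(2)[OF 3(1)] by simp
        then show ?thesis using IH(3)[OF 3(1) psi(3)[OF 3(1)]] d(3)[OF 3(1)] 3(2) by simp
      qed
    qed
    ultimately have con: "!!c. c \<in> set (concl t d ps) ==> \<alpha> c"
      using 3 t d(1) unfolding step_holds by blast
    have n1: "\<alpha> [0, Suc t, fst (?c (Suc t))]" using con d(4) unfolding sc by (simp add: concl_def)
    have n2: "\<alpha> [1, Suc t, i, nat (int ?T + hdp (?c (Suc t)) i)]" if i: "i < K" for i
    proof -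
      have "\<alpha> [1, Suc t, i, nth_default 0 ps i + nth_default 0 (snd (snd (snd (snd d)))) i - 1]"
        using con i by (simp add: concl_def)
      moreover have "nth_default 0 ps i + nth_default 0 (snd (snd (snd (snd d)))) i - 1 = nat (int ?T + hdp (?c (Suc t)) i)"
        using psi(2)[OF i] d(6)[OF i] hb[OF i, of t] t unfolding sc by linarith
      ultimately show ?thesis by simp
    qed
    have n3: "\<alpha> [2, Suc t, i, a, cont (?c (Suc t)) i (int a - int ?T)]" if i: "i < K" and a: "a <= ?T + ?T" for i a
    proof (cases "a = nth_default 0 ps i")
      case True
      have "\<alpha> [2, Suc t, i, nth_default 0 ps i, nth_default 0 (fst (snd (snd (snd d)))) i]"
        using con i by (simp add: concl_def)
      moreover have "int a - int ?T = hdp (?c t) i" using psi(2)[OF i] True by simp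
      ultimately show ?thesis using d(5)[OF i] True unfolding sc by simp
    next
      case False
      then have "int a - int ?T ~= hdp (?c t) i" using psi(2)[OF i] by auto
      then have e: "cont (?c (Suc t)) i (int a - int ?T) = cont (?c t) i (int a - int ?T)"
        unfolding sc by (rule step_good(3)[OF wf g i])
      have "cont (?c t) i (int a - int ?T) < nsyms M" using g[of t] i by (simp add: good_cfg_def)
      then show ?thesis unfolding e
        using 4 t i a psi(3)[OF i] False IH(2)[OF i] IH(3)[OF i a] psi(1)[OF i] unfolding inert_holds by metis
    qed
    show ?case using n1 n2 n3 by blast
  qed
  obtain t0 where t0: "t0 <= poly q (length x + length w)" "halted M (?c t0)" using halts by blast
  \<comment> \<open>Facts propagate up to the first halting time, which the time bound of the
    verifier places inside the tableau. Rejection is excluded there, so the machine accepts.\<close>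
  define t where "t = (LEAST t. halted M (?c t))"
  have h: "halted M (?c t)" unfolding t_def by (rule LeastI[of _ t0]) (rule t0)
  have "t <= t0" unfolding t_def by (rule Least_le) (rule t0)
  also have "... <= ?T" using t0(1) poly_mono_nat[of "length x + length w" "length x + ?L" q] nL lw by (simp add: tb_def)
  finally have tT: "t <= ?T" .
  have "\<not> halted M (?c u)" if "u < t" for u using that not_less_Least unfolding t_def by blast
  then have "\<alpha> [0, t, fst (?c t)]" using inv[OF tT] by blast
  then have "fst (?c t) ~= reject M" using 5 tT unfolding rej_holds by metis
  then have "fst (?c t) = accept M" using h by (auto simp: halted_def)
  then show ?thesis using that[of w t] nL lw by simp
qed

lemma formula_correct:
  "satP (to3 (formula x)) \<longleftrightarrow> (\<exists>w. length w <= poly p (length x) \<and> (\<exists>t. fst (run M [x, w] t) = accept M))"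
  unfolding to3_sat using formula_complete formula_sound unfolding lw_def by metis

end

theorem language_NP_hard:
  assumes "pattern h r N" "graph_iso (graph_on {..<h} N) R"
  shows "NP_hard (free_edge_deletion_language R)"
  unfolding NP_hard_def
proof (intro allI impI)
  fix A assume "in_NP A"
  then obtain M and p q :: "nat poly" where M: "wf_tm M" "2 <= ntapes M"
    "!!x w. \<exists>t \<le> poly q (length x + length w). halted M (run M [x, w] t)"
    "!!x. x \<in> A \<longleftrightarrow> (\<exists>w. length w <= poly p (length x) \<and> (\<exists>t. fst (run M [x, w] t) = accept M))"
    unfolding in_NP_def by blast
  interpret verifier M p q by unfold_locales (use M in auto)
  let ?f = "\<lambda>x. red h N (to3 (formula x))"
  have "fp ?f" by (rule fp_comp[OF fp_red[OF assms(1)] fp_comp[OF fp_to3 fp_formula]])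
  then have "poly_time_computable ?f" by (rule fp_poly_time)
  moreover have "x \<in> A \<longleftrightarrow> ?f x \<in> free_edge_deletion_language R" for x
    unfolding red_in_language[OF assms to3_ok] formula_correct M(4) ..
  ultimately show "poly_reducible A (free_edge_deletion_language R)" unfolding poly_reducible_def by blast
qed

section \<open>Sparsification\<close>

text \<open>A formula is a hypergraph of clauses on the literals \<open>U\<close>, minimal under inclusion. If many clauses
  of size \<open>s\<close> contain a heart \<open>h\<close>, one branches: add the clause \<open>h\<close>, or remove \<open>h\<close> from all of them. The
  potential \<open>gain\<close> never exceeds \<open>6 * j * card U\<close> and grows by at least 1 in the first branch and by at
  least \<open>j\<^sup>2\<close> in the second. A new unit clause may destroy up to \<open>2 * j\<close> of the counted clauses of size 2,
  hence its weight \<open>4 * j\<close>; clauses of the initial formula \<open>F0\<close> are not counted, as they may be arbitrarily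
  dense.\<close>

definition mins :: "'l set set => 'l set set" where
  "mins F = {C \<in> F. \<not> (\<exists>D\<in>F. D \<subset> C)}"

definition flower :: "'l set set => 'l set => nat => 'l set set" where
  "flower F h s = {C \<in> F. card C = s \<and> h \<subseteq> C}"

definition petals :: "'l set set => 'l set => nat => 'l set set" where
  "petals F h s = (\<lambda>C. C - h) ` flower F h s"

locale sparsification =
  fixes U :: "'l set" and F0 :: "'l set set" and j :: nat
  assumes U: "finite U" and j: "0 < j"
begin

definition new2 :: "'l set set => 'l set set" where
  "new2 F = {C \<in> F. card C = 2 \<and> C \<notin> F0}"

definition inv :: "'l set set => bool" where
  "inv F \<longleftrightarrow> (\<forall>C\<in>F. C \<subseteq> U \<and> card C <= 3 \<and> C ~= {}) \<and> (\<forall>C\<in>F. \<forall>D\<in>F. \<not> C \<subset> D) \<and>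
     (\<forall>C\<in>F0. \<exists>D\<in>F. D \<subseteq> C) \<and> (\<forall>x\<in>U. card {C \<in> new2 F. x \<in> C} <= 2 * j)"

definition gain :: "'l set set => nat" where
  "gain F = 4 * j * card {C \<in> F. card C = 1} + card (new2 F)"

lemma invD:
  assumes "inv F"
  shows "C \<in> F ==> C \<subseteq> U" "C \<in> F ==> card C <= 3" "C \<in> F ==> C ~= {}"
    "C \<in> F ==> D \<in> F ==> \<not> C \<subset> D" "C \<in> F0 ==> \<exists>D\<in>F. D \<subseteq> C"
    "x \<in> U ==> card {C \<in> new2 F. x \<in> C} <= 2 * j"
  using assms unfolding inv_def by (elim conjE, simp)+

lemma inv_finite: "inv F ==> finite F"
  using U by (auto simp: inv_def intro: finite_subset[of F "Pow U"])

text \<open>There are at most \<open>card U\<close> unit clauses of weight \<open>4 * j\<close>, and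
  the degree bound in \<open>inv\<close> allows at most \<open>2 * j * card U\<close> counted
  pairs.\<close>

lemma gain_bound:
  assumes "inv F"
  shows "gain F <= 6 * j * card U"
proof -
  have "{C \<in> F. card C = 1} \<subseteq> (\<lambda>x. {x}) ` U"
    using assms by (auto simp: inv_def card_1_singleton_iff)
  then have 1: "card {C \<in> F. card C = 1} <= card U"
    using surj_card_le[OF U] by blast
  have "new2 F \<subseteq> (\<Union>x\<in>U. {C \<in> new2 F. x \<in> C})"
  proof
    fix C assume C: "C \<in> new2 F"
    then obtain x where "x \<in> C" by (fastforce simp: new2_def)
    then show "C \<in> (\<Union>x\<in>U. {C \<in> new2 F. x \<in> C})" using C assms by (auto simp: new2_def inv_def)
  qed
  then have "card (new2 F) <= card (\<Union>x\<in>U. {C \<in> new2 F. x \<in> C})"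
    using U inv_finite[OF assms] by (intro card_mono) (auto simp: new2_def)
  also have "... <= (\<Sum>x\<in>U. card {C \<in> new2 F. x \<in> C})" by (rule card_UN_le[OF U])
  also have "... <= (\<Sum>x\<in>U. 2 * j)" using assms by (intro sum_mono) (auto simp: inv_def)
  finally have 2: "card (new2 F) <= card U * (2 * j)" by simp
  have "4 * j * card {C \<in> F. card C = 1} <= 4 * j * card U" by (rule mult_le_mono2[OF 1])
  moreover have "4 * j * card U + card U * (2 * j) = 6 * j * card U" by (simp add: algebra_simps)
  ultimately show ?thesis using 2 unfolding gain_def by linarith
qed

context
  fixes F P s
  assumes F: "inv F" and P: "!!p. p \<in> P ==> card p = s \<and> p ~= {} \<and> (\<exists>C\<in>F. p \<subset> C)"
begin

text \<open>New clauses lie strictly inside clauses of an antichain, so they are not present yet.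
  They are not in \<open>F0\<close> either, because every clause of \<open>F0\<close> still contains
  some member of \<open>F\<close>; hence a new pair really is counted by
  \<open>gain\<close>.\<close>

lemma add_fresh: "p \<in> P ==> p \<notin> F" "p \<in> P ==> p \<notin> F0" "p \<in> P ==> p \<subseteq> U" "p \<in> P ==> finite p" "p \<in> P ==> card p <= 3"
proof -
  assume p: "p \<in> P"
  then obtain C where C: "C \<in> F" "p \<subset> C" using P by blast
  show "p \<notin> F" using C invD(4)[OF F _ C(1), of p] by blast
  show "p \<notin> F0"
  proof
    assume "p \<in> F0"
    then obtain D where D: "D \<in> F" "D \<subseteq> p" using invD(5)[OF F] by blast
    then show False using invD(4)[OF F D(1) C(1)] C(2) by blast
  qed
  have CU: "C \<subseteq> U" "card C <= 3" using invD(1,2)[OF F C(1)] by blast+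
  show "p \<subseteq> U" using CU C by blast
  then show "finite p" using U finite_subset by blast
  show "card p <= 3" using CU C U by (meson card_mono finite_subset le_trans psubset_imp_subset)
qed

lemma add_mins: "mins (F \<union> P) = P \<union> {C \<in> F. \<not> (\<exists>p\<in>P. p \<subset> C)}"
proof -
  have 1: "\<not> D \<subset> p" if "p \<in> P" "D \<in> F" for p D
  proof
    assume "D \<subset> p"
    obtain C where C: "C \<in> F" "p \<subset> C" using P[of p] \<open>p \<in> P\<close> by blast
    then have "D \<subset> C" using \<open>D \<subset> p\<close> by blast
    then show False using invD(4)[OF F \<open>D \<in> F\<close> C(1)] by blast
  qed
  have 2: "\<not> q \<subset> p" if "p \<in> P" "q \<in> P" for p q
    using P[OF that(1)] P[OF that(2)] add_fresh(4)[OF that(1)] psubset_card_mono by (metis less_irrefl)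
  have 3: "\<not> D \<subset> C" if "C \<in> F" "D \<in> F" for C D by (rule invD(4)[OF F that(2,1)])
  show ?thesis
  proof (rule set_eqI)
    fix C
    show "C \<in> mins (F \<union> P) \<longleftrightarrow> C \<in> P \<union> {C \<in> F. \<not> (\<exists>p\<in>P. p \<subset> C)}"
    proof (cases "C \<in> P")
      case True
      then show ?thesis using 1[OF True] 2[OF True] unfolding mins_def by blast
    next
      case False
      then show ?thesis using 3[of C] unfolding mins_def by blast
    qed
  qed
qed

lemma add_inv:
  assumes "!!x. x \<in> U ==> card {C \<in> new2 (mins (F \<union> P)). x \<in> C} <= 2 * j"
  shows "inv (mins (F \<union> P))"
proof -
  let ?F = "mins (F \<union> P)"
  have "C \<subseteq> U \<and> card C <= 3 \<and> C ~= {}" if CF: "C \<in> ?F" for C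
  proof -
    consider "C \<in> P" | "C \<in> F" using CF unfolding add_mins by blast
    then show ?thesis
    proof cases
      case 1
      then show ?thesis using add_fresh(3,5)[OF 1] P[OF 1] by blast
    next
      case 2
      then show ?thesis using invD(1-3)[OF F 2] by blast
    qed
  qed
  moreover have "\<forall>C\<in>?F. \<forall>D\<in>?F. \<not> C \<subset> D" by (auto simp: mins_def)
  moreover have "\<exists>D\<in>?F. D \<subseteq> C" if C: "C \<in> F0" for C
  proof -
    obtain D where D: "D \<in> F" "D \<subseteq> C" using invD(5)[OF F C] by blast
    show ?thesis
    proof (cases "\<exists>p\<in>P. p \<subset> D")
      case True
      then show ?thesis using D unfolding add_mins by blast
    next
      case False
      then show ?thesis using D unfolding add_mins by blast
    qed
  qed
  moreover note assms
  ultimately show ?thesis unfolding inv_def by simp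
qed

text \<open>Each new unit earns \<open>4 * j\<close> and can make at most \<open>2 * j\<close>
  counted pairs redundant, namely those containing its literal. The difference \<open>2 * j\<close>
  remains.\<close>

lemma add_units:
  assumes s: "s = 1"
  shows "inv (mins (F \<union> P))" "gain F + 2 * j * card P <= gain (mins (F \<union> P))"
proof -
  let ?F = "mins (F \<union> P)"
  have fin: "finite F" "finite ?F" "finite P"
    using inv_finite[OF F] add_fresh(3) U unfolding add_mins by (auto intro: finite_subset[of P "Pow U"])
  have new: "new2 ?F \<subseteq> new2 F" using P s unfolding new2_def add_mins by auto
  show "inv ?F"
  proof (rule add_inv)
    fix x assume "x \<in> U"
    have "card {C \<in> new2 ?F. x \<in> C} <= card {C \<in> new2 F. x \<in> C}"
      using new fin(1) by (intro card_mono) (auto simp: new2_def)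
    then show "card {C \<in> new2 ?F. x \<in> C} <= 2 * j" using invD(6)[OF F \<open>x \<in> U\<close>] by linarith
  qed
  have "{C \<in> ?F. card C = 1} = {C \<in> F. card C = 1} \<union> P"
  proof -
    have "\<not> p \<subset> C" if "p \<in> P" "C \<in> F" "card C = 1" for p C
      using P[OF that(1)] that(3) by (metis card_1_singleton_iff psubset_eq subset_singletonD One_nat_def)
    then show ?thesis using P s unfolding add_mins by blast
  qed
  then have 1: "card {C \<in> ?F. card C = 1} = card {C \<in> F. card C = 1} + card P"
    using card_Un_disjoint[of "{C \<in> F. card C = 1}" P] fin add_fresh(1) by auto
  have "new2 F \<subseteq> new2 ?F \<union> (\<Union>p\<in>P. {C \<in> new2 F. p \<subset> C})"
    unfolding new2_def add_mins by blast
  then have "card (new2 F) <= card (new2 ?F \<union> (\<Union>p\<in>P. {C \<in> new2 F. p \<subset> C}))"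
    using fin by (intro card_mono) (auto simp: new2_def)
  also have "... <= card (new2 ?F) + card (\<Union>p\<in>P. {C \<in> new2 F. p \<subset> C})" by (rule card_Un_le)
  also have "card (\<Union>p\<in>P. {C \<in> new2 F. p \<subset> C}) <= (\<Sum>p\<in>P. card {C \<in> new2 F. p \<subset> C})" by (rule card_UN_le[OF fin(3)])
  also have "... <= (\<Sum>p\<in>P. 2 * j)"
  proof (rule sum_mono)
    fix p assume p: "p \<in> P"
    then obtain x where x: "p = {x}" using P s card_1_singletonE by metis
    then have "x \<in> U" using add_fresh(3)[OF p] by simp
    have "card {C \<in> new2 F. p \<subset> C} <= card {C \<in> new2 F. x \<in> C}"
      using fin(1) x by (intro card_mono) (auto simp: new2_def)
    then show "card {C \<in> new2 F. p \<subset> C} <= 2 * j" using invD(6)[OF F \<open>x \<in> U\<close>] by linarith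
  qed
  finally have 2: "card (new2 F) <= card (new2 ?F) + card P * (2 * j)" by simp
  show "gain F + 2 * j * card P <= gain ?F" unfolding gain_def 1 using 2 by (simp add: algebra_simps)
qed

text \<open>New pairs make only larger clauses redundant, so each earns 1. Fewer than
  \<open>j\<close> old and at most \<open>j\<close> new pairs at a literal keep the degree within
  \<open>2 * j\<close>.\<close>

lemma add_pairs:
  assumes s: "s = 2"
    and deg: "!!x. x \<in> U ==> card (flower F {x} 2) < j \<and> card {p \<in> P. x \<in> p} <= j"
  shows "inv (mins (F \<union> P))" "gain F + card P <= gain (mins (F \<union> P))"
proof -
  let ?F = "mins (F \<union> P)"
  have fin: "finite F" "finite ?F" "finite P"
    using inv_finite[OF F] add_fresh(3) U unfolding add_mins by (auto intro: finite_subset[of P "Pow U"])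
  have no: "\<not> p \<subset> C" if "p \<in> P" "C \<in> F" "card C <= 2" for p C
  proof
    assume "p \<subset> C"
    moreover have "finite C" using invD(1)[OF F that(2)] U finite_subset by blast
    ultimately have "card p < card C" by (rule psubset_card_mono[rotated])
    then show False using P[OF that(1)] that(3) s by simp
  qed
  have new: "new2 ?F = new2 F \<union> P"
    using P s no add_fresh(2) unfolding new2_def add_mins by fastforce
  show "inv ?F"
  proof (rule add_inv)
    fix x assume x: "x \<in> U"
    have "{C \<in> new2 ?F. x \<in> C} \<subseteq> flower F {x} 2 \<union> {p \<in> P. x \<in> p}"
      unfolding new by (auto simp: new2_def flower_def)
    then have "card {C \<in> new2 ?F. x \<in> C} <= card (flower F {x} 2 \<union> {p \<in> P. x \<in> p})"
      using fin by (intro card_mono) (auto simp: flower_def)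
    also have "... <= card (flower F {x} 2) + card {p \<in> P. x \<in> p}" by (rule card_Un_le)
    finally show "card {C \<in> new2 ?F. x \<in> C} <= 2 * j" using deg[OF x] by linarith
  qed
  have "{C \<in> ?F. card C = 1} = {C \<in> F. card C = 1}"
    using P s no unfolding add_mins by fastforce
  moreover have "card (new2 ?F) = card (new2 F) + card P"
    unfolding new using fin add_fresh(1) by (intro card_Un_disjoint) (auto simp: new2_def)
  ultimately show "gain F + card P <= gain ?F" unfolding gain_def by simp
qed

end

text \<open>The three kinds of flower are tried in this order because later ones rely on the absence
  of earlier ones: new pairs may only be added while all degrees in pairs are below
  \<open>j\<close>, and two-element petals are sparse at each literal only if no pair is the heart
  of \<open>j\<close> triples.\<close>

definition sel :: "'l set set => 'l set => nat => bool" where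
  "sel F h s \<longleftrightarrow> h \<subseteq> U \<and>
     (card h = 1 \<and> s = 2 \<and> j <= card (flower F h 2) \<or>
      (\<forall>x\<in>U. card (flower F {x} 2) < j) \<and>
      (card h = 2 \<and> s = 3 \<and> j <= card (flower F h 3) \<or>
       (\<forall>k\<subseteq>U. card k = 2 --> card (flower F k 3) < j) \<and>
       card h = 1 \<and> s = 3 \<and> j * j <= card (flower F h 3)))"

lemma card_petals: "card (petals F h s) = card (flower F h s)"
  unfolding petals_def by (rule card_image) (auto simp: inj_on_def flower_def)

lemma petals_add:
  assumes "inv F" "h \<subseteq> U" "0 < card h" "p \<in> petals F h s" "card h < s"
  shows "card p = s - card h \<and> p ~= {} \<and> (\<exists>C\<in>F. p \<subset> C)"
proof -
  obtain C where C: "C \<in> F" "card C = s" "h \<subseteq> C" "p = C - h"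
    using assms(4) by (auto simp: petals_def flower_def)
  have f: "finite h" using assms(2) U finite_subset by blast
  have "card p = s - card h" using C f by (simp add: card_Diff_subset)
  moreover have "p ~= {}" using calculation assms(5) by auto
  moreover have "p \<subset> C"
  proof -
    have "h ~= {}" using assms(3) by auto
    then show ?thesis using C by blast
  qed
  ultimately show ?thesis using C(1) by blast
qed

text \<open>The thresholds are made for the gain \<open>j * j\<close> of the petals:
  \<open>j\<close> petals of size 1 earn \<open>2 * j\<close> each, and \<open>j * j\<close> petals
  of size 2 earn 1 each. The heart alone may earn no more than 1.\<close>

theorem branch:
  assumes F: "inv F" and sel: "sel F h s"
  shows "inv (mins (F \<union> {h}))" "gain F + 1 <= gain (mins (F \<union> {h}))"
    "inv (mins (F \<union> petals F h s))" "gain F + j * j <= gain (mins (F \<union> petals F h s))"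
proof -
  have hU: "h \<subseteq> U" using sel by (simp add: sel_def)
  then have fh: "finite h" using U finite_subset by blast
  have c: "0 < card h" "card h < s" "j <= card (flower F h s)" using sel j unfolding sel_def
    by (auto intro: le_trans[OF le_square])
  have ph: "card p = card h \<and> p ~= {} \<and> (\<exists>C\<in>F. p \<subset> C)" if "p \<in> {h}" for p
  proof -
    have "flower F h s ~= {}" using c(3) j by auto
    then obtain C where "C \<in> F" "card C = s" "h \<subseteq> C" by (auto simp: flower_def)
    then have "h \<subset> C" using c(2) by auto
    then show ?thesis using that c(1) \<open>C \<in> F\<close> by auto
  qed
  note pp = petals_add[OF F hU c(1) _ c(2)]
  have sq: "j * j <= 2 * j * card (petals F h s)"
    using c(3) unfolding card_petals by (auto intro: mult_le_mono)
  have deg: "card (flower F {x} 2) < j" if "x \<in> U" "s = 3" for x using sel that unfolding sel_def by auto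
  consider (u) "card h = 1" | (p) "card h = 2" "s = 3" using sel unfolding sel_def by auto
  then have "inv (mins (F \<union> {h})) \<and> gain F + 1 <= gain (mins (F \<union> {h}))"
  proof cases
    case u
    have "inv (mins (F \<union> {h})) \<and> gain F + 2 * j * card {h} <= gain (mins (F \<union> {h}))"
      using add_units[OF F, of "{h}" "card h"] ph u by blast
    then show ?thesis using j by simp
  next
    case p
    have "card {q \<in> {h}. x \<in> q} <= j" for x
    proof -
      have "card {q \<in> {h}. x \<in> q} <= card {h}" by (rule card_mono) auto
      then show ?thesis using j by simp
    qed
    then have "inv (mins (F \<union> {h})) \<and> gain F + card {h} <= gain (mins (F \<union> {h}))"
      using add_pairs[OF F, of "{h}" "card h"] ph deg p by blast
    then show ?thesis by simp
  qed
  then show "inv (mins (F \<union> {h}))" "gain F + 1 <= gain (mins (F \<union> {h}))" by auto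
  consider (u) "s - card h = 1" | (p) "card h = 1" "s = 3" "j * j <= card (flower F h 3)"
      "\<forall>k\<subseteq>U. card k = 2 --> card (flower F k 3) < j"
    using sel unfolding sel_def by auto
  then have "inv (mins (F \<union> petals F h s)) \<and> gain F + j * j <= gain (mins (F \<union> petals F h s))"
  proof cases
    case u
    have "inv (mins (F \<union> petals F h s)) \<and> gain F + 2 * j * card (petals F h s) <= gain (mins (F \<union> petals F h s))"
      using add_units[OF F, of "petals F h s" "s - card h"] pp u by blast
    then show ?thesis using sq by linarith
  next
    case p
    obtain a where a: "h = {a}" using p(1) card_1_singletonE by metis
    have "card {q \<in> petals F h s. x \<in> q} <= j" if x: "x \<in> U" for x
    proof (cases "x = a")
      case True
      then have "{q \<in> petals F h s. x \<in> q} = {}" using a by (auto simp: petals_def)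
      then show ?thesis by (simp only: card.empty le0)
    next
      case False
      have "{q \<in> petals F h s. x \<in> q} \<subseteq> (\<lambda>C. C - h) ` flower F {a, x} 3"
        using a p(2) by (auto simp: petals_def flower_def)
      then have "card {q \<in> petals F h s. x \<in> q} <= card (flower F {a, x} 3)"
        using inv_finite[OF F] by (intro surj_card_le) (auto simp: flower_def)
      moreover have "card (flower F {a, x} 3) < j" using p(4) x hU a False by auto
      ultimately show ?thesis by simp
    qed
    then have "inv (mins (F \<union> petals F h s)) \<and> gain F + card (petals F h s) <= gain (mins (F \<union> petals F h s))"
      using add_pairs[OF F, of "petals F h s" "s - card h"] pp deg p by simp
    then show ?thesis using p(2,3) unfolding card_petals by simp
  qed
  then show "inv (mins (F \<union> petals F h s))" "gain F + j * j <= gain (mins (F \<union> petals F h s))" by auto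
qed

text \<open>Without a flower a literal lies in at most one unit, fewer than \<open>j\<close> pairs
  and fewer than \<open>j * j\<close> triples, and every clause contains some literal.\<close>

theorem leaf:
  assumes F: "inv F" and no: "!!h s. \<not> sel F h s"
  shows "card F <= card U * (1 + j + j * j)"
proof -
  have a: "card (flower F {x} 2) < j" if "x \<in> U" for x
    using no[of "{x}" 2] that unfolding sel_def by auto
  have b: "card (flower F k 3) < j" if "k \<subseteq> U" "card k = 2" for k
    proof (rule ccontr)
    assume "\<not> ?thesis"
    then have "sel F k 3" unfolding sel_def using a \<open>k \<subseteq> U\<close> \<open>card k = 2\<close> by simp
    then show False using no by blast
  qed
  have c: "card (flower F {x} 3) < j * j" if "x \<in> U" for x
    proof (rule ccontr)
    assume "\<not> ?thesis"
    then have "sel F {x} 3" unfolding sel_def using a b \<open>x \<in> U\<close> by simp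
    then show False using no by blast
  qed
  have fin: "finite F" by (rule inv_finite[OF F])
  have "F \<subseteq> (\<Union>x\<in>U. insert {x} (flower F {x} 2 \<union> flower F {x} 3))"
  proof
    fix C assume C: "C \<in> F"
    then have C': "C \<subseteq> U" "card C <= 3" "C ~= {}" using invD(1-3)[OF F] by blast+
    then have "finite C" using U finite_subset by blast
    then have "card C ~= 0" using C' by simp
    then consider "card C = 1" | "card C = 2" | "card C = 3" using C'(2) by linarith
    then show "C \<in> (\<Union>x\<in>U. insert {x} (flower F {x} 2 \<union> flower F {x} 3))"
      using C C'(1,3) by cases (auto simp: flower_def card_1_singleton_iff)
  qed
  then have "card F <= card (\<Union>x\<in>U. insert {x} (flower F {x} 2 \<union> flower F {x} 3))"
    using U fin by (intro card_mono) (auto simp: flower_def)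
  also have "... <= (\<Sum>x\<in>U. card (insert {x} (flower F {x} 2 \<union> flower F {x} 3)))" by (rule card_UN_le[OF U])
  also have "... <= (\<Sum>x\<in>U. 1 + j + j * j)"
  proof (rule sum_mono)
    fix x assume x: "x \<in> U"
    have "card (insert {x} (flower F {x} 2 \<union> flower F {x} 3)) <= Suc (card (flower F {x} 2 \<union> flower F {x} 3))"
      by (rule card_insert_le_m1) auto
    also have "... <= Suc (card (flower F {x} 2) + card (flower F {x} 3))" using card_Un_le by auto
    finally show "card (insert {x} (flower F {x} 2 \<union> flower F {x} 3)) <= 1 + j + j * j"
      using a[OF x] c[OF x] by linarith
  qed
  finally show ?thesis by simp
qed

end

subsection \<open>The branching step on lists\<close>

abbreviation "sets \<phi> \<equiv> set ` set \<phi>"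

definition prune :: "'l list list => 'l list list" where
  "prune \<phi> = remdups (filter (\<lambda>C. \<not> (\<exists>D\<in>set \<phi>. D ~= C \<and> (\<forall>l\<in>set D. l \<in> set C))) \<phi>)"

definition flower_list :: "'l list => nat => 'l list list => 'l list list" where
  "flower_list h s \<phi> = filter (\<lambda>C. length C = s \<and> (\<forall>l\<in>set h. l \<in> set C)) \<phi>"

text \<open>Hearts are sought only inside existing clauses, which suffices as the thresholds are
  positive. The order of the three lists is the priority of \<open>sel\<close>, so the first good
  candidate is one that \<open>sel\<close> admits; the last component is the threshold.\<close>

definition cands :: "nat => 'l list list => ('l list \<times> nat \<times> nat) list" where
  "cands j \<phi> =
     concat (map (\<lambda>C. map (\<lambda>x. ([x], 2, j)) C) (filter (\<lambda>C. length C = 2) \<phi>)) @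
     concat (map (\<lambda>C. map (\<lambda>x. (filter (\<lambda>y. y ~= x) C, 3, j)) C) (filter (\<lambda>C. length C = 3) \<phi>)) @
     concat (map (\<lambda>C. map (\<lambda>x. ([x], 3, j * j)) C) (filter (\<lambda>C. length C = 3) \<phi>))"

definition good_cands :: "nat => 'l list list => ('l list \<times> nat \<times> nat) list" where
  "good_cands j \<phi> = filter (\<lambda>d. snd (snd d) <= length (flower_list (fst d) (fst (snd d)) \<phi>)) (cands j \<phi>)"

definition add_heart :: "'l list => 'l list list => 'l list list" where
  "add_heart h \<phi> = prune (h # \<phi>)"

definition add_petals :: "'l list => nat => 'l list list => 'l list list" where
  "add_petals h s \<phi> = prune (map (\<lambda>C. if length C = s \<and> (\<forall>l\<in>set h. l \<in> set C)
     then filter (\<lambda>l. l \<notin> set h) C else C) \<phi>)"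

lemma fp_prune [fp_intros]:
  assumes "fp f"
  shows "fp (\<lambda>e. prune (f e :: 'l::code list list))"
  unfolding prune_def by (intro fp_intros fp_comp[OF assms])

lemma fp_flower_list [fp_intros]:
  assumes "fp h" "fp s" "fp f"
  shows "fp (\<lambda>e. flower_list (h e) (s e) (f e :: 'l::code list list))"
  unfolding flower_list_def by (intro fp_intros assms[THEN fp_comp])

lemma fp_good_cands [fp_intros]:
  assumes "fp j" "fp f"
  shows "fp (\<lambda>e. good_cands (j e) (f e :: 'l::code list list))"
  unfolding good_cands_def cands_def by (intro fp_intros assms[THEN fp_comp])

lemma fp_add_heart [fp_intros]: "fp h ==> fp f ==> fp (\<lambda>e. add_heart (h e) (f e :: 'l::code list list))"
  unfolding add_heart_def by (intro fp_intros)

lemma fp_add_petals [fp_intros]: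
  assumes "fp h" "fp s" "fp f"
  shows "fp (\<lambda>e. add_petals (h e) (s e) (f e :: 'l::code list list))"
  unfolding add_petals_def by (intro fp_intros assms[THEN fp_comp])

lemma csize_filter_le: "csize (filter P xs) <= csize xs"
  by (induction xs) auto

lemma csize_single_le: "x \<in> set C ==> csize [x] <= csize C"
proof (induction C)
  case (Cons y C)
  then show ?case using csize_pos(1)[of C] csize_pos(1)[of y] by (auto simp: less_eq_Suc_le)
qed simp

text \<open>Every clause lists its literals in the order of a fixed list, so that clauses with the same
  literals are equal.\<close>

definition canon :: "'l list => 'l list => bool" where
  "canon L C \<longleftrightarrow> C = filter (\<lambda>l. l \<in> set C) L"

lemma canon_filter: "canon L (filter P L)"
  unfolding canon_def by (rule filter_cong) auto

lemma canon_filter2: "canon L C ==> canon L (filter P C)"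
  unfolding canon_def by (metis canon_def canon_filter filter_filter)

lemma canon_eq: "canon L C ==> canon L D ==> set C = set D \<longleftrightarrow> C = D"
  unfolding canon_def by metis

lemma canon_sub: "canon L C ==> set C \<subseteq> set L"
  unfolding canon_def by (metis filter_is_subset)

lemma canon_single: "distinct L ==> x \<in> set L ==> canon L [x]"
  unfolding canon_def by (induction L) (auto intro!: filter_False[symmetric])

lemma canon_card: "distinct L ==> canon L C ==> card (set C) = length C"
  unfolding canon_def by (metis distinct_card distinct_filter)

definition canons :: "'l list => 'l list list => bool" where
  "canons L \<phi> \<longleftrightarrow> (\<forall>C\<in>set \<phi>. canon L C)"

lemma set_prune:
  assumes "canons L \<phi>"
  shows "sets (prune \<phi>) = mins (sets \<phi>)"
proof -
  have e: "D ~= C \<and> (\<forall>l\<in>set D. l \<in> set C) \<longleftrightarrow> set D \<subset> set C" if "C \<in> set \<phi>" "D \<in> set \<phi>" for C D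
    using canon_eq[of L C D] assms that unfolding canons_def by auto
  have "set (prune \<phi>) = {C \<in> set \<phi>. \<not> (\<exists>D\<in>set \<phi>. set D \<subset> set C)}"
  proof -
    have "(\<exists>D\<in>set \<phi>. D ~= C \<and> (\<forall>l\<in>set D. l \<in> set C)) \<longleftrightarrow> (\<exists>D\<in>set \<phi>. set D \<subset> set C)" if "C \<in> set \<phi>" for C
      by (rule bex_cong[OF refl]) (rule e[OF that])
    then show ?thesis unfolding prune_def set_remdups set_filter by blast
  qed
  then show ?thesis unfolding mins_def by auto
qed

lemma canons_prune: "canons L \<phi> ==> canons L (prune \<phi>)" "distinct (prune \<phi>)"
  by (auto simp: canons_def prune_def)

lemma canons_add:
  assumes "canons L \<phi>"
  shows "canon L h ==> canons L (add_heart h \<phi>)" "canons L (add_petals h s \<phi>)"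
    "distinct (add_heart h \<phi>)" "distinct (add_petals h s \<phi>)"
proof -
  have "canons L (map (\<lambda>C. if length C = s \<and> (\<forall>l\<in>set h. l \<in> set C)
     then filter (\<lambda>l. l \<notin> set h) C else C) \<phi>)"
    using assms by (auto intro!: canon_filter2 simp: canons_def)
  then show "canons L (add_petals h s \<phi>)" unfolding add_petals_def by (rule canons_prune)
  show "canons L (add_heart h \<phi>)" if "canon L h"
    unfolding add_heart_def using assms that by (intro canons_prune) (simp add: canons_def)
qed (simp_all add: add_heart_def add_petals_def canons_prune)

lemma sets_add_heart: "canons L \<phi> ==> canon L h ==> sets (add_heart h \<phi>) = mins (sets \<phi> \<union> {set h})"
  unfolding add_heart_def by (subst set_prune[of L]) (auto simp: canons_def)

text \<open>The list program replaces clauses by their petals, whereas the set version only adds the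
  petals. Both have the same minimal members, since each replaced clause contains a petal
  strictly.\<close>

lemma mins_replace:
  assumes "!!A. A \<in> X ==> \<exists>B\<in>P. B \<subset> A"
  shows "mins ((F - X) \<union> P) = mins (F \<union> P)"
proof (rule set_eqI)
  fix C
  have 1: "(\<exists>D\<in>F \<union> P. D \<subset> C) \<longleftrightarrow> (\<exists>D\<in>F - X \<union> P. D \<subset> C)"
  proof
    assume "\<exists>D\<in>F \<union> P. D \<subset> C"
    then obtain D where D: "D \<in> F \<union> P" "D \<subset> C" by blast
    show "\<exists>D\<in>F - X \<union> P. D \<subset> C"
    proof (cases "D \<in> X")
      case True
      then obtain B where "B \<in> P" "B \<subset> D" using assms by blast
      then show ?thesis using D by blast
    qed (use D in blast)
  qed blast
  have 2: "\<exists>D\<in>F \<union> P. D \<subset> C" if "C \<in> X" using assms[OF that] by blast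
  show "C \<in> mins ((F - X) \<union> P) \<longleftrightarrow> C \<in> mins (F \<union> P)"
    unfolding mins_def mem_Collect_eq 1[symmetric] using 2 by blast
qed

lemma sets_add_petals:
  assumes "distinct L" "canons L \<phi>" "h ~= []"
  shows "sets (add_petals h s \<phi>) = mins (sets \<phi> \<union> petals (sets \<phi>) (set h) s)"
proof -
  let ?X = "flower (sets \<phi>) (set h) s" and ?P = "petals (sets \<phi>) (set h) s"
  let ?g = "\<lambda>C. if length C = s \<and> (\<forall>l\<in>set h. l \<in> set C) then filter (\<lambda>l. l \<notin> set h) C else C"
  have c: "length C = s \<and> (\<forall>l\<in>set h. l \<in> set C) \<longleftrightarrow> set C \<in> ?X" if "C \<in> set \<phi>" for C
    using that assms(2) canon_card[OF assms(1), of C] by (auto simp: flower_def canons_def)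
  have g: "set (?g C) = (if set C \<in> ?X then set C - set h else set C)" if "C \<in> set \<phi>" for C
    unfolding c[OF that] by auto
  have "sets (map ?g \<phi>) = (\<lambda>C. set (?g C)) ` set \<phi>" unfolding set_map image_image ..
  also have "... = (\<lambda>C. if set C \<in> ?X then set C - set h else set C) ` set \<phi>"
    by (rule image_cong[OF refl g])
  also have "... = (\<lambda>C. if C \<in> ?X then C - set h else C) ` sets \<phi>" unfolding image_image ..
  also have "... = (sets \<phi> - ?X) \<union> ?P"
  proof -
    have "?X \<subseteq> sets \<phi>" by (auto simp: flower_def)
    then show ?thesis unfolding petals_def by auto
  qed
  finally have 1: "sets (map ?g \<phi>) = (sets \<phi> - ?X) \<union> ?P" .
  have "canons L (map ?g \<phi>)" using assms(2) by (auto simp: canons_def intro: canon_filter2)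
  then have "sets (add_petals h s \<phi>) = mins ((sets \<phi> - ?X) \<union> ?P)"
    unfolding add_petals_def 1[symmetric] by (rule set_prune)
  also have "... = mins (sets \<phi> \<union> ?P)"
  proof (rule mins_replace)
    fix A assume A: "A \<in> ?X"
    have "A - set h \<subset> A" using A assms(3) by (cases h) (auto simp: flower_def)
    then show "\<exists>B\<in>?P. B \<subset> A" using A unfolding petals_def by blast
  qed
  finally show ?thesis .
qed

lemma card_sets:
  assumes "canons L \<phi>" "distinct \<phi>"
  shows "card (sets \<phi>) = length \<phi>"
proof -
  have "inj_on set (set \<phi>)" using assms(1) canon_eq[of L] by (auto simp: inj_on_def canons_def)
  then show ?thesis using assms(2) by (simp add: card_image distinct_card)
qed

lemma length_flower_list:
  assumes "distinct L" "canons L \<phi>" "distinct \<phi>"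
  shows "length (flower_list h s \<phi>) = card (flower (sets \<phi>) (set h) s)"
proof -
  have "sets (flower_list h s \<phi>) = flower (sets \<phi>) (set h) s"
    using assms(2) canon_card[OF assms(1)] by (auto simp: flower_list_def flower_def canons_def)
  moreover have "canons L (flower_list h s \<phi>)" "distinct (flower_list h s \<phi>)"
    using assms by (auto simp: flower_list_def canons_def)
  ultimately show ?thesis using card_sets by metis
qed

lemma cands_cases:
  assumes "d \<in> set (cands j \<phi>)"
  obtains C x where "C \<in> set \<phi>" "length C = 2" "x \<in> set C" "d = ([x], 2, j)"
  | C x where "C \<in> set \<phi>" "length C = 3" "x \<in> set C" "d = (filter (\<lambda>y. y ~= x) C, 3, j)"
  | C x where "C \<in> set \<phi>" "length C = 3" "x \<in> set C" "d = ([x], 3, j * j)"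
  using assms unfolding cands_def by auto

lemma cands_heart:
  assumes "distinct L" "canons L \<phi>" "d \<in> set (cands j \<phi>)"
  shows "canon L (fst d)" "fst d ~= []" "set (fst d) \<subseteq> set L" "\<exists>C\<in>set \<phi>. csize (fst d) <= csize C"
proof -
  have "canon L (fst d) \<and> fst d ~= [] \<and> (\<exists>C\<in>set \<phi>. csize (fst d) <= csize C)"
    using assms(3)
  proof (cases rule: cands_cases)
    case (1 C x)
    have "x \<in> set L" using 1 assms(2) canon_sub[of L C] by (auto simp: canons_def)
    moreover have "csize [x] <= csize C" by (rule csize_single_le[OF 1(3)])
    ultimately show ?thesis using 1 canon_single[OF assms(1)] by auto
  next
    case (2 C x)
    have c: "canon L C" using 2 assms(2) by (simp add: canons_def)
    then have "distinct C" using assms(1) unfolding canon_def by (metis distinct_filter)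
    moreover have "set (filter (\<lambda>y. y ~= x) C) = set C - {x}" by auto
    ultimately have "card (set (filter (\<lambda>y. y ~= x) C)) = 2" using 2 distinct_card[of C] by simp
    then have "filter (\<lambda>y. y ~= x) C ~= []" by (metis card.empty list.set(1) zero_neq_numeral)
    then show ?thesis using 2 canon_filter2[OF c] csize_filter_le by auto
  next
    case (3 C x)
    have "x \<in> set L" using 3 assms(2) canon_sub[of L C] by (auto simp: canons_def)
    moreover have "csize [x] <= csize C" by (rule csize_single_le[OF 3(3)])
    ultimately show ?thesis using 3 canon_single[OF assms(1)] by auto
  qed
  then show "canon L (fst d)" "fst d ~= []" "\<exists>C\<in>set \<phi>. csize (fst d) <= csize C" by auto
  then show "set (fst d) \<subseteq> set L" using canon_sub by blast
qed

context
  fixes L :: "'l::code list" and \<phi> :: "'l list list" and F0 :: "'l set set" and j :: nat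
  assumes L: "distinct L" and can: "canons L \<phi>" and dis: "distinct \<phi>" and j: "0 < j"
    and inv: "sparsification.inv (set L) F0 j (sets \<phi>)"
begin

interpretation sparsification "set L" F0 j
  by unfold_locales (use j in auto)

lemma mem_clause: "C \<in> set \<phi> ==> distinct C" "C \<in> set \<phi> ==> card (set C) = length C" "C \<in> set \<phi> ==> set C \<subseteq> set L"
  using can canon_card[OF L] canon_sub L unfolding canons_def canon_def by (metis distinct_filter)+

lemma flower_candidate:
  assumes "t <= card (flower (sets \<phi>) k s)" "0 < t"
  obtains C where "C \<in> set \<phi>" "length C = s" "k \<subseteq> set C"
proof -
  have "flower (sets \<phi>) k s ~= {}" using assms by auto
  then obtain C where "C \<in> set \<phi>" "card (set C) = s" "k \<subseteq> set C" by (auto simp: flower_def)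
  then show ?thesis using that mem_clause by auto
qed

lemma good_iff: "(h, s, t) \<in> set (good_cands j \<phi>) \<longleftrightarrow> (h, s, t) \<in> set (cands j \<phi>) \<and> t <= card (flower (sets \<phi>) (set h) s)"
  unfolding good_cands_def using length_flower_list[OF L can dis] by auto

lemma cand1:
  assumes "x \<in> set L" "j <= card (flower (sets \<phi>) {x} 2)"
  shows "([x], 2, j) \<in> set (good_cands j \<phi>)"
proof -
  obtain C where "C \<in> set \<phi>" "length C = 2" "x \<in> set C" using flower_candidate[OF assms(2) j] by auto
  then show ?thesis unfolding good_iff using assms(2) by (auto simp: cands_def)
qed

lemma cand2:
  assumes "k \<subseteq> set L" "card k = 2" "j <= card (flower (sets \<phi>) k 3)"
  obtains h where "(h, 3, j) \<in> set (good_cands j \<phi>)" "set h = k"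
proof -
  obtain C where C: "C \<in> set \<phi>" "length C = 3" "k \<subseteq> set C" using flower_candidate[OF assms(3) j] by auto
  have "card (set C - k) = 1" using C assms(2) mem_clause[OF C(1)] card_Diff_subset[of k "set C"] finite_subset[OF C(3)] by simp
  then obtain x where x: "set C - k = {x}" using card_1_singletonE by metis
  let ?h = "filter (\<lambda>y. y ~= x) C"
  have "set ?h = k" using x C(3) by auto
  moreover have "(?h, 3, j) \<in> set (cands j \<phi>)" using C x unfolding cands_def by fastforce
  ultimately show ?thesis using that[of ?h] assms(3) unfolding good_iff by auto
qed

lemma cand3:
  assumes "x \<in> set L" "j * j <= card (flower (sets \<phi>) {x} 3)"
  shows "([x], 3, j * j) \<in> set (good_cands j \<phi>)"
proof -
  obtain C where "C \<in> set \<phi>" "length C = 3" "x \<in> set C" using flower_candidate[OF assms(2)] j by auto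
  then show ?thesis unfolding good_iff using assms(2) by (auto simp: cands_def)
qed

lemma good_cands_Nil: "good_cands j \<phi> = [] ==> length \<phi> <= length L * (1 + j + j * j)"
proof -
  assume n: "good_cands j \<phi> = []"
  have "\<not> sel (sets \<phi>) h s" for h s
  proof
    assume "sel (sets \<phi>) h s"
    then consider "h \<subseteq> set L" "card h = 1" "j <= card (flower (sets \<phi>) h 2)"
      | "h \<subseteq> set L" "card h = 2" "j <= card (flower (sets \<phi>) h 3)"
      | "h \<subseteq> set L" "card h = 1" "j * j <= card (flower (sets \<phi>) h 3)" unfolding sel_def by auto
    then show False
    proof cases
      case 1
      then show False using cand1 n by (auto simp: card_1_singleton_iff)
    next
      case 2
      then show False using cand2 n by (metis empty_iff list.set(1))
    next
      case 3
      then show False using cand3 n by (auto simp: card_1_singleton_iff)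
    qed
  qed
  then show ?thesis using leaf[OF inv] card_sets[OF can dis] distinct_card[OF L] by simp
qed

lemma good_cands_Cons:
  assumes g: "good_cands j \<phi> = (h, s, t) # ds"
  shows "sel (sets \<phi>) (set h) s"
proof -
  have m: "(h, s, t) \<in> set (cands j \<phi>)" "t <= card (flower (sets \<phi>) (set h) s)"
    using g good_iff[of h s t] by auto
  obtain xs ys where c1: "cands j \<phi> = xs @ (h, s, t) # ys"
    "\<forall>d\<in>set xs. \<not> snd (snd d) <= length (flower_list (fst d) (fst (snd d)) \<phi>)"
    using g unfolding good_cands_def filter_eq_Cons_iff by blast
  then have c: "cands j \<phi> = xs @ (h, s, t) # ys" "\<forall>d\<in>set xs. d \<notin> set (good_cands j \<phi>)"
    by (auto simp: good_cands_def)
  have hU: "set h \<subseteq> set L" using cands_heart(3)[OF L can m(1)] by simp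
  define A where "A = concat (map (\<lambda>C. map (\<lambda>x. ([x], 2::nat, j)) C) (filter (\<lambda>C. length C = 2) \<phi>))"
  define B where "B = concat (map (\<lambda>C. map (\<lambda>x. (filter (\<lambda>y. y ~= x) C, 3::nat, j)) C) (filter (\<lambda>C. length C = 3) \<phi>))"
  define D where "D = concat (map (\<lambda>C. map (\<lambda>x. ([x], 3::nat, j * j)) C) (filter (\<lambda>C. length C = 3) \<phi>))"
  have ABD: "cands j \<phi> = A @ B @ D" by (simp add: cands_def A_def B_def D_def)
  have noA: "\<forall>x\<in>set L. card (flower (sets \<phi>) {x} 2) < j" if nA: "\<forall>d\<in>set A. d \<notin> set (good_cands j \<phi>)"
  proof (intro ballI, rule ccontr)
    fix x assume x: "x \<in> set L" "\<not> card (flower (sets \<phi>) {x} 2) < j"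
    then have *: "([x], 2, j) \<in> set (good_cands j \<phi>)" using cand1 by simp
    obtain C where "C \<in> set \<phi>" "length C = 2" "x \<in> set C" using flower_candidate[of j "{x}" 2] x j by auto
    then have "([x], 2, j) \<in> set A" unfolding A_def by auto
    then show False using nA * by blast
  qed
  have noB: "\<forall>k\<subseteq>set L. card k = 2 --> card (flower (sets \<phi>) k 3) < j" if nB: "\<forall>d\<in>set B. d \<notin> set (good_cands j \<phi>)"
  proof (intro allI impI, rule ccontr)
    fix k assume k: "k \<subseteq> set L" "card k = 2" "\<not> card (flower (sets \<phi>) k 3) < j"
    have k3: "j <= card (flower (sets \<phi>) k 3)" using k(3) by simp
    obtain C where C: "C \<in> set \<phi>" "length C = 3" "k \<subseteq> set C" using flower_candidate[OF k3 j] by auto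
    have "card (set C - k) = 1" using C k(2) mem_clause[OF C(1)] card_Diff_subset[of k "set C"] finite_subset[OF C(3)] by simp
    then obtain x where x: "set C - k = {x}" using card_1_singletonE by metis
    let ?h = "filter (\<lambda>y. y ~= x) C"
    have hk: "set ?h = k" using x C(3) by auto
    have "(?h, 3, j) \<in> set B" unfolding B_def using C x by fastforce
    then show False using nB good_iff[of ?h 3 j] k3 hk ABD by auto
  qed
  \<comment> \<open>The chosen candidate is the first good one, so if it stems from a later list,
    all candidates of the earlier lists fail.\<close>
  consider (a) "(h, s, t) \<in> set A" | (b) "(h, s, t) \<in> set B" "set A \<subseteq> set xs" | (d) "(h, s, t) \<in> set D" "set A \<union> set B \<subseteq> set xs"
    using c(1) unfolding ABD append_eq_append_conv2 append_eq_Cons_conv by fastforce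
  then show ?thesis
  proof cases
    case a
    then have "card (set h) = 1" "s = 2" "t = j" unfolding A_def by auto
    then show ?thesis using m hU unfolding sel_def by simp
  next
    case b
    then obtain C x where C: "C \<in> set \<phi>" "length C = 3" "x \<in> set C" "h = filter (\<lambda>y. y ~= x) C" "s = 3" "t = j"
      unfolding B_def by auto
    have "set h = set C - {x}" using C by auto
    then have "card (set h) = 2" using C mem_clause[OF C(1)] by simp
    then show ?thesis using m hU C noA b(2) c(2) unfolding sel_def by blast
  next
    case d
    then have "card (set h) = 1" "s = 3" "t = j * j" unfolding D_def by auto
    moreover have "\<forall>d\<in>set A. d \<notin> set (good_cands j \<phi>)" "\<forall>d\<in>set B. d \<notin> set (good_cands j \<phi>)" using d(2) c(2) by auto
    ultimately show ?thesis using m hU noA noB unfolding sel_def by blast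
  qed
qed

lemma branch_list:
  assumes g: "good_cands j \<phi> = (h, s, t) # ds"
  shows "sparsification.inv (set L) F0 j (sets (add_heart h \<phi>))" "gain (sets \<phi>) + 1 <= gain (sets (add_heart h \<phi>))"
    "sparsification.inv (set L) F0 j (sets (add_petals h s \<phi>))" "gain (sets \<phi>) + j * j <= gain (sets (add_petals h s \<phi>))"
    "canons L (add_heart h \<phi>)" "canons L (add_petals h s \<phi>)"
    "distinct (add_heart h \<phi>)" "distinct (add_petals h s \<phi>)"
proof -
  have "(h, s, t) \<in> set (good_cands j \<phi>)" using g by simp
  then have m: "(h, s, t) \<in> set (cands j \<phi>)" unfolding good_iff ..
  have h: "canon L h" "h ~= []" using cands_heart[OF L can m] by auto
  note b = branch[OF inv good_cands_Cons[OF g]]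
  have e: "sets (add_heart h \<phi>) = mins (sets \<phi> \<union> {set h})"
    "sets (add_petals h s \<phi>) = mins (sets \<phi> \<union> petals (sets \<phi>) (set h) s)"
    by (rule sets_add_heart[OF can h(1)], rule sets_add_petals[OF L can h(2)])
  show "local.inv (sets (add_heart h \<phi>))" "gain (sets \<phi>) + 1 <= gain (sets (add_heart h \<phi>))"
    "local.inv (sets (add_petals h s \<phi>))" "gain (sets \<phi>) + j * j <= gain (sets (add_petals h s \<phi>))"
    unfolding e using b by auto
  show "canons L (add_heart h \<phi>)" "canons L (add_petals h s \<phi>)"
    "distinct (add_heart h \<phi>)" "distinct (add_petals h s \<phi>)" using canons_add[OF can] h(1) by auto
qed

end

section \<open>Satisfying assignments as hitting sets, and the correctness of branching\<close>

definition hits :: "('l => bool) => 'l list list => bool" where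
  "hits A \<phi> \<longleftrightarrow> (\<forall>C\<in>set \<phi>. \<exists>l\<in>set C. A l)"

lemma hits_sets: "hits A \<phi> \<longleftrightarrow> (\<forall>C\<in>sets \<phi>. \<exists>l\<in>C. A l)"
  by (auto simp: hits_def)

lemma mins_below:
  assumes "C \<in> F" "finite C"
  shows "\<exists>D\<in>mins F. D \<subseteq> C"
  using assms(2,1)
proof (induction C rule: finite_psubset_induct)
  case (psubset C)
  show ?case
  proof (cases "\<exists>D\<in>F. D \<subset> C")
    case True
    then show ?thesis using psubset.IH by (meson order.trans psubset_imp_subset)
  next
    case False
    then show ?thesis using psubset.prems by (auto simp: mins_def)
  qed
qed

lemma hits_mins: "(!!C. C \<in> F ==> finite C) ==> (\<forall>C\<in>mins F. \<exists>l\<in>C. A l) \<longleftrightarrow> (\<forall>C\<in>F. \<exists>l\<in>C. A l)"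
  using mins_below[of _ F] by (metis (no_types, lifting) mins_def mem_Collect_eq subsetD)

text \<open>Either some literal of the heart is true, or every clause of the flower owes its truth
  to its petal. Conversely both new formulas imply the old one.\<close>

lemma hits_branch:
  fixes L :: "'l::code list"
  assumes "distinct L" "canons L \<phi>" "d \<in> set (cands j \<phi>)"
  shows "hits A \<phi> \<longleftrightarrow> hits A (add_heart (fst d) \<phi>) \<or> hits A (add_petals (fst d) s \<phi>)"
proof -
  note h = cands_heart[OF assms]
  have H: "hits A (add_heart (fst d) \<phi>) \<longleftrightarrow> (\<exists>l\<in>set (fst d). A l) \<and> hits A \<phi>"
    unfolding hits_sets sets_add_heart[OF assms(2) h(1)] by (subst hits_mins) auto
  have P: "hits A (add_petals (fst d) s \<phi>) \<longleftrightarrow>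
      hits A \<phi> \<and> (\<forall>C\<in>flower (sets \<phi>) (set (fst d)) s. \<exists>l\<in>C. l \<notin> set (fst d) \<and> A l)"
    unfolding hits_sets sets_add_petals[OF assms(1,2) h(2)]
  proof (subst hits_mins)
    show "finite C" if "C \<in> sets \<phi> \<union> petals (sets \<phi>) (set (fst d)) s" for C
      using that by (auto simp: petals_def flower_def)
    show "(\<forall>C\<in>sets \<phi> \<union> petals (sets \<phi>) (set (fst d)) s. \<exists>l\<in>C. A l) \<longleftrightarrow>
      (\<forall>C\<in>sets \<phi>. \<exists>l\<in>C. A l) \<and> (\<forall>C\<in>flower (sets \<phi>) (set (fst d)) s. \<exists>l\<in>C. l \<notin> set (fst d) \<and> A l)"
      unfolding petals_def ball_Un ball_simps(9) by blast
  qed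
  show ?thesis unfolding H P by (auto simp: hits_def flower_def) blast
qed

section \<open>Simulating a machine\<close>

lemma nth_default_tl: "nth_default d (tl xs) i = nth_default d xs (Suc i)"
  by (cases xs) (auto simp: nth_default_def)

lemma nth_default_csize: "csize (nth_default d xs i) <= csize xs + csize d"
  using csize_mem[of "xs ! i" xs] by (auto simp: nth_default_def trans_le_add1)

lemma csize_tl: "csize (tl xs) <= csize xs"
  by (cases xs) auto

text \<open>A tape is represented by the cells to the left of the head, nearest first, and the cells
  from the head on to the right; all further cells are blank.\<close>

definition rep :: "nat list \<times> nat list => tape => bool" where
  "rep z tp \<longleftrightarrow> (\<forall>i. fst tp (snd tp + int i) = nth_default 0 (snd z) i) \<and>
     (\<forall>i. fst tp (snd tp - 1 - int i) = nth_default 0 (fst z) i)"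

definition zact :: "nat list \<times> nat list => nat => nat => nat list \<times> nat list" where
  "zact z a m = (if m = 0 then (tl (fst z), nth_default 0 (fst z) 0 # a # tl (snd z))
     else if m = 1 then (fst z, a # tl (snd z)) else (a # fst z, tl (snd z)))"

lemma rep_read: "rep z tp ==> nth_default 0 (snd z) 0 = fst tp (snd tp)"
  unfolding rep_def by (metis add.right_neutral of_nat_0)

lemma rep_zact:
  assumes z: "rep z (c, h)" and c': "c' h = a" "!!p. p ~= h ==> c' p = c p"
    and h': "int m - 1 = h' - h" "m <= 2"
  shows "rep (zact z a m) (c', h')"
proof -
  have z1: "c (h + int i) = nth_default 0 (snd z) i" "c (h - 1 - int i) = nth_default 0 (fst z) i" for i
    using z by (auto simp: rep_def)
  have r: "c' (h + 1 + int i) = nth_default 0 (tl (snd z)) i" for i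
    using c'(2)[of "h + 1 + int i"] z1(1)[of "Suc i"] by (simp add: nth_default_tl add.assoc)
  have l: "c' (h - 1 - int i) = nth_default 0 (fst z) i" for i
    using c'(2)[of "h - 1 - int i"] z1(2)[of i] by simp
  consider "m = 0" "h' = h - 1" | "m = 1" "h' = h" | "m = 2" "h' = h + 1" using h' by fastforce
  then show ?thesis
  proof cases
    case 1
    have "c' (h - 1 + int i) = nth_default 0 (nth_default 0 (fst z) 0 # a # tl (snd z)) i" for i
    proof (cases i)
      case 0
      then show ?thesis using l[of 0] by simp
    next
      case (Suc k)
      then show ?thesis using r[of "k - 1"] c'(1) by (cases k) (auto simp: algebra_simps)
    qed
    moreover have "c' (h - 1 - 1 - int i) = nth_default 0 (tl (fst z)) i" for i
      using l[of "Suc i"] by (simp add: nth_default_tl algebra_simps)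
    ultimately show ?thesis using 1 by (simp add: rep_def zact_def)
  next
    case 2
    have "c' (h + int i) = nth_default 0 (a # tl (snd z)) i" for i
      using r[of "i - 1"] c'(1) by (cases i) (auto simp: algebra_simps)
    then show ?thesis using 2 l by (simp add: rep_def zact_def)
  next
    case 3
    have "c' (h + 1 - 1 - int i) = nth_default 0 (a # fst z) i" for i
      using l[of "i - 1"] c'(1) by (cases i) (auto simp: algebra_simps)
    then show ?thesis using 3 r by (simp add: rep_def zact_def)
  qed
qed

lemma csize_zact: "csize (zact z a m) <= csize z + csize a + 3"
proof -
  obtain l r where z: "z = (l, r)" by (cases z)
  have "csize l = (if l = [] then 1 else Suc (csize (hd l) + csize (tl l)))" by (cases l) auto
  then show ?thesis unfolding z using csize_tl[of l] csize_tl[of r]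
    by (cases l) (auto simp: zact_def csize_prod)
qed

type_synonym sim = "nat \<times> (nat list \<times> nat list) list"

context wf_machine
begin

definition sim :: "sim => config => bool" where
  "sim z c \<longleftrightarrow> fst z = fst c \<and> length (snd z) = K \<and> (\<forall>i<K. rep (snd z ! i) (snd c ! i))"

definition tapez :: "sim => nat => nat list \<times> nat list" where
  "tapez z i = nth_default ([], []) (snd z) i"

definition matching :: "sim => (nat \<times> nat list \<times> nat \<times> nat list \<times> nat list) list" where
  "matching z = filter (\<lambda>d. fst d = fst z \<and>
     (\<forall>i\<in>set [0..<K]. nth_default 0 (fst (snd d)) i = nth_default 0 (snd (tapez z i)) 0)) table"

definition zstep :: "sim => sim" where
  "zstep z = (if matching z = [] then z else
     (fst (snd (snd (hd (matching z)))),
      map (\<lambda>i. zact (tapez z i) (nth_default 0 (fst (snd (snd (snd (hd (matching z)))))) i)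
        (nth_default 0 (snd (snd (snd (snd (hd (matching z)))))) i)) [0..<K]))"

definition zinit :: "bool list => sim" where
  "zinit y = (start M, ([], map (\<lambda>b. if b then 2 else 1) y) # replicate (K - 1) ([], []))"

lemma fp_zact [fp_intros]: "fp z ==> fp a ==> fp m ==> fp (\<lambda>e. zact (z e) (a e) (m e))"
  unfolding zact_def by (intro fp_intros)

lemma fp_zstep [fp_intros]: "fp f ==> fp (\<lambda>e. zstep (f e))"
proof (rule fp_comp[of zstep])
  show "fp zstep" unfolding zstep_def matching_def tapez_def by (intro fp_intros)
qed

lemma fp_zinit [fp_intros]: "fp f ==> fp (\<lambda>e. zinit (f e))"
proof (rule fp_comp[of zinit])
  show "fp zinit" unfolding zinit_def by (intro fp_intros)
qed

lemma K_pos: "0 < K" using wf by (simp add: wf_tm_def)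

lemma sim_zinit: "sim (zinit y) (run M [y] 0)"
proof -
  have "rep (([], map (\<lambda>b. if b then 2 else 1) y)) (input_tape y)"
    by (auto simp: rep_def input_tape_def nth_default_def elim: bit_sym.elims)
  moreover have "rep ([], []) (input_tape [])" by (auto simp: rep_def input_tape_def nth_default_def)
  ultimately show ?thesis using K_pos unfolding sim_def zinit_def run_def
    by (auto simp: initial_def nth_Cons split: nat.splits)
qed

lemma table_mv: "d \<in> set table ==> nth_default 0 (snd (snd (snd (snd d)))) i <= 2"
  unfolding table_def by (auto simp: nth_default_def mvc_def split: move.splits)

text \<open>When the machine has halted no table entry matches, so both sides stand still; otherwise
  the first matching entry is the right one by determinism.\<close>

lemma sim_zstep:
  assumes g: "good_cfg M c" and s: "sim z c"
  shows "sim (zstep z) (step M c)"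
proof (cases "halted M c")
  case True
  then have "matching z = []" using s
    by (auto simp: matching_def table_def sim_def halted_def filter_empty_conv)
  then show ?thesis using True s by (simp add: zstep_def step_def)
next
  case False
  have tz: "tapez z i = snd z ! i" "nth_default 0 (snd (tapez z i)) 0 = cont c i (hdp c i)" if "i < K" for i
    using s that rep_read[of "snd z ! i" "snd c ! i"] by (auto simp: tapez_def sim_def nth_default_nth)
  obtain d where d: "d \<in> set table" "fst d = fst c" "!!i. i < K ==> nth_default 0 (fst (snd d)) i = cont c i (hdp c i)"
    using table_entry[OF g False] by metis
  then have "d \<in> set (matching z)" using s tz(2) by (auto simp: matching_def sim_def)
  then have ne: "matching z ~= []" by auto
  let ?d = "hd (matching z)"
  have "?d \<in> set (matching z)" using ne by simp
  then have d': "?d \<in> set table" "fst ?d = fst c" "!!i. i < K ==> nth_default 0 (fst (snd ?d)) i = cont c i (hdp c i)"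
    using s tz(2) by (auto simp: matching_def sim_def)
  note e = table_entry_rev[OF d'(1) g d'(2) d'(3)]
  have "rep (zact (tapez z i) (nth_default 0 (fst (snd (snd (snd ?d)))) i) (nth_default 0 (snd (snd (snd (snd ?d)))) i))
     (snd (step M c) ! i)" if i: "i < K" for i
  proof -
    have r: "rep (tapez z i) (fst (snd c ! i), snd (snd c ! i))" using s i tz(1)[OF i] by (simp add: sim_def)
    have "rep (zact (tapez z i) (nth_default 0 (fst (snd (snd (snd ?d)))) i) (nth_default 0 (snd (snd (snd (snd ?d)))) i))
       (fst (snd (step M c) ! i), snd (snd (step M c) ! i))"
    proof (rule rep_zact[OF r])
      show "cont (step M c) i (hdp c i) = nth_default 0 (fst (snd (snd (snd ?d)))) i" using e(2)[OF _ i] by simp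
      show "p ~= hdp c i ==> cont (step M c) i p = cont c i p" for p by (rule step_good(3)[OF wf g i])
      show "int (nth_default 0 (snd (snd (snd (snd ?d)))) i) - 1 = hdp (step M c) i - hdp c i" using e(3)[OF _ i] by simp
    qed (rule table_mv[OF d'(1)])
    then show ?thesis by simp
  qed
  then show ?thesis using ne e(1) by (simp add: sim_def zstep_def)
qed

lemma sim_run: "sim ((zstep ^^ t) (zinit y)) (run M [y] t)"
proof (induction t)
  case 0
  then show ?case using sim_zinit by simp
next
  case (Suc t)
  have "run M [y] (Suc t) = step M (run M [y] t)" by (simp add: run_def)
  then show ?case using sim_zstep[OF run_good(1)[OF wf] Suc] by simp
qed

lemma csize_map_le:
  assumes "!!i. i < n ==> csize (f i) <= csize (g i) + b"
  shows "csize (map f [0..<n]) <= csize (map g [0..<n]) + n * b"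
  using assms
proof (induction n)
  case (Suc n)
  then have "csize (map f [0..<n]) <= csize (map g [0..<n]) + n * b" "csize (f n) <= csize (g n) + b" by auto
  moreover have "csize (map f [0..<Suc n]) = csize (map f [0..<n]) + csize (f n) + 1"
    "csize (map g [0..<Suc n]) = csize (map g [0..<n]) + csize (g n) + 1" by (simp_all add: csize_append)
  ultimately show ?case by simp
qed simp

lemma csize_zstep:
  assumes "length (snd z) = K"
  shows "csize (zstep z) <= csize z + (K + 1) * (csize table + 5)"
proof (cases "matching z = []")
  case True
  then show ?thesis by (simp add: zstep_def)
next
  case False
  let ?d = "hd (matching z)"
  have "?d \<in> set (matching z)" using False by simp
  then have "?d \<in> set table" by (simp add: matching_def)
  then have d: "csize ?d <= csize table" by (rule csize_mem)
  obtain a b c e f where abc: "?d = (a, b, c, e, f)" by (metis prod.exhaust)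
  have ce: "csize c <= csize table" "csize e <= csize table" using d unfolding abc by auto
  have "csize (zact (tapez z i) (nth_default 0 e i) (nth_default 0 f i)) <= csize (tapez z i) + (csize table + 5)" for i
    using csize_zact[of "tapez z i" "nth_default 0 e i" "nth_default 0 f i"] nth_default_csize[of 0 e i] ce(2) by simp
  then have "csize (map (\<lambda>i. zact (tapez z i) (nth_default 0 e i) (nth_default 0 f i)) [0..<K])
      <= csize (map (tapez z) [0..<K]) + K * (csize table + 5)"
    by (rule csize_map_le)
  moreover have "map (tapez z) [0..<K] = snd z"
    using assms by (intro nth_equalityI) (auto simp: tapez_def nth_default_nth)
  ultimately show ?thesis using False ce csize_prod[of "fst z" "snd z"] unfolding zstep_def abc by simp
qed

text \<open>Each simulated step adds at most a constant that depends on the machine alone, so memory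
  is linear in the simulated time.\<close>

lemma csize_zrun: "csize ((zstep ^^ t) (zinit y)) <= csize (zinit y) + t * ((K + 1) * (csize table + 5))"
proof (induction t)
  case (Suc t)
  have "length (snd ((zstep ^^ t) (zinit y))) = K" using sim_run[of t y] by (simp add: sim_def)
  then show ?case using csize_zstep[of "(zstep ^^ t) (zinit y)"] Suc by simp
qed simp

end

section \<open>Decoding formulas\<close>

type_synonym pstate = "nat \<times> (bool \<times> nat) list \<times> bool \<times> nat \<times> cnf"

text \<open>Modes: 0 between clauses, 1 between literals, 2 before a sign, 3 inside a variable, 4 at the end.\<close>

definition pstep :: "pstate => bool => pstate" where
  "pstep s b =
    (if fst s = 0 then (if b then 1 else 4, [], False, 0, snd (snd (snd (snd s))))
     else if fst s = 1 then
       (if b then (2, snd s) else (0, [], False, 0, snd (snd (snd (snd s))) @ [fst (snd s)]))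
     else if fst s = 2 then (3, fst (snd s), b, 0, snd (snd (snd (snd s))))
     else if fst s = 3 then
       (if b then (3, fst (snd s), fst (snd (snd s)), Suc (fst (snd (snd (snd s)))), snd (snd (snd (snd s))))
        else (1, fst (snd s) @ [(fst (snd (snd s)), fst (snd (snd (snd s))))], False, 0, snd (snd (snd (snd s)))))
     else s)"

definition dec :: "bool list => cnf" where
  "dec x = snd (snd (snd (snd (foldl pstep (0, [], False, 0, []) x))))"

lemma pstep_unary: "foldl pstep (3, c, b, k, a) (enc_unary n) = (1, c @ [(b, k + n)], False, 0, a)"
  by (induction n arbitrary: k) (auto simp: enc_unary_def pstep_def)

lemma pstep_clause:
  "foldl pstep (1, c, False, 0, a) (enc_list (\<lambda>(b, v). b # enc_unary v) C) = (0, [], False, 0, a @ [c @ C])"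
proof (induction C arbitrary: c)
  case Nil
  then show ?case by (simp add: enc_list_def pstep_def)
next
  case (Cons l C)
  have "enc_list (\<lambda>(b, v). b # enc_unary v) (l # C) =
      True # fst l # enc_unary (snd l) @ enc_list (\<lambda>(b, v). b # enc_unary v) C"
    by (simp add: enc_list_def case_prod_beta)
  moreover have "pstep (pstep (1, c, False, 0, a) True) (fst l) = (3, c, fst l, 0, a)" by (simp add: pstep_def)
  ultimately show ?case using Cons by (simp add: pstep_unary)
qed

lemma pstep_cnf:
  "foldl pstep (0, [], False, 0, a) (enc_cnf \<phi>) = (4, [], False, 0, a @ \<phi>)"
proof (induction \<phi> arbitrary: a)
  case Nil
  then show ?case by (simp add: enc_cnf_def enc_list_def pstep_def)
next
  case (Cons C \<phi>)
  have "enc_cnf (C # \<phi>) = True # enc_list (\<lambda>(b, v). b # enc_unary v) C @ enc_cnf \<phi>"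
    by (simp add: enc_cnf_def enc_list_def)
  moreover have "pstep (0, [], False, 0, a) True = (1, [], False, 0, a)" by (simp add: pstep_def)
  ultimately show ?case using Cons pstep_clause[of "[]" a C] by simp
qed

lemma dec_enc: "dec (enc_cnf \<phi>) = \<phi>"
  by (simp add: dec_def pstep_cnf)

text \<open>Mode and sign are left out because they are bounded; the other components grow by a
  constant per bit.\<close>

definition parse_size :: "pstate => nat" where
  "parse_size s = csize (fst (snd s)) + csize (fst (snd (snd (snd s)))) + csize (snd (snd (snd (snd s))))"

lemma csize_snoc: "csize (xs @ [x]) = csize xs + csize x + 1"
  by (simp add: csize_append)

lemma pstep_size:
  assumes "fst s <= 4"
  shows "fst (pstep s b) <= 4 \<and> parse_size (pstep s b) <= parse_size s + 6"
proof -
  obtain m c g k a where s: "s = (m, c, g, k, a)" by (metis prod.exhaust)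
  show ?thesis using assms csize_pos(1)[of c] csize_pos(1)[of k] csize_bool[of g] csize_bool[of b]
    unfolding s pstep_def parse_size_def by (auto simp: csize_snoc)
qed

lemma pfold_size: "fst (foldl pstep (0, [], False, 0, []) x) <= 4 \<and> parse_size (foldl pstep (0, [], False, 0, []) x) <= 3 + 6 * length x"
proof (induction x rule: rev_induct)
  case Nil
  then show ?case by (simp add: parse_size_def)
next
  case (snoc b x)
  then show ?case using pstep_size[of "foldl pstep (0, [], False, 0, []) x" b] by simp
qed

lemma fp_dec [fp_intros]: "fp x ==> fp (\<lambda>e. dec (x e))"
proof (rule fp_comp[of dec])
  have "fp (\<lambda>x. foldl pstep (0, [], False, 0, []) x)"
  proof (rule fp_foldl[where B = "\<lambda>x. 20 + 6 * csize x"])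
    show "fp (\<lambda>p :: bool list \<times> pstate \<times> bool. pstep (fst (snd p)) (snd (snd p)))"
      unfolding pstep_def by (intro fp_intros)
    fix e ys zs :: "bool list" assume e: "e = ys @ zs"
    obtain m c g k a where s: "foldl pstep (0, [], False, 0, []) ys = (m, c, g, k, a)" by (metis prod.exhaust)
    have "length ys <= csize e" using length_le_csize[of e] e by simp
    then show "csize (foldl pstep (0, [], False, 0, []) ys) <= 20 + 6 * csize e"
      using pfold_size[of ys] csize_bool[of g] unfolding s by (simp add: parse_size_def)
  qed (intro fp_intros pbo_intros)+
  then show "fp dec" unfolding dec_def by (intro fp_snd)
qed

section \<open>Deciding 3-SAT with a solver for edge deletion\<close>

type_synonym worker = "nat \<times> cnf list \<times> sim list"

text \<open>A worker carries the parameter \<open>j\<close> of the sparsification, the formulas still to be examined and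
  at most one running simulation.\<close>

definition stack :: "cnf => cnf list" where
  "stack \<phi> = (if [] \<in> set \<phi> then []
     else [prune (map (\<lambda>C. filter (\<lambda>l. l \<in> set C) (remdups (concat \<phi>))) \<phi>)])"

lemma fp_stack [fp_intros]: "fp f ==> fp (\<lambda>e. stack (f e))"
proof (rule fp_comp[of stack])
  show "fp stack" unfolding stack_def by (intro fp_intros)
qed

lemma satP_hits: "satP \<phi> \<longleftrightarrow> (\<exists>\<alpha>. hits (\<lambda>l. \<alpha> (snd l) = fst l) \<phi>)"
  by (simp add: satP_def hits_def case_prod_beta)

text \<open>Only the correctness of the solver is assumed. The search is built without knowing a
  time bound, which enters later in the analysis.\<close>

locale search = wf_machine +
  fixes h r N
  assumes pat: "pattern h r N"
    and ans: "!!\<phi> :: cnf. clauses_ok \<phi> ==>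
       \<exists>t. fst (run M [red h N \<phi>] t) = (if satP \<phi> then accept M else reject M)"
begin

text \<open>An accepting simulation is kept forever: this is how a worker records the answer yes.
  The stack makes the branching a depth-first search, so memory grows with the number of steps and
  not with the size of the search tree.\<close>

definition wstep :: "worker => worker" where
  "wstep w =
    (if snd (snd w) ~= [] then
       (if fst (hd (snd (snd w))) = accept M then w
        else if fst (hd (snd (snd w))) = reject M then (fst w, fst (snd w), [])
        else (fst w, fst (snd w), [zstep (hd (snd (snd w)))]))
     else if fst (snd w) = [] then w
     else if good_cands (fst w) (hd (fst (snd w))) = [] then
       (fst w, tl (fst (snd w)), [zinit (red h N (hd (fst (snd w))))])
     else (fst w, add_heart (fst (hd (good_cands (fst w) (hd (fst (snd w)))))) (hd (fst (snd w))) #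
        add_petals (fst (hd (good_cands (fst w) (hd (fst (snd w))))))
          (fst (snd (hd (good_cands (fst w) (hd (fst (snd w))))))) (hd (fst (snd w))) # tl (fst (snd w)), []))"

definition yes :: "worker => bool" where
  "yes w \<longleftrightarrow> snd (snd w) ~= [] \<and> fst (hd (snd (snd w))) = accept M"

definition finished :: "worker => bool" where
  "finished w \<longleftrightarrow> yes w \<or> snd (snd w) = [] \<and> fst (snd w) = []"

lemma fp_red': "fp f ==> fp (\<lambda>e. red h N (f e :: cnf))"
  by (rule fp_comp[OF fp_red[OF pat]])

lemma fp_wstep: "fp wstep"
  unfolding wstep_def by (intro fp_intros fp_red')

lemma wstep_finished: "finished w ==> wstep w = w"
  by (auto simp: finished_def yes_def wstep_def)

lemma wsteps_finished: "finished w ==> (wstep ^^ s) w = w"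
  by (induction s) (auto simp: wstep_finished)

lemma wstep_simps:
  "good_cands j \<phi> = [] ==> wstep (j, \<phi> # st, []) = (j, st, [zinit (red h N \<phi>)])"
  "good_cands j \<phi> = d # ds ==> wstep (j, \<phi> # st, []) =
     (j, add_heart (fst d) \<phi> # add_petals (fst d) (fst (snd d)) \<phi> # st, [])"
  "fst z ~= accept M ==> wstep (j, st, [z]) = (if fst z = reject M then (j, st, []) else (j, st, [zstep z]))"
  "finished (j, [], [])" "wstep (j, [], []) = (j, [], [])"
  by (auto simp: wstep_def finished_def yes_def)

definition zrun :: "cnf => nat => sim" where
  "zrun \<phi> t = (zstep ^^ t) (zinit (red h N \<phi>))"

lemma fst_zrun: "fst (zrun \<phi> t) = fst (run M [red h N \<phi>] t)"
  using sim_run[of t "red h N \<phi>"] by (simp add: zrun_def sim_def)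

lemma zrun_answer:
  assumes "clauses_ok \<phi>"
  shows "fst (zrun \<phi> t) = accept M ==> satP \<phi>" "fst (zrun \<phi> t) = reject M ==> \<not> satP \<phi>"
proof -
  let ?c = "run M [red h N \<phi>]"
  obtain u where u: "fst (?c u) = (if satP \<phi> then accept M else reject M)" using ans[OF assms] by blast
  then have hu: "halted M (?c u)" by (auto simp: halted_def split: if_splits)
  have eq: "?c t = ?c u" if "halted M (?c t)"
    using run_stable[OF that, of u] run_stable[OF hu, of t] by (metis nat_le_linear)
  show "satP \<phi>" if "fst (zrun \<phi> t) = accept M"
    using eq that u wf unfolding fst_zrun by (auto simp: halted_def wf_tm_def split: if_splits)
  show "\<not> satP \<phi>" if "fst (zrun \<phi> t) = reject M"
    using eq that u wf unfolding fst_zrun by (auto simp: halted_def wf_tm_def split: if_splits)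
qed

section \<open>Correctness and running time of a single worker\<close>

context
  fixes L :: "literal list" and F0 :: "literal set set" and j :: nat
  assumes L: "distinct L" and j: "0 < j"
begin

interpretation sparsification "set L" F0 j
  by unfold_locales (use j in auto)

definition okf :: "cnf => bool" where
  "okf \<phi> \<longleftrightarrow> canons L \<phi> \<and> distinct \<phi> \<and> sparsification.inv (set L) F0 j (sets \<phi>)"

lemma okf_clauses:
  assumes "okf \<phi>"
  shows "clauses_ok \<phi>"
  unfolding clauses_ok_def
proof
  fix C assume C: "C \<in> set \<phi>"
  have i: "local.inv (sets \<phi>)" and c: "canon L C" using assms C by (auto simp: okf_def canons_def)
  have "set C ~= {}" "card (set C) <= 3" using invD(2,3)[OF i, of "set C"] C by auto
  then show "C ~= [] \<and> length C <= 3" using canon_card[OF L c] by auto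
qed

lemma okf_branch:
  assumes ok: "okf \<phi>" and g: "good_cands j \<phi> = d # ds"
  shows "okf (add_heart (fst d) \<phi>)" "okf (add_petals (fst d) (fst (snd d)) \<phi>)"
    "gain (sets \<phi>) + 1 <= gain (sets (add_heart (fst d) \<phi>))"
    "gain (sets \<phi>) + j * j <= gain (sets (add_petals (fst d) (fst (snd d)) \<phi>))"
    "satP \<phi> \<longleftrightarrow> satP (add_heart (fst d) \<phi>) \<or> satP (add_petals (fst d) (fst (snd d)) \<phi>)"
    "d \<in> set (cands j \<phi>)"
proof -
  obtain k s t where d: "d = (k, s, t)" by (metis prod.exhaust)
  have o: "canons L \<phi>" "distinct \<phi>" "sparsification.inv (set L) F0 j (sets \<phi>)" using ok by (auto simp: okf_def)
  note b = branch_list[OF L o(1,2) j o(3) g[unfolded d]]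
  show "okf (add_heart (fst d) \<phi>)" "okf (add_petals (fst d) (fst (snd d)) \<phi>)"
    "gain (sets \<phi>) + 1 <= gain (sets (add_heart (fst d) \<phi>))"
    "gain (sets \<phi>) + j * j <= gain (sets (add_petals (fst d) (fst (snd d)) \<phi>))"
    using b unfolding okf_def d fst_conv snd_conv by blast+
  have "d \<in> set (good_cands j \<phi>)" using g by simp
  then show m: "d \<in> set (cands j \<phi>)" by (simp add: good_cands_def)
  show "satP \<phi> \<longleftrightarrow> satP (add_heart (fst d) \<phi>) \<or> satP (add_petals (fst d) (fst (snd d)) \<phi>)"
    unfolding satP_hits hits_branch[OF L o(1) m, of _ "fst (snd d)"] by blast
qed

lemma okf_leaf: "okf \<phi> ==> good_cands j \<phi> = [] ==> length \<phi> <= length L * (1 + j + j * j)"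
  using good_cands_Nil[OF L _ _ j] unfolding okf_def by blast

text \<open>The two extra steps start the simulation and discard it after a rejection.\<close>

lemma process_leaf:
  assumes ok: "okf \<phi>" and g: "good_cands j \<phi> = []" and t: "halted M (run M [red h N \<phi>] t)"
  obtains s where "s <= t + 2" "(wstep ^^ s) (j, \<phi> # st, []) = (j, st, []) \<or> finished ((wstep ^^ s) (j, \<phi> # st, []))"
proof -
  define u where "u = (LEAST t. halted M (run M [red h N \<phi>] t))"
  have hu: "halted M (run M [red h N \<phi>] u)" unfolding u_def by (rule LeastI) (rule t)
  have ut: "u <= t" unfolding u_def by (rule Least_le) (rule t)
  have nh: "\<not> halted M (run M [red h N \<phi>] v)" if "v < u" for v
    using that not_less_Least unfolding u_def by blast
  have run: "v <= u ==> (wstep ^^ Suc v) (j, \<phi> # st, []) = (j, st, [zrun \<phi> v])" for v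
  proof (induction v)
    case 0
    then show ?case using wstep_simps(1)[OF g] by (simp add: zrun_def)
  next
    case (Suc v)
    have "fst (zrun \<phi> v) ~= accept M" "fst (zrun \<phi> v) ~= reject M"
      using nh[of v] Suc.prems unfolding fst_zrun by (auto simp: halted_def)
    then show ?case using Suc wstep_simps(3)[of "zrun \<phi> v" j st] by (simp add: zrun_def)
  qed
  show ?thesis
  proof (cases "fst (zrun \<phi> u) = accept M")
    case True
    then show ?thesis using that[of "Suc u"] run[of u] ut by (simp add: finished_def yes_def)
  next
    case False
    then have "fst (zrun \<phi> u) = reject M" using hu unfolding fst_zrun by (auto simp: halted_def)
    then have "(wstep ^^ Suc (Suc u)) (j, \<phi> # st, []) = (j, st, [])"
      using run[of u] wstep_simps(3)[OF False, of j st] by simp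
    then show ?thesis using that[of "Suc (Suc u)"] ut by simp
  qed
qed

context
  fixes W \<beta> :: real
  assumes \<beta>: "1 <= \<beta>" "\<beta> ^ (j * j - 1) + 1 <= \<beta> ^ (j * j)" and W: "1 <= W"
    and T: "!!\<phi>. clauses_ok \<phi> ==> snd ` set (concat \<phi>) \<subseteq> snd ` set L ==> length \<phi> <= length L * (1 + j + j * j) ==>
      \<exists>t. halted M (run M [red h N \<phi>] t) \<and> real (t + 2) <= W"
begin

text \<open>With remaining potential \<open>m\<close> the search tree has about
  \<open>\<beta> ^ m\<close> leaves of cost \<open>W\<close> and one inner node less, each of cost
  at most \<open>W\<close>; hence \<open>W * (2 * \<beta> ^ m - 1)\<close>. The subtraction absorbs
  the branching step itself, and the condition on \<open>\<beta>\<close> is the recurrence for the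
  branching vector. A worker that has found yes stops early, which the second disjunct
  allows.\<close>

lemma process:
  assumes "okf \<phi>"
  shows "\<exists>s. real s <= W * (2 * \<beta> ^ (6 * j * card (set L) - gain (sets \<phi>)) - 1) \<and>
     ((wstep ^^ s) (j, \<phi> # st, []) = (j, st, []) \<or> finished ((wstep ^^ s) (j, \<phi> # st, [])))"
  using assms
proof (induction "6 * j * card (set L) - gain (sets \<phi>)" arbitrary: \<phi> st rule: less_induct)
  case less
  let ?B = "6 * j * card (set L)"
  let ?m = "?B - gain (sets \<phi>)"
  show ?case
  proof (cases "good_cands j \<phi>")
    case Nil
    have "canons L \<phi>" using less.prems by (simp add: okf_def)
    then have "set (concat \<phi>) \<subseteq> set L" using canon_sub by (fastforce simp: canons_def)
    then obtain t where t: "halted M (run M [red h N \<phi>] t)" "real (t + 2) <= W"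
      using T[OF okf_clauses[OF less.prems] _ okf_leaf[OF less.prems Nil]] by (meson image_mono)
    obtain s where s: "s <= t + 2" "(wstep ^^ s) (j, \<phi> # st, []) = (j, st, []) \<or> finished ((wstep ^^ s) (j, \<phi> # st, []))"
      using process_leaf[OF less.prems Nil t(1)] by blast
    have "real s <= W * 1" using s(1) t(2) by simp
    also have "... <= W * (2 * \<beta> ^ ?m - 1)" using W one_le_power[OF \<beta>(1), of ?m] by (intro mult_left_mono) auto
    finally show ?thesis using s(2) by blast
  next
    case (Cons d ds)
    let ?h = "add_heart (fst d) \<phi>" and ?p = "add_petals (fst d) (fst (snd d)) \<phi>"
    note b = okf_branch[OF less.prems Cons]
    have gp: "gain (sets \<phi>) <= ?B" "gain (sets ?h) <= ?B" "gain (sets ?p) <= ?B"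
      using gain_bound less.prems b(1,2) unfolding okf_def by blast+
    have m: "j * j <= ?m" "?B - gain (sets ?h) <= ?m - 1" "?B - gain (sets ?p) <= ?m - j * j" "1 <= ?m"
      using gp b(3,4) by linarith+
    have jj: "1 <= j * j" using j by simp
    have lt: "?B - gain (sets ?h) < ?m" "?B - gain (sets ?p) < ?m" using m jj by linarith+
    obtain s2 where s2: "real s2 <= W * (2 * \<beta> ^ (?B - gain (sets ?p)) - 1)"
      "(wstep ^^ s2) (j, ?p # st, []) = (j, st, []) \<or> finished ((wstep ^^ s2) (j, ?p # st, []))"
      using less.hyps[OF lt(2) b(2), of st] by blast
    obtain s1 where s1: "real s1 <= W * (2 * \<beta> ^ (?B - gain (sets ?h)) - 1)"
      "(wstep ^^ s1) (j, ?h # ?p # st, []) = (j, ?p # st, []) \<or> finished ((wstep ^^ s1) (j, ?h # ?p # st, []))"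
      using less.hyps[OF lt(1) b(1), of "?p # st"] by blast
    let ?s = "s2 + (s1 + 1)"
    have "(wstep ^^ ?s) (j, \<phi> # st, []) = (wstep ^^ s2) ((wstep ^^ s1) (j, ?h # ?p # st, []))"
      by (simp only: funpow_add comp_apply One_nat_def funpow.simps id_apply wstep_simps(2)[OF Cons])
    then have fin: "(wstep ^^ ?s) (j, \<phi> # st, []) = (j, st, []) \<or> finished ((wstep ^^ ?s) (j, \<phi> # st, []))"
      using s1(2) s2(2) wsteps_finished by metis
    have p1: "\<beta> ^ (?B - gain (sets ?h)) <= \<beta> ^ (?m - 1)" "\<beta> ^ (?B - gain (sets ?p)) <= \<beta> ^ (?m - j * j)"
      using m \<beta>(1) by (auto intro: power_increasing)
    have "\<beta> ^ (?m - 1) + \<beta> ^ (?m - j * j) = \<beta> ^ (?m - j * j) * (\<beta> ^ (j * j - 1) + 1)"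
    proof -
      have "?m - 1 = (?m - j * j) + (j * j - 1)" using m(1) jj by linarith
      then show ?thesis by (simp add: power_add algebra_simps)
    qed
    also have "... <= \<beta> ^ (?m - j * j) * \<beta> ^ (j * j)" using \<beta> by (intro mult_left_mono) auto
    also have "... = \<beta> ^ ?m" unfolding power_add[symmetric] le_add_diff_inverse2[OF m(1)] ..
    finally have p2: "\<beta> ^ (?B - gain (sets ?h)) + \<beta> ^ (?B - gain (sets ?p)) <= \<beta> ^ ?m" using p1 by linarith
    have "real ?s <= W * (2 * \<beta> ^ (?B - gain (sets ?p)) - 1) + W * (2 * \<beta> ^ (?B - gain (sets ?h)) - 1) + W"
      using s1(1) s2(1) W by simp
    also have "... = W * (2 * (\<beta> ^ (?B - gain (sets ?h)) + \<beta> ^ (?B - gain (sets ?p))) - 1)"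
      by (simp add: algebra_simps)
    also have "... <= W * (2 * \<beta> ^ ?m - 1)" using p2 W by (intro mult_left_mono) auto
    finally show ?thesis using fin by blast
  qed
qed

lemma process_all:
  assumes "okf \<phi>"
  shows "\<exists>s. real s <= W * (2 * \<beta> ^ (6 * j * length L)) \<and> finished ((wstep ^^ s) (j, [\<phi>], []))"
proof -
  obtain s where s: "real s <= W * (2 * \<beta> ^ (6 * j * card (set L) - gain (sets \<phi>)) - 1)"
    "(wstep ^^ s) (j, [\<phi>], []) = (j, [], []) \<or> finished ((wstep ^^ s) (j, [\<phi>], []))"
    using process[OF assms, of "[]"] by blast
  note s(1)
  also have "W * (2 * \<beta> ^ (6 * j * card (set L) - gain (sets \<phi>)) - 1) <= W * (2 * \<beta> ^ (6 * j * length L))"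
  proof (rule mult_left_mono)
    have "\<beta> ^ (6 * j * card (set L) - gain (sets \<phi>)) <= \<beta> ^ (6 * j * length L)"
      using \<beta>(1) distinct_card[OF L] by (intro power_increasing) auto
    then show "2 * \<beta> ^ (6 * j * card (set L) - gain (sets \<phi>)) - 1 <= 2 * \<beta> ^ (6 * j * length L)" by simp
  qed (use W in simp)
  finally show ?thesis using s(2) wstep_simps(4) by metis
qed

end

section \<open>The invariant behind the answers of a worker\<close>

definition accurate :: "cnf => worker => bool" where
  "accurate \<phi>0 w \<longleftrightarrow> fst w = j \<and> (\<forall>\<phi>\<in>set (fst (snd w)). okf \<phi>) \<and>
     (snd (snd w) = [] \<and> (satP \<phi>0 \<longleftrightarrow> (\<exists>\<phi>\<in>set (fst (snd w)). satP \<phi>)) \<or>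
      (\<exists>\<phi> t. clauses_ok \<phi> \<and> snd (snd w) = [zrun \<phi> t] \<and>
         (satP \<phi>0 \<longleftrightarrow> satP \<phi> \<or> (\<exists>\<psi>\<in>set (fst (snd w)). satP \<psi>))))"

lemma accurate_step:
  assumes "accurate \<phi>0 w"
  shows "accurate \<phi>0 (wstep w)"
proof -
  obtain st sims where w: "w = (j, st, sims)" using assms by (cases w) (auto simp: accurate_def)
  have ok: "!!\<phi>. \<phi> \<in> set st ==> okf \<phi>" using assms by (simp add: accurate_def w)
  show ?thesis
  proof (cases "sims = []")
    case True
    then have s0: "satP \<phi>0 \<longleftrightarrow> (\<exists>\<phi>\<in>set st. satP \<phi>)" using assms by (simp add: accurate_def w)
    show ?thesis
    proof (cases st)
      case Nil
      then show ?thesis using assms True by (simp add: w wstep_simps)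
    next
      case (Cons \<phi> st')
      show ?thesis
      proof (cases "good_cands j \<phi>")
        case Nil
        have "zinit (red h N \<phi>) = zrun \<phi> 0" by (simp add: zrun_def)
        moreover have "clauses_ok \<phi>" using ok Cons okf_clauses by simp
        ultimately show ?thesis using s0 ok Cons True unfolding w accurate_def
          by (simp only: wstep_simps(1)[OF Nil] fst_conv snd_conv) auto
      next
        fix d ds assume g: "good_cands j \<phi> = d # ds"
        have "okf \<phi>" using ok Cons by simp
        note b = okf_branch[OF this g]
        show ?thesis using s0 b(1,2,5) ok unfolding w Cons True accurate_def wstep_simps(2)[OF g] by auto
      qed
    qed
  next
    case False
    then obtain \<phi> t where f: "clauses_ok \<phi>" "sims = [zrun \<phi> t]" "satP \<phi>0 \<longleftrightarrow> satP \<phi> \<or> (\<exists>\<psi>\<in>set st. satP \<psi>)"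
      using assms by (auto simp: accurate_def w)
    consider "fst (zrun \<phi> t) = accept M" | "fst (zrun \<phi> t) ~= accept M" "fst (zrun \<phi> t) = reject M"
      | "fst (zrun \<phi> t) ~= accept M" "fst (zrun \<phi> t) ~= reject M" by blast
    then show ?thesis
    proof cases
      case 1
      then have "finished w" by (simp add: w f finished_def yes_def)
      then show ?thesis using assms wstep_finished by simp
    next
      case 2
      then have "\<not> satP \<phi>" using zrun_answer(2)[OF f(1)] by blast
      then show ?thesis using f(3) ok 2 unfolding w f(2) wstep_simps(3)[OF 2(1)] by (simp add: accurate_def)
    next
      case 3
      have "zstep (zrun \<phi> t) = zrun \<phi> (Suc t)" by (simp add: zrun_def)
      then show ?thesis using f(1,3) ok 3(2) unfolding w f(2) wstep_simps(3)[OF 3(1)]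
        by (auto simp: accurate_def)
    qed
  qed
qed

lemma accurate_finished:
  assumes "accurate \<phi>0 w" "finished w"
  shows "yes w \<longleftrightarrow> satP \<phi>0"
proof (cases "snd (snd w) = []")
  case True
  then show ?thesis using assms by (auto simp: accurate_def finished_def yes_def)
next
  case False
  then show ?thesis using assms zrun_answer(1) by (auto simp: accurate_def finished_def yes_def)
qed

lemma accurate_steps: "accurate \<phi>0 w ==> accurate \<phi>0 ((wstep ^^ s) w)"
  by (induction s) (auto simp: accurate_step)

section \<open>Growth of the state of a worker\<close>

definition bounded :: "nat => nat => nat => worker => bool" where
  "bounded n c s w \<longleftrightarrow> fst w = j \<and> length (fst (snd w)) <= Suc s \<and>
     (\<forall>\<phi>\<in>set (fst (snd w)). okf \<phi> \<and> length \<phi> <= n + s \<and> (\<forall>C\<in>set \<phi>. csize C <= c)) \<and>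
     (snd (snd w) = [] \<or> (\<exists>\<phi> t. t <= s \<and> snd (snd w) = [zrun \<phi> t] \<and> length \<phi> <= n + s \<and> (\<forall>C\<in>set \<phi>. csize C <= c)))"

text \<open>A step lengthens the stack by at most one formula and a formula by at most one clause.
  Clauses only shrink, and a new heart is no larger than some existing clause, so the bound
  \<open>c\<close> persists.\<close>

lemma bounded_step:
  assumes "bounded n c s w"
  shows "bounded n c (Suc s) (wstep w)"
proof -
  obtain st sims where w: "w = (j, st, sims)" using assms by (cases w) (auto simp: bounded_def)
  have len: "length st <= Suc s" using assms by (simp add: bounded_def w)
  have ok: "okf \<phi>" "length \<phi> <= n + s" "!!C. C \<in> set \<phi> ==> csize C <= c" if "\<phi> \<in> set st" for \<phi>
    using assms that by (auto simp: bounded_def w)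
  have ok': "okf \<phi> \<and> length \<phi> <= n + Suc s \<and> (\<forall>C\<in>set \<phi>. csize C <= c)" if "\<phi> \<in> set st" for \<phi>
    using ok[OF that] by simp
  have "sims = [] \<or> (\<exists>\<phi> t. t <= Suc s \<and> sims = [zrun \<phi> t] \<and> length \<phi> <= n + Suc s \<and> (\<forall>C\<in>set \<phi>. csize C <= c))"
  proof (cases "sims = []")
    case False
    then obtain \<phi> t where f: "t <= s" "sims = [zrun \<phi> t]" "length \<phi> <= n + s" "\<forall>C\<in>set \<phi>. csize C <= c"
      using assms by (auto simp: bounded_def w)
    then show ?thesis by (intro disjI2 exI[of _ \<phi>] exI[of _ t]) simp
  qed simp
  then have weak: "bounded n c (Suc s) w"
    unfolding bounded_def w fst_conv snd_conv using len by (intro conjI refl ballI ok') (simp, assumption+)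
  show ?thesis
  proof (cases "sims = []")
    case True
    show ?thesis
    proof (cases st)
      case Nil
      then show ?thesis using weak True by (simp add: w wstep_simps)
    next
      case (Cons \<phi> st')
      have p: "okf \<phi>" "length \<phi> <= n + s" "!!C. C \<in> set \<phi> ==> csize C <= c" using ok[of \<phi>] Cons by auto
      have st': "!!\<psi>. \<psi> \<in> set st' ==> okf \<psi> \<and> length \<psi> <= n + Suc s \<and> (\<forall>C\<in>set \<psi>. csize C <= c)"
        by (rule ok') (simp add: Cons)
      show ?thesis
      proof (cases "good_cands j \<phi>")
        case Nil
        have "zinit (red h N \<phi>) = zrun \<phi> 0" by (simp add: zrun_def)
        then have "\<exists>\<psi> t. t <= Suc s \<and> [zinit (red h N \<phi>)] = [zrun \<psi> t] \<and> length \<psi> <= n + Suc s \<and> (\<forall>C\<in>set \<psi>. csize C <= c)"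
          using p by (intro exI[of _ \<phi>] exI[of _ 0]) simp
        then show ?thesis using st' len unfolding w Cons True wstep_simps(1)[OF Nil] bounded_def fst_conv snd_conv by simp
      next
        fix d ds assume g: "good_cands j \<phi> = d # ds"
        note b = okf_branch[OF p(1) g]
        have can: "canons L \<phi>" using p(1) by (simp add: okf_def)
        obtain D where D: "D \<in> set \<phi>" "csize (fst d) <= csize D" using cands_heart(4)[OF L can b(6)] by blast
        let ?h = "add_heart (fst d) \<phi>" and ?p = "add_petals (fst d) (fst (snd d)) \<phi>"
        have h: "length ?h <= n + Suc s" "\<forall>C\<in>set ?h. csize C <= c"
        proof -
          show "length ?h <= n + Suc s" using p(2) unfolding add_heart_def prune_def
            by (intro order.trans[OF length_remdups_leq] order.trans[OF length_filter_le]) simp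
          show "\<forall>C\<in>set ?h. csize C <= c" using p(3)[OF D(1)] D(2) p(3) by (auto simp: add_heart_def prune_def)
        qed
        have q: "length ?p <= n + Suc s" "\<forall>C\<in>set ?p. csize C <= c"
        proof -
          show "length ?p <= n + Suc s" using p(2) unfolding add_petals_def prune_def
            by (intro order.trans[OF length_remdups_leq] order.trans[OF length_filter_le]) simp
          have "csize (filter P C) <= c" if "C \<in> set \<phi>" for C P using csize_filter_le[of P C] p(3)[OF that] by simp
          then show "\<forall>C\<in>set ?p. csize C <= c" using p(3) by (auto simp: add_petals_def prune_def)
        qed
        show ?thesis using st' b(1,2) h q len unfolding w Cons True wstep_simps(2)[OF g] bounded_def by simp
      qed
    qed
  next
    case False
    then obtain \<phi> t where f: "t <= s" "sims = [zrun \<phi> t]" "length \<phi> <= n + s" "\<forall>C\<in>set \<phi>. csize C <= c"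
      using assms by (auto simp: bounded_def w)
    have st': "!!\<psi>. \<psi> \<in> set st ==> okf \<psi> \<and> length \<psi> <= n + Suc s \<and> (\<forall>C\<in>set \<psi>. csize C <= c)"
      by (rule ok')
    show ?thesis
    proof (cases "fst (zrun \<phi> t) = accept M")
      case True
      then have "finished w" by (simp add: w f finished_def yes_def)
      then show ?thesis using weak wstep_finished by simp
    next
      case False
      have "zstep (zrun \<phi> t) = zrun \<phi> (Suc t)" by (simp add: zrun_def)
      moreover have "\<exists>\<psi> u. u <= Suc s \<and> [zrun \<phi> (Suc t)] = [zrun \<psi> u] \<and> length \<psi> <= n + Suc s \<and> (\<forall>C\<in>set \<psi>. csize C <= c)"
        using f by (intro exI[of _ \<phi>] exI[of _ "Suc t"]) simp
      ultimately show ?thesis using st' len unfolding w f(2) wstep_simps(3)[OF False] bounded_def by simp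
    qed
  qed
qed

lemma bounded_csize:
  assumes "bounded n c s w" and Q: "!!\<phi> :: cnf. csize (zinit (red h N \<phi>)) <= poly Q (csize \<phi>)"
  shows "csize w <= 2 * j + 10 + (s + 1) * ((n + s) * (c + 1) + 2) + poly Q (1 + (n + s) * (c + 1)) +
    s * ((K + 1) * (csize table + 5))"
proof -
  let ?F = "1 + (n + s) * (c + 1)" and ?A = "(K + 1) * (csize table + 5)"
  have F: "csize \<phi> <= ?F" if "length \<phi> <= n + s" "\<forall>C\<in>set \<phi>. csize C <= c" for \<phi> :: cnf
  proof -
    have "csize \<phi> <= 1 + length \<phi> * (c + 1)" by (rule csize_list_le) (use that in auto)
    also have "... <= ?F" using that by (intro add_mono mult_le_mono) auto
    finally show ?thesis .
  qed
  have "csize (fst (snd w)) <= 1 + length (fst (snd w)) * (?F + 1)"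
    by (rule csize_list_le) (use assms F in \<open>auto simp: bounded_def\<close>)
  also have "... <= 1 + (s + 1) * (?F + 1)" using assms by (intro add_mono mult_le_mono) (auto simp: bounded_def)
  finally have 1: "csize (fst (snd w)) <= 1 + (s + 1) * (?F + 1)" .
  have 2: "csize (snd (snd w)) <= 2 + poly Q ?F + s * ?A"
  proof (cases "snd (snd w) = []")
    case False
    then obtain \<phi> t where f: "t <= s" "snd (snd w) = [zrun \<phi> t]" "length \<phi> <= n + s" "\<forall>C\<in>set \<phi>. csize C <= c"
      using assms unfolding bounded_def by blast
    have "csize (zrun \<phi> t) <= csize (zinit (red h N \<phi>)) + t * ?A" unfolding zrun_def by (rule csize_zrun)
    also have "... <= poly Q ?F + s * ?A"
      using f(1) order.trans[OF Q poly_mono_nat[OF F[OF f(3,4)]]] by (intro add_mono mult_le_mono) auto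
    finally show ?thesis unfolding f(2) by simp
  qed simp
  have "csize (fst w) = 2 * j + 1" using assms by (simp add: bounded_def)
  then have "csize w = 2 + (2 * j + 1) + csize (fst (snd w)) + csize (snd (snd w))"
    by (cases w) (auto simp: csize_prod)
  then show ?thesis using 1 2 by simp
qed

end

lemma stack_props:
  assumes "\<phi> \<in> three_cnf" "[] \<notin> set \<phi>" "0 < j"
  obtains \<phi>' where "stack \<phi> = [\<phi>']" "okf (remdups (concat \<phi>)) (sets \<phi>') j \<phi>'" "satP \<phi>' \<longleftrightarrow> satP \<phi>"
    "length \<phi>' <= length \<phi>" "\<forall>C\<in>set \<phi>'. csize C <= csize (remdups (concat \<phi>))"
proof -
  let ?L = "remdups (concat \<phi>)"
  let ?g = "\<lambda>C. filter (\<lambda>l. l \<in> set C) ?L"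
  let ?\<psi> = "prune (map ?g \<phi>)"
  interpret sparsification "set ?L" "sets ?\<psi>" j by unfold_locales (use assms in auto)
  have g: "set (?g C) = set C" if "C \<in> set \<phi>" for C using that by auto
  then have s: "sets (map ?g \<phi>) = sets \<phi>" unfolding set_map image_image by (intro image_cong) auto
  have c: "canons ?L (map ?g \<phi>)" using canon_filter by (auto simp: canons_def)
  have S: "sets ?\<psi> = mins (sets \<phi>)" using set_prune[OF c] s by simp
  have card: "card (set C) <= 3" if "C \<in> set \<phi>" for C
    using that assms(1) card_length[of C] by (auto simp: three_cnf_def)
  have cl: "set C \<subseteq> set ?L \<and> card (set C) <= 3 \<and> set C ~= {}" if "C \<in> set \<phi>" for C
    using that card[OF that] assms(2) by auto
  \<comment> \<open>The pruned input itself plays the role of \<open>F0\<close>, so nothing is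
    counted at the start and the degree bound holds however dense the input is.\<close>
  have "new2 (sets ?\<psi>) = {}" by (auto simp: new2_def)
  then have "local.inv (sets ?\<psi>)"
    unfolding inv_def
  proof (intro conjI ballI)
    fix C assume "C \<in> sets ?\<psi>"
    then have "C \<in> sets \<phi>" unfolding S mins_def by blast
    then show "C \<subseteq> set ?L" "card C <= 3" "C ~= {}" using cl by blast+
  next
    fix C D assume "C \<in> sets ?\<psi>" "D \<in> sets ?\<psi>"
    then show "\<not> C \<subset> D" unfolding S mins_def by blast
  next
    fix C assume "C \<in> sets ?\<psi>"
    then show "\<exists>D\<in>sets ?\<psi>. D \<subseteq> C" by blast
  qed simp
  then have ok: "okf ?L (sets ?\<psi>) j ?\<psi>"
    using canons_prune(1)[OF c] canons_prune(2)[of "map ?g \<phi>"] assms(3) by (simp add: okf_def)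
  have "hits A ?\<psi> \<longleftrightarrow> hits A \<phi>" for A unfolding hits_sets S by (rule hits_mins) auto
  then have sat: "satP ?\<psi> \<longleftrightarrow> satP \<phi>" unfolding satP_hits by simp
  show ?thesis
  proof (rule that[OF _ ok sat])
    show "stack \<phi> = [?\<psi>]" using assms(2) by (simp add: stack_def)
    show "length ?\<psi> <= length \<phi>" unfolding prune_def
      by (intro order.trans[OF length_remdups_leq] order.trans[OF length_filter_le]) simp
    show "\<forall>C\<in>set ?\<psi>. csize C <= csize ?L" using csize_filter_le by (auto simp: prune_def)
  qed
qed

subsection \<open>Dovetailing\<close>

text \<open>Each round advances all workers by one step and adds the one with the next parameter.
  Worker \<open>j\<close> has thus made \<open>T - j\<close> steps after \<open>T\<close>
  rounds.\<close>

definition gstep :: "cnf list \<times> nat \<times> worker list => cnf list \<times> nat \<times> worker list" where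
  "gstep g = (fst g, Suc (fst (snd g)), map wstep (snd (snd g)) @ [(fst (snd g), fst g, [])])"

definition ginit :: "bool list => cnf list \<times> nat \<times> worker list" where
  "ginit x = (stack (dec x), 1, [])"

definition work :: "cnf => nat => nat => worker" where
  "work \<phi> j s = (wstep ^^ s) (j, stack \<phi>, [])"

lemma gsteps: "(gstep ^^ T) (ginit x) = (stack (dec x), Suc T, map (\<lambda>j. work (dec x) j (T - j)) [1..<Suc T])"
proof (induction T)
  case (Suc T)
  have "map wstep (map (\<lambda>j. work (dec x) j (T - j)) [1..<Suc T]) = map (\<lambda>j. work (dec x) j (Suc T - j)) [1..<Suc T]"
    unfolding map_map
  proof (rule map_cong[OF refl])
    fix j assume "j \<in> set [1..<Suc T]"
    then have "j <= T" by auto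
    then show "(wstep \<circ> (\<lambda>j. work (dec x) j (T - j))) j = work (dec x) j (Suc T - j)"
      by (simp add: work_def Suc_diff_le)
  qed
  moreover have "work (dec x) (Suc T) 0 = (Suc T, stack (dec x), [])" by (simp add: work_def)
  ultimately show ?case using Suc by (simp add: gstep_def)
qed (simp add: ginit_def)

lemma work_finished:
  assumes "\<phi> \<in> three_cnf" "0 < j" "finished (work \<phi> j s)"
  shows "yes (work \<phi> j s) \<longleftrightarrow> satP \<phi>"
proof (cases "[] \<in> set \<phi>")
  case True
  have "\<not> satP \<phi>"
  proof
    assume "satP \<phi>"
    then obtain \<alpha> where "\<forall>C\<in>set \<phi>. \<exists>(b, v)\<in>set C. \<alpha> v = b" unfolding satP_def by blast
    from bspec[OF this True] show False by simp
  qed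
  moreover have "finished (j, [], [])" by (rule wstep_simps)
  ultimately show ?thesis using True wsteps_finished[of "(j, [], [])" s] by (simp add: work_def stack_def yes_def)
next
  case False
  obtain \<phi>' where p: "stack \<phi> = [\<phi>']" "okf (remdups (concat \<phi>)) (sets \<phi>') j \<phi>'" "satP \<phi>' \<longleftrightarrow> satP \<phi>"
    using stack_props[OF assms(1) False assms(2)] by metis
  have d: "distinct (remdups (concat \<phi>))" by simp
  have "accurate (remdups (concat \<phi>)) (sets \<phi>') j \<phi> (j, stack \<phi>, [])"
    using p by (simp add: accurate_def[OF d assms(2)])
  from accurate_steps[OF d assms(2) this, of s]
  show ?thesis using accurate_finished[OF d assms(2) _ assms(3)] unfolding work_def by blast
qed

lemma work_csize:
  assumes "\<phi> \<in> three_cnf" "0 < j" and Q: "!!\<phi> :: cnf. csize (zinit (red h N \<phi>)) <= poly Q (csize \<phi>)"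
    and n: "n = length \<phi>" and c: "c = csize (remdups (concat \<phi>))"
  shows "csize (work \<phi> j s) <= 2 * j + 10 + (s + 1) * ((n + s) * (c + 1) + 2) + poly Q (1 + (n + s) * (c + 1)) +
    s * ((K + 1) * (csize table + 5))"
proof (cases "[] \<in> set \<phi>")
  case True
  have "finished (j, [], [])" by (rule wstep_simps)
  then have "work \<phi> j s = (j, [], [])" using True wsteps_finished[of "(j, [], [])" s] by (simp add: work_def stack_def)
  then show ?thesis by simp
next
  case False
  let ?L = "remdups (concat \<phi>)"
  obtain \<phi>' where p: "stack \<phi> = [\<phi>']" "okf ?L (sets \<phi>') j \<phi>'" "length \<phi>' <= length \<phi>" "\<forall>C\<in>set \<phi>'. csize C <= csize ?L"
    using stack_props[OF assms(1) False assms(2)] by metis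
  have d: "distinct ?L" by simp
  have b0: "bounded ?L (sets \<phi>') j n c 0 (j, stack \<phi>, [])"
    using p n c by (simp add: bounded_def[OF d assms(2)])
  have "bounded ?L (sets \<phi>') j n c s (work \<phi> j s)"
    unfolding work_def by (induction s) (use b0 bounded_step[OF d assms(2)] in auto)
  from bounded_csize[OF d assms(2) this Q] show ?thesis .
qed

end

context search
begin

lemma fp_yes: "fp yes"
  unfolding yes_def by (intro fp_intros)

lemma fp_finished: "fp finished"
  unfolding finished_def by (intro fp_intros fp_comp[OF fp_yes])

text \<open>The bound holds for every worker \<open>j\<close> that is done after \<open>s\<close>
  steps, since this is noticed by round \<open>j + s\<close> at the latest and the rounds cost a
  polynomial in their number and the input. So the machine is as good as its best parameter without
  knowing it.\<close>

theorem search_machine: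
  obtains M' and q :: "nat poly" where "wf_tm M'"
    "!!\<phi> j s. \<phi> \<in> three_cnf ==> 0 < j ==> finished (work \<phi> j s) ==>
       \<exists>t\<le>poly q (j + s + length (enc_cnf \<phi>)).
         fst (run M' [enc_cnf \<phi>] t) = (if satP \<phi> then accept M' else reject M')"
proof -
  let ?P = "\<lambda>g :: cnf list \<times> nat \<times> worker list. \<forall>w\<in>set (snd (snd g)). \<not> finished w"
  let ?out = "\<lambda>g :: cnf list \<times> nat \<times> worker list. \<exists>w\<in>set (snd (snd g)). yes w"
  have fp1: "fp ginit" unfolding ginit_def by (intro fp_intros)
  have fp2: "fp ?P" by (intro fp_intros fp_comp[OF fp_finished])
  have fp3: "fp gstep" unfolding gstep_def by (intro fp_intros fp_comp[OF fp_wstep])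
  have fp4: "fp ?out" by (intro fp_intros fp_comp[OF fp_yes])
  have "fp (\<lambda>\<phi> :: cnf. zinit (red h N \<phi>))" by (intro fp_intros fp_red')
  then obtain Q where Q: "!!\<phi> :: cnf. csize (zinit (red h N \<phi>)) <= poly Q (csize \<phi>)" using fp_size by metis
  let ?A = "(K + 1) * (csize table + 5)"
  define B where "B T x = 2 * T + 10 + (T + 1) * ((length (dec x) + T) * (csize (remdups (concat (dec x))) + 1) + 2) +
      poly Q (1 + (length (dec x) + T) * (csize (remdups (concat (dec x))) + 1)) + T * ?A" for T x
  \<comment> \<open>The size bound is read as a function of the pair \<open>(T, x)\<close> with
    \<open>T\<close> in unary; the rules for \<open>pbo\<close> then supply a polynomial.\<close>
  define G where "G e = csize (stack (dec (snd e))) + 2 * fst e + 6 + fst e * (B (fst e) (snd e) + 1)" for e :: "nat \<times> bool list"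
  have "pbo G" unfolding G_def B_def by (intro pbo_intros pbo_nat fp_intros)
  then obtain p where p: "!!e. G e <= poly p (csize e)" unfolding pbo_def by blast
  let ?r = "[:0, 1:] + p \<circ>\<^sub>p [:4, 4:]"
  show ?thesis
  proof (rule fp_loop_decides[OF fp1 fp2 fp3 fp4])
    fix M' and q0 :: "nat poly"
    assume M': "wf_tm M'"
      "!!x N S. (!!i. i < N ==> ?P ((gstep ^^ i) (ginit x))) ==> \<not> ?P ((gstep ^^ N) (ginit x)) ==>
       (!!i. i <= N ==> csize ((gstep ^^ i) (ginit x)) <= S) ==>
       \<exists>t\<le>poly q0 (N + S + length x). fst (run M' [x] t) = (if ?out ((gstep ^^ N) (ginit x)) then accept M' else reject M')"
    show ?thesis
    proof (rule that[OF M'(1), of "q0 \<circ>\<^sub>p ?r"])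
      fix \<phi> j s
      assume \<phi>: "\<phi> \<in> three_cnf" and j: "0 < j" and fin: "finished (work \<phi> j s)"
      let ?x = "enc_cnf \<phi>"
      let ?g = "\<lambda>T. (gstep ^^ T) (ginit ?x)"
      have g: "?g T = (stack \<phi>, Suc T, map (\<lambda>j. work \<phi> j (T - j)) [1..<Suc T])" for T
        unfolding gsteps dec_enc ..
      have "work \<phi> j s \<in> set (snd (snd (?g (j + s))))"
        unfolding g snd_conv set_map using j by (intro image_eqI[of _ _ j]) auto
      then have ex: "\<not> ?P (?g (j + s))" using fin by blast
      \<comment> \<open>The loop stops as soon as any worker is done, perhaps another one than
        \<open>j\<close>. All finished workers give the same answer by
        \<open>work_finished\<close>.\<close>
      define T where "T = (LEAST T. \<not> ?P (?g T))"
      have T: "\<not> ?P (?g T)" unfolding T_def by (rule LeastI[of "\<lambda>T. \<not> ?P (?g T)"]) (rule ex)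
      have Tle: "T <= j + s" unfolding T_def by (rule Least_le[of "\<lambda>T. \<not> ?P (?g T)"]) (rule ex)
      have before: "?P (?g i)" if "i < T" for i
        using not_less_Least[of i "\<lambda>T. \<not> ?P (?g T)"] that unfolding T_def by blast
      have size: "csize (?g i) <= G (T, ?x)" if i: "i <= T" for i
      proof -
        have w: "csize (work \<phi> k (i - k)) <= B T ?x" if "k \<in> set [1..<Suc i]" for k
        proof -
          have k: "0 < k" "k <= T" "i - k <= T" using that i by auto
          let ?n = "length \<phi>" and ?c = "csize (remdups (concat \<phi>))"
          have "csize (work \<phi> k (i - k)) <= 2 * k + 10 + (i - k + 1) * ((?n + (i - k)) * (?c + 1) + 2) +
              poly Q (1 + (?n + (i - k)) * (?c + 1)) + (i - k) * ?A"
            by (rule work_csize[OF \<phi> k(1) Q refl refl])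
          also have "... <= B T ?x" unfolding B_def dec_enc
            using k by (intro add_mono mult_le_mono poly_mono_nat order.refl) auto
          finally show ?thesis .
        qed
        have "csize w' <= B T ?x" if "w' \<in> set (map (\<lambda>k. work \<phi> k (i - k)) [1..<Suc i])" for w'
          using that w unfolding set_map by blast
        then have "csize (map (\<lambda>k. work \<phi> k (i - k)) [1..<Suc i]) <= 1 + length (map (\<lambda>k. work \<phi> k (i - k)) [1..<Suc i]) * (B T ?x + 1)"
          by (rule csize_list_le)
        also have "... <= 1 + T * (B T ?x + 1)" using i by (intro add_left_mono mult_le_mono1) simp
        finally have "csize (map (\<lambda>k. work \<phi> k (i - k)) [1..<Suc i]) <= 1 + T * (B T ?x + 1)" .
        moreover have "Suc (c + Suc (2 * Suc i + 1 + X)) <= c + 2 * T + 6 + Y" if "X <= 1 + Y" for c X Y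
          using that i by simp
        ultimately show ?thesis unfolding g G_def fst_conv snd_conv dec_enc csize_prod csize_nat by blast
      qed
      obtain t where t: "t <= poly q0 (T + G (T, ?x) + length ?x)"
        "fst (run M' [?x] t) = (if ?out (?g T) then accept M' else reject M')"
        using M'(2)[OF before T size] by blast
      have out: "?out (?g T) \<longleftrightarrow> satP \<phi>"
      proof
        assume "?out (?g T)"
        then obtain k where k: "k \<in> set [1..<Suc T]" "yes (work \<phi> k (T - k))" unfolding g snd_conv set_map by blast
        then have "0 < k" "finished (work \<phi> k (T - k))" by (auto simp: finished_def)
        then show "satP \<phi>" using work_finished[OF \<phi>] k(2) by blast
      next
        assume s: "satP \<phi>"
        obtain k where k: "k \<in> set [1..<Suc T]" "finished (work \<phi> k (T - k))" using T unfolding g snd_conv set_map by blast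
        then have "0 < k" by auto
        then have "yes (work \<phi> k (T - k))" using work_finished[OF \<phi> _ k(2)] s by blast
        then show "?out (?g T)" using k(1) unfolding g snd_conv set_map by blast
      qed
      let ?m = "j + s + length ?x"
      have "csize (T, ?x) <= 4 + 4 * ?m" using csize_bools[of ?x] Tle by simp
      then have "G (T, ?x) <= poly p (4 + 4 * ?m)" using p order.trans poly_mono_nat by blast
      then have "T + G (T, ?x) + length ?x <= poly ?r ?m" using Tle by (simp add: poly_pcompose algebra_simps)
      then have "poly q0 (T + G (T, ?x) + length ?x) <= poly (q0 \<circ>\<^sub>p ?r) ?m"
        unfolding poly_pcompose by (rule poly_mono_nat)
      then have "t <= poly (q0 \<circ>\<^sub>p ?r) ?m" using t(1) by (rule order.trans[rotated])
      then show "\<exists>t\<le>poly (q0 \<circ>\<^sub>p ?r) ?m. fst (run M' [?x] t) = (if satP \<phi> then accept M' else reject M')"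
        using t(2) unfolding out by blast
    qed
  qed
qed

end

section \<open>Subexponential bounds\<close>

text \<open>A form of \<open>2^(o(k))\<close> that behaves well under sums and products: for each
  rate a constant absorbs the small values of \<open>k\<close>.\<close>

definition subexp :: "(nat => real) => bool" where
  "subexp g \<longleftrightarrow> (\<forall>\<epsilon>>0. \<exists>C\<ge>1. \<forall>k. g k <= C * 2 powr (\<epsilon> * real k))"

lemma subexp_mult:
  assumes "subexp f" "subexp g" "!!k. 0 <= f k" "!!k. 0 <= g k"
  shows "subexp (\<lambda>k. f k * g k)"
  unfolding subexp_def
proof (intro allI impI)
  fix \<epsilon> :: real assume "0 < \<epsilon>"
  then have "0 < \<epsilon> / 2" by simp
  then obtain C D where C: "1 <= C" "!!k. f k <= C * 2 powr (\<epsilon> / 2 * real k)" and D: "1 <= D" "!!k. g k <= D * 2 powr (\<epsilon> / 2 * real k)"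
    using assms(1,2) unfolding subexp_def by metis
  have "f k * g k <= (C * D) * 2 powr (\<epsilon> * real k)" for k
  proof -
    have "f k * g k <= (C * 2 powr (\<epsilon> / 2 * real k)) * (D * 2 powr (\<epsilon> / 2 * real k))"
      using C D assms(3,4) by (intro mult_mono) auto
    also have "... = (C * D) * (2 powr (\<epsilon> / 2 * real k) * 2 powr (\<epsilon> / 2 * real k))" by simp
    also have "2 powr (\<epsilon> / 2 * real k) * 2 powr (\<epsilon> / 2 * real k) = 2 powr (\<epsilon> * real k)" by (simp flip: powr_add)
    finally show ?thesis .
  qed
  moreover have "1 <= C * D" using C(1) D(1) mult_mono[of 1 C 1 D] by simp
  ultimately show "\<exists>C\<ge>1. \<forall>k. f k * g k <= C * 2 powr (\<epsilon> * real k)" by blast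
qed

lemma subexp_add:
  assumes "subexp f" "subexp g"
  shows "subexp (\<lambda>k. f k + g k)"
  unfolding subexp_def
proof (intro allI impI)
  fix \<epsilon> :: real assume "0 < \<epsilon>"
  then obtain C D where C: "1 <= C" "!!k. f k <= C * 2 powr (\<epsilon> * real k)" and D: "1 <= D" "!!k. g k <= D * 2 powr (\<epsilon> * real k)"
    using assms unfolding subexp_def by metis
  have "f k + g k <= (C + D) * 2 powr (\<epsilon> * real k)" for k
    using C(2)[of k] D(2)[of k] by (simp add: distrib_right)
  then show "\<exists>C\<ge>1. \<forall>k. f k + g k <= C * 2 powr (\<epsilon> * real k)" using C(1) D(1) by (intro exI[of _ "C + D"]) auto
qed

lemma subexp_const: "subexp (\<lambda>_. c)"
  unfolding subexp_def
proof (intro allI impI exI conjI)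
  fix \<epsilon> :: real and k :: nat assume "0 < \<epsilon>"
  have "c <= (1 + \<bar>c\<bar>) * 1" by simp
  also have "... <= (1 + \<bar>c\<bar>) * 2 powr (\<epsilon> * real k)" using \<open>0 < \<epsilon>\<close> by (intro mult_left_mono ge_one_powr_ge_zero) auto
  finally show "c <= (1 + \<bar>c\<bar>) * 2 powr (\<epsilon> * real k)" .
qed simp

lemma powr2_ge: "1 + x * ln 2 <= 2 powr (x :: real)"
  using exp_ge_add_one_self[of "x * ln 2"] by (simp add: powr_def)

lemma subexp_real: "subexp real"
  unfolding subexp_def
proof (intro allI impI exI conjI)
  fix \<epsilon> :: real and k :: nat assume \<epsilon>: "0 < \<epsilon>"
  have "real k = 1 / (\<epsilon> * ln 2) * (\<epsilon> * real k * ln 2)" using \<epsilon> by simp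
  also have "... <= 1 / (\<epsilon> * ln 2) * 2 powr (\<epsilon> * real k)"
    using \<epsilon> powr2_ge[of "\<epsilon> * real k"] by (intro mult_left_mono) auto
  also have "... <= max 1 (1 / (\<epsilon> * ln 2)) * 2 powr (\<epsilon> * real k)" by (intro mult_right_mono) auto
  finally show "real k <= max 1 (1 / (\<epsilon> * ln 2)) * 2 powr (\<epsilon> * real k)" .
qed simp

lemma subexp_poly: "subexp (\<lambda>k. real (poly p k))" for p :: "nat poly"
proof (induction p)
  case 0
  then show ?case using subexp_const[of 0] by simp
next
  case (pCons a p)
  then show ?case using subexp_add[OF subexp_const[of "real a"] subexp_mult[OF subexp_real pCons(2)]] by simp
qed

lemma subexp_powr:
  assumes "f \<in> o(\<lambda>n. real n)"
  shows "subexp (\<lambda>k. 2 powr f k)"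
  unfolding subexp_def
proof (intro allI impI)
  fix \<epsilon> :: real assume \<epsilon>: "0 < \<epsilon>"
  have "eventually (\<lambda>k. norm (f k) <= \<epsilon> * norm (real k)) at_top" by (rule landau_o.smallD[OF assms \<epsilon>])
  then obtain k0 where k0: "!!k. k0 <= k ==> \<bar>f k\<bar> <= \<epsilon> * real k" by (auto simp: eventually_at_top_linorder)
  define C where "C = 1 + (\<Sum>k<k0. 2 powr f k)"
  have C: "1 <= C" unfolding C_def by (simp add: sum_nonneg)
  have "2 powr f k <= C * 2 powr (\<epsilon> * real k)" for k
  proof (cases "k < k0")
    case True
    then have "2 powr f k <= (\<Sum>k<k0. 2 powr f k)" by (intro member_le_sum) auto
    then have "2 powr f k <= C * 1" by (simp add: C_def)
    also have "... <= C * 2 powr (\<epsilon> * real k)" using C \<epsilon> by (intro mult_left_mono ge_one_powr_ge_zero) auto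
    finally show ?thesis .
  next
    case False
    then have "2 powr f k <= 1 * 2 powr (\<epsilon> * real k)" using k0[of k] by simp
    also have "... <= C * 2 powr (\<epsilon> * real k)" using C by (intro mult_right_mono) auto
    finally show ?thesis .
  qed
  then show "\<exists>C\<ge>1. \<forall>k. 2 powr f k <= C * 2 powr (\<epsilon> * real k)" using C by blast
qed

text \<open>Diagonalising over the bounds for \<open>\<epsilon> = 1 / (m + 1)\<close> yields a single \<open>o(n)\<close> exponent.\<close>

lemma smallo_exponent:
  fixes T :: "'a => real" and \<kappa> :: "'a => nat" and Y :: "'a => real"
  assumes bound: "!!\<epsilon>. 0 < \<epsilon> ==> \<exists>C\<ge>1. \<forall>x\<in>I. T x <= C * 2 powr (\<epsilon> * real (\<kappa> x)) * Y x"
  obtains F where "F \<in> o(\<lambda>n. real n)" "!!x. x \<in> I ==> T x <= 2 powr F (\<kappa> x) * Y x"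
proof -
  have "\<forall>m. \<exists>C\<ge>1. \<forall>x\<in>I. T x <= C * 2 powr (1 / real (Suc m) * real (\<kappa> x)) * Y x"
    by (intro allI bound) simp
  then obtain C where C: "!!m. 1 <= C m" "!!m x. x \<in> I ==> T x <= C m * 2 powr (1 / real (Suc m) * real (\<kappa> x)) * Y x" by metis
  define b where "b m n = log 2 (C m) + real n / real (Suc m)" for m n
  \<comment> \<open>The best of the first \<open>n + 1\<close> bounds. The minimum is over a finite
    set, and each single bound takes part for all large \<open>n\<close>, which makes
    \<open>F\<close> sublinear.\<close>
  define F where "F n = Min ((\<lambda>m. b m n) ` {..n})" for n
  have T: "T x <= 2 powr b m (\<kappa> x) * Y x" if "x \<in> I" for m x
  proof -
    have "2 powr b m (\<kappa> x) = C m * 2 powr (1 / real (Suc m) * real (\<kappa> x))"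
      using C(1)[of m] unfolding b_def powr_add by (subst powr_log_cancel) auto
    then show ?thesis using C(2)[OF that, of m] by simp
  qed
  have "F n \<in> (\<lambda>m. b m n) ` {..n}" for n unfolding F_def by (rule Min_in) auto
  then have Fb: "\<exists>m. F n = b m n" for n by blast
  have "0 <= log 2 (C m)" for m using C(1)[of m] by (subst zero_le_log_cancel_iff) auto
  then have F0: "0 <= F n" for n using Fb[of n] by (auto simp: b_def)
  have Fle: "F n <= b m n" if "m <= n" for m n unfolding F_def using that by (intro Min_le) auto
  show ?thesis
  proof (rule that)
    show "F \<in> o(\<lambda>n. real n)"
    proof (rule landau_o.smallI)
      fix c :: real assume c: "0 < c"
      obtain m where m: "2 / c < real m" using reals_Archimedean2 by blast
      have m1: "1 / real (Suc m) <= c / 2"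
      proof -
        have "2 / c <= real (Suc m)" using m by simp
        then show ?thesis using c by (simp add: field_simps)
      qed
      obtain n0 where n0: "2 * log 2 (C m) / c < real n0" using reals_Archimedean2 by blast
      have "norm (F n) <= c * norm (real n)" if n: "max m n0 <= n" for n
      proof -
        have "F n <= b m n" using n by (intro Fle) auto
        also have "... <= c / 2 * real n + c / 2 * real n"
        proof -
          have "2 * log 2 (C m) / c < real n" using n0 n by simp
          then have "log 2 (C m) <= c / 2 * real n" using c by (simp add: field_simps)
          moreover have "real n / real (Suc m) <= c / 2 * real n"
            using mult_right_mono[OF m1, of "real n"] by simp
          ultimately show ?thesis unfolding b_def by linarith
        qed
        finally show ?thesis using F0[of n] by simp
      qed
      then show "eventually (\<lambda>n. norm (F n) <= c * norm (real n)) at_top"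
        by (auto simp: eventually_at_top_linorder intro!: exI[of _ "max m n0"])
    qed
    show "T x <= 2 powr F (\<kappa> x) * Y x" if "x \<in> I" for x using T[OF that] Fb[of "\<kappa> x"] by metis
  qed
qed

text \<open>\<open>\<beta>\<close> bounds the growth rate of a recursion with branching vector \<open>(1, j\<^sup>2)\<close>. It exists because
  \<open>2 powr (\<epsilon> / (12 * j)) - 1\<close> decays like \<open>1 / j\<close>, much more slowly than \<open>2 powr (- \<epsilon> * j / 12)\<close>.\<close>

lemma branching_root:
  fixes \<epsilon> :: real
  assumes \<epsilon>: "0 < \<epsilon>"
  obtains j :: nat and \<beta> :: real where "0 < j" "1 <= \<beta>" "\<beta> ^ (j * j - 1) + 1 <= \<beta> ^ (j * j)" "\<beta> ^ (12 * j) = 2 powr \<epsilon>"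
proof -
  \<comment> \<open>The 12 comes from the potential bound \<open>6 * j * card U\<close> with two
    literals per variable. For \<open>\<beta> = 2 powr (a / j)\<close> the recurrence asks that
    \<open>\<beta> ^ (j * j - 1) * (\<beta> - 1)\<close> be at least 1.\<close>
  define a where "a = \<epsilon> / 12"
  have a: "0 < a" using \<epsilon> by (simp add: a_def)
  \<comment> \<open>\<open>\<beta> - 1\<close> is at least \<open>a * ln 2 / j\<close>, and
    \<open>\<beta> ^ (j * j - 1)\<close> is at least half of \<open>2 powr (a * j)\<close>, hence at
    least \<open>(a * j * ln 2)^2 / 4\<close> by the quadratic Taylor term. The product is
    \<open>(a * ln 2)^3 * j / 4\<close>, whence the threshold for \<open>j\<close>.\<close>
  obtain j :: nat where j: "max (max 1 a) (4 / (a * ln 2) ^ 3) < real j" using reals_Archimedean2 by blast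
  have jpos: "0 < j" "1 < real j" "a <= real j" "4 <= (a * ln 2) ^ 3 * real j"
  proof -
    show "0 < j" "1 < real j" "a <= real j" using j by auto
    have "4 / (a * ln 2) ^ 3 <= real j" using j by simp
    then show "4 <= (a * ln 2) ^ 3 * real j" using a by (simp add: field_simps)
  qed
  define \<beta> where "\<beta> = 2 powr (a / real j)"
  have \<beta>: "1 <= \<beta>" unfolding \<beta>_def using a by (intro ge_one_powr_ge_zero) auto
  have pw: "\<beta> ^ n = 2 powr (a / real j * real n)" for n
    unfolding \<beta>_def by (simp add: powr_powr flip: powr_realpow)
  have b1: "a / real j * ln 2 <= \<beta> - 1" using powr2_ge[of "a / real j"] by (simp add: \<beta>_def)
  have jj: "1 <= j * j" using jpos(1) by simp
  have e: "a / real j * real (j * j - 1) = a * real j - a / real j"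
    using jpos(1) jj by (simp add: of_nat_diff field_simps)
  have "(a * real j * ln 2)\<^sup>2 / 2 <= 2 powr (a * real j)"
  proof -
    have "0 <= a * real j * ln 2" using a by simp
    then have "1 + a * real j * ln 2 + (a * real j * ln 2)\<^sup>2 / 2 <= exp (a * real j * ln 2)" by (rule exp_lower_Taylor_quadratic)
    moreover have "0 <= a * real j * ln 2" using a by simp
    moreover have "2 powr (a * real j) = exp (a * real j * ln 2)" by (simp add: powr_def)
    ultimately show ?thesis by linarith
  qed
  also have "2 powr (a * real j) = 2 powr (a * real j - a / real j) * 2 powr (a / real j)" by (simp flip: powr_add)
  also have "... <= 2 powr (a * real j - a / real j) * 2"
  proof (rule mult_left_mono)
    have "2 powr (a / real j) <= 2 powr 1" using jpos(1,3) by (intro powr_mono) (auto simp: field_simps)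
    then show "2 powr (a / real j) <= 2" by simp
  qed simp
  finally have b2: "(a * real j * ln 2)\<^sup>2 / 4 <= \<beta> ^ (j * j - 1)" unfolding pw e by simp
  have "1 <= (a * real j * ln 2)\<^sup>2 / 4 * (a / real j * ln 2)"
    using jpos(1,4) by (simp add: power2_eq_square power3_eq_cube field_simps)
  also have "... <= \<beta> ^ (j * j - 1) * (\<beta> - 1)"
    using b1 b2 a \<beta> by (intro mult_mono) auto
  also have "... = \<beta> ^ (j * j) - \<beta> ^ (j * j - 1)"
    using power_minus_mult[of "j * j" \<beta>] jj by (simp add: algebra_simps)
  finally have "\<beta> ^ (j * j - 1) + 1 <= \<beta> ^ (j * j)" by simp
  moreover have "\<beta> ^ (12 * j) = 2 powr \<epsilon>" using jpos(1) by (simp add: pw a_def)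
  ultimately show ?thesis using that jpos(1) \<beta> by blast
qed

text \<open>Separates the search effort \<open>a\<close> from the formula length \<open>b\<close>
  multiplicatively: one factor goes into the exponent, the other into the polynomial in the input
  length.\<close>

lemma poly_split:
  fixes q :: "nat poly"
  obtains c d :: nat where "!!a b. 1 <= a ==> 1 <= b ==> poly q (a + b) <= c * a ^ d * b ^ d"
proof -
  have one: "poly q m <= poly q 1 * m ^ degree q" if "1 <= m" for m
  proof -
    have "poly q m = (\<Sum>i\<le>degree q. coeff q i * m ^ i)" by (rule poly_altdef)
    also have "... <= (\<Sum>i\<le>degree q. coeff q i * m ^ degree q)"
      using that by (intro sum_mono mult_left_mono power_increasing) auto
    also have "... = poly q 1 * m ^ degree q" by (simp add: poly_altdef sum_distrib_right)
    finally show ?thesis .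
  qed
  have "poly q (a + b) <= poly q 1 * 2 ^ degree q * a ^ degree q * b ^ degree q" if "1 <= a" "1 <= b" for a b
  proof -
    have "a <= a * b" "b <= a * b" using that by auto
    then have "a + b <= 2 * a * b" by linarith
    have "poly q (a + b) <= poly q 1 * (a + b) ^ degree q" using that by (intro one) simp
    also have "... <= poly q 1 * (2 * a * b) ^ degree q"
      using \<open>a + b <= 2 * a * b\<close> by (intro mult_left_mono power_mono) auto
    finally show ?thesis by (simp add: power_mult_distrib mult.assoc)
  qed
  then show ?thesis using that by blast
qed

section \<open>The lower bound under ETH\<close>

lemma ngraph_size: "graph_size (ngraph n a) <= n + n ^ 2"
proof -
  have "edges (ngraph n a) \<subseteq> (\<lambda>(i, j). {i, j}) ` ({..<n} \<times> {..<n})" by (auto simp: ngraph_def)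
  then have "card (edges (ngraph n a)) <= card ({..<n} \<times> {..<n})" by (rule surj_card_le[rotated]) simp
  then show ?thesis by (simp add: graph_size_def ngraph_def power2_eq_square)
qed

lemma length_gvl: "length (gvl h \<phi>) <= 1 + (9 + 12 * h) * (length (vlist \<phi>) + 5 * length \<phi>)"
proof -
  let ?v = "length (vlist \<phi>)" and ?m = "length \<phi>"
  have q: "length (qlist \<phi>) = 2 * ?v + 9 * ?m"
    by (simp add: qlist_def length_concat sum_list_triv o_def)
  have e: "length (elist \<phi>) = ?v + 12 * ?m"
    by (simp add: elist_def clause_edges_def length_concat sum_list_triv o_def)
  have "length (gvl h \<phi>) <= 1 + length (qlist \<phi>) + length (elist \<phi>) * (h - 3)"
    unfolding gvl_def by (rule order.trans[OF length_remdups_leq]) (simp add: length_concat sum_list_triv o_def)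
  also have "... <= 1 + (2 * ?v + 9 * ?m) + (?v + 12 * ?m) * h" unfolding q e by (intro add_mono mult_le_mono) auto
  also have "... <= 1 + (9 + 12 * h) * (?v + 5 * ?m)" by (simp add: algebra_simps)
  finally show ?thesis .
qed

section \<open>The search with a subexponential solver for edge deletion\<close>

context
  fixes R :: "'a ugraph" and h r N and Mr :: tm and f :: "nat => real" and p :: "nat poly"
  assumes pat: "pattern h r N" and iso: "graph_iso (graph_on {..<h} N) R"
    and f: "f \<in> o(\<lambda>n. real n)"
    and solves: "solves_in_time Mr edge_deletion_instances enc_edge_deletion (free_edge_deletion R)
       (\<lambda>x. 2 powr f (snd x) * real (poly p (graph_size (fst x))))"
begin

text \<open>The number of vertices of an instance is linear in its budget by
  \<open>length_gvl\<close>. So the polynomial in the graph size becomes one in the budget and can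
  be absorbed by a subexponential function of it.\<close>

lemma red_time:
  obtains p' :: "nat poly" where "!!\<phi> :: cnf. clauses_ok \<phi> ==>
     \<exists>t. real t <= 2 powr f (length (vlist \<phi>) + 5 * length \<phi>) * real (poly p' (length (vlist \<phi>) + 5 * length \<phi>)) \<and>
       fst (run Mr [red h N \<phi>] t) = (if satP \<phi> then accept Mr else reject Mr)"
proof -
  let ?b = "[:1, 9 + 12 * h:]"
  show ?thesis
  proof (rule that[of "p \<circ>\<^sub>p (?b + ?b ^ 2)"])
    fix \<phi> :: cnf assume ok: "clauses_ok \<phi>"
    let ?k = "length (vlist \<phi>) + 5 * length \<phi>"
    note ic = inst_correct[OF pat ok]
    have e: "enc_edge_deletion (inst h N \<phi>) = red h N \<phi>" unfolding ic(3) red_def ..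
    have yes: "free_edge_deletion R (inst h N \<phi>) \<longleftrightarrow> satP \<phi>" unfolding free_edge_deletion_pattern[OF iso] by (rule ic(2))
    have k: "snd (inst h N \<phi>) = ?k" by (simp add: inst_def)
    have "graph_size (fst (inst h N \<phi>)) <= length (gvl h \<phi>) + length (gvl h \<phi>) ^ 2" unfolding inst_def fst_conv by (rule ngraph_size)
    also have "... <= poly ?b ?k + poly ?b ?k ^ 2"
      using length_gvl[of h \<phi>] by (intro add_mono power_mono) (auto simp: mult.commute)
    finally have "poly p (graph_size (fst (inst h N \<phi>))) <= poly (p \<circ>\<^sub>p (?b + ?b ^ 2)) ?k"
      unfolding poly_pcompose poly_add poly_power by (rule poly_mono_nat)
    then have le: "2 powr f ?k * real (poly p (graph_size (fst (inst h N \<phi>)))) <= 2 powr f ?k * real (poly (p \<circ>\<^sub>p (?b + ?b ^ 2)) ?k)"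
      by (intro mult_left_mono) simp_all
    obtain t where "real t <= 2 powr f ?k * real (poly p (graph_size (fst (inst h N \<phi>))))"
      "fst (run Mr [red h N \<phi>] t) = (if satP \<phi> then accept Mr else reject Mr)"
      using solves ic(1) unfolding solves_in_time_def by (metis e k yes)
    then show "\<exists>t. real t <= 2 powr f ?k * real (poly (p \<circ>\<^sub>p (?b + ?b ^ 2)) ?k) \<and>
       fst (run Mr [red h N \<phi>] t) = (if satP \<phi> then accept Mr else reject Mr)"
      using le by (meson order.trans)
  qed
qed

lemma searching: "search Mr h r N"
proof -
  have wf: "wf_tm Mr" using solves by (simp add: solves_in_time_def)
  have "\<exists>t. fst (run Mr [red h N \<phi>] t) = (if satP \<phi> then accept Mr else reject Mr)"
    if "clauses_ok \<phi>" for \<phi> :: cnf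
    using red_time that by metis
  then show ?thesis by (intro search.intro wf_machine.intro search_axioms.intro wf pat)
qed

interpretation search Mr h r N by (rule searching)

text \<open>Half of \<open>\<epsilon>\<close> pays for the number of leaves of the search, the other
  half for one run of the solver. The order matters: \<open>\<epsilon>\<close> determines
  \<open>j\<close>, this the density of the leaves, and only then the rate demanded of the solver is
  fixed.\<close>

lemma search_bound:
  fixes \<epsilon> :: real
  assumes \<epsilon>: "0 < \<epsilon>"
  shows "\<exists>C\<ge>1. \<forall>\<phi>\<in>three_cnf. \<exists>j s. 0 < j \<and> finished (work \<phi> j s) \<and>
     real (j + s) <= C * 2 powr (\<epsilon> * real (card (cnf_vars \<phi>)))"
proof -
  obtain p' :: "nat poly" where p': "!!\<phi> :: cnf. clauses_ok \<phi> ==>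
     \<exists>t. real t <= 2 powr f (length (vlist \<phi>) + 5 * length \<phi>) * real (poly p' (length (vlist \<phi>) + 5 * length \<phi>)) \<and>
       fst (run Mr [red h N \<phi>] t) = (if satP \<phi> then accept Mr else reject Mr)"
    using red_time by metis
  have "0 < \<epsilon> / 2" using \<epsilon> by simp
  then obtain j \<beta> where j: "0 < j" "1 <= \<beta>" "\<beta> ^ (j * j - 1) + 1 <= \<beta> ^ (j * j)" "\<beta> ^ (12 * j) = 2 powr (\<epsilon> / 2)"
    using branching_root by metis
  \<comment> \<open>A leaf has at most \<open>2 * n * (1 + j + j * j)\<close> clauses over
    \<open>n\<close> variables, and each clause contributes 5 to the budget; so \<open>D * n\<close>
    bounds the parameter of every instance handed to the solver.\<close>
  define D where "D = 1 + 10 * (1 + j + j * j)"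
  have D: "0 < D" by (simp add: D_def)
  have "subexp (\<lambda>k. 2 powr f k * real (poly p' k) + 2)"
    by (intro subexp_add subexp_mult subexp_powr[OF f] subexp_poly subexp_const) auto
  moreover have "0 < \<epsilon> / (2 * real D)" using \<epsilon> D by simp
  ultimately obtain C where C: "1 <= C" "!!k. 2 powr f k * real (poly p' k) + 2 <= C * 2 powr (\<epsilon> / (2 * real D) * real k)"
    unfolding subexp_def by metis
  have "\<exists>j s. 0 < j \<and> finished (work \<phi> j s) \<and> real (j + s) <= (real j0 + 2 * C) * 2 powr (\<epsilon> * real (card (cnf_vars \<phi>)))"
    if \<phi>: "\<phi> \<in> three_cnf" and j0: "j0 = j" for \<phi> j0
  proof (cases "[] \<in> set \<phi>")
    case True
    have "real (j + 0) <= (real j0 + 2 * C) * 1" using C(1) j0 by simp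
    also have "... <= (real j0 + 2 * C) * 2 powr (\<epsilon> * real (card (cnf_vars \<phi>)))"
      using C(1) \<epsilon> by (intro mult_left_mono ge_one_powr_ge_zero) auto
    finally show ?thesis using True j(1) wstep_simps(4)
      by (intro exI[of _ j] exI[of _ 0]) (simp add: work_def stack_def)
  next
    case False
    let ?L = "remdups (concat \<phi>)" and ?n = "card (cnf_vars \<phi>)"
    obtain \<phi>' where ph: "stack \<phi> = [\<phi>']" "okf ?L (sets \<phi>') j \<phi>'" using stack_props[OF \<phi> False j(1)] by metis
    have vars: "cnf_vars \<phi> = snd ` set ?L" by (auto simp: cnf_vars_def)
    then have fin: "finite (cnf_vars \<phi>)" by simp
    have "set ?L \<subseteq> UNIV \<times> cnf_vars \<phi>" unfolding vars by force
    then have "card (set ?L) <= card ((UNIV :: bool set) \<times> cnf_vars \<phi>)" using fin by (intro card_mono) auto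
    then have Ln: "length ?L <= 2 * ?n" unfolding distinct_card[OF distinct_remdups] card_cartesian_product by simp
    define W where "W = C * 2 powr (\<epsilon> / 2 * real ?n)"
    have W: "1 <= W" unfolding W_def
      using C(1) \<epsilon> mult_mono[of 1 C 1 "2 powr (\<epsilon> / 2 * real ?n)"] ge_one_powr_ge_zero[of 2 "\<epsilon> / 2 * real ?n"] by simp
    have T: "\<exists>t. halted Mr (run Mr [red h N \<psi>] t) \<and> real (t + 2) <= W"
      if ok: "clauses_ok \<psi>" and sub: "snd ` set (concat \<psi>) \<subseteq> snd ` set ?L"
        and len: "length \<psi> <= length ?L * (1 + j + j * j)" for \<psi>
    proof -
      let ?k = "length (vlist \<psi>) + 5 * length \<psi>"
      have "length (vlist \<psi>) = card (snd ` set (concat \<psi>))"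
        unfolding vlist_def by (metis length_remdups_card_conv list.set_map)
      also have "... <= ?n" unfolding vars using sub by (intro card_mono) auto
      finally have v: "length (vlist \<psi>) <= ?n" .
      have "length \<psi> <= 2 * ?n * (1 + j + j * j)" using len Ln by (meson mult_le_mono1 order.trans)
      then have "?k <= D * ?n" using v unfolding D_def by (simp add: algebra_simps)
      then have k: "real ?k <= real D * real ?n" by (metis of_nat_le_iff of_nat_mult)
      obtain t where t: "real t <= 2 powr f ?k * real (poly p' ?k)"
        "fst (run Mr [red h N \<psi>] t) = (if satP \<psi> then accept Mr else reject Mr)"
        using p'[OF ok] by blast
      have "real (t + 2) <= C * 2 powr (\<epsilon> / (2 * real D) * real ?k)" using t(1) C(2)[of ?k] by simp
      also have "... <= W" unfolding W_def
      proof (intro mult_left_mono powr_mono)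
        have "\<epsilon> / (2 * real D) * real ?k <= \<epsilon> / (2 * real D) * (real D * real ?n)"
          using \<epsilon> k by (intro mult_left_mono) auto
        then show "\<epsilon> / (2 * real D) * real ?k <= \<epsilon> / 2 * real ?n" using D by simp
      qed (use C(1) in auto)
      finally show ?thesis using t(2) by (auto simp: halted_def split: if_splits)
    qed
    obtain s where s: "real s <= W * (2 * \<beta> ^ (6 * j * length ?L))" "finished ((wstep ^^ s) (j, [\<phi>'], []))"
      using process_all[OF distinct_remdups j(1) j(2,3) W T ph(2)] by blast
    have "\<beta> ^ (6 * j * length ?L) <= \<beta> ^ (12 * j * ?n)" using j(2) Ln by (intro power_increasing) auto
    also have "... = (2 powr (\<epsilon> / 2)) ^ ?n" unfolding power_mult[of \<beta> "12 * j"] j(4) ..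
    also have "... = 2 powr (\<epsilon> / 2 * real ?n)" by (simp add: powr_powr flip: powr_realpow)
    finally have "W * (2 * \<beta> ^ (6 * j * length ?L)) <= W * (2 * 2 powr (\<epsilon> / 2 * real ?n))" using W by (intro mult_left_mono) auto
    also have "... = 2 * C * (2 powr (\<epsilon> / 2 * real ?n) * 2 powr (\<epsilon> / 2 * real ?n))" by (simp add: W_def)
    also have "2 powr (\<epsilon> / 2 * real ?n) * 2 powr (\<epsilon> / 2 * real ?n) = 2 powr (\<epsilon> * real ?n)" by (simp flip: powr_add)
    finally have "real s <= 2 * C * 2 powr (\<epsilon> * real ?n)" using s(1) by simp
    moreover have "real j0 * 1 <= real j0 * 2 powr (\<epsilon> * real ?n)" using \<epsilon> by (intro mult_left_mono ge_one_powr_ge_zero) auto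
    ultimately have "real (j + s) <= (real j0 + 2 * C) * 2 powr (\<epsilon> * real ?n)" using j0 by (simp add: distrib_right)
    then show ?thesis using s(2) j(1) ph(1) unfolding work_def by metis
  qed
  then show ?thesis using C(1) by (intro exI[of _ "real j + 2 * C"]) auto
qed

lemma three_sat_subexp:
  "subexp_solvable three_cnf enc_cnf satisfiable (\<lambda>\<phi>. card (cnf_vars \<phi>)) (\<lambda>\<phi>. length (enc_cnf \<phi>))"
proof -
  obtain M' and q :: "nat poly" where M': "wf_tm M'"
    "!!\<phi> j s. \<phi> \<in> three_cnf ==> 0 < j ==> finished (work \<phi> j s) ==>
       \<exists>t\<le>poly q (j + s + length (enc_cnf \<phi>)).
         fst (run M' [enc_cnf \<phi>] t) = (if satP \<phi> then accept M' else reject M')"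
    using search_machine by blast
  obtain c d where cd: "!!a b. 1 <= a ==> 1 <= b ==> poly q (a + b) <= c * a ^ d * b ^ d" using poly_split by metis
  let ?ok = "\<lambda>\<phi> t. fst (run M' [enc_cnf \<phi>] t) = (if satP \<phi> then accept M' else reject M')"
  \<comment> \<open>The actual running time, one function for all \<open>\<epsilon>\<close>; this
    allows its bounds for different \<open>\<epsilon>\<close> to be merged by
    \<open>smallo_exponent\<close>.\<close>
  define T where "T \<phi> = (LEAST t. ?ok \<phi> t)" for \<phi>
  have T: "T \<phi> <= t" if "?ok \<phi> t" for \<phi> t unfolding T_def by (rule Least_le) (rule that)
  have okT: "?ok \<phi> (T \<phi>)" if "?ok \<phi> t" for \<phi> t unfolding T_def by (rule LeastI) (rule that)
  have len: "1 <= length (enc_cnf \<phi>)" for \<phi> by (simp add: enc_cnf_def enc_list_def)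
  let ?Y = "\<lambda>\<phi>. real (poly (monom 1 d) (length (enc_cnf \<phi>)))"
  have bound: "\<exists>C\<ge>1. \<forall>\<phi>\<in>three_cnf. real (T \<phi>) <= C * 2 powr (\<epsilon> * real (card (cnf_vars \<phi>))) * ?Y \<phi>" if \<epsilon>: "0 < \<epsilon>" for \<epsilon> :: real
  proof -
    \<comment> \<open>The machine may need the \<open>d\<close>-th power of \<open>j + s\<close>, so
      the search bound is used at a correspondingly smaller rate; adding 1 covers
      \<open>d = 0\<close>.\<close>
    have "0 < \<epsilon> / (real d + 1)" using \<epsilon> by simp
    then obtain C where C: "1 <= C" "!!\<phi>. \<phi> \<in> three_cnf ==> \<exists>j s. 0 < j \<and> finished (work \<phi> j s) \<and>
       real (j + s) <= C * 2 powr (\<epsilon> / (real d + 1) * real (card (cnf_vars \<phi>)))" using search_bound by metis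
    have "real (T \<phi>) <= (real c + 1) * C ^ d * 2 powr (\<epsilon> * real (card (cnf_vars \<phi>))) * ?Y \<phi>" if \<phi>: "\<phi> \<in> three_cnf" for \<phi>
    proof -
      let ?n = "card (cnf_vars \<phi>)" and ?l = "length (enc_cnf \<phi>)"
      obtain j s where js: "0 < j" "finished (work \<phi> j s)" "real (j + s) <= C * 2 powr (\<epsilon> / (real d + 1) * real ?n)"
        using C(2)[OF \<phi>] by blast
      obtain t where t: "t <= poly q (j + s + ?l)" "?ok \<phi> t" using M'(2)[OF \<phi> js(1,2)] by blast
      have "T \<phi> <= c * (j + s) ^ d * ?l ^ d" using T[OF t(2)] t(1) cd[of "j + s" ?l] js(1) len[of \<phi>] by simp
      then have "real (T \<phi>) <= real (c * (j + s) ^ d * ?l ^ d)" by (rule of_nat_mono)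
      also have "... = real c * real (j + s) ^ d * real ?l ^ d" by simp
      also have "... <= (real c + 1) * (C ^ d * 2 powr (\<epsilon> * real ?n)) * real ?l ^ d"
      proof (intro mult_right_mono mult_mono)
        have "real (j + s) ^ d <= (C * 2 powr (\<epsilon> / (real d + 1) * real ?n)) ^ d" by (intro power_mono js) auto
        also have "... = C ^ d * 2 powr (\<epsilon> / (real d + 1) * real ?n * real d)"
          by (simp add: power_mult_distrib powr_powr flip: powr_realpow)
        also have "... <= C ^ d * 2 powr (\<epsilon> * real ?n)"
        proof (intro mult_left_mono powr_mono)
          have "\<epsilon> * real ?n * (real d / (real d + 1)) <= \<epsilon> * real ?n * 1" using \<epsilon> by (intro mult_left_mono) auto
          then show "\<epsilon> / (real d + 1) * real ?n * real d <= \<epsilon> * real ?n" by (simp add: field_simps)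
        qed (use C(1) in auto)
        finally show "real (j + s) ^ d <= C ^ d * 2 powr (\<epsilon> * real ?n)" .
      qed auto
      finally show ?thesis by (simp add: poly_monom mult.assoc)
    qed
    moreover have "1 <= (real c + 1) * C ^ d" using mult_mono[of 1 "real c + 1" 1 "C ^ d"] one_le_power[OF C(1), of d] by simp
    ultimately show ?thesis by blast
  qed
  obtain F where F: "F \<in> o(\<lambda>n. real n)" "!!\<phi>. \<phi> \<in> three_cnf ==> real (T \<phi>) <= 2 powr F (card (cnf_vars \<phi>)) * ?Y \<phi>"
    using smallo_exponent[of three_cnf "\<lambda>\<phi>. real (T \<phi>)" "\<lambda>\<phi>. card (cnf_vars \<phi>)" ?Y, OF bound] by blast
  have sat: "satisfiable \<phi> \<longleftrightarrow> satP \<phi>" for \<phi> by (simp add: satisfiable_def satP_def)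
  have "solves_in_time M' three_cnf enc_cnf satisfiable (\<lambda>\<phi>. 2 powr F (card (cnf_vars \<phi>)) * ?Y \<phi>)"
    unfolding solves_in_time_def sat
  proof (intro conjI M' ballI)
    fix \<phi> assume \<phi>: "\<phi> \<in> three_cnf"
    obtain C j s where "0 < j" "finished (work \<phi> j s)" using search_bound[of 1] \<phi> by (meson zero_less_one)
    then have "?ok \<phi> (T \<phi>)" using M'(2)[OF \<phi>] okT by blast
    then show "\<exists>t. real t <= 2 powr F (card (cnf_vars \<phi>)) * ?Y \<phi> \<and> ?ok \<phi> t" using F(2)[OF \<phi>] by blast
  qed
  then show ?thesis unfolding subexp_solvable_def using F(1) by blast
qed

end

theorem eth_lower_bound:
  fixes R :: "'a ugraph"
  assumes "pattern h r N" "graph_iso (graph_on {..<h} N) R" "ETH"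
  shows "\<not> subexp_solvable edge_deletion_instances enc_edge_deletion (free_edge_deletion R)
     (\<lambda>(G, k). k) (\<lambda>(G, k). graph_size G)"
proof
  assume "subexp_solvable edge_deletion_instances enc_edge_deletion (free_edge_deletion R)
     (\<lambda>(G, k). k) (\<lambda>(G, k). graph_size G)"
  then obtain M f and p :: "nat poly" where f: "f \<in> o(\<lambda>n. real n)"
    and "solves_in_time M edge_deletion_instances enc_edge_deletion (free_edge_deletion R)
       (\<lambda>x. 2 powr f ((\<lambda>(G, k). k) x) * real (poly p ((\<lambda>(G, k). graph_size G) x)))"
    unfolding subexp_solvable_def by blast
  then have "solves_in_time M edge_deletion_instances enc_edge_deletion (free_edge_deletion R)
       (\<lambda>x. 2 powr f (snd x) * real (poly p (graph_size (fst x))))"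
    by (simp add: case_prod_beta)
  from three_sat_subexp[OF assms(1,2) f this] show False using assms(3) by (simp add: ETH_def)
qed

theorem theorem4p8:
  fixes R :: "'a ugraph"
  assumes "simple_graph R"
    and "connected_graph R"
    and "regular_graph R"
    and "card (edges R) \<ge> 2"
  shows "NP_complete (free_edge_deletion_language R) \<and>
    (ETH \<longrightarrow>
      \<not> subexp_solvable edge_deletion_instances enc_edge_deletion (free_edge_deletion R)
          (\<lambda>(G, k). k) (\<lambda>(G, k). graph_size G))"
proof -
  obtain h r N where p: "pattern h r N" "graph_iso (graph_on {..<h} N) R"
    using pattern_exists[OF assms] by blast
  show ?thesis unfolding NP_complete_def
    using language_in_NP[OF p] language_NP_hard[OF p] eth_lower_bound[OF p] by blast
qed

end
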